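(* Let $\Gamma$ be an infinite countable discrete group with Kazhdan's property (T). If $\Gamma$ is sofic, then $\Gamma$ is not locally P-stable. If $\Gamma$ is hyperlinear, then $\Gamma$ is not locally HS-stable.
   Context: $\mathrm{Sym}(k)$ is the symmetric group on $\{1,\dots,k\}$ with the normalized Hamming distance $d(\sigma,\tau)=\frac1k\#\{i:\sigma(i)\ne\tau(i)\}$. $\mathrm{U}(k)$ is the group of $k\times k$ complex unitary matrices with the distance $d(u,v)=\|u-v\|_2$, where $\|x\|_2=(\frac1k\mathrm{Tr}(x^*x))^{1/2}$. Let $(G_k)_{k\ge1}$ be either $(\mathrm{Sym}(k))_k$ or $(\mathrm{U}(k))_k$ with these distances. A sequence of maps $\varphi_n:\Gamma\to G_{k_n}$ ($(k_n)_n$ any sequence of positive integers) is an approximate homomorphism if $d(\varphi_n(gh),\varphi_n(g)\varphi_n(h))\to0$ for all $g,h\in\Gamma$; it is a partial homomorphism if for all $g,h\in\Gamma$ there is $N$ such that $\varphi_n(gh)=\varphi_n(g)\varphi_n(h)$ for all $n\ge N$; it is separating if $\liminf_n d(\varphi_n(g),1_{G_{k_n}})>0$ for all $e\neq g\in\Gamma$. $\Gamma$ is sofic (respectively hyperlinear) if it admits a separating approximate homomorphism to $(\mathrm{Sym}(k))_k$ (respectively to $(\mathrm{U}(k))_k$). $\Gamma$ is locally P-stable (respectively locally HS-stable) if for every approximate homomorphism $\varphi_n:\Gamma\to G_{k_n}$ with $G_k=\mathrm{Sym}(k)$ (respectively $G_k=\mathrm{U}(k)$) there is a partial homomorphism $\psi_n:\Gamma\to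 G_{k_n}$ with $d(\varphi_n(g),\psi_n(g))\to0$ for all $g\in\Gamma$. *)

theory Defs
  imports
    "HOL-Algebra.Sym_Groups"
    "HOL-Library.Liminf_Limsup"
    "HOL-Library.Extended_Real"
    "HOL-Library.Countable_Set"
    "Jordan_Normal_Form.Schur_Decomposition"
    "Jordan_Normal_Form.VS_Connect"
begin

section \<open>Complex Hilbert spaces and unitary representations\<close>

record 'h hilbert_space = "(complex, 'h) module" +
  iprod :: "'h \<Rightarrow> 'h \<Rightarrow> complex"

definition hnorm :: "('h, 'm) hilbert_space_scheme \<Rightarrow> 'h \<Rightarrow> real" where
  "hnorm H x = sqrt (Re (iprod H x x))"

text \<open>The fields \<open>mult\<close> and \<open>one\<close>, inherited from the record type of modules, are
  irrelevant. The inner product is linear in its first argument.\<close>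

locale complex_hilbert_space =
  vectorspace "class_ring :: complex ring" H
  for H :: "('h, 'm) hilbert_space_scheme" (structure) +
  assumes iprod_add: "\<lbrakk>x \<in> carrier H; y \<in> carrier H; z \<in> carrier H\<rbrakk> \<Longrightarrow>
      iprod H (x \<oplus> y) z = iprod H x z + iprod H y z"
    and iprod_smult: "\<lbrakk>x \<in> carrier H; y \<in> carrier H\<rbrakk> \<Longrightarrow>
      iprod H (c \<odot> x) y = c * iprod H x y"
    and iprod_cnj: "\<lbrakk>x \<in> carrier H; y \<in> carrier H\<rbrakk> \<Longrightarrow> iprod H y x = cnj (iprod H x y)"
    and iprod_nonneg: "x \<in> carrier H \<Longrightarrow> Re (iprod H x x) \<ge> 0"
    and iprod_definite: "\<lbrakk>x \<in> carrier H; iprod H x x = 0\<rbrakk> \<Longrightarrow> x = \<zero>"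
    and complete:
      "\<lbrakk>\<And>n :: nat. X n \<in> carrier H;
        \<And>e. e > 0 \<Longrightarrow> \<exists>N. \<forall>m\<ge>N. \<forall>n\<ge>N. hnorm H (X m \<ominus> X n) < e\<rbrakk> \<Longrightarrow>
       \<exists>x\<in>carrier H. (\<lambda>n. hnorm H (X n \<ominus> x)) \<longlonglongrightarrow> 0"

definition unitary_operator :: "('h, 'm) hilbert_space_scheme \<Rightarrow> ('h \<Rightarrow> 'h) \<Rightarrow> bool" where
  "unitary_operator H u \<longleftrightarrow>
     u \<in> module_hom (class_ring :: complex ring) H H \<and>
     bij_betw u (carrier H) (carrier H) \<and>
     (\<forall>x\<in>carrier H. \<forall>y\<in>carrier H. iprod H (u x) (u y) = iprod H x y)"

definition unitary_rep ::
  "('g, 'n) monoid_scheme \<Rightarrow> ('h, 'm) hilbert_space_scheme \<Rightarrow> ('g \<Rightarrow> 'h \<Rightarrow> 'h) \<Rightarrow> bool" where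
  "unitary_rep G H \<pi> \<longleftrightarrow>
     complex_hilbert_space H \<and>
     (\<forall>g\<in>carrier G. unitary_operator H (\<pi> g)) \<and>
     (\<forall>g\<in>carrier G. \<forall>h\<in>carrier G. \<forall>x\<in>carrier H. \<pi> (g \<otimes>\<^bsub>G\<^esub> h) x = \<pi> g (\<pi> h x))"


section \<open>Kazhdan's property (T) for discrete groups\<close>

text \<open>A pair \<open>(Q, \<epsilon>)\<close> is a Kazhdan pair if every unitary representation with a
  \<open>(Q, \<epsilon>)\<close>-invariant vector has a nonzero invariant vector.
  HOL cannot quantify over all types, so the underlying sets of the Hilbert spaces are taken
  inside the type \<open>nat \<times> 'g \<Rightarrow> complex\<close>, where \<open>'g\<close> is the type of group elements. This is no
  restriction: the closed invariant subspace generated by a \<open>(Q, \<epsilon>)\<close>-invariant vector is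
  the closure of the image of the finitely supported functions \<open>'g \<Rightarrow> complex\<close>, hence
  is isometric to \<open>\<ell>\<^sup>2(I)\<close> for some \<open>I \<subseteq> nat \<times> 'g\<close>, and an invariant vector of a
  subrepresentation is an invariant vector of the whole representation.\<close>

definition kazhdan_pair :: "('g, 'n) monoid_scheme \<Rightarrow> 'g set \<Rightarrow> real \<Rightarrow> bool" where
  "kazhdan_pair G Q \<epsilon> \<longleftrightarrow>
     (\<forall>(H :: (nat \<times> 'g \<Rightarrow> complex) hilbert_space) \<pi>.
        unitary_rep G H \<pi> \<longrightarrow>
        (\<exists>x\<in>carrier H. x \<noteq> \<zero>\<^bsub>H\<^esub> \<and> (\<forall>g\<in>Q. hnorm H (\<pi> g x \<ominus>\<^bsub>H\<^esub> x) < \<epsilon> * hnorm H x)) \<longrightarrow>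
        (\<exists>x\<in>carrier H. x \<noteq> \<zero>\<^bsub>H\<^esub> \<and> (\<forall>g\<in>carrier G. \<pi> g x = x)))"

text \<open>The compact subsets of a discrete group are its finite subsets.\<close>

definition property_T :: "('g, 'n) monoid_scheme \<Rightarrow> bool" where
  "property_T G \<longleftrightarrow> (\<exists>Q \<epsilon>. finite Q \<and> Q \<subseteq> carrier G \<and> \<epsilon> > 0 \<and> kazhdan_pair G Q \<epsilon>)"


section \<open>Symmetric and unitary groups with their normalized distances\<close>

definition hamming_dist :: "nat \<Rightarrow> (nat \<Rightarrow> nat) \<Rightarrow> (nat \<Rightarrow> nat) \<Rightarrow> real" where
  "hamming_dist k \<sigma> \<tau> = real (card {i \<in> {1..k}. \<sigma> i \<noteq> \<tau> i}) / real k"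

definition unitary_group :: "nat \<Rightarrow> complex mat monoid" where
  "unitary_group k =
     \<lparr>carrier = {u \<in> carrier_mat k k. mat_adjoint u * u = 1\<^sub>m k \<and> u * mat_adjoint u = 1\<^sub>m k},
      mult = (*), one = 1\<^sub>m k\<rparr>"

definition mat_trace :: "complex mat \<Rightarrow> complex" where
  "mat_trace a = sum_list (diag_mat a)"

definition hs_norm :: "nat \<Rightarrow> complex mat \<Rightarrow> real" where
  "hs_norm k x = sqrt (Re (mat_trace (mat_adjoint x * x)) / real k)"

definition hs_dist :: "nat \<Rightarrow> complex mat \<Rightarrow> complex mat \<Rightarrow> real" where
  "hs_dist k u v = hs_norm k (u - v)"


section \<open>Approximate homomorphisms and stability\<close>

text \<open>Throughout, \<open>\<G>\<close> is a family of groups with distances \<open>d\<close>, both indexed by positive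
  integers, and \<open>k\<close> is the sequence of indices of the target groups.\<close>

definition map_seq ::
  "('g, 'n) monoid_scheme \<Rightarrow> (nat \<Rightarrow> 'b monoid) \<Rightarrow> (nat \<Rightarrow> nat) \<Rightarrow> (nat \<Rightarrow> 'g \<Rightarrow> 'b) \<Rightarrow> bool" where
  "map_seq G \<G> k \<phi> \<longleftrightarrow> (\<forall>n. k n > 0 \<and> \<phi> n \<in> carrier G \<rightarrow> carrier (\<G> (k n)))"

definition approx_hom ::
  "('g, 'n) monoid_scheme \<Rightarrow> (nat \<Rightarrow> 'b monoid) \<Rightarrow> (nat \<Rightarrow> 'b \<Rightarrow> 'b \<Rightarrow> real) \<Rightarrow>
   (nat \<Rightarrow> nat) \<Rightarrow> (nat \<Rightarrow> 'g \<Rightarrow> 'b) \<Rightarrow> bool" where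
  "approx_hom G \<G> d k \<phi> \<longleftrightarrow> map_seq G \<G> k \<phi> \<and>
     (\<forall>g\<in>carrier G. \<forall>h\<in>carrier G.
        (\<lambda>n. d (k n) (\<phi> n (g \<otimes>\<^bsub>G\<^esub> h)) (\<phi> n g \<otimes>\<^bsub>\<G> (k n)\<^esub> \<phi> n h)) \<longlonglongrightarrow> 0)"

definition partial_hom ::
  "('g, 'n) monoid_scheme \<Rightarrow> (nat \<Rightarrow> 'b monoid) \<Rightarrow> (nat \<Rightarrow> nat) \<Rightarrow> (nat \<Rightarrow> 'g \<Rightarrow> 'b) \<Rightarrow> bool" where
  "partial_hom G \<G> k \<psi> \<longleftrightarrow> map_seq G \<G> k \<psi> \<and>
     (\<forall>g\<in>carrier G. \<forall>h\<in>carrier G. \<exists>N. \<forall>n\<ge>N.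
        \<psi> n (g \<otimes>\<^bsub>G\<^esub> h) = \<psi> n g \<otimes>\<^bsub>\<G> (k n)\<^esub> \<psi> n h)"

definition separating ::
  "('g, 'n) monoid_scheme \<Rightarrow> (nat \<Rightarrow> 'b monoid) \<Rightarrow> (nat \<Rightarrow> 'b \<Rightarrow> 'b \<Rightarrow> real) \<Rightarrow>
   (nat \<Rightarrow> nat) \<Rightarrow> (nat \<Rightarrow> 'g \<Rightarrow> 'b) \<Rightarrow> bool" where
  "separating G \<G> d k \<phi> \<longleftrightarrow>
     (\<forall>g\<in>carrier G. g \<noteq> \<one>\<^bsub>G\<^esub> \<longrightarrow>
        liminf (\<lambda>n. ereal (d (k n) (\<phi> n g) \<one>\<^bsub>\<G> (k n)\<^esub>)) > 0)"

definition admits_separating_approx_hom ::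
  "('g, 'n) monoid_scheme \<Rightarrow> (nat \<Rightarrow> 'b monoid) \<Rightarrow> (nat \<Rightarrow> 'b \<Rightarrow> 'b \<Rightarrow> real) \<Rightarrow> bool" where
  "admits_separating_approx_hom G \<G> d \<longleftrightarrow>
     (\<exists>k \<phi>. approx_hom G \<G> d k \<phi> \<and> separating G \<G> d k \<phi>)"

definition locally_stable ::
  "('g, 'n) monoid_scheme \<Rightarrow> (nat \<Rightarrow> 'b monoid) \<Rightarrow> (nat \<Rightarrow> 'b \<Rightarrow> 'b \<Rightarrow> real) \<Rightarrow> bool" where
  "locally_stable G \<G> d \<longleftrightarrow>
     (\<forall>k \<phi>. approx_hom G \<G> d k \<phi> \<longrightarrow>
        (\<exists>\<psi>. partial_hom G \<G> k \<psi> \<and>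
             (\<forall>g\<in>carrier G. (\<lambda>n. d (k n) (\<phi> n g) (\<psi> n g)) \<longlonglongrightarrow> 0)))"

definition sofic :: "('g, 'n) monoid_scheme \<Rightarrow> bool" where
  "sofic G \<longleftrightarrow> admits_separating_approx_hom G sym_group hamming_dist"

definition hyperlinear :: "('g, 'n) monoid_scheme \<Rightarrow> bool" where
  "hyperlinear G \<longleftrightarrow> admits_separating_approx_hom G unitary_group hs_dist"

definition locally_P_stable :: "('g, 'n) monoid_scheme \<Rightarrow> bool" where
  "locally_P_stable G \<longleftrightarrow> locally_stable G sym_group hamming_dist"

definition locally_HS_stable :: "('g, 'n) monoid_scheme \<Rightarrow> bool" where
  "locally_HS_stable G \<longleftrightarrow> locally_stable G unitary_group hs_dist"

end

theory Submission
  imports Defs "HOL-Library.Function_Algebras" "HOL-Library.Diagonal_Subsequence"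
begin

text \<open>
  Property (T) gives a finite symmetric generating set \<open>S\<close> with a spectral gap. By a compactness
  argument the gap persists, with uniform constants, for maps that satisfy only the relators of
  length at most some \<open>R\<close> (\<^emph>\<open>local representations\<close>, to which partial homomorphisms restrict). Hence
  a matrix \<open>X\<close> that almost intertwines two local representations on \<open>S\<close> is close to a true
  intertwiner \<open>T\<close>, no matter how large the dimensions are.

  A separating partial homomorphism of an infinite group yields transitive, respectively irreducible,
  local representations \<open>\<sigma>\<close> of arbitrarily large degree \<open>m\<close>. Deleting one point, respectively one
  dimension, perturbs them by a bounded amount in the unnormalized norm, so the results are
  approximate homomorphisms into the group of degree \<open>m - 1\<close>. If the group were locally stable, they
  would be close to local representations \<open>\<rho>\<close> of degree \<open>m - 1\<close>, and the inclusion of the smaller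
  space into the larger one would almost intertwine \<open>\<rho>\<close> and \<open>\<sigma>\<close>. The nearby intertwiner \<open>T\<close> is
  impossible: for permutations its entries close to 1 would
  give an equivariant injection of \<open>m\<close> points into \<open>m - 1\<close> points, and for unitaries the kernel of
  its adjoint would be a proper nonzero invariant subspace.
\<close>

section \<open>Averages over isometries\<close>

text \<open>A local representation need not factor through the group, so its gap is no formal
  consequence of property (T). Suppose vectors x in ever better local representations violate it:
  the Laplacian of x is small against the energy of x. Normalizing the energy then sends the norm of
  x to infinity. What survives in the limit is the displacement function, half the squared norm of
  gx - x: it behaves like the squared norm of a harmonic cocycle. Property (T) bounds it, but its
  Laplacian is a nonzero constant, which no bounded function allows. Sizes decide the second half.
  In the squared unnormalized norm a deletion costs O(1) and stability a small multiple of the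
  degree m, whereas the inclusion has squared norm m - 1, so the indecomposable pieces must be
  large. A separating partial homomorphism may be large merely by repeating small pieces. Small
  transitive pieces are excluded by counting actions. Unitary irreducibles of bounded dimension have
  only finitely many characters, which would put some nontrivial word near the identity in all of
  them; tensor powers refute this.\<close>

instantiation "fun" :: (type, real_vector) real_vector
begin

definition scaleR_fun :: "real \<Rightarrow> ('a \<Rightarrow> 'b) \<Rightarrow> 'a \<Rightarrow> 'b" where
  "scaleR_fun r f = (\<lambda>x. r *\<^sub>R f x)"

instance
  by standard (auto simp: scaleR_fun_def fun_eq_iff scaleR_add_right scaleR_add_left)

end

lemma scaleR_fun_apply [simp]: "(r *\<^sub>R f) x = r *\<^sub>R f x"
  by (simp add: scaleR_fun_def)

text \<open>The form may be degenerate, and null vectors are never factored out: positive definite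
  functions give only semidefinite forms, and matrix entries outside the intended range are null.
  Limits are therefore expressed through \<open>nrm\<close>. The carrier \<open>V\<close> is a
  subset because the finitely supported functions are not a type of their own.\<close>

locale semi_ip =
  fixes V :: "'v::real_vector set" and B :: "'v \<Rightarrow> 'v \<Rightarrow> real"
  assumes V_zero: "0 \<in> V"
    and V_add: "\<lbrakk>x \<in> V; y \<in> V\<rbrakk> \<Longrightarrow> x + y \<in> V"
    and V_scale: "x \<in> V \<Longrightarrow> r *\<^sub>R x \<in> V"
    and B_add: "\<lbrakk>x \<in> V; y \<in> V; z \<in> V\<rbrakk> \<Longrightarrow> B (x + y) z = B x z + B y z"
    and B_scale: "\<lbrakk>x \<in> V; y \<in> V\<rbrakk> \<Longrightarrow> B (r *\<^sub>R x) y = r * B x y"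
    and B_sym: "\<lbrakk>x \<in> V; y \<in> V\<rbrakk> \<Longrightarrow> B x y = B y x"
    and B_nonneg: "x \<in> V \<Longrightarrow> B x x \<ge> 0"
begin

lemma V_diff: "\<lbrakk>x \<in> V; y \<in> V\<rbrakk> \<Longrightarrow> x - y \<in> V"
  using V_add[of x "(-1) *\<^sub>R y"] V_scale[of y "-1"] by simp

lemma V_sum: "(\<And>i. i \<in> I \<Longrightarrow> f i \<in> V) \<Longrightarrow> (\<Sum>i\<in>I. f i) \<in> V"
  by (induction I rule: infinite_finite_induct) (auto simp: V_zero V_add)

lemmas V_closed = V_zero V_add V_scale V_diff

lemma B_add_right: "\<lbrakk>x \<in> V; y \<in> V; z \<in> V\<rbrakk> \<Longrightarrow> B z (x + y) = B z x + B z y"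
  by (metis B_add B_sym V_add)

lemma B_scale_right: "\<lbrakk>x \<in> V; y \<in> V\<rbrakk> \<Longrightarrow> B y (r *\<^sub>R x) = r * B y x"
  by (metis B_scale B_sym V_scale)

lemma B_diff: "\<lbrakk>x \<in> V; y \<in> V; z \<in> V\<rbrakk> \<Longrightarrow> B (x - y) z = B x z - B y z"
  using B_add[of "x - y" y z] by (simp add: V_diff)

lemma B_diff_right: "\<lbrakk>x \<in> V; y \<in> V; z \<in> V\<rbrakk> \<Longrightarrow> B z (x - y) = B z x - B z y"
  by (metis B_diff B_sym V_diff)

lemma B_zero: "x \<in> V \<Longrightarrow> B 0 x = 0"
  using B_scale[of x x 0] by simp

lemma B_sum: "\<lbrakk>\<And>i. i \<in> I \<Longrightarrow> f i \<in> V; y \<in> V\<rbrakk> \<Longrightarrow> B (\<Sum>i\<in>I. f i) y = (\<Sum>i\<in>I. B (f i) y)"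
  by (induction I rule: infinite_finite_induct) (auto simp: B_zero B_add V_sum)

lemma B_sum_right: "\<lbrakk>\<And>i. i \<in> I \<Longrightarrow> f i \<in> V; y \<in> V\<rbrakk> \<Longrightarrow> B y (\<Sum>i\<in>I. f i) = (\<Sum>i\<in>I. B y (f i))"
  using B_sum[of I f y] by (simp add: B_sym V_sum)

lemma Cauchy_Schwarz:
  assumes "x \<in> V" "y \<in> V"
  shows "(B x y)\<^sup>2 \<le> B x x * B y y"
proof -
  have q: "0 \<le> B x x - 2 * r * B x y + r\<^sup>2 * B y y" for r
  proof -
    have "B (x - r *\<^sub>R y) (x - r *\<^sub>R y) = B x x - 2 * r * B x y + r\<^sup>2 * B y y"
      using assms by (simp add: B_diff B_diff_right V_closed B_scale B_scale_right B_sym[of y x]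
          power2_eq_square algebra_simps)
    then show ?thesis using B_nonneg[of "x - r *\<^sub>R y"] assms by (simp add: V_closed)
  qed
  show ?thesis
  proof (cases "B y y = 0")
    case True
    have "B x y = 0"
    proof (rule ccontr)
      assume "B x y \<noteq> 0"
      \<comment> \<open>This parameter makes the remaining linear function of \<open>r\<close> equal
        to -1.\<close>
      with q[of "(B x x + 1) / (2 * B x y)"] True show False
        by (simp add: field_simps)
    qed
    then show ?thesis using True by simp
  next
    case False
    then have pos: "B y y > 0" using B_nonneg[OF assms(2)] by simp
    have "0 \<le> (B x x - 2 * (B x y / B y y) * B x y + (B x y / B y y)\<^sup>2 * B y y) * B y y"
      using q[of "B x y / B y y"] pos by simp
    also have "\<dots> = B x x * B y y - (B x y)\<^sup>2"
      using pos by (simp add: field_simps power2_eq_square)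
    finally show ?thesis by simp
  qed
qed

definition nrm :: "'v \<Rightarrow> real" where "nrm x = sqrt (B x x)"

lemma nrm_nonneg: "x \<in> V \<Longrightarrow> 0 \<le> nrm x"
  by (simp add: nrm_def B_nonneg)

lemma nrm_sq: "x \<in> V \<Longrightarrow> (nrm x)\<^sup>2 = B x x"
  by (simp add: nrm_def B_nonneg)

lemma abs_B_le: "\<lbrakk>x \<in> V; y \<in> V\<rbrakk> \<Longrightarrow> \<bar>B x y\<bar> \<le> nrm x * nrm y"
  using real_sqrt_le_mono[OF Cauchy_Schwarz[of x y]] by (simp add: nrm_def real_sqrt_mult)

lemma nrm_triangle:
  assumes "x \<in> V" "y \<in> V"
  shows "nrm (x + y) \<le> nrm x + nrm y"
proof (rule power2_le_imp_le)
  have "(nrm (x + y))\<^sup>2 = B x x + 2 * B x y + B y y"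
    using assms by (simp add: nrm_sq V_closed B_add B_add_right B_sym[of y x])
  also have "\<dots> \<le> (nrm x + nrm y)\<^sup>2"
    using abs_B_le[OF assms] assms by (simp add: power2_sum nrm_sq)
  finally show "(nrm (x + y))\<^sup>2 \<le> (nrm x + nrm y)\<^sup>2" .
qed (use assms nrm_nonneg in auto)

lemma nrm_triangle_diff:
  assumes "x \<in> V" "y \<in> V" "z \<in> V"
  shows "nrm (x - z) \<le> nrm (x - y) + nrm (y - z)"
  using nrm_triangle[of "x - y" "y - z"] assms by (simp add: V_closed)

lemma B_minus_minus: "\<lbrakk>x \<in> V; y \<in> V\<rbrakk> \<Longrightarrow> B (x - y) (x - y) = B (y - x) (y - x)"
  by (simp add: B_diff B_diff_right V_closed)

lemma nrm_minus_commute: "\<lbrakk>x \<in> V; y \<in> V\<rbrakk> \<Longrightarrow> nrm (x - y) = nrm (y - x)"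
  by (simp add: nrm_def B_minus_minus)

text \<open>Convexity of the squared norm: nonnegativity of \<open>B (f i - f j) (f i - f j)\<close>
  bounds each mixed term by the mean of two diagonal ones.\<close>

lemma B_sum_sum_le:
  assumes "finite I" "\<And>i. i \<in> I \<Longrightarrow> f i \<in> V"
  shows "B (\<Sum>i\<in>I. f i) (\<Sum>i\<in>I. f i) \<le> real (card I) * (\<Sum>i\<in>I. B (f i) (f i))"
proof -
  have le: "B (f i) (f j) \<le> (B (f i) (f i) + B (f j) (f j)) / 2" if "i \<in> I" "j \<in> I" for i j
    using B_nonneg[of "f i - f j"] assms(2) that
    by (simp add: V_closed B_diff B_diff_right B_sym[of "f j" "f i"])
  have "B (\<Sum>i\<in>I. f i) (\<Sum>i\<in>I. f i) = (\<Sum>i\<in>I. \<Sum>j\<in>I. B (f i) (f j))"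
    using assms by (subst B_sum) (auto simp: B_sum_right V_sum)
  also have "\<dots> \<le> (\<Sum>i\<in>I. \<Sum>j\<in>I. (B (f i) (f i) + B (f j) (f j)) / 2)"
    using le by (intro sum_mono) auto
  also have "\<dots> = real (card I) * (\<Sum>i\<in>I. B (f i) (f i))"
    by (simp add: add_divide_distrib sum.distrib flip: sum_divide_distrib sum_distrib_left)
  finally show ?thesis .
qed

end

section \<open>The Laplacian and the lazy average of finitely many isometries\<close>

locale isometry_family = semi_ip V B for V :: "'v::real_vector set" and B +
  fixes S :: "'s set" and L :: "'s \<Rightarrow> 'v \<Rightarrow> 'v"
  assumes S_finite: "finite S" and S_ne: "S \<noteq> {}"
    and L_in: "\<lbrakk>s \<in> S; x \<in> V\<rbrakk> \<Longrightarrow> L s x \<in> V"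
    and L_add: "\<lbrakk>s \<in> S; x \<in> V; y \<in> V\<rbrakk> \<Longrightarrow> L s (x + y) = L s x + L s y"
    and L_scale: "\<lbrakk>s \<in> S; x \<in> V\<rbrakk> \<Longrightarrow> L s (r *\<^sub>R x) = r *\<^sub>R L s x"
    and L_iso: "\<lbrakk>s \<in> S; x \<in> V; y \<in> V\<rbrakk> \<Longrightarrow> B (L s x) (L s y) = B x y"
begin

text \<open>The factor 1/2 makes \<open>avg\<close> the lazy average \<open>(x + m) / 2\<close>,
  where \<open>m\<close> is the mean of the vectors \<open>L s x\<close>. Laziness keeps -1 out of
  the spectrum, so that a gap at the invariant vectors alone gives contraction.\<close>

definition lap :: "'v \<Rightarrow> 'v" where
  "lap x = (1 / (2 * real (card S))) *\<^sub>R (\<Sum>s\<in>S. x - L s x)"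

definition avg :: "'v \<Rightarrow> 'v" where
  "avg x = x - lap x"

lemma card_pos: "real (card S) > 0"
  using S_finite S_ne by (simp add: card_gt_0_iff)

lemma lap_in: "x \<in> V \<Longrightarrow> lap x \<in> V"
  by (auto simp: lap_def intro!: V_scale V_sum V_diff L_in)

lemma avg_in: "x \<in> V \<Longrightarrow> avg x \<in> V"
  by (simp add: avg_def V_diff lap_in)

lemma L_diff: "\<lbrakk>s \<in> S; x \<in> V; y \<in> V\<rbrakk> \<Longrightarrow> L s (x - y) = L s x - L s y"
  using L_add[of s "x - y" y] by (simp add: V_diff)

lemma lap_diff: "\<lbrakk>x \<in> V; y \<in> V\<rbrakk> \<Longrightarrow> lap (x - y) = lap x - lap y"
proof -
  assume a: "x \<in> V" "y \<in> V"
  have "(\<Sum>s\<in>S. (x - y) - L s (x - y)) = (\<Sum>s\<in>S. (x - L s x) - (y - L s y))"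
    by (rule sum.cong) (auto simp: L_diff a)
  also have "\<dots> = (\<Sum>s\<in>S. x - L s x) - (\<Sum>s\<in>S. y - L s y)"
    by (rule sum_subtractf)
  finally show ?thesis by (simp only: lap_def scaleR_diff_right)
qed

lemma L_displacement:
  "\<lbrakk>s \<in> S; x \<in> V\<rbrakk> \<Longrightarrow> B (x - L s x) (x - L s x) = 2 * B (x - L s x) x"
  by (simp add: B_diff B_diff_right L_in V_closed L_iso B_sym[of x "L s x"])

lemma lap_energy:
  assumes "x \<in> V"
  shows "(\<Sum>s\<in>S. B (x - L s x) (x - L s x)) = 4 * real (card S) * B (lap x) x"
proof -
  have "B (lap x) x = (1 / (2 * real (card S))) * (\<Sum>s\<in>S. B (x - L s x) x)"
    using assms by (simp add: lap_def B_scale V_sum V_diff L_in B_sum)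
  moreover have "(\<Sum>s\<in>S. B (x - L s x) (x - L s x)) = 2 * (\<Sum>s\<in>S. B (x - L s x) x)"
    by (simp add: L_displacement assms sum_distrib_left)
  ultimately show ?thesis using card_pos by (simp add: field_simps)
qed

text \<open>The operator inequality \<open>lap^2 \<le> lap\<close>. By convexity the squared norm of
  the mean displacement is at most the mean squared displacement, which for isometries is a multiple
  of \<open>B (lap x) x\<close>.\<close>

lemma lap_sq_le:
  assumes "x \<in> V"
  shows "B (lap x) (lap x) \<le> B (lap x) x"
proof -
  have "B (lap x) (lap x) = (1 / (2 * real (card S)))\<^sup>2 *
      B (\<Sum>s\<in>S. x - L s x) (\<Sum>s\<in>S. x - L s x)"
    using assms by (simp add: lap_def B_scale B_scale_right V_scale V_sum V_diff L_in power2_eq_square)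
  also have "\<dots> \<le> (1 / (2 * real (card S)))\<^sup>2 *
      (real (card S) * (\<Sum>s\<in>S. B (x - L s x) (x - L s x)))"
    by (intro mult_left_mono B_sum_sum_le) (auto simp: S_finite assms V_diff L_in)
  also have "\<dots> = B (lap x) x"
    using card_pos by (simp add: lap_energy assms power2_eq_square)
  finally show ?thesis .
qed

lemma nrm_L: "\<lbrakk>s \<in> S; x \<in> V\<rbrakk> \<Longrightarrow> nrm (L s x) = nrm x"
  by (simp add: nrm_def L_iso)

lemma nrm_avg_le:
  assumes "x \<in> V" shows "nrm (avg x) \<le> nrm x"
proof -
  have "B (avg x) (avg x) = B x x - 2 * B (lap x) x + B (lap x) (lap x)"
    using assms by (simp add: avg_def B_diff B_diff_right V_closed lap_in B_sym[of x "lap x"])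
  then have "B (avg x) (avg x) \<le> B x x"
    using lap_sq_le[OF assms] B_nonneg[OF lap_in[OF assms]] by simp
  then show ?thesis by (simp add: nrm_def)
qed

lemma funpow_avg_in: "x \<in> V \<Longrightarrow> (avg ^^ k) x \<in> V"
  by (induction k) (auto simp: avg_in)

lemma nrm_funpow_avg_le: "x \<in> V \<Longrightarrow> nrm ((avg ^^ k) x) \<le> nrm x"
  by (induction k) (auto intro: order_trans nrm_avg_le funpow_avg_in)

lemma lap_avg: "x \<in> V \<Longrightarrow> lap (avg x) = avg (lap x)"
  by (simp add: avg_def lap_diff lap_in)

lemma lap_funpow_avg: "x \<in> V \<Longrightarrow> lap ((avg ^^ k) x) = (avg ^^ k) (lap x)"
  by (induction k) (auto simp: lap_avg funpow_avg_in)

text \<open>A single generator contributes at most the total energy, and Cauchy-Schwarz makes the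
  energy small once \<open>lap x\<close> is small and \<open>nrm x\<close> stays bounded. This is
  how the iterates of \<open>avg\<close> become almost invariant.\<close>

lemma displacement_le:
  assumes "s \<in> S" "x \<in> V"
  shows "(nrm (x - L s x))\<^sup>2 \<le> 4 * real (card S) * nrm (lap x) * nrm x"
proof -
  have "(nrm (x - L s x))\<^sup>2 \<le> (\<Sum>s\<in>S. B (x - L s x) (x - L s x))"
    using assms by (subst nrm_sq) (auto intro!: member_le_sum simp: V_diff L_in B_nonneg S_finite)
  also have "\<dots> \<le> 4 * real (card S) * (nrm (lap x) * nrm x)"
    using lap_energy[OF assms(2)] abs_B_le[OF lap_in assms(2), of x] assms card_pos
    by (simp add: mult_left_mono)
  finally show ?thesis by simp
qed

end

text \<open>\<open>W\<close> stands for a complement of the invariant vectors. Only the values of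
  \<open>lap\<close> have to lie in it: consecutive iterates of \<open>avg\<close> differ by a value
  of \<open>lap\<close>, so their convergence can be controlled without decomposing the starting
  vector. The two instances are the functions of sum zero and the range of \<open>lap\<close>
  itself.\<close>

locale gapped_family = isometry_family V B S L
  for V :: "'v::real_vector set" and B and S :: "'s set" and L +
  fixes W :: "'v set" and C :: real
  assumes W_sub: "W \<subseteq> V" and lap_W: "x \<in> V \<Longrightarrow> lap x \<in> W"
    and avg_W: "x \<in> W \<Longrightarrow> avg x \<in> W"
    and C_ge: "C \<ge> 1"
    and gap: "x \<in> W \<Longrightarrow> B x x \<le> C * B (lap x) x"
begin

definition rate :: real where "rate = sqrt (1 - 1 / C)"

lemma rate_nonneg: "rate \<ge> 0" and rate_less: "rate < 1"
  using C_ge by (auto simp: rate_def field_simps)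

lemma avg_contraction:
  assumes "x \<in> W" shows "nrm (avg x) \<le> rate * nrm x"
proof -
  have x: "x \<in> V" using assms W_sub by auto
  have "B (avg x) (avg x) = B x x - 2 * B (lap x) x + B (lap x) (lap x)"
    using x by (simp add: avg_def B_diff B_diff_right V_closed lap_in B_sym[of x "lap x"])
  \<comment> \<open>Half of the loss \<open>2 * B (lap x) x\<close> pays for the quadratic
    term.\<close>
  also have "\<dots> \<le> B x x - B (lap x) x" using lap_sq_le[OF x] by simp
  also have "\<dots> \<le> (1 - 1 / C) * B x x" using gap[OF assms] C_ge by (simp add: field_simps)
  finally show ?thesis by (simp add: nrm_def rate_def flip: real_sqrt_mult)
qed

lemma funpow_avg_W: "x \<in> W \<Longrightarrow> (avg ^^ k) x \<in> W"
  by (induction k) (auto simp: avg_W)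

lemma funpow_avg_contraction:
  assumes "x \<in> W" shows "nrm ((avg ^^ k) x) \<le> rate ^ k * nrm x"
proof (induction k)
  case (Suc k)
  have "nrm ((avg ^^ Suc k) x) \<le> rate * nrm ((avg ^^ k) x)"
    using avg_contraction funpow_avg_W assms by simp
  also have "\<dots> \<le> rate * (rate ^ k * nrm x)" using Suc rate_nonneg by (rule mult_left_mono)
  finally show ?case by simp
qed simp

lemma nrm_lap_funpow_avg:
  "x \<in> V \<Longrightarrow> nrm (lap ((avg ^^ k) x)) \<le> rate ^ k * nrm (lap x)"
  by (simp add: lap_funpow_avg funpow_avg_contraction lap_W)

lemma funpow_avg_dist:
  assumes "x \<in> V"
  shows "nrm ((avg ^^ m) x - (avg ^^ (m + k)) x) \<le> rate ^ m / (1 - rate) * nrm (lap x)"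
proof -
  have "nrm ((avg ^^ m) x - (avg ^^ (m + k)) x) \<le> (\<Sum>i<k. rate ^ (m + i) * nrm (lap x))"
  proof (induction k)
    case 0
    then show ?case using assms by (simp add: nrm_def B_zero V_zero)
  next
    case (Suc k)
    have "nrm ((avg ^^ m) x - (avg ^^ (m + Suc k)) x) \<le> nrm ((avg ^^ m) x - (avg ^^ (m + k)) x)
        + nrm ((avg ^^ (m + k)) x - (avg ^^ (m + Suc k)) x)"
      by (rule nrm_triangle_diff) (use assms funpow_avg_in in blast)+
    moreover have "(avg ^^ (m + k)) x - (avg ^^ (m + Suc k)) x = lap ((avg ^^ (m + k)) x)"
      by (simp add: avg_def)
    ultimately show ?case using Suc nrm_lap_funpow_avg[OF assms, of "m + k"] by simp
  qed
  also have "\<dots> = rate ^ m * nrm (lap x) * (\<Sum>i<k. rate ^ i)"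
    by (simp add: sum_distrib_left sum_distrib_right power_add mult_ac)
  also have "\<dots> \<le> rate ^ m * nrm (lap x) * (1 / (1 - rate))"
  proof (rule mult_left_mono)
    show "(\<Sum>i<k. rate ^ i) \<le> 1 / (1 - rate)"
      using rate_nonneg rate_less by (simp add: sum_gp_strict divide_right_mono)
  qed (simp add: rate_nonneg nrm_nonneg assms lap_in)
  finally show ?thesis by (simp add: mult_ac)
qed

end

section \<open>Positive definite kernels and the spectral gap\<close>

text \<open>Symmetry is a separate clause because a real quadratic form does not see the
  antisymmetric part of its kernel. The kernel is invariant under left translation of both
  arguments, which is what later makes translations isometries.\<close>

definition posdef :: "('g, 'n) monoid_scheme \<Rightarrow> ('g \<Rightarrow> real) \<Rightarrow> bool" where
  "posdef G f \<longleftrightarrow> (\<forall>g\<in>carrier G. f (inv\<^bsub>G\<^esub> g) = f g) \<and>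
     (\<forall>F a. finite F \<longrightarrow> F \<subseteq> carrier G \<longrightarrow>
        0 \<le> (\<Sum>g\<in>F. \<Sum>h\<in>F. a g * a h * f (inv\<^bsub>G\<^esub> h \<otimes>\<^bsub>G\<^esub> g)))"

definition supp :: "('g \<Rightarrow> 'a::zero) \<Rightarrow> 'g set" where
  "supp a = {g. a g \<noteq> 0}"

definition fsupp :: "'g set \<Rightarrow> ('g \<Rightarrow> 'a::zero) set" where
  "fsupp C = {a. finite (supp a) \<and> supp a \<subseteq> C}"

context group
begin

text \<open>The Gelfand-Naimark-Segal form of \<open>f\<close> on finitely supported real functions,
  in which the point masses at \<open>g\<close> and \<open>h\<close> pair to
  \<open>f (inv h \<otimes> g)\<close>.\<close>

definition kform :: "('a \<Rightarrow> real) \<Rightarrow> ('a \<Rightarrow> real) \<Rightarrow> ('a \<Rightarrow> real) \<Rightarrow> real" where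
  "kform f a b = (\<Sum>g\<in>supp a. \<Sum>h\<in>supp b. a g * b h * f (inv h \<otimes> g))"

definition ltrans :: "'a \<Rightarrow> ('a \<Rightarrow> 'c::zero) \<Rightarrow> 'a \<Rightarrow> 'c" where
  "ltrans s a = (\<lambda>g. if g \<in> carrier G then a (inv s \<otimes> g) else 0)"

definition delta :: "'a \<Rightarrow> real" where
  "delta = (\<lambda>g. if g = \<one> then 1 else 0)"

text \<open>Supports change under sums and multiples, so linearity is checked over a common finite
  set.\<close>

lemma kform_superset:
  assumes "finite E" "finite E'" "supp a \<subseteq> E" "supp b \<subseteq> E'"
  shows "kform f a b = (\<Sum>g\<in>E. \<Sum>h\<in>E'. a g * b h * f (inv h \<otimes> g))"
proof -
  have "kform f a b = (\<Sum>g\<in>E. \<Sum>h\<in>supp b. a g * b h * f (inv h \<otimes> g))"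
    unfolding kform_def
    by (rule sum.mono_neutral_left) (use assms in \<open>auto simp: supp_def\<close>)
  also have "\<dots> = (\<Sum>g\<in>E. \<Sum>h\<in>E'. a g * b h * f (inv h \<otimes> g))"
    by (intro sum.cong refl sum.mono_neutral_left) (use assms in \<open>auto simp: supp_def\<close>)
  finally show ?thesis .
qed

lemma kform_sym:
  assumes "posdef G f" "a \<in> fsupp (carrier G)" "b \<in> fsupp (carrier G)"
  shows "kform f a b = kform f b a"
proof -
  have "f (inv h \<otimes> g) = f (inv g \<otimes> h)" if "g \<in> supp a" "h \<in> supp b" for g h
  proof -
    have gh: "g \<in> carrier G" "h \<in> carrier G" using that assms by (auto simp: fsupp_def)
    then have "f (inv (inv h \<otimes> g)) = f (inv h \<otimes> g)" using assms(1) by (simp add: posdef_def)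
    then show ?thesis using gh by (simp add: inv_mult_group)
  qed
  then have "kform f a b = (\<Sum>g\<in>supp a. \<Sum>h\<in>supp b. b h * a g * f (inv g \<otimes> h))"
    unfolding kform_def by (intro sum.cong refl) (auto simp: mult_ac)
  also have "\<dots> = kform f b a" unfolding kform_def by (rule sum.swap)
  finally show ?thesis .
qed

lemma fsupp_add: "a \<in> fsupp C \<Longrightarrow> b \<in> fsupp C \<Longrightarrow> a + b \<in> fsupp C" for a b :: "'g \<Rightarrow> 'c::monoid_add"
  unfolding fsupp_def
proof (intro CollectI conjI)
  assume "a \<in> {a. finite (supp a) \<and> supp a \<subseteq> C}" "b \<in> {a. finite (supp a) \<and> supp a \<subseteq> C}"
  moreover have "supp (a + b) \<subseteq> supp a \<union> supp b" by (auto simp: supp_def)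
  ultimately show "finite (supp (a + b))" "supp (a + b) \<subseteq> C"
    by (auto intro: finite_subset)
qed

lemma fsupp_scale: "a \<in> fsupp C \<Longrightarrow> r *\<^sub>R a \<in> fsupp C" for a :: "'g \<Rightarrow> real"
  unfolding fsupp_def by (auto intro: finite_subset[of _ "supp a"] simp: supp_def)

lemma semi_ip_kform:
  assumes "posdef G f"
  shows "semi_ip (fsupp (carrier G)) (kform f)"
proof
  show "0 \<in> fsupp (carrier G)" by (simp add: fsupp_def supp_def)
next
  fix a b c :: "'a \<Rightarrow> real"
  assume abc: "a \<in> fsupp (carrier G)" "b \<in> fsupp (carrier G)" "c \<in> fsupp (carrier G)"
  let ?E = "supp a \<union> supp b"
  have E: "finite ?E" "finite (supp c)" using abc by (auto simp: fsupp_def)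
  have "kform f (a + b) c = (\<Sum>g\<in>?E. \<Sum>h\<in>supp c. (a + b) g * c h * f (inv h \<otimes> g))"
    by (rule kform_superset) (use E in \<open>auto simp: supp_def\<close>)
  moreover have "kform f a c = (\<Sum>g\<in>?E. \<Sum>h\<in>supp c. a g * c h * f (inv h \<otimes> g))"
    by (rule kform_superset) (use E in \<open>auto simp: supp_def\<close>)
  moreover have "kform f b c = (\<Sum>g\<in>?E. \<Sum>h\<in>supp c. b g * c h * f (inv h \<otimes> g))"
    by (rule kform_superset) (use E in \<open>auto simp: supp_def\<close>)
  ultimately show "kform f (a + b) c = kform f a c + kform f b c"
    by (simp add: sum.distrib algebra_simps)
next
  fix a b :: "'a \<Rightarrow> real" and r :: real
  assume ab: "a \<in> fsupp (carrier G)" "b \<in> fsupp (carrier G)"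
  have "kform f (r *\<^sub>R a) b = (\<Sum>g\<in>supp a. \<Sum>h\<in>supp b. (r *\<^sub>R a) g * b h * f (inv h \<otimes> g))"
    by (rule kform_superset) (use ab in \<open>auto simp: supp_def fsupp_def\<close>)
  then show "kform f (r *\<^sub>R a) b = r * kform f a b"
    by (simp add: kform_def sum_distrib_left mult_ac)
next
  fix a b :: "'a \<Rightarrow> real"
  assume "a \<in> fsupp (carrier G)" "b \<in> fsupp (carrier G)"
  then show "kform f a b = kform f b a" by (rule kform_sym[OF assms])
next
  fix a :: "'a \<Rightarrow> real"
  assume "a \<in> fsupp (carrier G)"
  then show "0 \<le> kform f a a" using assms by (simp add: posdef_def kform_def fsupp_def)
qed (auto intro: fsupp_add fsupp_scale)

lemma supp_ltrans:
  assumes "s \<in> carrier G" "supp a \<subseteq> carrier G"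
  shows "supp (ltrans s a) = (\<lambda>g. s \<otimes> g) ` supp a"
proof (intro equalityI subsetI)
  fix g assume g: "g \<in> supp (ltrans s a)"
  then have "inv s \<otimes> g \<in> supp a" "g \<in> carrier G"
    by (auto simp: supp_def ltrans_def split: if_splits)
  moreover from this have "g = s \<otimes> (inv s \<otimes> g)" using assms by (simp add: m_assoc[symmetric])
  ultimately show "g \<in> (\<lambda>g. s \<otimes> g) ` supp a" by blast
next
  fix g assume "g \<in> (\<lambda>g. s \<otimes> g) ` supp a"
  then obtain h where h: "h \<in> supp a" "g = s \<otimes> h" by blast
  then have "h \<in> carrier G" using assms by auto
  then show "g \<in> supp (ltrans s a)" using h assms
    by (simp add: supp_def ltrans_def m_assoc[symmetric])
qed

lemma ltrans_apply:
  assumes "s \<in> carrier G" "g \<in> carrier G"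
  shows "ltrans s a (s \<otimes> g) = a g"
  using assms by (simp add: ltrans_def m_assoc[symmetric])

lemma ltrans_fsupp:
  assumes "s \<in> carrier G" "a \<in> fsupp (carrier G)"
  shows "ltrans s a \<in> fsupp (carrier G)"
  using assms supp_ltrans[of s a] by (auto simp: fsupp_def)

lemma inj_on_lmult: "s \<in> carrier G \<Longrightarrow> A \<subseteq> carrier G \<Longrightarrow> inj_on (\<lambda>g. s \<otimes> g) A"
  by (auto simp: inj_on_def subset_eq)

lemma kform_ltrans_left:
  assumes "s \<in> carrier G" "supp a \<subseteq> carrier G"
  shows "kform f (ltrans s a) b =
    (\<Sum>g\<in>supp a. \<Sum>h\<in>supp b. a g * b h * f (inv h \<otimes> (s \<otimes> g)))"
  unfolding kform_def supp_ltrans[OF assms]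
  using assms by (subst sum.reindex) (auto simp: inj_on_lmult ltrans_apply subset_eq intro!: sum.cong)

lemma kform_ltrans:
  assumes "s \<in> carrier G" "supp a \<subseteq> carrier G" "supp b \<subseteq> carrier G"
  shows "kform f (ltrans s a) (ltrans s b) = kform f a b"
proof -
  have "f (inv (s \<otimes> h) \<otimes> (s \<otimes> g)) = f (inv h \<otimes> g)" if "g \<in> supp a" "h \<in> supp b" for g h
  proof -
    have "g \<in> carrier G" "h \<in> carrier G" using that assms by auto
    then have "inv (s \<otimes> h) \<otimes> (s \<otimes> g) = inv h \<otimes> (inv s \<otimes> s \<otimes> g)"
      using assms(1) by (metis inv_closed inv_mult_group m_assoc m_closed)
    also have "\<dots> = inv h \<otimes> g" using assms(1) \<open>g \<in> carrier G\<close> by (simp only: l_inv l_one)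
    finally show ?thesis by (rule arg_cong)
  qed
  moreover have "kform f (ltrans s a) (ltrans s b) =
      (\<Sum>g\<in>supp a. \<Sum>h\<in>supp b. a g * b h * f (inv (s \<otimes> h) \<otimes> (s \<otimes> g)))"
    using assms by (subst kform_ltrans_left)
      (auto simp: supp_ltrans sum.reindex inj_on_lmult ltrans_apply subset_eq intro!: sum.cong)
  ultimately show ?thesis unfolding kform_def by (simp cong: sum.cong)
qed

lemma ltrans_add: "ltrans s (a + b) = ltrans s a + ltrans s b" for a b :: "'a \<Rightarrow> 'c::monoid_add"
  by (simp add: ltrans_def fun_eq_iff)

lemma ltrans_scale: "ltrans s (r *\<^sub>R a) = r *\<^sub>R ltrans s a" for a :: "'a \<Rightarrow> real"
  by (simp add: ltrans_def fun_eq_iff)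

lemma ltrans_mult:
  assumes "s \<in> carrier G" "t \<in> carrier G"
  shows "ltrans (s \<otimes> t) a = ltrans s (ltrans t a)"
  using assms by (auto simp: ltrans_def fun_eq_iff inv_mult_group m_assoc)

lemma ltrans_one: "supp a \<subseteq> carrier G \<Longrightarrow> ltrans \<one> a = a"
  by (auto simp: ltrans_def fun_eq_iff supp_def)

lemma supp_delta: "supp delta = {\<one>}"
  by (auto simp: supp_def delta_def)

lemma delta_fsupp: "delta \<in> fsupp (carrier G)"
  by (simp add: fsupp_def supp_delta)

lemma kform_delta: "s \<in> carrier G \<Longrightarrow> kform f (ltrans s delta) delta = f s"
  by (subst kform_ltrans_left) (simp_all add: supp_delta, simp add: delta_def)

lemma kform_delta_one: "kform f delta delta = f \<one>"
  by (simp add: kform_def supp_delta) (simp add: delta_def)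

text \<open>The trivial representation. Its form is the product of the two coefficient sums, so
  pairing with \<open>delta\<close> recovers the sum of a function.\<close>

lemma posdef_const: "posdef G (\<lambda>_. 1)"
  by (simp add: posdef_def sum_product[symmetric])

end

text \<open>Property (T) in the one form used from here on, free of Hilbert spaces: the summand for
  \<open>s\<close> on the right is half the squared displacement of \<open>a\<close> by
  \<open>s\<close> in the form of \<open>f\<close>. An invariant vector pairs equally with all point
  masses, hence with \<open>a\<close> to a multiple of the coefficient sum; so the condition of sum
  zero plays the role of orthogonality to the invariant vectors.\<close>

locale kazhdan_gap = group G for G (structure) +
  fixes S :: "'a set" and \<kappa> :: real
  assumes S_finite: "finite S" and S_carrier: "S \<subseteq> carrier G"
    and S_one: "\<one> \<in> S" and S_inv: "s \<in> S \<Longrightarrow> inv s \<in> S"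
    and S_generate: "generate G S = carrier G"
    and \<kappa>_pos: "\<kappa> > 0"
    and kazhdan_ineq: "\<lbrakk>posdef G f; finite F; F \<subseteq> carrier G; (\<Sum>g\<in>F. a g) = 0\<rbrakk> \<Longrightarrow>
      \<kappa> * (\<Sum>g\<in>F. \<Sum>h\<in>F. a g * a h * f (inv h \<otimes> g)) \<le>
      (\<Sum>s\<in>S. \<Sum>g\<in>F. \<Sum>h\<in>F. a g * a h * (f (inv h \<otimes> g) - f (inv h \<otimes> (s \<otimes> g))))"
begin

text \<open>The total squared displacement is \<open>4 * real (card S)\<close> times the pairing of
  \<open>lap a\<close> with \<open>a\<close>, and half of it enters the Kazhdan inequality; this
  gives \<open>2 * real (card S) / \<kappa>\<close>. The maximum with 1 keeps the argument of the
  square root in \<open>gap_rate\<close> nonnegative.\<close>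

definition gap_const :: real where
  "gap_const = max 1 (2 * real (card S) / \<kappa>)"

definition gap_rate :: real where
  "gap_rate = sqrt (1 - 1 / gap_const)"

text \<open>Two distances of at most \<open>nrm (lap delta) / (1 - gap_rate)\<close> give the factor
  \<open>4 / (1 - gap_rate)\<^sup>2\<close> in squared form. Then \<open>lap_energy\<close>, and the
  factor 2 between a squared displacement of \<open>delta\<close> and \<open>f \<one> - f g\<close>,
  lead to this value.\<close>

definition kaz_const :: real where
  "kaz_const = 1 / ((1 - gap_rate)\<^sup>2 * real (card S))"

lemma gap_const_ge: "gap_const \<ge> 1"
  by (simp add: gap_const_def)

lemma gap_rate_bounds: "0 \<le> gap_rate" "gap_rate < 1"
  using gap_const_ge by (auto simp: gap_rate_def field_simps)

lemma card_S: "real (card S) > 0"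
  using S_finite S_one by (auto simp: card_gt_0_iff)

lemma kaz_const_pos: "kaz_const > 0"
  using card_S gap_rate_bounds by (simp add: kaz_const_def)

text \<open>The vectors of sum zero contain no invariant vectors, so the averaging operator contracts
  them; its iterates on the cyclic vector therefore converge to an invariant vector.\<close>

lemma posdef_uniform:
  assumes f: "posdef G f" and g: "g \<in> carrier G"
  shows "f \<one> - f g \<le> kaz_const * (\<Sum>s\<in>S. f \<one> - f s)"
proof -
  let ?V = "fsupp (carrier G) :: ('a \<Rightarrow> real) set"
  have isom: "isometry_family ?V (kform h) S ltrans" if h: "posdef G h" for h
  proof -
    interpret semi_ip ?V "kform h" by (rule semi_ip_kform[OF h])
    show ?thesis
      using S_finite S_one S_carrier
      by unfold_locales (auto simp: ltrans_fsupp ltrans_add ltrans_scale subset_eq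
          intro!: kform_ltrans; auto simp: fsupp_def)+
  qed
  \<comment> \<open>A second form on the same space, which detects the coefficient sum.\<close>
  interpret one: isometry_family ?V "kform (\<lambda>_. 1)" S ltrans
    by (rule isom) (rule posdef_const)
  interpret isometry_family ?V "kform f" S ltrans
    by (rule isom) (rule f)
  define W where "W = {a \<in> ?V. kform (\<lambda>_. 1) a delta = 0}"
  have lap_W: "lap a \<in> W" if a: "a \<in> ?V" for a
  proof -
    have "kform (\<lambda>_. 1) (a - ltrans s a) delta = 0" if "s \<in> S" for s
    proof -
      have s: "s \<in> carrier G" using that S_carrier by auto
      have "kform (\<lambda>_. 1) (ltrans s a) delta = kform (\<lambda>_. 1) a delta"
        using a s by (subst kform_ltrans_left) (auto simp: fsupp_def kform_def)
      then show ?thesis using a s by (simp add: one.B_diff delta_fsupp ltrans_fsupp)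
    qed
    then have "kform (\<lambda>_. 1) (lap a) delta = 0"
      using a by (simp add: lap_def one.B_scale one.B_sum one.V_sum one.V_diff delta_fsupp L_in)
    then show ?thesis using a by (simp add: W_def lap_in)
  qed
  interpret gapped_family ?V "kform f" S ltrans W gap_const
  proof
    show "W \<subseteq> ?V" by (auto simp: W_def)
    show "lap a \<in> W" if "a \<in> ?V" for a using lap_W[OF that] .
    show "avg a \<in> W" if "a \<in> W" for a
      using lap_W[of a] that by (simp add: W_def avg_def V_diff one.B_diff delta_fsupp)
    show "gap_const \<ge> 1" by (rule gap_const_ge)
    fix a assume "a \<in> W"
    then have a: "a \<in> ?V" "finite (supp a)" "supp a \<subseteq> carrier G"
        "kform (\<lambda>_. 1) a delta = 0" by (auto simp: W_def fsupp_def)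
    have "(\<Sum>g\<in>supp a. a g) = 0" using a(4) by (simp add: kform_def supp_delta) (simp add: delta_def)
    from kazhdan_ineq[OF f a(2,3) this]
    have "\<kappa> * kform f a a \<le> (\<Sum>s\<in>S. \<Sum>g\<in>supp a. \<Sum>h\<in>supp a.
        a g * a h * (f (inv h \<otimes> g) - f (inv h \<otimes> (s \<otimes> g))))"
      by (simp add: kform_def)
    also have "\<dots> = (\<Sum>s\<in>S. kform f a a - kform f (ltrans s a) a)"
    proof (rule sum.cong[OF refl])
      fix s assume "s \<in> S"
      then have "s \<in> carrier G" using S_carrier by auto
      then show "(\<Sum>g\<in>supp a. \<Sum>h\<in>supp a. a g * a h * (f (inv h \<otimes> g) - f (inv h \<otimes> (s \<otimes> g)))) =
        kform f a a - kform f (ltrans s a) a"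
        by (subst kform_ltrans_left) (auto simp: a kform_def right_diff_distrib sum_subtractf)
    qed
    also have "\<dots> = 2 * real (card S) * kform f (lap a) a"
    proof -
      have "(\<Sum>s\<in>S. kform f (a - ltrans s a) (a - ltrans s a)) =
          2 * (\<Sum>s\<in>S. kform f a a - kform f (ltrans s a) a)"
        unfolding sum_distrib_left
        by (rule sum.cong) (auto simp: L_displacement a(1) B_diff L_in)
      then show ?thesis using lap_energy[OF a(1)] by simp
    qed
    finally have "kform f a a \<le> 2 * real (card S) / \<kappa> * kform f (lap a) a"
      using \<kappa>_pos by (simp add: field_simps)
    also have "\<dots> \<le> gap_const * kform f (lap a) a"
      using order_trans[OF B_nonneg[OF lap_in[OF a(1)]] lap_sq_le[OF a(1)]]
      by (intro mult_right_mono) (auto simp: gap_const_def)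
    finally show "kform f a a \<le> gap_const * kform f (lap a) a" .
  qed
  have rate: "rate = gap_rate" by (simp add: rate_def gap_rate_def)
  define x where "x k = (avg ^^ k) delta" for k
  have x: "x k \<in> ?V" for k unfolding x_def by (rule funpow_avg_in) (rule delta_fsupp)
  have Lin: "ltrans h a \<in> ?V" if "h \<in> carrier G" "a \<in> ?V" for h a
    using that by (rule ltrans_fsupp)
  have nrmL: "nrm (ltrans h a - ltrans h b) = nrm (a - b)"
    if "h \<in> carrier G" "a \<in> ?V" "b \<in> ?V" for h a b
  proof -
    have "ltrans h (a - b) = ltrans h a - ltrans h b" by (simp add: ltrans_def fun_eq_iff)
    moreover have "kform f (ltrans h (a - b)) (ltrans h (a - b)) = kform f (a - b) (a - b)"
      using V_diff[OF that(2,3)] that(1) by (intro kform_ltrans) (auto simp: fsupp_def)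
    ultimately show ?thesis by (simp add: nrm_def)
  qed
  have step: "(\<lambda>k. nrm (x k - ltrans s (x k))) \<longlonglongrightarrow> 0" if s: "s \<in> S" for s
  proof -
    define M where "M = 4 * real (card S) * (nrm (lap delta) * nrm delta)"
    have bound: "(nrm (x k - ltrans s (x k)))\<^sup>2 \<le> rate ^ k * M" for k
    proof -
      have "(nrm (x k - ltrans s (x k)))\<^sup>2 \<le> 4 * real (card S) * (nrm (lap (x k)) * nrm (x k))"
        using displacement_le[OF s x] by (simp add: mult_ac)
      also have "\<dots> \<le> 4 * real (card S) * ((rate ^ k * nrm (lap delta)) * nrm delta)"
        unfolding x_def
        by (intro mult_left_mono mult_mono nrm_lap_funpow_avg nrm_funpow_avg_le delta_fsupp)
          (auto simp: nrm_nonneg lap_in funpow_avg_in delta_fsupp rate_nonneg)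
      finally show ?thesis by (simp add: M_def mult_ac)
    qed
    have "(\<lambda>k. rate ^ k * M) \<longlonglongrightarrow> 0"
      using LIMSEQ_realpow_zero[OF rate_nonneg rate_less] by (rule tendsto_mult_left_zero)
    then have "(\<lambda>k. (nrm (x k - ltrans s (x k)))\<^sup>2) \<longlonglongrightarrow> 0"
      by (rule tendsto_sandwich[rotated 2, OF tendsto_const]) (auto simp: bound)
    then show ?thesis by (simp add: tendsto_null_power)
  qed
  have lim0: "(\<lambda>k. nrm (x k - ltrans h (x k))) \<longlonglongrightarrow> 0" if "h \<in> generate G S" for h
    using that
  proof (induction rule: generate.induct)
    case one
    have "ltrans \<one> (x k) = x k" for k using x[of k] by (intro ltrans_one) (auto simp: fsupp_def)
    moreover have "nrm (x k - x k) = 0" for k using x[of k] by (simp only: nrm_def B_diff V_diff) simp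
    ultimately show ?case by (simp only: tendsto_const)
  next
    case (incl s)
    then show ?case by (rule step)
  next
    case (inv s)
    then have "inv s \<in> S" by (rule S_inv)
    have eq: "nrm (x k - ltrans (inv s) (x k)) = nrm (x k - ltrans s (x k))" for k
    proof -
      have s: "s \<in> carrier G" using inv S_carrier by auto
      \<comment> \<open>Translating by \<open>s\<close> turns the displacement by
        \<open>inv s\<close> into the displacement by \<open>s\<close>.\<close>
      have "nrm (x k - ltrans (inv s) (x k)) = nrm (ltrans s (x k) - ltrans s (ltrans (inv s) (x k)))"
        using s x Lin by (simp add: nrmL)
      also have "ltrans s (ltrans (inv s) (x k)) = x k"
        using x[of k] s by (subst ltrans_mult[symmetric]) (auto intro!: ltrans_one simp: fsupp_def)
      also have "nrm (ltrans s (x k) - x k) = nrm (x k - ltrans s (x k))"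
        by (rule nrm_minus_commute[OF Lin[OF s x] x])
      finally show ?thesis .
    qed
    show ?case using step[OF inv] by (simp only: eq)
  next
    case (eng h1 h2)
    then have h: "h1 \<in> carrier G" "h2 \<in> carrier G" using S_generate by auto
    have "nrm (x k - ltrans (h1 \<otimes> h2) (x k)) \<le>
        nrm (x k - ltrans h1 (x k)) + nrm (x k - ltrans h2 (x k))" for k
    proof -
      have "nrm (x k - ltrans (h1 \<otimes> h2) (x k)) \<le>
        nrm (x k - ltrans h1 (x k)) + nrm (ltrans h1 (x k) - ltrans (h1 \<otimes> h2) (x k))"
        by (intro nrm_triangle_diff Lin x) (auto simp: h)
      then show ?thesis using h x Lin by (simp add: ltrans_mult nrmL)
    qed
    note le = this
    have lim: "(\<lambda>k. nrm (x k - ltrans h1 (x k)) + nrm (x k - ltrans h2 (x k))) \<longlonglongrightarrow> 0"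
      using tendsto_add[OF eng.IH] by (simp only: add_0)
    show ?case
    proof (rule tendsto_sandwich[OF _ _ tendsto_const lim])
      show "\<forall>\<^sub>F k in sequentially. 0 \<le> nrm (x k - ltrans (h1 \<otimes> h2) (x k))"
        using h by (intro always_eventually allI nrm_nonneg V_diff x Lin) auto
      show "\<forall>\<^sub>F k in sequentially. nrm (x k - ltrans (h1 \<otimes> h2) (x k)) \<le>
          nrm (x k - ltrans h1 (x k)) + nrm (x k - ltrans h2 (x k))"
        by (intro always_eventually allI le)
    qed
  qed
  \<comment> \<open>\<open>delta\<close> and its translate lie within
    \<open>nrm (lap delta) / (1 - rate)\<close> of an iterate and its translate, and these two merge
    in the limit. Hence the factor 2, and the same bound for every \<open>g\<close>.\<close>
  have "nrm (delta - ltrans g delta) \<le> 2 / (1 - rate) * nrm (lap delta)"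
  proof (rule LIMSEQ_le_const)
    show "(\<lambda>k. 2 / (1 - rate) * nrm (lap delta) + nrm (x k - ltrans g (x k)))
        \<longlonglongrightarrow> 2 / (1 - rate) * nrm (lap delta)"
      using tendsto_add[OF tendsto_const lim0] g S_generate by force
    have "nrm (delta - ltrans g delta) \<le>
        2 / (1 - rate) * nrm (lap delta) + nrm (x k - ltrans g (x k))" for k
    proof -
      have d: "nrm (delta - x k) \<le> 1 / (1 - rate) * nrm (lap delta)"
        using funpow_avg_dist[OF delta_fsupp, of 0 k] by (simp add: x_def)
      have "nrm (delta - ltrans g delta) \<le> nrm (delta - x k) + nrm (x k - ltrans g delta)"
        by (intro nrm_triangle_diff Lin x delta_fsupp g)
      moreover have "nrm (x k - ltrans g delta) \<le>
          nrm (x k - ltrans g (x k)) + nrm (ltrans g (x k) - ltrans g delta)"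
        by (intro nrm_triangle_diff Lin x delta_fsupp g)
      moreover have "nrm (ltrans g (x k) - ltrans g delta) = nrm (delta - x k)"
        by (simp add: nrmL g x delta_fsupp nrm_minus_commute)
      moreover have "2 / (1 - rate) * nrm (lap delta) =
          1 / (1 - rate) * nrm (lap delta) + 1 / (1 - rate) * nrm (lap delta)" by simp
      ultimately show ?thesis using d by linarith
    qed
    then show "\<exists>N. \<forall>k\<ge>N. nrm (delta - ltrans g delta) \<le>
        2 / (1 - rate) * nrm (lap delta) + nrm (x k - ltrans g (x k))" by blast
  qed
  then have "(nrm (delta - ltrans g delta))\<^sup>2 \<le> (2 / (1 - rate) * nrm (lap delta))\<^sup>2"
    by (intro power_mono nrm_nonneg V_diff Lin delta_fsupp g)
  also have "\<dots> \<le> 4 / (1 - rate)\<^sup>2 * kform f (lap delta) delta"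
    using lap_sq_le[OF delta_fsupp]
    by (simp add: power_mult_distrib power_divide nrm_sq lap_in delta_fsupp divide_right_mono)
  finally have main: "(nrm (delta - ltrans g delta))\<^sup>2 \<le> 4 / (1 - rate)\<^sup>2 * kform f (lap delta) delta" .
  have disp: "kform f (delta - ltrans h delta) (delta - ltrans h delta) = 2 * (f \<one> - f h)"
    if h: "h \<in> carrier G" for h
  proof -
    have "kform f (ltrans h delta) (ltrans h delta) = kform f delta delta"
      by (rule kform_ltrans) (use h in \<open>auto simp: supp_delta\<close>)
    then show ?thesis
      using h kform_sym[OF f delta_fsupp Lin[OF h delta_fsupp]]
      by (simp add: B_diff B_diff_right V_diff Lin delta_fsupp kform_delta kform_delta_one)
  qed
  have "(\<Sum>s\<in>S. 2 * (f \<one> - f s)) = 4 * real (card S) * kform f (lap delta) delta"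
    using lap_energy[OF delta_fsupp] S_carrier by (simp add: disp subset_eq cong: sum.cong)
  then have "2 * (\<Sum>s\<in>S. f \<one> - f s) = 4 * real (card S) * kform f (lap delta) delta"
    by (simp only: sum_distrib_left)
  then have energy: "kform f (lap delta) delta = (\<Sum>s\<in>S. f \<one> - f s) / (2 * real (card S))"
    using card_S by (simp add: field_simps)
  have "2 * (f \<one> - f g) \<le> 4 / (1 - rate)\<^sup>2 * kform f (lap delta) delta"
    using main g by (simp add: nrm_sq V_diff Lin delta_fsupp disp)
  then have "f \<one> - f g \<le> 2 / (1 - rate)\<^sup>2 * kform f (lap delta) delta"
    by simp
  also have "\<dots> = kaz_const * (\<Sum>s\<in>S. f \<one> - f s)"
    unfolding energy kaz_const_def rate by (simp add: field_simps)
  finally show ?thesis .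
qed

end

section \<open>Limits of almost invariant functions\<close>

lemma bounded_real_subseq:
  fixes f :: "nat \<Rightarrow> real"
  assumes "\<And>n. \<bar>f n\<bar> \<le> M"
  shows "\<exists>r. strict_mono r \<and> convergent (f \<circ> r)"
proof -
  obtain r where r: "strict_mono r" "monoseq (\<lambda>n. f (r n))"
    using seq_monosub[of f] by blast
  have "Bseq (\<lambda>n. f (r n))" by (rule BseqI'[of _ M]) (use assms in auto)
  then show ?thesis using r Bseq_monoseq_convergent[of "\<lambda>n. f (r n)"] by (auto simp: o_def)
qed

text \<open>Cantor's diagonal argument. It is here that countability of the group enters.\<close>

lemma pointwise_convergent_subseq:
  fixes f :: "nat \<Rightarrow> 'a \<Rightarrow> real"
  assumes "countable A" "\<And>x n. x \<in> A \<Longrightarrow> \<bar>f n x\<bar> \<le> M"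
  obtains r where "strict_mono r" "\<And>x. x \<in> A \<Longrightarrow> convergent (\<lambda>n. f (r n) x)"
proof (cases "A = {}")
  case True
  then show ?thesis using that[of id] by (simp add: strict_mono_id)
next
  case False
  define e where "e = from_nat_into A"
  have e: "e i \<in> A" for i using False by (simp add: e_def from_nat_into)
  interpret subseqs "\<lambda>i s. convergent (\<lambda>n. f (s n) (e i))"
  proof
    fix i s assume "strict_mono (s :: nat \<Rightarrow> nat)"
    show "\<exists>r'. strict_mono r' \<and> convergent (\<lambda>n. f ((s \<circ> r') n) (e i))"
      using bounded_real_subseq[of "\<lambda>n. f (s n) (e i)" M] assms(2)[OF e] by (auto simp: o_def)
  qed
  show ?thesis
  proof (rule that[OF subseq_diagseq])
    fix x assume "x \<in> A"
    then obtain i where i: "x = e i"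
      using from_nat_into_surj[OF assms(1)] by (auto simp: e_def)
    have "convergent (\<lambda>n. f ((diagseq \<circ> (+) (Suc i)) n) (e i))"
    proof (rule diagseq_holds)
      fix n s r assume "strict_mono (r :: nat \<Rightarrow> nat)" "convergent (\<lambda>k. f (s k) (e n))"
      then show "convergent (\<lambda>k. f ((s \<circ> r) k) (e n))"
        using convergent_subseq_convergent[of "\<lambda>k. f (s k) (e n)" r] by (simp add: o_def)
    qed
    then have "convergent (\<lambda>n. f (diagseq (n + Suc i)) x)" by (simp add: i o_def add.commute)
    then show "convergent (\<lambda>n. f (diagseq n) x)"
      using convergent_ignore_initial_segment[of "\<lambda>n. f (diagseq n) x" "Suc i"] by blast
  qed
qed

text \<open>Positive definiteness on a finite window \<open>F\<close>, witnessed by vectors. A local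
  representation yields it for windows that are small against its relator length. Vectors with
  finitely many coordinates make products available, and placing the coordinate set inside
  \<open>nat\<close> costs nothing by \<open>gramI\<close>.\<close>

definition gram :: "('g, 'n) monoid_scheme \<Rightarrow> 'g set \<Rightarrow> ('g \<Rightarrow> real) \<Rightarrow> bool" where
  "gram G F \<phi> \<longleftrightarrow> (\<exists>(I :: nat set) x. finite I \<and>
     (\<forall>g\<in>F. \<forall>h\<in>F. \<phi> (inv\<^bsub>G\<^esub> h \<otimes>\<^bsub>G\<^esub> g) = (\<Sum>i\<in>I. x g i * x h i)))"

lemma gramI:
  fixes I :: "'i set" and G (structure)
  assumes "finite I"
    and "\<And>g h. \<lbrakk>g \<in> F; h \<in> F\<rbrakk> \<Longrightarrow> \<phi> (inv h \<otimes> g) = (\<Sum>i\<in>I. x g i * x h i)"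
  shows "gram G F \<phi>"
proof -
  obtain e where e: "bij_betw e {..<card I} I"
    using assms(1) bij_betw_from_nat_into_finite by blast
  show ?thesis unfolding gram_def
    by (rule exI[of _ "{..<card I}"], rule exI[of _ "\<lambda>g. x g \<circ> e"])
      (auto simp: assms(2) sum.reindex_bij_betw[OF e, symmetric])
qed

text \<open>Schur product theorem: the tensor products of the two families of vectors have the
  product kernel.\<close>

lemma gram_mult:
  assumes "gram G F \<phi>" "gram G F \<psi>"
  shows "gram G F (\<lambda>g. \<phi> g * \<psi> g)"
proof -
  obtain I :: "nat set" and x where I: "finite I"
    "\<forall>g\<in>F. \<forall>h\<in>F. \<phi> (inv\<^bsub>G\<^esub> h \<otimes>\<^bsub>G\<^esub> g) = (\<Sum>i\<in>I. x g i * x h i)"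
    using assms(1) unfolding gram_def by blast
  obtain J :: "nat set" and y where J: "finite J"
    "\<forall>g\<in>F. \<forall>h\<in>F. \<psi> (inv\<^bsub>G\<^esub> h \<otimes>\<^bsub>G\<^esub> g) = (\<Sum>i\<in>J. y g i * y h i)"
    using assms(2) unfolding gram_def by blast
  show ?thesis
  proof (rule gramI[of "I \<times> J" _ _ _ "\<lambda>g (i, j). x g i * y g j"])
    fix g h assume "g \<in> F" "h \<in> F"
    then show "\<phi> (inv\<^bsub>G\<^esub> h \<otimes>\<^bsub>G\<^esub> g) * \<psi> (inv\<^bsub>G\<^esub> h \<otimes>\<^bsub>G\<^esub> g) =
        (\<Sum>i\<in>I \<times> J. (case i of (i, j) \<Rightarrow> x g i * y g j) * (case i of (i, j) \<Rightarrow> x h i * y h j))"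
      using I J by (simp add: sum_product sum.cartesian_product split_def mult_ac)
  qed (use I J in simp)
qed

lemma gram_scale:
  assumes "gram G F \<phi>" "c \<ge> 0"
  shows "gram G F (\<lambda>g. c * \<phi> g)"
proof -
  have "gram G F (\<lambda>_. c)"
    by (rule gramI[of "{()}" _ _ _ "\<lambda>_ _. sqrt c"]) (use assms in auto)
  from gram_mult[OF this assms(1)] show ?thesis .
qed

lemma gram_power:
  assumes "gram G F \<phi>"
  shows "gram G F (\<lambda>g. \<phi> g ^ k)"
proof (induction k)
  case 0
  show ?case by (rule gramI[of "{()}" _ _ _ "\<lambda>_ _. 1"]) auto
next
  case (Suc k)
  from gram_mult[OF assms this] show ?case by simp
qed

definition coord_ip :: "'i set \<Rightarrow> ('i \<Rightarrow> real) \<Rightarrow> ('i \<Rightarrow> real) \<Rightarrow> real" where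
  "coord_ip I u v = (\<Sum>i\<in>I. u i * v i)"

lemma semi_ip_coord: "semi_ip UNIV (coord_ip I)"
  by unfold_locales
    (auto simp: coord_ip_def sum.distrib algebra_simps sum_distrib_left sum_nonneg)

lemma gramE:
  fixes G (structure)
  assumes "gram G F \<phi>"
  obtains I :: "nat set" and x where
    "\<And>g h. \<lbrakk>g \<in> F; h \<in> F\<rbrakk> \<Longrightarrow> \<phi> (inv h \<otimes> g) = coord_ip I (x g) (x h)"
  using assms unfolding gram_def coord_ip_def by blast

context group
begin

lemma gram_inv:
  assumes "gram G F \<phi>" "\<one> \<in> F" "g \<in> F" "F \<subseteq> carrier G"
  shows "\<phi> (inv g) = \<phi> g"
proof -
  obtain I :: "nat set" and x where x: "\<And>g h. \<lbrakk>g \<in> F; h \<in> F\<rbrakk> \<Longrightarrow> \<phi> (inv h \<otimes> g) = coord_ip I (x g) (x h)"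
    using gramE[OF assms(1)] by blast
  show ?thesis using x[of g \<one>] x[of \<one> g] assms(2-) by (auto simp: coord_ip_def mult.commute)
qed

lemma gram_quadratic:
  assumes "gram G F \<phi>"
  shows "0 \<le> (\<Sum>g\<in>F. \<Sum>h\<in>F. a g * a h * \<phi> (inv h \<otimes> g))"
proof -
  obtain I :: "nat set" and x where x: "\<And>g h. \<lbrakk>g \<in> F; h \<in> F\<rbrakk> \<Longrightarrow> \<phi> (inv h \<otimes> g) = coord_ip I (x g) (x h)"
    using gramE[OF assms(1)] by blast
  interpret semi_ip UNIV "coord_ip I" by (rule semi_ip_coord)
  have "(\<Sum>g\<in>F. \<Sum>h\<in>F. a g * a h * \<phi> (inv h \<otimes> g)) =
      coord_ip I (\<Sum>g\<in>F. a g *\<^sub>R x g) (\<Sum>g\<in>F. a g *\<^sub>R x g)"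
    by (subst B_sum, simp, simp, intro sum.cong refl, subst B_sum_right)
      (auto simp: B_scale B_scale_right x sum_distrib_left mult_ac intro!: sum.cong)
  then show ?thesis using B_nonneg by simp
qed

text \<open>The vectors attached to \<open>F\<close> all have squared norm
  \<open>\<phi> \<one>\<close>, because \<open>inv g \<otimes> g = \<one>\<close>; the rest is
  Cauchy-Schwarz.\<close>

lemma gram_abs_le:
  assumes "gram G F \<phi>" "\<one> \<in> F" "g \<in> F" "F \<subseteq> carrier G"
  shows "\<bar>\<phi> g\<bar> \<le> \<phi> \<one>"
proof -
  obtain I :: "nat set" and x where x: "\<And>g h. \<lbrakk>g \<in> F; h \<in> F\<rbrakk> \<Longrightarrow> \<phi> (inv h \<otimes> g) = coord_ip I (x g) (x h)"
    using gramE[OF assms(1)] by blast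
  interpret semi_ip UNIV "coord_ip I" by (rule semi_ip_coord)
  have g: "g \<in> carrier G" using assms by auto
  have "\<bar>\<phi> g\<bar> \<le> nrm (x g) * nrm (x \<one>)"
    using abs_B_le[of "x g" "x \<one>"] x[of g \<one>] assms g by simp
  moreover have "nrm (x g) = nrm (x \<one>)"
    using x[of g g] x[of \<one> \<one>] assms g by (simp add: nrm_def)
  moreover have "nrm (x \<one>) * nrm (x \<one>) = \<phi> \<one>"
    using x[of \<one> \<one>] assms nrm_sq[of "x \<one>"] by (simp add: power2_eq_square)
  ultimately show ?thesis by simp
qed

end

section \<open>Limits of vectors that violate the gap\<close>

context kazhdan_gap
begin

text \<open>For vectors \<open>x\<close> of a Gram representation let \<open>w\<close> be the sum of
  \<open>x \<one> - x s\<close> over \<open>S\<close>. Then \<open>energy1\<close> is the pairing of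
  \<open>w\<close> with \<open>x \<one>\<close>, and \<open>energy2\<close> is the squared norm of
  \<open>w\<close>. Up to normalization \<open>w\<close> is the Laplacian of
  \<open>x \<one>\<close>, so a bound of \<open>energy1\<close> by a multiple of
  \<open>energy2\<close> is a spectral gap.\<close>

definition energy1 :: "('a \<Rightarrow> real) \<Rightarrow> real" where
  "energy1 \<phi> = (\<Sum>s\<in>S. \<phi> \<one> - \<phi> s)"

definition energy2 :: "('a \<Rightarrow> real) \<Rightarrow> real" where
  "energy2 \<phi> = (\<Sum>s\<in>S. \<Sum>t\<in>S. \<phi> \<one> - \<phi> s - \<phi> t + \<phi> (inv t \<otimes> s))"

text \<open>The two inequalities are Cauchy-Schwarz for the Laplacian vector \<open>w\<close>
  against \<open>x \<one>\<close> and against \<open>x g - x \<one>\<close>. The pairing of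
  \<open>w\<close> with \<open>x g\<close> is the discrete Laplacian of \<open>\<phi>\<close> at
  \<open>g\<close>, so small \<open>energy2\<close> makes this Laplacian almost the constant
  \<open>energy1\<close> wherever \<open>\<phi> \<one> - \<phi> g\<close> is bounded.\<close>

lemma gram_energy:
  assumes "gram G F \<phi>" "S \<subseteq> F" "F \<subseteq> carrier G" "g \<in> F"
  shows "0 \<le> energy2 \<phi>" "(energy1 \<phi>)\<^sup>2 \<le> energy2 \<phi> * \<phi> \<one>"
    "((\<Sum>s\<in>S. \<phi> g - \<phi> (inv s \<otimes> g)) - energy1 \<phi>)\<^sup>2 \<le> energy2 \<phi> * (2 * (\<phi> \<one> - \<phi> g))"
proof -
  obtain I :: "nat set" and x where x: "\<And>g h. \<lbrakk>g \<in> F; h \<in> F\<rbrakk> \<Longrightarrow> \<phi> (inv h \<otimes> g) = coord_ip I (x g) (x h)"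
    using gramE[OF assms(1)] by blast
  interpret semi_ip UNIV "coord_ip I" by (rule semi_ip_coord)
  have oneF: "\<one> \<in> F" using assms(2) S_one by auto
  have SF: "s \<in> F" "s \<in> carrier G" if "s \<in> S" for s using assms(2,3) that by auto
  have gG: "g \<in> carrier G" using assms by auto
  have sym: "\<phi> (inv s) = \<phi> s" if "s \<in> F" for s
    by (rule gram_inv[OF assms(1) oneF that assms(3)])
  have x1: "coord_ip I (x h) (x \<one>) = \<phi> h" "coord_ip I (x \<one>) (x h) = \<phi> h" if "h \<in> F" for h
    using x[OF that oneF] x[OF oneF that] that assms(3) sym[OF that] by auto
  define w where "w = (\<Sum>s\<in>S. x \<one> - x s)"
  have ww: "coord_ip I w w = energy2 \<phi>"
    unfolding w_def energy2_def
    by (subst B_sum, simp, simp, intro sum.cong refl, subst B_sum_right)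
      (auto simp: B_diff B_diff_right x1 oneF SF x sum.distrib sum_subtractf intro!: sum.cong)
  have w1: "coord_ip I w (x \<one>) = energy1 \<phi>"
    unfolding w_def energy1_def by (subst B_sum) (auto simp: B_diff x1 oneF SF)
  have xs: "coord_ip I (x s) (x g) = \<phi> (inv s \<otimes> g)" if "s \<in> S" for s
    using x[OF assms(4) SF(1)[OF that]] B_sym[of "x s" "x g"] by simp
  have wg: "coord_ip I w (x g) = (\<Sum>s\<in>S. \<phi> g - \<phi> (inv s \<otimes> g))"
    unfolding w_def
    by (subst B_sum)
      (auto simp: B_diff x1 assms(4) xs intro!: sum.cong)
  show "0 \<le> energy2 \<phi>" using B_nonneg[of w] ww by simp
  show "(energy1 \<phi>)\<^sup>2 \<le> energy2 \<phi> * \<phi> \<one>"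
    using Cauchy_Schwarz[of w "x \<one>"] by (simp add: ww w1 x1 oneF)
  have "coord_ip I (x g) (x g) = \<phi> \<one>" using x[of g g] assms(4) gG by simp
  then show "((\<Sum>s\<in>S. \<phi> g - \<phi> (inv s \<otimes> g)) - energy1 \<phi>)\<^sup>2 \<le> energy2 \<phi> * (2 * (\<phi> \<one> - \<phi> g))"
    using Cauchy_Schwarz[of w "x g - x \<one>"]
    by (simp add: B_diff_right B_diff ww w1 wg x1 oneF assms(4))
qed

text \<open>In the limit, \<open>\<phi> \<one> - \<phi>\<close> becomes a function whose average over the translates by \<open>S\<close>
  exceeds its value by a constant; such a function cannot be bounded.\<close>

lemma gram_seq_unbounded:
  assumes cnt: "countable (carrier G)"
    and gram: "\<And>F. finite F \<Longrightarrow> F \<subseteq> carrier G \<Longrightarrow> \<forall>\<^sub>F n in sequentially. gram G F (\<psi> n)"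
    and e1: "\<forall>\<^sub>F n in sequentially. energy1 (\<psi> n) = 1"
    and e2: "(\<lambda>n. energy2 (\<psi> n)) \<longlonglongrightarrow> 0"
    and bd: "\<And>g. g \<in> carrier G \<Longrightarrow> \<forall>\<^sub>F n in sequentially. \<psi> n \<one> - \<psi> n g \<le> R"
  shows False
proof -
  \<comment> \<open>Truncation gives the uniform bound that the diagonal argument requires; at each
    fixed \<open>g\<close> it is eventually inactive.\<close>
  define D where "D n g = max 0 (min R (\<psi> n \<one> - \<psi> n g))" for n g
  obtain r where r: "strict_mono r" "\<And>g. g \<in> carrier G \<Longrightarrow> convergent (\<lambda>n. D (r n) g)"
  proof (rule pointwise_convergent_subseq[OF cnt, of D "\<bar>R\<bar>"])
    show "\<bar>D n g\<bar> \<le> \<bar>R\<bar>" for n g by (auto simp: D_def)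
  qed blast
  define \<nu> where "\<nu> g = lim (\<lambda>n. D (r n) g)" for g
  have lim: "(\<lambda>n. D (r n) g) \<longlonglongrightarrow> \<nu> g" if "g \<in> carrier G" for g
    using r(2)[OF that] by (simp add: \<nu>_def convergent_LIMSEQ_iff)
  have sub: "\<forall>\<^sub>F n in sequentially. P (r n)" if "\<forall>\<^sub>F n in sequentially. P n" for P
    using eventually_subseq[OF r(1) that] .
  have Deq: "\<forall>\<^sub>F n in sequentially. D n g = \<psi> n \<one> - \<psi> n g" if "g \<in> carrier G" for g
  proof -
    have "\<forall>\<^sub>F n in sequentially. gram G {\<one>, g} (\<psi> n)" by (rule gram) (use that in auto)
    with bd[OF that] show ?thesis
    proof eventually_elim
      case (elim n)
      then have "\<bar>\<psi> n g\<bar> \<le> \<psi> n \<one>" using that by (intro gram_abs_le[of "{\<one>, g}"]) auto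
      then show ?case using elim(1) by (auto simp: D_def)
    qed
  qed
  have eq: "(\<Sum>s\<in>S. \<nu> (inv s \<otimes> g) - \<nu> g) = 1" if g: "g \<in> carrier G" for g
  proof -
    let ?F = "insert g S"
    have SG: "s \<in> carrier G" if "s \<in> S" for s using S_carrier that by auto
    have "\<forall>\<^sub>F n in sequentially. gram G ?F (\<psi> n)"
      by (rule gram) (use g S_carrier S_finite in auto)
    moreover have "\<forall>\<^sub>F n in sequentially. \<forall>s\<in>S. D n (inv s \<otimes> g) = \<psi> n \<one> - \<psi> n (inv s \<otimes> g)"
      by (intro eventually_ball_finite S_finite ballI Deq) (use g SG in auto)
    ultimately have ev: "\<forall>\<^sub>F n in sequentially.
      ((\<Sum>s\<in>S. D n (inv s \<otimes> g) - D n g) - 1)\<^sup>2 \<le> energy2 (\<psi> n) * (2 * R)"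
      using Deq[OF g] e1 bd[OF g]
    proof eventually_elim
      case (elim n)
      note E = gram_energy[OF elim(1), of g]
      have "(\<Sum>s\<in>S. D n (inv s \<otimes> g) - D n g) = (\<Sum>s\<in>S. \<psi> n g - \<psi> n (inv s \<otimes> g))"
        using elim(2,3) by (intro sum.cong) auto
      then have "((\<Sum>s\<in>S. D n (inv s \<otimes> g) - D n g) - 1)\<^sup>2 \<le>
          energy2 (\<psi> n) * (2 * (\<psi> n \<one> - \<psi> n g))"
        using E(3) S_carrier g elim(4) by auto
      also have "\<dots> \<le> energy2 (\<psi> n) * (2 * R)"
        using E(1) S_carrier g elim(5) by (intro mult_left_mono) auto
      finally show ?case .
    qed
    have "(\<lambda>n. ((\<Sum>s\<in>S. D (r n) (inv s \<otimes> g) - D (r n) g) - 1)\<^sup>2)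
        \<longlonglongrightarrow> ((\<Sum>s\<in>S. \<nu> (inv s \<otimes> g) - \<nu> g) - 1)\<^sup>2"
      by (intro tendsto_intros lim) (use g SG in auto)
    from _ this have "((\<Sum>s\<in>S. \<nu> (inv s \<otimes> g) - \<nu> g) - 1)\<^sup>2 \<le> 0"
    proof (rule tendsto_le[OF sequentially_bot _ _ sub[OF ev]])
      show "(\<lambda>n. energy2 (\<psi> (r n)) * (2 * R)) \<longlonglongrightarrow> 0"
        using LIMSEQ_subseq_LIMSEQ[OF e2 r(1)] by (auto simp: o_def intro: tendsto_mult_left_zero)
    qed
    then show ?thesis by simp
  qed
  have \<nu>_le: "\<nu> g \<le> \<bar>R\<bar>" if "g \<in> carrier G" for g
    by (rule LIMSEQ_le_const2[OF lim[OF that]]) (auto simp: D_def)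
  define M where "M = (SUP g\<in>carrier G. \<nu> g)"
  have bdd: "bdd_above (\<nu> ` carrier G)" by (rule bdd_aboveI2[OF \<nu>_le])
  have le_M: "\<nu> g \<le> M" if "g \<in> carrier G" for g
    unfolding M_def using that bdd by (rule cSUP_upper)
  \<comment> \<open>At a point this close to the supremum, each of the \<open>card S\<close>
    increments is at most \<open>1 / (2 * real (card S))\<close>, although together they add up to
    1.\<close>
  have "M - 1 / (2 * real (card S)) < M" using card_S by simp
  then obtain g where g: "g \<in> carrier G" "M - 1 / (2 * real (card S)) < \<nu> g"
    unfolding M_def using less_cSUP_iff[OF _ bdd] one_closed by (metis empty_iff)
  have "1 = (\<Sum>s\<in>S. \<nu> (inv s \<otimes> g) - \<nu> g)" using eq[OF g(1)] by simp
  also have "\<dots> \<le> (\<Sum>s\<in>S. 1 / (2 * real (card S)))"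
  proof (rule sum_mono)
    fix s assume "s \<in> S"
    then have "inv s \<otimes> g \<in> carrier G" using S_carrier g by auto
    from le_M[OF this] show "\<nu> (inv s \<otimes> g) - \<nu> g \<le> 1 / (2 * real (card S))" using g(2) by simp
  qed
  also have "\<dots> = 1 / 2" using card_S by simp
  finally show False by simp
qed

text \<open>Normalize \<open>energy1 = 1\<close>, so that \<open>c = \<psi> n \<one>\<close> tends to infinity. The powers
  \<open>(\<psi> n / c) ^ k\<close> with \<open>k\<close> proportional to \<open>c\<close> approximate \<open>exp (- t (c - \<psi> n))\<close> and are
  positive definite by the Schur product theorem; property (T), through the uniform bound above,
  keeps their limit away from 0, whence \<open>c - \<psi> n\<close> is bounded. The exponent is chosen odd so that
  the power retains the sign of its base.\<close>

lemma normalized_gram_seq_False: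
  assumes cnt: "countable (carrier G)"
    and gram: "\<And>F. finite F \<Longrightarrow> F \<subseteq> carrier G \<Longrightarrow> \<forall>\<^sub>F n in sequentially. gram G F (\<psi> n)"
    and e1: "\<forall>\<^sub>F n in sequentially. energy1 (\<psi> n) = 1"
    and e2: "(\<lambda>n. energy2 (\<psi> n)) \<longlonglongrightarrow> 0"
  shows False
proof -
  define c where "c n = \<psi> n \<one>" for n
  \<comment> \<open>Chosen so that \<open>kaz_const * (2 * t) = 1 / 2\<close>, which keeps the limit
    function at least 1/2 everywhere.\<close>
  define t where "t = 1 / (4 * kaz_const)"
  have t: "t > 0" using kaz_const_pos by (simp add: t_def)
  define k where "k n = 2 * nat \<lceil>t * c n\<rceil> + 1" for n
  define p where "p n g = (\<psi> n g / c n) ^ k n" for n g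
  \<comment> \<open>The bound of \<open>p\<close> by 1 holds only from an index depending on
    \<open>g\<close> on; \<open>P\<close> enforces it throughout, so that a subsequence can be
    chosen.\<close>
  define P where "P n g = (if \<bar>p n g\<bar> \<le> 1 then p n g else 0)" for n g
  have SG: "s \<in> carrier G" if "s \<in> S" for s using S_carrier that by auto
  have c_top: "filterlim c at_top sequentially"
    unfolding filterlim_at_top
  proof
    fix Z :: real
    have "\<forall>\<^sub>F n in sequentially. energy2 (\<psi> n) < 1 / (\<bar>Z\<bar> + 1)"
      by (rule order_tendstoD(2)[OF e2]) simp
    with gram[OF S_finite S_carrier] e1 show "\<forall>\<^sub>F n in sequentially. Z \<le> c n"
    proof eventually_elim
      case (elim n)
      note E = gram_energy[OF elim(1) order_refl S_carrier S_one]
      \<comment> \<open>Energy 1 against vanishing \<open>energy2\<close> forces the squared norm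
        \<open>c n\<close> to infinity.\<close>
      have le: "1 \<le> energy2 (\<psi> n) * c n" using E(2) elim(2) by (simp add: c_def)
      have c0: "c n > 0"
      proof (rule ccontr)
        assume "\<not> c n > 0"
        then have "energy2 (\<psi> n) * c n \<le> 0" using E(1) by (simp add: mult_nonneg_nonpos)
        with le show False by simp
      qed
      have "1 \<le> 1 / (\<bar>Z\<bar> + 1) * c n"
        using le elim(3) c0 by (meson less_eq_real_def mult_right_mono order_trans)
      then show ?case by (simp add: field_simps)
    qed
  qed
  have c_pos: "\<forall>\<^sub>F n in sequentially. c n \<ge> 1"
    using c_top unfolding filterlim_at_top by blast
  have abs_le: "\<forall>\<^sub>F n in sequentially. \<bar>\<psi> n g\<bar> \<le> c n" if "g \<in> carrier G" for g
  proof -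
    have "\<forall>\<^sub>F n in sequentially. gram G {\<one>, g} (\<psi> n)" by (rule gram) (use that in auto)
    then show ?thesis
    proof eventually_elim
      case (elim n)
      then show ?case using that unfolding c_def by (intro gram_abs_le[of "{\<one>, g}"]) auto
    qed
  qed
  have p_abs: "\<forall>\<^sub>F n in sequentially. \<bar>p n g\<bar> \<le> 1" if "g \<in> carrier G" for g
    using abs_le[OF that] c_pos
    by eventually_elim (auto simp: p_def power_abs abs_divide intro!: power_le_one)
  have pP: "\<forall>\<^sub>F n in sequentially. P n g = p n g" if "g \<in> carrier G" for g
    using p_abs[OF that] by eventually_elim (simp add: P_def)
  obtain r where r: "strict_mono r" "\<And>g. g \<in> carrier G \<Longrightarrow> convergent (\<lambda>n. P (r n) g)"
  proof (rule pointwise_convergent_subseq[OF cnt, of P 1])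
    show "\<bar>P n g\<bar> \<le> 1" for n g by (simp add: P_def)
  qed blast
  have sub: "\<forall>\<^sub>F n in sequentially. Q (r n)" if "\<forall>\<^sub>F n in sequentially. Q n" for Q
    using eventually_subseq[OF r(1) that] .
  have sublim: "(\<lambda>n. h (r n)) \<longlonglongrightarrow> l" if "h \<longlonglongrightarrow> l" for h :: "nat \<Rightarrow> real" and l
    using LIMSEQ_subseq_LIMSEQ[OF that r(1)] by (simp add: o_def)
  define f where "f g = lim (\<lambda>n. P (r n) g)" for g
  have lim: "(\<lambda>n. p (r n) g) \<longlonglongrightarrow> f g" if g: "g \<in> carrier G" for g
  proof -
    have "(\<lambda>n. P (r n) g) \<longlonglongrightarrow> f g"
      using r(2)[OF g] by (simp add: f_def convergent_LIMSEQ_iff)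
    then show ?thesis
      by (rule Lim_transform_eventually) (rule sub[OF pP[OF g]])
  qed
  have pgram: "\<forall>\<^sub>F n in sequentially. gram G F (p n)" if "finite F" "F \<subseteq> carrier G" for F
    using gram[OF that] c_pos
  proof eventually_elim
    case (elim n)
    have "gram G F (\<lambda>g. (1 / c n * \<psi> n g) ^ k n)"
      by (intro gram_power gram_scale) (use elim in auto)
    then show ?case by (simp add: p_def[abs_def])
  qed
  have f: "posdef G f"
    unfolding posdef_def
  proof (intro conjI ballI allI impI)
    fix g assume g: "g \<in> carrier G"
    have "\<forall>\<^sub>F n in sequentially. gram G {\<one>, g} (p n)" by (rule pgram) (use g in auto)
    then have "\<forall>\<^sub>F n in sequentially. p n (inv g) = p n g"
      by eventually_elim (use g in \<open>auto intro!: gram_inv[of "{\<one>, g}"]\<close>)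
    from Lim_transform_eventually[OF lim sub[OF this]] g
    have "(\<lambda>n. p (r n) g) \<longlonglongrightarrow> f (inv g)" by simp
    then show "f (inv g) = f g" using lim[OF g] LIMSEQ_unique by blast
  next
    fix F :: "'a set" and a :: "'a \<Rightarrow> real" assume F: "finite F" "F \<subseteq> carrier G"
    have "(\<lambda>n. \<Sum>g\<in>F. \<Sum>h\<in>F. a g * a h * p (r n) (inv h \<otimes> g)) \<longlonglongrightarrow>
        (\<Sum>g\<in>F. \<Sum>h\<in>F. a g * a h * f (inv h \<otimes> g))"
      by (intro tendsto_intros lim) (use F in auto)
    then show "0 \<le> (\<Sum>g\<in>F. \<Sum>h\<in>F. a g * a h * f (inv h \<otimes> g))"
    proof (rule tendsto_lowerbound)
      show "\<forall>\<^sub>F n in sequentially. 0 \<le> (\<Sum>g\<in>F. \<Sum>h\<in>F. a g * a h * p (r n) (inv h \<otimes> g))"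
        using sub[OF pgram[OF F]] by eventually_elim (rule gram_quadratic)
    qed simp
  qed
  have "\<forall>\<^sub>F n in sequentially. p n \<one> = 1"
    using c_pos by eventually_elim (simp add: p_def flip: c_def)
  from Lim_transform_eventually[OF lim[OF one_closed] sub[OF this]]
  have "(\<lambda>n. 1) \<longlonglongrightarrow> f \<one>" .
  then have f1: "f \<one> = 1" using LIMSEQ_unique tendsto_const by blast
  have k_le: "\<forall>\<^sub>F n in sequentially. real (k n) / c n \<le> 2 * t + 3 / c n"
    using c_pos
  proof eventually_elim
    case (elim n)
    have "real (nat \<lceil>t * c n\<rceil>) \<le> t * c n + 1"
      using t elim by (simp add: of_nat_nat)
    then have "real (k n) / c n \<le> (2 * (t * c n) + 3) / c n"
      using elim by (intro divide_right_mono) (auto simp: k_def)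
    then show ?case using elim by (simp add: add_divide_distrib)
  qed
  have Sle: "\<forall>\<^sub>F n in sequentially. (\<Sum>s\<in>S. 1 - p n s) \<le> 2 * t + 3 / c n"
  proof -
    have "\<forall>\<^sub>F n in sequentially. \<forall>s\<in>S. \<bar>\<psi> n s\<bar> \<le> c n"
      by (intro eventually_ball_finite S_finite ballI abs_le SG)
    then show ?thesis using e1 c_pos k_le
    proof eventually_elim
      case (elim n)
      have "(\<Sum>s\<in>S. 1 - p n s) \<le> (\<Sum>s\<in>S. real (k n) / c n * (\<psi> n \<one> - \<psi> n s))"
      proof (rule sum_mono)
        fix s assume s: "s \<in> S"
        \<comment> \<open>One defect is at most the total energy 1, hence at most
          \<open>c n\<close>. This makes the base of the power nonnegative and Bernoulli's
          inequality applicable.\<close>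
        have "\<psi> n \<one> - \<psi> n s \<le> (\<Sum>s\<in>S. \<psi> n \<one> - \<psi> n s)"
          using s elim(1) S_finite by (intro member_le_sum) (auto simp: c_def abs_le_iff)
        then have "\<psi> n \<one> - \<psi> n s \<le> 1" using elim(2) by (simp add: energy1_def)
        then have "0 \<le> \<psi> n s / c n" using elim(3) by (simp add: c_def)
        then have "1 + real (k n) * (\<psi> n s / c n - 1) \<le> (1 + (\<psi> n s / c n - 1)) ^ k n"
          by (intro Bernoulli_inequality) simp
        then have "1 - p n s \<le> real (k n) * (1 - \<psi> n s / c n)"
          by (simp add: p_def algebra_simps)
        also have "\<dots> = real (k n) / c n * (\<psi> n \<one> - \<psi> n s)"
          using elim(3) by (simp add: field_simps flip: c_def)
        finally show "1 - p n s \<le> real (k n) / c n * (\<psi> n \<one> - \<psi> n s)" .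
      qed
      also have "\<dots> = real (k n) / c n"
        using elim(2) by (simp only: energy1_def flip: sum_distrib_left)
      finally show ?case using elim(4) by simp
    qed
  qed
  have "(\<Sum>s\<in>S. 1 - f s) \<le> 2 * t"
  proof (rule tendsto_le[OF sequentially_bot _ _ sub[OF Sle]])
    have "(\<lambda>n. 3 / c n) \<longlonglongrightarrow> 0"
      by (rule real_tendsto_divide_at_top[OF tendsto_const c_top])
    from tendsto_add[OF tendsto_const[of "2 * t"] sublim[OF this]]
    show "(\<lambda>n. 2 * t + 3 / c (r n)) \<longlonglongrightarrow> 2 * t" by simp
    show "(\<lambda>n. \<Sum>s\<in>S. 1 - p (r n) s) \<longlonglongrightarrow> (\<Sum>s\<in>S. 1 - f s)"
      by (intro tendsto_intros lim SG)
  qed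
  then have "kaz_const * (\<Sum>s\<in>S. 1 - f s) \<le> kaz_const * (2 * t)"
    using kaz_const_pos by (intro mult_left_mono) auto
  also have "\<dots> = 1 / 2" using kaz_const_pos by (simp add: t_def)
  finally have f_ge: "f g \<ge> 1 / 2" if "g \<in> carrier G" for g
    using posdef_uniform[OF f that] by (simp add: f1)
  have bd: "\<forall>\<^sub>F n in sequentially. \<psi> (r n) \<one> - \<psi> (r n) g \<le> ln 4 / t" if g: "g \<in> carrier G" for g
  proof -
    \<comment> \<open>Any threshold strictly below 1/2 would do; 1/4 is the origin of the bound
      \<open>ln 4 / t\<close>.\<close>
    have "\<forall>\<^sub>F n in sequentially. p (r n) g > 1 / 4"
      by (rule order_tendstoD(1)[OF lim[OF g]]) (use f_ge[OF g] in linarith)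
    then show ?thesis using sub[OF abs_le[OF g]] sub[OF c_pos]
    proof eventually_elim
      case (elim n)
      let ?m = "r n"
      let ?y = "\<psi> ?m g / c ?m"
      have y_pos: "?y > 0"
      proof (rule ccontr)
        assume "\<not> ?y > 0"
        then have "?y * (?y ^ nat \<lceil>t * c ?m\<rceil>)\<^sup>2 \<le> 0"
          by (intro mult_nonpos_nonneg) auto
        then have "?y ^ k ?m \<le> 0"
          by (simp only: k_def power_add power_one_right power_even_eq mult.commute[of ?y])
        then show False using elim(1) by (simp add: p_def)
      qed
      have "t * c ?m \<le> real (k ?m)" unfolding k_def by linarith
      then have kt: "t * c ?m * (1 - ?y) \<le> real (k ?m) * (1 - ?y)"
        using elim by (intro mult_right_mono) (auto simp: abs_le_iff)
      \<comment> \<open>The estimate \<open>ln y \<le> y - 1\<close> turns the lower bound on the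
        power into an upper bound on the exponent times \<open>1 - y\<close>, and the exponent is at
        least \<open>t * c ?m\<close>.\<close>
      have "ln (1 / 4) < ln (?y ^ k ?m)"
        using elim(1) y_pos by (subst ln_less_cancel_iff) (auto simp: p_def)
      also have "\<dots> = real (k ?m) * ln ?y" using y_pos by (simp add: ln_realpow)
      also have "\<dots> \<le> real (k ?m) * (?y - 1)"
        using ln_le_minus_one[OF y_pos] by (intro mult_left_mono) auto
      finally have "real (k ?m) * (1 - ?y) \<le> ln 4" by (simp add: ln_div algebra_simps)
      with kt have "t * (c ?m * (1 - ?y)) \<le> ln 4" by simp
      moreover have "c ?m * (1 - ?y) = \<psi> ?m \<one> - \<psi> ?m g"
        using elim(3) by (simp add: field_simps flip: c_def)
      ultimately show ?case using t by (simp add: field_simps)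
    qed
  qed
  show False
    by (rule gram_seq_unbounded[of "\<lambda>n. \<psi> (r n)", OF cnt sub[OF gram] sub[OF e1] sublim[OF e2] bd])
qed

text \<open>Dividing by the energy normalizes it to 1 and pushes \<open>energy2\<close> below
  \<open>1 / n\<close>. The energy is eventually positive because it strictly exceeds a nonnegative
  multiple of the nonnegative \<open>energy2\<close>.\<close>

lemma gram_seq_gap:
  assumes cnt: "countable (carrier G)"
    and gram: "\<And>F. finite F \<Longrightarrow> F \<subseteq> carrier G \<Longrightarrow> \<forall>\<^sub>F n in sequentially. gram G F (\<phi> n)"
    and D: "\<And>n. energy1 (\<phi> n) > real n * energy2 (\<phi> n)"
  shows False
proof -
  define \<psi> where "\<psi> n g = 1 / energy1 (\<phi> n) * \<phi> n g" for n g
  have pos: "\<forall>\<^sub>F n in sequentially. energy1 (\<phi> n) > 0 \<and> energy2 (\<phi> n) \<ge> 0"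
    using gram[OF S_finite S_carrier]
  proof eventually_elim
    case (elim n)
    have "energy2 (\<phi> n) \<ge> 0" using gram_energy(1)[OF elim order_refl S_carrier S_one] .
    then show ?case using D[of n] by (meson mult_nonneg_nonneg of_nat_0_le_iff order_le_less_trans)
  qed
  have e1: "energy1 (\<psi> n) = 1 / energy1 (\<phi> n) * energy1 (\<phi> n)" for n
    unfolding energy1_def[of "\<psi> n"] energy1_def[of "\<phi> n"] \<psi>_def sum_distrib_left
    by (simp only: right_diff_distrib)
  have e2: "energy2 (\<psi> n) = energy2 (\<phi> n) / energy1 (\<phi> n)" for n
    unfolding energy2_def[of "\<psi> n"]
    by (simp add: \<psi>_def energy2_def sum_divide_distrib diff_divide_distrib add_divide_distrib)
  show False
  proof (rule normalized_gram_seq_False[OF cnt, of \<psi>])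
    fix F assume F: "finite F" "F \<subseteq> carrier G"
    show "\<forall>\<^sub>F n in sequentially. gram G F (\<psi> n)"
      using gram[OF F] pos unfolding \<psi>_def[abs_def]
      by eventually_elim (rule gram_scale, simp_all)
  next
    show "\<forall>\<^sub>F n in sequentially. energy1 (\<psi> n) = 1"
      using pos by eventually_elim (simp add: e1)
  next
    show "(\<lambda>n. energy2 (\<psi> n)) \<longlonglongrightarrow> 0"
    proof (rule tendsto_sandwich[OF _ _ tendsto_const lim_1_over_n])
      show "\<forall>\<^sub>F n in sequentially. 0 \<le> energy2 (\<psi> n)"
        using pos by eventually_elim (simp add: e2)
      show "\<forall>\<^sub>F n in sequentially. energy2 (\<psi> n) \<le> 1 / of_nat n"
        using pos eventually_gt_at_top[of 0]
      proof eventually_elim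
        case (elim n)
        then show ?case using D[of n] by (simp add: e2 field_simps)
      qed
    qed
  qed
qed

end

section \<open>Completion of a Hermitian form\<close>

lemma null_comparison:
  fixes f :: "nat \<Rightarrow> 'b::real_normed_vector"
  assumes "g \<longlonglongrightarrow> 0" "\<And>n. norm (f n) \<le> g n"
  shows "f \<longlonglongrightarrow> 0"
proof (rule tendsto_norm_zero_cancel, rule tendsto_sandwich[OF _ _ tendsto_const assms(1)])
qed (use assms(2) in auto)

locale hermitian_form =
  fixes P :: "('x \<Rightarrow> complex) set" and hf :: "('x \<Rightarrow> complex) \<Rightarrow> ('x \<Rightarrow> complex) \<Rightarrow> complex"
  assumes P_zero: "(\<lambda>_. 0) \<in> P"
    and P_add: "\<lbrakk>a \<in> P; b \<in> P\<rbrakk> \<Longrightarrow> a + b \<in> P"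
    and P_smult: "a \<in> P \<Longrightarrow> (\<lambda>x. c * a x) \<in> P"
    and hf_add: "\<lbrakk>a \<in> P; b \<in> P; d \<in> P\<rbrakk> \<Longrightarrow> hf (a + b) d = hf a d + hf b d"
    and hf_smult: "\<lbrakk>a \<in> P; b \<in> P\<rbrakk> \<Longrightarrow> hf (\<lambda>x. c * a x) b = c * hf a b"
    and hf_cnj: "\<lbrakk>a \<in> P; b \<in> P\<rbrakk> \<Longrightarrow> hf b a = cnj (hf a b)"
    and hf_nonneg: "a \<in> P \<Longrightarrow> Re (hf a a) \<ge> 0"
begin

sublocale semi_ip P "\<lambda>a b. Re (hf a b)"
proof
  fix x and r :: real assume x: "x \<in> P"
  have *: "r *\<^sub>R x = (\<lambda>y. complex_of_real r * x y)"
    by (simp add: fun_eq_iff scaleR_conv_of_real)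
  show "r *\<^sub>R x \<in> P" unfolding * using x by (rule P_smult)
  fix y assume "y \<in> P"
  then show "Re (hf (r *\<^sub>R x) y) = r * Re (hf x y)" unfolding * using x by (simp add: hf_smult)
next
  show "0 \<in> P" using P_zero by (simp add: zero_fun_def)
  show "Re (hf x y) = Re (hf y x)" if "x \<in> P" "y \<in> P" for x y
    using hf_cnj[OF that] by simp
qed (auto simp: P_add hf_add hf_nonneg)

lemma hf_add_right: "\<lbrakk>a \<in> P; b \<in> P; d \<in> P\<rbrakk> \<Longrightarrow> hf d (a + b) = hf d a + hf d b"
  using hf_cnj[of "a + b" d] hf_cnj[of a d] hf_cnj[of b d] by (simp add: hf_add P_add)

lemma hf_diff: "\<lbrakk>a \<in> P; b \<in> P; d \<in> P\<rbrakk> \<Longrightarrow> hf (a - b) d = hf a d - hf b d"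
  using hf_add[of "a - b" b d] by (simp add: V_diff)

lemma hf_diff_right: "\<lbrakk>a \<in> P; b \<in> P; d \<in> P\<rbrakk> \<Longrightarrow> hf d (a - b) = hf d a - hf d b"
  using hf_add_right[of "a - b" b d] by (simp add: V_diff)

lemma Im_hf_self: "a \<in> P \<Longrightarrow> Im (hf a a) = 0"
  using hf_cnj[of a a] by (simp add: complex_eq_iff)

lemma hf_self: "a \<in> P \<Longrightarrow> hf a a = complex_of_real ((nrm a)\<^sup>2)"
  by (simp add: nrm_sq Im_hf_self complex_eq_iff)

lemma nrm_smult: "a \<in> P \<Longrightarrow> nrm (\<lambda>x. c * a x) = cmod c * nrm a"
proof -
  assume a: "a \<in> P"
  have "hf (\<lambda>x. c * a x) (\<lambda>x. c * a x) = c * cnj c * hf a a"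
    using a hf_cnj[of "\<lambda>x. c * a x" a] by (simp add: hf_smult P_smult hf_cnj[of a a, symmetric])
  also have "\<dots> = complex_of_real ((cmod c)\<^sup>2 * (nrm a)\<^sup>2)"
    using a by (simp only: hf_self complex_norm_square[symmetric] of_real_mult of_real_power)
  finally show ?thesis
    using nrm_nonneg[OF a] by (simp add: nrm_def[of "\<lambda>x. c * a x"] real_sqrt_mult)
qed

text \<open>Rotating \<open>a\<close> by a unit scalar makes the pairing real and nonnegative, which
  reduces the claim to the real inequality.\<close>

lemma cmod_hf_le:
  assumes "a \<in> P" "b \<in> P"
  shows "cmod (hf a b) \<le> nrm a * nrm b"
proof (cases "hf a b = 0")
  case True
  then show ?thesis using assms by (simp add: nrm_nonneg)
next
  case False
  define c where "c = cnj (hf a b) / complex_of_real (cmod (hf a b))"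
  have c: "cmod c = 1" using False by (simp add: c_def norm_divide)
  have "hf (\<lambda>x. c * a x) b = complex_of_real (cmod (hf a b))"
    using False
    unfolding hf_smult[OF assms] c_def
    by (simp add: complex_norm_square[symmetric] power2_eq_square mult.commute)
  then have "cmod (hf a b) \<le> nrm (\<lambda>x. c * a x) * nrm b"
    using abs_B_le[OF P_smult[OF assms(1)] assms(2), of c] by simp
  then show ?thesis by (simp add: nrm_smult assms c)
qed

end

text \<open>The completion of a space with a Hermitian form, realized by functions: \<open>ev a\<close> lists the
  inner products of \<open>a\<close> with a family of vectors whose inner products determine the form, and
  a Cauchy sequence is represented by the limit of its images under \<open>ev\<close>. The argument of type
  \<open>nat\<close> is a dummy.\<close>

locale pre_hilbert = hermitian_form P hf
  for P :: "('x \<Rightarrow> complex) set" and hf +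
  fixes ev :: "('x \<Rightarrow> complex) \<Rightarrow> 'x \<Rightarrow> complex"
  assumes ev_add: "\<lbrakk>a \<in> P; b \<in> P\<rbrakk> \<Longrightarrow> ev (a + b) h = ev a h + ev b h"
    and ev_smult: "a \<in> P \<Longrightarrow> ev (\<lambda>x. c * a x) h = c * ev a h"
    and ev_bound: "\<exists>M. \<forall>a\<in>P. cmod (ev a h) \<le> M * nrm a"
    and ev_form: "b \<in> P \<Longrightarrow> \<exists>T w. finite T \<and> (\<forall>a\<in>P. hf a b = (\<Sum>h\<in>T. w h * ev a h))"
begin

definition cauchy_seqs :: "(nat \<Rightarrow> 'x \<Rightarrow> complex) set" where
  "cauchy_seqs = {X. (\<forall>n. X n \<in> P) \<and>
     (\<forall>e>0. \<exists>N. \<forall>m\<ge>N. \<forall>n\<ge>N. nrm (X m - X n) < e)}"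

definition limfun :: "(nat \<Rightarrow> 'x \<Rightarrow> complex) \<Rightarrow> nat \<times> 'x \<Rightarrow> complex" where
  "limfun X = (\<lambda>(_, h). lim (\<lambda>n. ev (X n) h))"

text \<open>The inner product of the completion is defined through one chosen Cauchy sequence;
  \<open>iprod_tendsto\<close> then makes it computable from any sequence with the same limit
  function.\<close>

definition rep :: "(nat \<times> 'x \<Rightarrow> complex) \<Rightarrow> nat \<Rightarrow> 'x \<Rightarrow> complex" where
  "rep u = (SOME X. X \<in> cauchy_seqs \<and> limfun X = u)"

definition completion :: "(nat \<times> 'x \<Rightarrow> complex) hilbert_space" where
  "completion = \<lparr>carrier = limfun ` cauchy_seqs, mult = (\<lambda>u v. u), one = (\<lambda>_. 0),
     ring.zero = (\<lambda>_. 0), ring.add = (\<lambda>u v x. u x + v x), module.smult = (\<lambda>c u x. c * u x),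
     iprod = (\<lambda>u v. lim (\<lambda>n. hf (rep u n) (rep v n)))\<rparr>"

lemma cauchy_in: "X \<in> cauchy_seqs \<Longrightarrow> X n \<in> P"
  by (simp add: cauchy_seqs_def)

lemma cauchyD: "X \<in> cauchy_seqs \<Longrightarrow> e > 0 \<Longrightarrow> \<exists>N. \<forall>m\<ge>N. \<forall>n\<ge>N. nrm (X m - X n) < e"
  by (simp add: cauchy_seqs_def)

lemma cauchy_bounded:
  assumes "X \<in> cauchy_seqs"
  shows "\<exists>K>0. \<forall>n. nrm (X n) \<le> K"
proof -
  obtain N where N: "\<And>m n. m \<ge> N \<Longrightarrow> n \<ge> N \<Longrightarrow> nrm (X m - X n) < 1"
    using cauchyD[OF assms, of 1] by auto
  have "nrm (X n) \<le> 1 + (\<Sum>m\<le>N. nrm (X m))" for n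
  proof (cases "n \<le> N")
    case True
    then have "nrm (X n) \<le> (\<Sum>m\<le>N. nrm (X m))"
      by (intro member_le_sum) (auto simp: nrm_nonneg cauchy_in[OF assms])
    then show ?thesis by simp
  next
    case False
    have "nrm (X n) \<le> nrm (X n - X N) + nrm (X N)"
      using nrm_triangle[OF V_diff[OF cauchy_in[OF assms] cauchy_in[OF assms]] cauchy_in[OF assms], of n N N]
      by (simp only: diff_add_cancel)
    moreover have "nrm (X N) \<le> (\<Sum>m\<le>N. nrm (X m))"
      by (intro member_le_sum) (auto simp: nrm_nonneg cauchy_in[OF assms])
    moreover have "nrm (X n - X N) < 1" using N[of n N] False by linarith
    ultimately show ?thesis by linarith
  qed
  moreover have "1 + (\<Sum>m\<le>N. nrm (X m)) > 0"
    by (intro add_pos_nonneg sum_nonneg) (auto simp: nrm_nonneg cauchy_in[OF assms])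
  ultimately show ?thesis by blast
qed

lemma cauchy_add:
  assumes "X \<in> cauchy_seqs" "Y \<in> cauchy_seqs"
  shows "(\<lambda>n. X n + Y n) \<in> cauchy_seqs"
  unfolding cauchy_seqs_def
proof (intro CollectI conjI allI impI)
  note inP = cauchy_in[OF assms(1)] cauchy_in[OF assms(2)]
  show "X n + Y n \<in> P" for n by (intro P_add inP)
  fix e :: real assume "e > 0"
  then obtain N M where N: "\<And>m n. m \<ge> N \<Longrightarrow> n \<ge> N \<Longrightarrow> nrm (X m - X n) < e / 2"
    and M: "\<And>m n. m \<ge> M \<Longrightarrow> n \<ge> M \<Longrightarrow> nrm (Y m - Y n) < e / 2"
    using cauchyD[OF assms(1) half_gt_zero] cauchyD[OF assms(2) half_gt_zero] by metis
  show "\<exists>N. \<forall>m\<ge>N. \<forall>n\<ge>N. nrm (X m + Y m - (X n + Y n)) < e"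
  proof (intro exI allI impI)
    fix m n assume mn: "max N M \<le> m" "max N M \<le> n"
    have "nrm ((X m - X n) + (Y m - Y n)) \<le> nrm (X m - X n) + nrm (Y m - Y n)"
      by (intro nrm_triangle V_diff inP)
    moreover have "(X m - X n) + (Y m - Y n) = X m + Y m - (X n + Y n)" by (rule add_diff_add[symmetric])
    ultimately show "nrm (X m + Y m - (X n + Y n)) < e" using N[of m n] M[of m n] mn by simp
  qed
qed

lemma cauchy_smult:
  assumes "X \<in> cauchy_seqs"
  shows "(\<lambda>n x. c * X n x) \<in> cauchy_seqs"
  unfolding cauchy_seqs_def
proof (intro CollectI conjI allI impI)
  note inP = cauchy_in[OF assms(1)]
  show "(\<lambda>x. c * X n x) \<in> P" for n by (intro P_smult inP)
  fix e :: real assume e: "e > 0"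
  then obtain N where N: "\<And>m n. m \<ge> N \<Longrightarrow> n \<ge> N \<Longrightarrow> nrm (X m - X n) < e / (cmod c + 1)"
    using cauchyD[OF assms(1), of "e / (cmod c + 1)"] by (auto simp: add_nonneg_pos)
  show "\<exists>N. \<forall>m\<ge>N. \<forall>n\<ge>N. nrm ((\<lambda>x. c * X m x) - (\<lambda>x. c * X n x)) < e"
  proof (intro exI allI impI)
    fix m n assume mn: "N \<le> m" "N \<le> n"
    have "(\<lambda>x. c * X m x) - (\<lambda>x. c * X n x) = (\<lambda>x. c * (X m - X n) x)"
      by (simp add: fun_eq_iff right_diff_distrib)
    then have "nrm ((\<lambda>x. c * X m x) - (\<lambda>x. c * X n x)) = cmod c * nrm (X m - X n)"
      using nrm_smult[OF V_diff[OF inP inP]] by simp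
    also have "\<dots> \<le> (cmod c + 1) * nrm (X m - X n)"
      using nrm_nonneg[OF V_diff[OF inP inP], of m n] by (simp add: distrib_right)
    also have "\<dots> < (cmod c + 1) * (e / (cmod c + 1))"
      using N[OF mn] by (intro mult_strict_left_mono) (auto simp: add_nonneg_pos)
    also have "\<dots> = e" by (simp add: add_nonneg_eq_0_iff)
    finally show "nrm ((\<lambda>x. c * X m x) - (\<lambda>x. c * X n x)) < e" .
  qed
qed

lemma cauchy_diff:
  assumes "X \<in> cauchy_seqs" "Y \<in> cauchy_seqs"
  shows "(\<lambda>n. X n - Y n) \<in> cauchy_seqs"
proof -
  have "(\<lambda>n. X n + (\<lambda>x. - 1 * Y n x)) \<in> cauchy_seqs"
    by (intro cauchy_add cauchy_smult assms)
  moreover have "(\<lambda>n. X n + (\<lambda>x. - 1 * Y n x)) = (\<lambda>n. X n - Y n)"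
    by (simp add: fun_eq_iff)
  ultimately show ?thesis by simp
qed

lemma cauchy_const: "a \<in> P \<Longrightarrow> (\<lambda>_. a) \<in> cauchy_seqs"
  unfolding cauchy_seqs_def
proof (intro CollectI conjI allI impI)
  fix e :: real assume "a \<in> P" "e > 0"
  then have "nrm (a - a) = 0" by (simp only: nrm_def B_diff V_diff) simp
  then show "\<exists>N. \<forall>m\<ge>N. \<forall>n\<ge>N. nrm (a - a) < e" using \<open>e > 0\<close> by simp
qed simp

lemma ev_diff: "\<lbrakk>a \<in> P; b \<in> P\<rbrakk> \<Longrightarrow> ev (a - b) h = ev a h - ev b h"
  using ev_add[of "a - b" b h] by (simp add: V_diff)

lemma ev_tendsto:
  assumes "X \<in> cauchy_seqs"
  shows "(\<lambda>n. ev (X n) h) \<longlonglongrightarrow> limfun X (m, h)"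
proof -
  obtain M where M: "\<And>a. a \<in> P \<Longrightarrow> cmod (ev a h) \<le> M * nrm a" using ev_bound by blast
  have "Cauchy (\<lambda>n. ev (X n) h)"
  proof (rule CauchyI)
    fix e :: real assume "e > 0"
    then obtain N where N: "\<And>m n. m \<ge> N \<Longrightarrow> n \<ge> N \<Longrightarrow> nrm (X m - X n) < e / (\<bar>M\<bar> + 1)"
      using cauchyD[OF assms, of "e / (\<bar>M\<bar> + 1)"] by auto
    show "\<exists>N. \<forall>m\<ge>N. \<forall>n\<ge>N. norm (ev (X m) h - ev (X n) h) < e"
    proof (intro exI allI impI)
      fix m n assume mn: "N \<le> m" "N \<le> n"
      have "norm (ev (X m) h - ev (X n) h) = cmod (ev (X m - X n) h)"
        by (simp add: ev_diff cauchy_in[OF assms])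
      also have "\<dots> \<le> M * nrm (X m - X n)" by (intro M V_diff cauchy_in[OF assms])
      also have "\<dots> \<le> (\<bar>M\<bar> + 1) * nrm (X m - X n)"
        by (intro mult_right_mono nrm_nonneg V_diff cauchy_in[OF assms]) auto
      also have "\<dots> < (\<bar>M\<bar> + 1) * (e / (\<bar>M\<bar> + 1))"
        using N[OF mn] by (intro mult_strict_left_mono) auto
      also have "\<dots> = e" by (simp add: field_simps)
      finally show "norm (ev (X m) h - ev (X n) h) < e" .
    qed
  qed
  then have "convergent (\<lambda>n. ev (X n) h)" by (simp add: Cauchy_convergent_iff)
  then show ?thesis by (simp add: limfun_def convergent_LIMSEQ_iff)
qed

lemma limfun_eqI:
  assumes "X \<in> cauchy_seqs" "\<And>m h. (\<lambda>n. ev (X n) h) \<longlonglongrightarrow> u (m, h)"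
  shows "limfun X = u"
proof
  fix p :: "nat \<times> 'x"
  show "limfun X p = u p"
    using LIMSEQ_unique[OF ev_tendsto[OF assms(1)] assms(2)] by (cases p) auto
qed

lemma limfun_add:
  assumes "X \<in> cauchy_seqs" "Y \<in> cauchy_seqs"
  shows "limfun (\<lambda>n. X n + Y n) = (\<lambda>x. limfun X x + limfun Y x)"
  by (rule limfun_eqI[OF cauchy_add[OF assms]])
    (simp add: ev_add cauchy_in[OF assms(1)] cauchy_in[OF assms(2)] tendsto_add ev_tendsto assms)

lemma limfun_smult:
  assumes "X \<in> cauchy_seqs"
  shows "limfun (\<lambda>n x. c * X n x) = (\<lambda>x. c * limfun X x)"
  by (rule limfun_eqI[OF cauchy_smult[OF assms]])
    (simp add: ev_smult cauchy_in[OF assms(1)] tendsto_mult ev_tendsto assms)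

lemma limfun_diff:
  assumes "X \<in> cauchy_seqs" "Y \<in> cauchy_seqs"
  shows "limfun (\<lambda>n. X n - Y n) = (\<lambda>x. limfun X x - limfun Y x)"
  by (rule limfun_eqI[OF cauchy_diff[OF assms]])
    (simp add: ev_diff cauchy_in[OF assms(1)] cauchy_in[OF assms(2)] tendsto_diff ev_tendsto assms)

text \<open>For a Cauchy sequence the squared norm of \<open>Z n\<close> is its pairing with
  \<open>Z n - Z N\<close> plus its pairing with the fixed vector \<open>Z N\<close>; the first is
  uniformly small, the second tends to 0. As pairings with fixed vectors are finite combinations of
  values of \<open>ev\<close>, it follows that the limit function determines a Cauchy sequence up to
  null sequences.\<close>

lemma weakly_null_imp_null:
  assumes Z: "Z \<in> cauchy_seqs" and w: "\<And>b. b \<in> P \<Longrightarrow> (\<lambda>n. hf (Z n) b) \<longlonglongrightarrow> 0"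
  shows "(\<lambda>n. nrm (Z n)) \<longlonglongrightarrow> 0"
proof -
  obtain K where K: "K > 0" "\<And>n. nrm (Z n) \<le> K" using cauchy_bounded[OF Z] by blast
  have "(\<lambda>n. (nrm (Z n))\<^sup>2) \<longlonglongrightarrow> 0"
  proof (rule LIMSEQ_I)
    fix e :: real assume e: "e > 0"
    have e': "e / (2 * K) > 0" using e K by simp
    obtain N where N: "\<And>m n. m \<ge> N \<Longrightarrow> n \<ge> N \<Longrightarrow> nrm (Z m - Z n) < e / (2 * K)"
      using cauchyD[OF Z e'] by metis
    obtain N' where N': "\<And>n. n \<ge> N' \<Longrightarrow> cmod (hf (Z n) (Z N)) < e / 2"
      using LIMSEQ_D[OF w[OF cauchy_in[OF Z]] half_gt_zero[OF e]] by (metis diff_zero)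
    show "\<exists>no. \<forall>n\<ge>no. norm ((nrm (Z n))\<^sup>2 - 0) < e"
    proof (intro exI allI impI)
      fix n assume n: "max N N' \<le> n"
      have "(nrm (Z n))\<^sup>2 = cmod (hf (Z n) (Z n))"
        using hf_self[OF cauchy_in[OF Z], of n] by (simp add: norm_power)
      also have "\<dots> \<le> cmod (hf (Z n) (Z n - Z N)) + cmod (hf (Z n) (Z N))"
        using norm_triangle_ineq[of "hf (Z n) (Z n - Z N)" "hf (Z n) (Z N)"]
        by (simp add: hf_diff_right cauchy_in[OF Z])
      also have "\<dots> \<le> nrm (Z n) * nrm (Z n - Z N) + cmod (hf (Z n) (Z N))"
        by (intro add_right_mono cmod_hf_le V_diff cauchy_in[OF Z])
      also have "\<dots> \<le> K * nrm (Z n - Z N) + cmod (hf (Z n) (Z N))"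
        by (intro add_right_mono mult_right_mono K nrm_nonneg V_diff cauchy_in[OF Z])
      also have "\<dots> < K * (e / (2 * K)) + e / 2"
        using N[of n N] N'[of n] n K by (intro add_strict_mono mult_strict_left_mono) auto
      also have "\<dots> = e" using K by simp
      finally show "norm ((nrm (Z n))\<^sup>2 - 0) < e" by simp
    qed
  qed
  then show ?thesis by (simp add: tendsto_null_power)
qed

lemma null_imp_limfun:
  assumes "Z \<in> cauchy_seqs" "(\<lambda>n. nrm (Z n)) \<longlonglongrightarrow> 0"
  shows "limfun Z = (\<lambda>_. 0)"
proof (rule limfun_eqI[OF assms(1)])
  fix h
  obtain M where M: "\<And>a. a \<in> P \<Longrightarrow> cmod (ev a h) \<le> M * nrm a" using ev_bound by blast
  have "(\<lambda>n. M * nrm (Z n)) \<longlonglongrightarrow> 0" using assms(2) by (rule tendsto_mult_right_zero)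
  then show "(\<lambda>n. ev (Z n) h) \<longlonglongrightarrow> 0"
    by (rule null_comparison) (auto simp: M cauchy_in[OF assms(1)])
qed

lemma limfun_imp_null:
  assumes Z: "Z \<in> cauchy_seqs" and E: "limfun Z = (\<lambda>_. 0)"
  shows "(\<lambda>n. nrm (Z n)) \<longlonglongrightarrow> 0"
proof (rule weakly_null_imp_null[OF Z])
  fix b assume "b \<in> P"
  from ev_form[OF this] obtain T w where Tw: "finite T" "\<forall>a\<in>P. hf a b = (\<Sum>h\<in>T. w h * ev a h)"
    by (elim exE conjE)
  have "(\<lambda>n. \<Sum>h\<in>T. w h * ev (Z n) h) \<longlonglongrightarrow> (\<Sum>h\<in>T. w h * limfun Z (0, h))"
    by (intro tendsto_intros ev_tendsto Z)
  moreover have "hf (Z n) b = (\<Sum>h\<in>T. w h * ev (Z n) h)" for n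
    using Tw(2) cauchy_in[OF Z] by blast
  ultimately show "(\<lambda>n. hf (Z n) b) \<longlonglongrightarrow> 0" by (simp add: E)
qed

lemma hf_convergent:
  assumes "X \<in> cauchy_seqs" "Y \<in> cauchy_seqs"
  shows "convergent (\<lambda>n. hf (X n) (Y n))"
proof -
  note inP = cauchy_in[OF assms(1)] cauchy_in[OF assms(2)]
  obtain K where K: "K > 0" "\<And>n. nrm (X n) \<le> K" using cauchy_bounded[OF assms(1)] by blast
  obtain L where L: "L > 0" "\<And>n. nrm (Y n) \<le> L" using cauchy_bounded[OF assms(2)] by blast
  have "Cauchy (\<lambda>n. hf (X n) (Y n))"
  proof (rule CauchyI)
    fix e :: real assume e: "e > 0"
    then have e': "e / (2 * L) > 0" "e / (2 * K) > 0" using K L by auto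
    obtain N where N: "\<And>m n. m \<ge> N \<Longrightarrow> n \<ge> N \<Longrightarrow> nrm (X m - X n) < e / (2 * L)"
      using cauchyD[OF assms(1) e'(1)] by metis
    obtain M where M: "\<And>m n. m \<ge> M \<Longrightarrow> n \<ge> M \<Longrightarrow> nrm (Y m - Y n) < e / (2 * K)"
      using cauchyD[OF assms(2) e'(2)] by metis
    show "\<exists>N. \<forall>m\<ge>N. \<forall>n\<ge>N. norm (hf (X m) (Y m) - hf (X n) (Y n)) < e"
    proof (intro exI allI impI)
      fix m n assume mn: "max N M \<le> m" "max N M \<le> n"
      have "hf (X m) (Y m) - hf (X n) (Y n) = hf (X m - X n) (Y m) + hf (X n) (Y m - Y n)"
        by (simp add: hf_diff hf_diff_right inP)
      then have "norm (hf (X m) (Y m) - hf (X n) (Y n)) \<le>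
          cmod (hf (X m - X n) (Y m)) + cmod (hf (X n) (Y m - Y n))"
        by (simp add: norm_triangle_ineq)
      also have "\<dots> \<le> nrm (X m - X n) * nrm (Y m) + nrm (X n) * nrm (Y m - Y n)"
        by (intro add_mono cmod_hf_le V_diff inP)
      also have "\<dots> \<le> nrm (X m - X n) * L + K * nrm (Y m - Y n)"
        by (intro add_mono mult_left_mono mult_right_mono K L nrm_nonneg V_diff inP)
      also have "\<dots> < e / (2 * L) * L + K * (e / (2 * K))"
        using N[of m n] M[of m n] mn K L
        by (intro add_strict_mono mult_strict_left_mono mult_strict_right_mono) auto
      also have "\<dots> = e" using K L by simp
      finally show "norm (hf (X m) (Y m) - hf (X n) (Y n)) < e" .
    qed
  qed
  then show ?thesis by (simp add: Cauchy_convergent_iff)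
qed

lemma rep:
  assumes "u \<in> limfun ` cauchy_seqs"
  shows "rep u \<in> cauchy_seqs" "limfun (rep u) = u"
proof -
  have "\<exists>X. X \<in> cauchy_seqs \<and> limfun X = u" using assms by auto
  from someI_ex[OF this] show "rep u \<in> cauchy_seqs" "limfun (rep u) = u" by (auto simp: rep_def)
qed

lemma hf_diff_null:
  assumes "X \<in> cauchy_seqs" "X' \<in> cauchy_seqs" "Y \<in> cauchy_seqs" "limfun X = limfun X'"
  shows "(\<lambda>n. hf (X n) (Y n) - hf (X' n) (Y n)) \<longlonglongrightarrow> 0"
proof -
  note inP = cauchy_in[OF assms(1)] cauchy_in[OF assms(2)] cauchy_in[OF assms(3)]
  obtain L where L: "L > 0" "\<And>n. nrm (Y n) \<le> L" using cauchy_bounded[OF assms(3)] by blast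
  have "(\<lambda>n. nrm (X n - X' n)) \<longlonglongrightarrow> 0"
    by (rule limfun_imp_null[OF cauchy_diff[OF assms(1,2)]])
      (simp add: limfun_diff assms)
  then have "(\<lambda>n. nrm (X n - X' n) * L) \<longlonglongrightarrow> 0" by (rule tendsto_mult_left_zero)
  then show ?thesis
  proof (rule null_comparison)
    fix n
    have "norm (hf (X n) (Y n) - hf (X' n) (Y n)) = cmod (hf (X n - X' n) (Y n))"
      by (simp add: hf_diff inP)
    also have "\<dots> \<le> nrm (X n - X' n) * nrm (Y n)" by (intro cmod_hf_le V_diff inP)
    also have "\<dots> \<le> nrm (X n - X' n) * L" by (intro mult_left_mono L nrm_nonneg V_diff inP)
    finally show "norm (hf (X n) (Y n) - hf (X' n) (Y n)) \<le> nrm (X n - X' n) * L" .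
  qed
qed

lemma iprod_tendsto:
  assumes X: "X \<in> cauchy_seqs" and Y: "Y \<in> cauchy_seqs"
  shows "(\<lambda>n. hf (X n) (Y n)) \<longlonglongrightarrow> iprod completion (limfun X) (limfun Y)"
proof -
  let ?X = "rep (limfun X)" and ?Y = "rep (limfun Y)"
  have r: "?X \<in> cauchy_seqs" "limfun ?X = limfun X" "?Y \<in> cauchy_seqs" "limfun ?Y = limfun Y"
    using X Y by (auto intro!: rep)
  have "(\<lambda>n. hf (X n) (Y n) - hf (?X n) (Y n)) \<longlonglongrightarrow> 0"
    by (rule hf_diff_null) (use X Y r in auto)
  moreover have "(\<lambda>n. cnj (hf (Y n) (?X n) - hf (?Y n) (?X n))) \<longlonglongrightarrow> cnj 0"
    by (intro tendsto_cnj hf_diff_null) (use X Y r in auto)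
  then have "(\<lambda>n. hf (?X n) (Y n) - hf (?X n) (?Y n)) \<longlonglongrightarrow> 0"
    by (simp add: hf_cnj[symmetric] cauchy_in[OF Y] cauchy_in[OF r(1)] cauchy_in[OF r(3)])
  moreover have "(\<lambda>n. hf (?X n) (?Y n)) \<longlonglongrightarrow> iprod completion (limfun X) (limfun Y)"
    using hf_convergent[OF r(1,3)] by (simp add: completion_def convergent_LIMSEQ_iff)
  ultimately have "(\<lambda>n. (hf (X n) (Y n) - hf (?X n) (Y n)) +
      ((hf (?X n) (Y n) - hf (?X n) (?Y n)) + hf (?X n) (?Y n)))
    \<longlonglongrightarrow> 0 + (0 + iprod completion (limfun X) (limfun Y))"
    by (intro tendsto_add)
  then show ?thesis by simp
qed

lemma carrier_completion: "carrier completion = limfun ` cauchy_seqs"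
  and add_completion: "ring.add completion = (\<lambda>u v x. u x + v x)"
  and zero_completion: "ring.zero completion = (\<lambda>_. 0)"
  and smult_completion: "module.smult completion = (\<lambda>c u x. c * u x)"
  by (simp_all add: completion_def)

lemma hnorm_tendsto:
  assumes "X \<in> cauchy_seqs"
  shows "(\<lambda>n. nrm (X n)) \<longlonglongrightarrow> hnorm completion (limfun X)"
  unfolding hnorm_def nrm_def
  by (intro tendsto_real_sqrt tendsto_Re iprod_tendsto assms)

lemma abelian_group_completion: "abelian_group completion"
proof (rule abelian_groupI)
  have c: "limfun (\<lambda>n x. - 1 * X n x) \<in> carrier completion" if "X \<in> cauchy_seqs" for X
    unfolding carrier_completion by (rule imageI[OF cauchy_smult[OF that]])
  show "\<exists>y\<in>carrier completion. y \<oplus>\<^bsub>completion\<^esub> x = \<zero>\<^bsub>completion\<^esub>" if x: "x \<in> carrier completion" for x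
  proof -
    obtain X where X: "X \<in> cauchy_seqs" "x = limfun X" using x by (auto simp: carrier_completion)
    show ?thesis
      by (rule bexI[OF _ c[OF X(1)]])
        (simp only: limfun_smult[OF X(1)] X(2) add_completion zero_completion, simp)
  qed
  show "\<zero>\<^bsub>completion\<^esub> \<in> carrier completion"
  proof -
    have "limfun (\<lambda>_ _. 0) = (\<lambda>_. 0)"
      using limfun_smult[OF cauchy_const[OF P_zero], of 0] by simp
    from image_eqI[where f = limfun, OF this[symmetric] cauchy_const[OF P_zero]]
    show ?thesis by (simp only: carrier_completion zero_completion)
  qed
  show "x \<oplus>\<^bsub>completion\<^esub> y \<in> carrier completion"
    if prems: "x \<in> carrier completion" "y \<in> carrier completion" for x y
  proof -
    obtain X Y where XY: "X \<in> cauchy_seqs" "Y \<in> cauchy_seqs" "x = limfun X" "y = limfun Y"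
      using prems by (auto simp: carrier_completion)
    show ?thesis
      unfolding carrier_completion add_completion XY(3,4)
      by (rule image_eqI[where f = limfun, OF limfun_add[OF XY(1,2), symmetric] cauchy_add[OF XY(1,2)]])
  qed
qed (auto simp: add_completion zero_completion algebra_simps)

lemma module_completion: "Module.module (class_ring :: complex ring) completion"
proof (rule Module.moduleI)
  show "cring (class_ring :: complex ring)" by unfold_locales
  show "abelian_group completion" by (rule abelian_group_completion)
  show "a \<odot>\<^bsub>completion\<^esub> x \<in> carrier completion"
    if prems: "x \<in> carrier completion" for a x
  proof -
    obtain X where X: "X \<in> cauchy_seqs" "x = limfun X" using prems by (auto simp: carrier_completion)
    show ?thesis
      unfolding carrier_completion smult_completion X(2)
      by (rule image_eqI[where f = limfun, OF _ cauchy_smult[OF X(1), of a]]) (subst limfun_smult[OF X(1)], rule refl)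
  qed
qed (auto simp: smult_completion add_completion class_ring_simps algebra_simps)

lemma minus_completion:
  assumes "u \<in> carrier completion" "v \<in> carrier completion"
  shows "u \<ominus>\<^bsub>completion\<^esub> v = (\<lambda>x. u x - v x)"
proof -
  interpret H: abelian_group completion by (rule abelian_group_completion)
  obtain X where X: "X \<in> cauchy_seqs" "v = limfun X" using assms by (auto simp: carrier_completion)
  have "(\<lambda>x. - v x) \<in> carrier completion"
    unfolding carrier_completion X(2)
    by (rule image_eqI[where f = limfun, OF _ cauchy_smult[OF X(1), of "-1"]]) (subst limfun_smult[OF X(1)], simp)
  then have "\<ominus>\<^bsub>completion\<^esub> v = (\<lambda>x. - v x)"
    using assms by (intro H.minus_equality) (auto simp: add_completion zero_completion)
  then show ?thesis by (simp add: a_minus_def add_completion)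
qed

lemma hnorm_minus_tendsto:
  assumes "X \<in> cauchy_seqs" "Y \<in> cauchy_seqs"
  shows "(\<lambda>n. nrm (X n - Y n)) \<longlonglongrightarrow> hnorm completion (limfun X \<ominus>\<^bsub>completion\<^esub> limfun Y)"
  using hnorm_tendsto[OF cauchy_diff[OF assms]] assms
  by (simp add: minus_completion carrier_completion limfun_diff)

lemma completion_complete:
  assumes U: "\<And>n :: nat. U n \<in> carrier completion"
    and C: "\<And>e. e > 0 \<Longrightarrow> \<exists>N. \<forall>m\<ge>N. \<forall>n\<ge>N. hnorm completion (U m \<ominus>\<^bsub>completion\<^esub> U n) < e"
  shows "\<exists>x\<in>carrier completion. (\<lambda>n. hnorm completion (U n \<ominus>\<^bsub>completion\<^esub> x)) \<longlonglongrightarrow> 0"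
proof -
  define X where "X n = rep (U n)" for n
  have X: "X n \<in> cauchy_seqs" "limfun (X n) = U n" for n
    using rep U by (auto simp: X_def carrier_completion)
  \<comment> \<open>After its index \<open>m n\<close> the sequence representing \<open>U n\<close>
    moves by less than \<open>1 / real (Suc n)\<close>; the diagonal choice of these terms will
    represent the limit.\<close>
  have "\<exists>m. \<forall>k\<ge>m. nrm (X n m - X n k) < 1 / real (Suc n)" for n
    using cauchyD[OF X(1), of "1 / real (Suc n)" n] by (meson order_refl zero_less_divide_1_iff of_nat_0_less_iff zero_less_Suc)
  then obtain m where m: "\<And>n k. k \<ge> m n \<Longrightarrow> nrm (X n (m n) - X n k) < 1 / real (Suc n)" by metis
  define Z where "Z n = X n (m n)" for n
  have inP: "X n k \<in> P" "Z n \<in> P" for n k using cauchy_in[OF X(1)] by (auto simp: Z_def)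
  have Zc: "Z \<in> cauchy_seqs"
    unfolding cauchy_seqs_def
  proof (intro CollectI conjI allI impI)
    fix e :: real assume e: "e > 0"
    then obtain N where N: "\<And>p q. p \<ge> N \<Longrightarrow> q \<ge> N \<Longrightarrow> hnorm completion (U p \<ominus>\<^bsub>completion\<^esub> U q) < e / 3"
      using C[of "e / 3"] by auto
    obtain M where M: "1 / real (Suc M) < e / 3" using reals_Archimedean[of "e / 3"] e
      by (auto simp: inverse_eq_divide)
    show "\<exists>N. \<forall>p\<ge>N. \<forall>q\<ge>N. nrm (Z p - Z q) < e"
    proof (intro exI allI impI)
      fix p q assume pq: "max N M \<le> p" "max N M \<le> q"
      have "(\<lambda>k. nrm (X p k - X q k)) \<longlonglongrightarrow> hnorm completion (U p \<ominus>\<^bsub>completion\<^esub> U q)"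
        using hnorm_minus_tendsto[OF X(1) X(1), of p q] by (simp add: X(2))
      then have "\<forall>\<^sub>F k in sequentially. nrm (X p k - X q k) < e / 3"
        by (rule order_tendstoD) (use N pq in auto)
      then have "\<forall>\<^sub>F k in sequentially. nrm (X p k - X q k) < e / 3 \<and> k \<ge> m p \<and> k \<ge> m q"
        by (intro eventually_conj eventually_ge_at_top)
      then obtain k where k: "nrm (X p k - X q k) < e / 3" "k \<ge> m p" "k \<ge> m q"
        by (auto simp: eventually_sequentially)
      have small: "1 / real (Suc r) < e / 3" if "max N M \<le> r" for r
      proof -
        have "1 / real (Suc r) \<le> 1 / real (Suc M)" using that by (intro frac_le) auto
        then show ?thesis using M by linarith
      qed
      have 1: "nrm (Z p - X p k) < e / 3"
        using m[OF k(2)] small[OF pq(1)] by (simp add: Z_def)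
      have 2: "nrm (X q k - Z q) < e / 3"
        using m[OF k(3)] small[OF pq(2)] nrm_minus_commute[OF inP(1)[of q k] inP(2)[of q]] by (simp add: Z_def)
      have "nrm (Z p - Z q) \<le> nrm (Z p - X p k) + nrm (X p k - Z q)"
        by (intro nrm_triangle_diff inP)
      moreover have "nrm (X p k - Z q) \<le> nrm (X p k - X q k) + nrm (X q k - Z q)"
        by (intro nrm_triangle_diff inP)
      ultimately show "nrm (Z p - Z q) < e" using 1 2 k(1) by linarith
    qed
  qed (rule inP)
  have "(\<lambda>n. hnorm completion (U n \<ominus>\<^bsub>completion\<^esub> limfun Z)) \<longlonglongrightarrow> 0"
  proof (rule LIMSEQ_I)
    fix e :: real assume e: "e > 0"
    then obtain N where N: "\<And>p q. p \<ge> N \<Longrightarrow> q \<ge> N \<Longrightarrow> nrm (Z p - Z q) < e / 3"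
      using cauchyD[OF Zc, of "e / 3"] by auto
    obtain M where M: "1 / real (Suc M) < e / 3" using reals_Archimedean[of "e / 3"] e
      by (auto simp: inverse_eq_divide)
    show "\<exists>no. \<forall>n\<ge>no. norm (hnorm completion (U n \<ominus>\<^bsub>completion\<^esub> limfun Z) - 0) < e"
    proof (intro exI allI impI)
      fix n assume n: "max N M \<le> n"
      have lim: "(\<lambda>k. nrm (X n k - Z k)) \<longlonglongrightarrow> hnorm completion (U n \<ominus>\<^bsub>completion\<^esub> limfun Z)"
        using hnorm_minus_tendsto[OF X(1) Zc, of n] by (simp add: X(2))
      have small: "1 / real (Suc n) < e / 3"
      proof -
        have "1 / real (Suc n) \<le> 1 / real (Suc M)" using n by (intro frac_le) auto
        then show ?thesis using M by linarith
      qed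
      have "nrm (X n k - Z k) \<le> 2 * e / 3" if "k \<ge> max N (m n)" for k
      proof -
        have "nrm (X n k - Z n) < e / 3"
          using m[of n k] that small nrm_minus_commute[OF inP(1)[of n k] inP(2)[of n]] by (simp add: Z_def)
        moreover have "nrm (Z n - Z k) < e / 3" using N n that by simp
        moreover have "nrm (X n k - Z k) \<le> nrm (X n k - Z n) + nrm (Z n - Z k)"
          by (intro nrm_triangle_diff inP)
        ultimately show ?thesis by linarith
      qed
      then have "hnorm completion (U n \<ominus>\<^bsub>completion\<^esub> limfun Z) \<le> 2 * e / 3"
        by (intro LIMSEQ_le_const2[OF lim]) blast
      moreover have "hnorm completion (U n \<ominus>\<^bsub>completion\<^esub> limfun Z) \<ge> 0"
        by (intro LIMSEQ_le_const[OF lim]) (auto intro: nrm_nonneg V_diff inP)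
      ultimately show "norm (hnorm completion (U n \<ominus>\<^bsub>completion\<^esub> limfun Z) - 0) < e"
        using e by simp
    qed
  qed
  then show ?thesis using Zc by (auto simp: carrier_completion)
qed

lemma complex_hilbert_space_completion: "complex_hilbert_space completion"
proof -
  interpret H: Module.module "class_ring :: complex ring" completion by (rule module_completion)
  interpret F: field "class_ring :: complex ring" by (rule class_field)
  interpret V: vectorspace "class_ring :: complex ring" completion by unfold_locales
  have iprod_add: "iprod completion (x \<oplus>\<^bsub>completion\<^esub> y) z = iprod completion x z + iprod completion y z"
    if prems: "x \<in> carrier completion" "y \<in> carrier completion" "z \<in> carrier completion" for x y z
  proof -
    obtain X Y Z where XYZ: "X \<in> cauchy_seqs" "Y \<in> cauchy_seqs" "Z \<in> cauchy_seqs"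
      "x = limfun X" "y = limfun Y" "z = limfun Z"
      using prems by (auto simp: carrier_completion)
    have "(\<lambda>n. hf (X n + Y n) (Z n)) \<longlonglongrightarrow> iprod completion (x \<oplus>\<^bsub>completion\<^esub> y) z"
      using iprod_tendsto[OF cauchy_add[OF XYZ(1,2)] XYZ(3)] XYZ by (simp add: limfun_add add_completion)
    moreover have "(\<lambda>n. hf (X n + Y n) (Z n)) \<longlonglongrightarrow> iprod completion x z + iprod completion y z"
      using tendsto_add[OF iprod_tendsto[OF XYZ(1,3)] iprod_tendsto[OF XYZ(2,3)]] XYZ
      by (simp add: hf_add cauchy_in)
    ultimately show ?thesis by (rule LIMSEQ_unique)
  qed
  have iprod_smult: "iprod completion (c \<odot>\<^bsub>completion\<^esub> x) y = c * iprod completion x y"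
    if prems: "x \<in> carrier completion" "y \<in> carrier completion" for c x y
  proof -
    obtain X Y where XY: "X \<in> cauchy_seqs" "Y \<in> cauchy_seqs" "x = limfun X" "y = limfun Y"
      using prems by (auto simp: carrier_completion)
    have "(\<lambda>n. hf (\<lambda>x. c * X n x) (Y n)) \<longlonglongrightarrow> iprod completion (c \<odot>\<^bsub>completion\<^esub> x) y"
      using iprod_tendsto[OF cauchy_smult[OF XY(1)] XY(2), of c] XY by (simp add: limfun_smult smult_completion)
    moreover have "(\<lambda>n. hf (\<lambda>x. c * X n x) (Y n)) \<longlonglongrightarrow> c * iprod completion x y"
      using tendsto_mult[OF tendsto_const iprod_tendsto[OF XY(1,2)], of c] XY
      by (simp add: hf_smult cauchy_in)
    ultimately show ?thesis by (rule LIMSEQ_unique)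
  qed
  have iprod_cnj: "iprod completion y x = cnj (iprod completion x y)"
    if prems: "x \<in> carrier completion" "y \<in> carrier completion" for x y
  proof -
    obtain X Y where XY: "X \<in> cauchy_seqs" "Y \<in> cauchy_seqs" "x = limfun X" "y = limfun Y"
      using prems by (auto simp: carrier_completion)
    have "(\<lambda>n. hf (Y n) (X n)) \<longlonglongrightarrow> iprod completion y x"
      using iprod_tendsto[OF XY(2,1)] XY by simp
    moreover have "(\<lambda>n. hf (Y n) (X n)) \<longlonglongrightarrow> cnj (iprod completion x y)"
      using tendsto_cnj[OF iprod_tendsto[OF XY(1,2)]] XY
      by (simp add: hf_cnj[symmetric] cauchy_in)
    ultimately show ?thesis by (rule LIMSEQ_unique)
  qed
  have nrm_lim: "(\<lambda>n. (nrm (X n))\<^sup>2) \<longlonglongrightarrow> Re (iprod completion (limfun X) (limfun X))"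
    if "X \<in> cauchy_seqs" for X
    using tendsto_Re[OF iprod_tendsto[OF that that]] by (simp add: nrm_sq cauchy_in[OF that])
  show ?thesis
  proof
    show "0 \<le> Re (iprod completion x x)" if prems: "x \<in> carrier completion" for x
    proof -
      obtain X where X: "X \<in> cauchy_seqs" "x = limfun X" using prems by (auto simp: carrier_completion)
      show ?thesis by (rule LIMSEQ_le_const[OF nrm_lim[OF X(1), folded X(2)]]) auto
    qed
    show "x = \<zero>\<^bsub>completion\<^esub>" if prems: "x \<in> carrier completion" "iprod completion x x = 0" for x
    proof -
      obtain X where X: "X \<in> cauchy_seqs" "x = limfun X" using prems by (auto simp: carrier_completion)
      have "(\<lambda>n. (nrm (X n))\<^sup>2) \<longlonglongrightarrow> 0" using nrm_lim[OF X(1)] prems(2) X(2) by simp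
      then have "(\<lambda>n. nrm (X n)) \<longlonglongrightarrow> 0" by (simp add: tendsto_null_power)
      then show ?thesis using null_imp_limfun X by (simp add: zero_completion)
    qed
  qed (rule iprod_add iprod_smult iprod_cnj completion_complete; assumption)+
qed

text \<open>Two descriptions of one operator are matched under limits: \<open>T\<close> acts before
  completion and carries the isometry property, while \<open>U\<close> acts on functions and carries
  linearity and the inverse. Each property is thus checked where it is visible without
  limits.\<close>

lemma unitary_operator_completion:
  assumes T: "\<And>a. a \<in> P \<Longrightarrow> T a \<in> P" "\<And>a b. \<lbrakk>a \<in> P; b \<in> P\<rbrakk> \<Longrightarrow> T (a - b) = T a - T b"
      "\<And>a b. \<lbrakk>a \<in> P; b \<in> P\<rbrakk> \<Longrightarrow> hf (T a) (T b) = hf a b"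
    and U: "\<And>X. X \<in> cauchy_seqs \<Longrightarrow> limfun (\<lambda>n. T (X n)) = U (limfun X)"
    and U_add: "\<And>u v. U (\<lambda>x. u x + v x) = (\<lambda>x. U u x + U v x)"
    and U_smult: "\<And>c u. U (\<lambda>x. c * u x) = (\<lambda>x. c * U u x)"
    and U': "\<And>u. u \<in> carrier completion \<Longrightarrow> U' u \<in> carrier completion \<and> U (U' u) = u \<and> U' (U u) = u"
  shows "unitary_operator completion U"
proof -
  have TX: "(\<lambda>n. T (X n)) \<in> cauchy_seqs" if X: "X \<in> cauchy_seqs" for X
  proof -
    have "nrm (T (X m) - T (X n)) = nrm (X m - X n)" for m n
      using V_diff[OF cauchy_in[OF X] cauchy_in[OF X], of m n] cauchy_in[OF X]
      by (simp add: nrm_def T flip: T(2))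
    then show ?thesis using X by (simp add: cauchy_seqs_def T)
  qed
  have Uc: "U u \<in> carrier completion" if prems: "u \<in> carrier completion" for u
  proof -
    obtain X where X: "X \<in> cauchy_seqs" "u = limfun X" using prems by (auto simp: carrier_completion)
    show ?thesis unfolding carrier_completion X(2) by (rule image_eqI[where f = limfun, OF U[OF X(1), symmetric] TX[OF X(1)]])
  qed
  have iso: "iprod completion (U u) (U v) = iprod completion u v"
    if prems: "u \<in> carrier completion" "v \<in> carrier completion" for u v
  proof -
    obtain X Y where XY: "X \<in> cauchy_seqs" "Y \<in> cauchy_seqs" "u = limfun X" "v = limfun Y"
      using prems by (auto simp: carrier_completion)
    have "(\<lambda>n. hf (X n) (Y n)) \<longlonglongrightarrow> iprod completion (U u) (U v)"
      using iprod_tendsto[OF TX[OF XY(1)] TX[OF XY(2)]] XY by (simp add: U T cauchy_in)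
    then show ?thesis using iprod_tendsto[OF XY(1,2)] XY(3,4) LIMSEQ_unique by blast
  qed
  have "bij_betw U (carrier completion) (carrier completion)"
    by (rule bij_betwI[of _ _ _ U']) (use Uc U' in auto)
  then show ?thesis
    using Uc iso unfolding unitary_operator_def module_hom_def
    by (auto simp: add_completion smult_completion U_add U_smult)
qed

end

section \<open>Spectral gap from property (T)\<close>

context group
begin

text \<open>Complex version of \<open>kform\<close>: Kazhdan pairs speak of complex Hilbert spaces,
  whereas the gap inequality is real.\<close>

definition cform :: "('a \<Rightarrow> real) \<Rightarrow> ('a \<Rightarrow> complex) \<Rightarrow> ('a \<Rightarrow> complex) \<Rightarrow> complex" where
  "cform f a b = (\<Sum>g\<in>supp a. \<Sum>h\<in>supp b. a g * cnj (b h) * complex_of_real (f (inv h \<otimes> g)))"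

definition cev :: "('a \<Rightarrow> real) \<Rightarrow> ('a \<Rightarrow> complex) \<Rightarrow> 'a \<Rightarrow> complex" where
  "cev f a h = (if h \<in> carrier G then \<Sum>g\<in>supp a. a g * complex_of_real (f (inv h \<otimes> g)) else 0)"

text \<open>Restricting to sum zero removes the invariant vectors before completing. A Kazhdan pair
  then forbids almost invariant vectors altogether, which is a quantitative inequality instead of
  the mere existence of an invariant vector.\<close>

definition zero_sum :: "('a \<Rightarrow> complex) set" where
  "zero_sum = {a \<in> fsupp (carrier G). (\<Sum>g\<in>supp a. a g) = 0}"

definition trans_op :: "'a \<Rightarrow> (nat \<times> 'a \<Rightarrow> complex) \<Rightarrow> nat \<times> 'a \<Rightarrow> complex" where
  "trans_op s u = (\<lambda>(n, h). if h \<in> carrier G then u (n, inv s \<otimes> h) else 0)"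

lemma cform_superset:
  assumes "finite E" "finite E'" "supp a \<subseteq> E" "supp b \<subseteq> E'"
  shows "cform f a b = (\<Sum>g\<in>E. \<Sum>h\<in>E'. a g * cnj (b h) * complex_of_real (f (inv h \<otimes> g)))"
proof -
  have "cform f a b = (\<Sum>g\<in>E. \<Sum>h\<in>supp b. a g * cnj (b h) * complex_of_real (f (inv h \<otimes> g)))"
    unfolding cform_def
    by (rule sum.mono_neutral_left) (use assms in \<open>auto simp: supp_def\<close>)
  also have "\<dots> = (\<Sum>g\<in>E. \<Sum>h\<in>E'. a g * cnj (b h) * complex_of_real (f (inv h \<otimes> g)))"
    by (intro sum.cong refl sum.mono_neutral_left) (use assms in \<open>auto simp: supp_def\<close>)
  finally show ?thesis .
qed

lemma sum_supp_superset: "finite E \<Longrightarrow> supp a \<subseteq> E \<Longrightarrow> (\<Sum>g\<in>supp a. a g) = (\<Sum>g\<in>E. a g)"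
  by (rule sum.mono_neutral_left) (auto simp: supp_def)

lemma cev_superset:
  "finite E \<Longrightarrow> supp a \<subseteq> E \<Longrightarrow> cev f a h =
    (if h \<in> carrier G then \<Sum>g\<in>E. a g * complex_of_real (f (inv h \<otimes> g)) else 0)"
  unfolding cev_def by (auto intro!: sum.mono_neutral_left simp: supp_def)

lemma supp_add: "supp (a + b) \<subseteq> supp a \<union> supp b" for a b :: "'x \<Rightarrow> complex"
  by (auto simp: supp_def)

lemma supp_smult: "supp (\<lambda>x. c * a x) \<subseteq> supp a" for a :: "'x \<Rightarrow> complex"
  by (auto simp: supp_def)

lemma fsupp_smult: "a \<in> fsupp C \<Longrightarrow> (\<lambda>x. c * a x) \<in> fsupp C" for a :: "'x \<Rightarrow> complex"
  using supp_smult[of c a] by (auto simp: fsupp_def intro: finite_subset)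

lemma hermitian_form_cform:
  assumes f: "posdef G f"
  shows "hermitian_form (fsupp (carrier G)) (cform f)"
proof
  show "(\<lambda>_. 0) \<in> fsupp (carrier G)" by (simp add: fsupp_def supp_def)
next
  fix a b c :: "'a \<Rightarrow> complex"
  assume abc: "a \<in> fsupp (carrier G)" "b \<in> fsupp (carrier G)" "c \<in> fsupp (carrier G)"
  let ?E = "supp a \<union> supp b"
  have E: "finite ?E" "finite (supp c)" using abc by (auto simp: fsupp_def)
  show "cform f (a + b) c = cform f a c + cform f b c"
    using cform_superset[OF E supp_add order_refl, of f] cform_superset[OF E, of a c f]
      cform_superset[OF E, of b c f]
    by (simp add: sum.distrib algebra_simps)
next
  fix a b :: "'a \<Rightarrow> complex" and c
  assume ab: "a \<in> fsupp (carrier G)" "b \<in> fsupp (carrier G)"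
  then have E: "finite (supp a)" "finite (supp b)" by (auto simp: fsupp_def)
  show "cform f (\<lambda>x. c * a x) b = c * cform f a b"
    using cform_superset[OF E supp_smult order_refl, of f c]
    by (simp add: cform_def sum_distrib_left mult_ac)
next
  fix a b :: "'a \<Rightarrow> complex"
  assume ab: "a \<in> fsupp (carrier G)" "b \<in> fsupp (carrier G)"
  have "f (inv h \<otimes> g) = f (inv g \<otimes> h)" if "g \<in> supp a" "h \<in> supp b" for g h
  proof -
    have gh: "g \<in> carrier G" "h \<in> carrier G" using that ab by (auto simp: fsupp_def)
    then have "f (inv (inv h \<otimes> g)) = f (inv h \<otimes> g)" using f by (simp add: posdef_def)
    then show ?thesis using gh by (simp add: inv_mult_group)
  qed
  then have "cnj (cform f a b) =
      (\<Sum>g\<in>supp a. \<Sum>h\<in>supp b. b h * cnj (a g) * complex_of_real (f (inv g \<otimes> h)))"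
    unfolding cform_def cnj_sum by (intro sum.cong refl) (auto simp: mult_ac)
  also have "\<dots> = cform f b a" unfolding cform_def by (rule sum.swap)
  finally show "cform f b a = cnj (cform f a b)" by simp
next
  fix a :: "'a \<Rightarrow> complex"
  assume a: "a \<in> fsupp (carrier G)"
  let ?q = "\<lambda>x. \<Sum>g\<in>supp a. \<Sum>h\<in>supp a. x g * x h * f (inv h \<otimes> g)"
  have "Re (cform f a a) =
      (\<Sum>g\<in>supp a. \<Sum>h\<in>supp a. (Re (a g) * Re (a h) + Im (a g) * Im (a h)) * f (inv h \<otimes> g))"
    by (simp add: cform_def)
  also have "\<dots> = ?q (\<lambda>g. Re (a g)) + ?q (\<lambda>g. Im (a g))"
    by (simp add: distrib_right sum.distrib)
  also have "\<dots> \<ge> 0" using f a by (intro add_nonneg_nonneg) (auto simp: posdef_def fsupp_def)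
  finally show "0 \<le> Re (cform f a a)" .
qed (auto intro: fsupp_add fsupp_smult)

lemma cev_eq_cform:
  assumes "h \<in> carrier G"
  shows "cev f a h = cform f a (\<lambda>x. if x = h then 1 else 0)"
proof -
  have "supp (\<lambda>x. if x = h then 1 else (0::complex)) = {h}" by (auto simp: supp_def)
  then show ?thesis using assms by (simp add: cev_def cform_def)
qed

lemma cform_eq_cev:
  assumes "supp b \<subseteq> carrier G"
  shows "cform f a b = (\<Sum>h\<in>supp b. cnj (b h) * cev f a h)"
proof -
  have "cform f a b = (\<Sum>h\<in>supp b. \<Sum>g\<in>supp a. a g * cnj (b h) * complex_of_real (f (inv h \<otimes> g)))"
    unfolding cform_def by (rule sum.swap)
  also have "\<dots> = (\<Sum>h\<in>supp b. cnj (b h) * cev f a h)"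
    using assms by (intro sum.cong refl) (auto simp: cev_def sum_distrib_left mult_ac)
  finally show ?thesis .
qed

lemma pre_hilbert_cform:
  assumes f: "posdef G f"
  shows "pre_hilbert zero_sum (cform f) (cev f)"
proof -
  interpret F: hermitian_form "fsupp (carrier G)" "cform f" by (rule hermitian_form_cform[OF f])
  have sub: "zero_sum \<subseteq> fsupp (carrier G)" by (auto simp: zero_sum_def)
  interpret Z: hermitian_form zero_sum "cform f"
  proof
    show "(\<lambda>_. 0) \<in> zero_sum" using F.P_zero by (simp add: zero_sum_def)
  next
    fix a b assume ab: "a \<in> zero_sum" "b \<in> zero_sum"
    then have fin: "finite (supp a \<union> supp b)" by (auto simp: zero_sum_def fsupp_def)
    show "a + b \<in> zero_sum"
    proof -
      have "(\<Sum>g\<in>supp (a + b). (a + b) g) = (\<Sum>g\<in>supp a \<union> supp b. (a + b) g)"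
        by (rule sum_supp_superset[OF fin supp_add])
      also have "\<dots> = (\<Sum>g\<in>supp a \<union> supp b. a g) + (\<Sum>g\<in>supp a \<union> supp b. b g)"
        by (simp add: sum.distrib)
      also have "\<dots> = (\<Sum>g\<in>supp a. a g) + (\<Sum>g\<in>supp b. b g)"
        using sum_supp_superset[OF fin, of a] sum_supp_superset[OF fin, of b] by simp
      finally show ?thesis using ab fsupp_add[of a _ b] by (simp add: zero_sum_def)
    qed
  next
    fix a c assume a: "a \<in> zero_sum"
    then have fin: "finite (supp a)" by (auto simp: zero_sum_def fsupp_def)
    show "(\<lambda>x. c * a x) \<in> zero_sum"
    proof -
      have "(\<Sum>g\<in>supp (\<lambda>x. c * a x). c * a g) = (\<Sum>g\<in>supp a. c * a g)"
        by (rule sum_supp_superset[OF fin supp_smult])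
      also have "\<dots> = c * (\<Sum>g\<in>supp a. a g)" by (rule sum_distrib_left[symmetric])
      finally show ?thesis using a fsupp_smult[of a _ c] by (simp add: zero_sum_def)
    qed
  next
    fix a b d assume "a \<in> zero_sum" "b \<in> zero_sum" "d \<in> zero_sum"
    then show "cform f (a + b) d = cform f a d + cform f b d"
      by (intro F.hf_add subsetD[OF sub])
  next
    fix a b c assume "a \<in> zero_sum" "b \<in> zero_sum"
    then show "cform f (\<lambda>x. c * a x) b = c * cform f a b"
      by (intro F.hf_smult subsetD[OF sub])
  next
    fix a b assume "a \<in> zero_sum" "b \<in> zero_sum"
    then show "cform f b a = cnj (cform f a b)"
      by (intro F.hf_cnj subsetD[OF sub])
  next
    fix a assume "a \<in> zero_sum"
    then show "0 \<le> Re (cform f a a)" by (intro F.hf_nonneg subsetD[OF sub])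
  qed
  show ?thesis
  proof
    fix a b h assume ab: "a \<in> zero_sum" "b \<in> zero_sum"
    then have fin: "finite (supp a \<union> supp b)" by (auto simp: zero_sum_def fsupp_def)
    show "cev f (a + b) h = cev f a h + cev f b h"
      using cev_superset[OF fin supp_add, of f h] cev_superset[OF fin, of a f h]
        cev_superset[OF fin, of b f h]
      by (simp add: sum.distrib algebra_simps)
  next
    fix a c h assume a: "a \<in> zero_sum"
    then have fin: "finite (supp a)" by (auto simp: zero_sum_def fsupp_def)
    show "cev f (\<lambda>x. c * a x) h = c * cev f a h"
    proof -
      have "cev f (\<lambda>x. c * a x) h = (if h \<in> carrier G then
          \<Sum>g\<in>supp a. c * a g * complex_of_real (f (inv h \<otimes> g)) else 0)"
        by (rule cev_superset[OF fin supp_smult])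
      then show ?thesis by (simp add: cev_def sum_distrib_left mult_ac)
    qed
  next
    fix h
    show "\<exists>M. \<forall>a\<in>zero_sum. cmod (cev f a h) \<le> M * Z.nrm a"
    proof (cases "h \<in> carrier G")
      case True
      \<comment> \<open>The point mass at \<open>h\<close> does not have sum zero, so the bound
        comes from Cauchy-Schwarz in the larger space of all finitely supported functions.\<close>
      let ?d = "\<lambda>x. if x = h then 1 else (0::complex)"
      have d: "?d \<in> fsupp (carrier G)"
        using True by (auto simp: fsupp_def supp_def)
      show ?thesis
      proof (intro exI ballI)
        fix a assume "a \<in> zero_sum"
        then have "a \<in> fsupp (carrier G)" using sub by auto
        from F.cmod_hf_le[OF this d]
        show "cmod (cev f a h) \<le> F.nrm ?d * Z.nrm a"
          by (simp add: cev_eq_cform[OF True] mult.commute F.nrm_def Z.nrm_def)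
      qed
    next
      case False
      then show ?thesis by (intro exI[of _ 0]) (simp add: cev_def)
    qed
  next
    fix b assume b: "b \<in> zero_sum"
    then have s: "finite (supp b)" "supp b \<subseteq> carrier G" by (auto simp: zero_sum_def fsupp_def)
    show "\<exists>T w. finite T \<and> (\<forall>a\<in>zero_sum. cform f a b = (\<Sum>h\<in>T. w h * cev f a h))"
      by (rule exI[of _ "supp b"], rule exI[of _ "\<lambda>h. cnj (b h)"])
        (use s cform_eq_cev[OF s(2), of f] in auto)
  qed
qed

lemma cform_ltrans:
  assumes "s \<in> carrier G" "supp a \<subseteq> carrier G" "supp b \<subseteq> carrier G"
  shows "cform f (ltrans s a) (ltrans s b) = cform f a b"
proof -
  have "inv (s \<otimes> h) \<otimes> (s \<otimes> g) = inv h \<otimes> g" if "g \<in> supp a" "h \<in> supp b" for g h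
  proof -
    have "g \<in> carrier G" "h \<in> carrier G" using that assms by auto
    then have "inv (s \<otimes> h) \<otimes> (s \<otimes> g) = inv h \<otimes> (inv s \<otimes> s \<otimes> g)"
      using assms(1) by (metis inv_closed inv_mult_group m_assoc m_closed)
    also have "\<dots> = inv h \<otimes> g" using assms(1) \<open>g \<in> carrier G\<close> by (simp only: l_inv l_one)
    finally show ?thesis .
  qed
  moreover have "ltrans s a (s \<otimes> g) = a g" if "g \<in> supp a" for g
    using that assms by (intro ltrans_apply) auto
  moreover have "ltrans s b (s \<otimes> g) = b g" if "g \<in> supp b" for g
    using that assms by (intro ltrans_apply) auto
  ultimately show ?thesis
    unfolding cform_def supp_ltrans[OF assms(1,2)] supp_ltrans[OF assms(1,3)]
    using inj_on_lmult[OF assms(1,2)] inj_on_lmult[OF assms(1,3)]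
    by (simp add: sum.reindex)
qed

lemma cev_ltrans:
  assumes "s \<in> carrier G" "supp a \<subseteq> carrier G" "h \<in> carrier G"
  shows "cev f (ltrans s a) h = cev f a (inv s \<otimes> h)"
proof -
  have "inv h \<otimes> (s \<otimes> g) = inv (inv s \<otimes> h) \<otimes> g" if "g \<in> supp a" for g
  proof -
    have "g \<in> carrier G" using that assms by auto
    then show ?thesis using assms by (simp add: inv_mult_group m_assoc)
  qed
  moreover have "ltrans s a (s \<otimes> g) = a g" if "g \<in> supp a" for g
    using that assms by (intro ltrans_apply) auto
  ultimately show ?thesis
    using assms inj_on_lmult[OF assms(1,2)]
    by (simp add: cev_def supp_ltrans sum.reindex)
qed

lemma zero_sum_ltrans:
  assumes "s \<in> carrier G" "a \<in> zero_sum"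
  shows "ltrans s a \<in> zero_sum"
proof -
  have a: "supp a \<subseteq> carrier G" using assms by (auto simp: zero_sum_def fsupp_def)
  have "ltrans s a (s \<otimes> g) = a g" if "g \<in> supp a" for g
    using that assms a by (intro ltrans_apply) auto
  then have "(\<Sum>g\<in>supp (ltrans s a). ltrans s a g) = (\<Sum>g\<in>supp a. a g)"
    using assms(1) a inj_on_lmult[OF assms(1) a] by (simp add: supp_ltrans sum.reindex)
  then show ?thesis using assms by (simp add: zero_sum_def ltrans_fsupp)
qed

text \<open>An invariant vector of the completion is constant on \<open>G\<close> as a function, hence orthogonal to
  every vector of sum zero, hence zero.\<close>

lemma kazhdan_pair_zero_sum:
  assumes kp: "kazhdan_pair G Q \<epsilon>" and Q: "Q \<subseteq> carrier G" and f: "posdef G f"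
    and a: "a \<in> zero_sum" and pos: "Re (cform f a a) > 0"
  shows "\<exists>q\<in>Q. \<epsilon>\<^sup>2 * Re (cform f a a) \<le> Re (cform f (ltrans q a - a) (ltrans q a - a)) \<or> \<epsilon> \<le> 0"
proof -
  interpret pre_hilbert zero_sum "cform f" "cev f" by (rule pre_hilbert_cform[OF f])
  have zsupp: "supp b \<subseteq> carrier G" if "b \<in> zero_sum" for b
    using that by (auto simp: zero_sum_def fsupp_def)
  have lim_trans: "limfun (\<lambda>n. ltrans s (X n)) = trans_op s (limfun X)"
    and cauchy_trans: "(\<lambda>n. ltrans s (X n)) \<in> cauchy_seqs"
    if s: "s \<in> carrier G" and X: "X \<in> cauchy_seqs" for s X
  proof -
    have XP: "X n \<in> zero_sum" for n by (rule cauchy_in[OF X])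
    have "nrm (ltrans s (X m) - ltrans s (X n)) = nrm (X m - X n)" for m n
    proof -
      have "ltrans s (X m) - ltrans s (X n) = ltrans s (X m - X n)"
        by (simp add: ltrans_def fun_eq_iff)
      then show ?thesis
        using V_diff[OF XP XP, of m n] by (simp add: nrm_def cform_ltrans[OF s] zsupp)
    qed
    then show c: "(\<lambda>n. ltrans s (X n)) \<in> cauchy_seqs"
      using X by (simp add: cauchy_seqs_def zero_sum_ltrans[OF s])
    show "limfun (\<lambda>n. ltrans s (X n)) = trans_op s (limfun X)"
    proof (rule limfun_eqI[OF c])
      fix m h
      show "(\<lambda>n. cev f (ltrans s (X n)) h) \<longlonglongrightarrow> trans_op s (limfun X) (m, h)"
      proof (cases "h \<in> carrier G")
        case True
        then show ?thesis
          using ev_tendsto[OF X, of "inv s \<otimes> h" m] s XP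
          by (simp add: cev_ltrans zsupp trans_op_def)
      next
        case False
        then show ?thesis by (simp add: cev_def trans_op_def)
      qed
    qed
  qed
  have outside: "u (n, h) = 0" if "u \<in> carrier completion" "h \<notin> carrier G" for u n h
    using that by (auto simp: carrier_completion limfun_def cev_def)
  have trans_closed: "trans_op s u \<in> carrier completion"
    if prems: "s \<in> carrier G" "u \<in> carrier completion" for s u
  proof -
    obtain X where X: "X \<in> cauchy_seqs" "u = limfun X" using prems by (auto simp: carrier_completion)
    show ?thesis
      unfolding carrier_completion X(2)
      by (rule image_eqI[where f = limfun, OF lim_trans[symmetric] cauchy_trans]) (rule prems X)+
  qed
  have trans_inv: "trans_op s (trans_op (inv s) u) = u" "trans_op (inv s) (trans_op s u) = u"
    if prems: "s \<in> carrier G" "u \<in> carrier completion" for s u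
  proof -
    have c: "s \<otimes> (inv s \<otimes> h) = h" "inv s \<otimes> (s \<otimes> h) = h" if "h \<in> carrier G" for h
      using prems(1) that by (simp_all add: m_assoc[symmetric])
    have o: "u (n, h) = 0" if "h \<notin> carrier G" for n h using outside[OF prems(2) that] .
    show "trans_op s (trans_op (inv s) u) = u"
    proof
      fix p :: "nat \<times> 'a"
      obtain n h where p: "p = (n, h)" by (cases p)
      show "trans_op s (trans_op (inv s) u) p = u p"
        using prems(1) c(1)[of h] o[of h n] by (cases "h \<in> carrier G") (simp_all add: p trans_op_def)
    qed
    show "trans_op (inv s) (trans_op s u) = u"
    proof
      fix p :: "nat \<times> 'a"
      obtain n h where p: "p = (n, h)" by (cases p)
      show "trans_op (inv s) (trans_op s u) p = u p"
        using prems(1) c(2)[of h] o[of h n] by (cases "h \<in> carrier G") (simp_all add: p trans_op_def)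
    qed
  qed
  have unitary: "unitary_rep G completion trans_op"
    unfolding unitary_rep_def
  proof (intro conjI ballI)
    show "complex_hilbert_space completion" by (rule complex_hilbert_space_completion)
    fix s assume s: "s \<in> carrier G"
    show "unitary_operator completion (trans_op s)"
    proof (rule unitary_operator_completion[where T = "ltrans s" and U' = "trans_op (inv s)"])
      show "ltrans s (a - b) = ltrans s a - ltrans s b" for a b :: "'a \<Rightarrow> complex"
        by (simp add: ltrans_def fun_eq_iff)
      show "trans_op (inv s) u \<in> carrier completion \<and> trans_op s (trans_op (inv s) u) = u \<and>
          trans_op (inv s) (trans_op s u) = u" if "u \<in> carrier completion" for u
        using trans_closed[of "inv s" u] trans_inv[OF s that] s that by simp
      show "cform f (ltrans s a) (ltrans s b) = cform f a b"
        if "a \<in> zero_sum" "b \<in> zero_sum" for a b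
        using that by (intro cform_ltrans s zsupp)
      show "trans_op s (\<lambda>x. u x + v x) = (\<lambda>x. trans_op s u x + trans_op s v x)" for u v
        by (auto simp: trans_op_def)
      show "trans_op s (\<lambda>x. c * u x) = (\<lambda>x. c * trans_op s u x)" for c u
        by (auto simp: trans_op_def)
    qed (rule zero_sum_ltrans[OF s] lim_trans[OF s]; assumption)+
    fix t u assume t: "t \<in> carrier G"
    show "trans_op (s \<otimes> t) u = trans_op s (trans_op t u)"
      using s t by (auto simp: trans_op_def fun_eq_iff inv_mult_group m_assoc)
  qed
  have inv_zero: "x = \<zero>\<^bsub>completion\<^esub>"
    if x: "x \<in> carrier completion" "\<forall>g\<in>carrier G. trans_op g x = x" for x
  proof -
    obtain X where X: "X \<in> cauchy_seqs" "x = limfun X" using x by (auto simp: carrier_completion)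
    have const: "x (0, h) = x (0, \<one>)" if h: "h \<in> carrier G" for h
    proof -
      have "trans_op h x (0, h) = x (0, h)" by (rule fun_cong[OF bspec[OF x(2) h]])
      moreover have "trans_op h x (0, h) = x (0, \<one>)" using h by (simp add: trans_op_def)
      ultimately show ?thesis by simp
    qed
    have "(\<lambda>n. nrm (X n)) \<longlonglongrightarrow> 0"
    proof (rule weakly_null_imp_null[OF X(1)])
      fix b assume b: "b \<in> zero_sum"
      have "(\<lambda>n. \<Sum>h\<in>supp b. cnj (b h) * cev f (X n) h) \<longlonglongrightarrow> (\<Sum>h\<in>supp b. cnj (b h) * x (0, h))"
        unfolding X(2) by (intro tendsto_intros ev_tendsto X(1))
      moreover have "(\<Sum>h\<in>supp b. cnj (b h) * x (0, h)) = 0"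
      proof -
        have "(\<Sum>h\<in>supp b. cnj (b h) * x (0, h)) = (\<Sum>h\<in>supp b. cnj (b h) * x (0, \<one>))"
        proof (rule sum.cong[OF refl])
          fix h assume "h \<in> supp b"
          then have "h \<in> carrier G" using zsupp[OF b] by auto
          then show "cnj (b h) * x (0, h) = cnj (b h) * x (0, \<one>)" by (simp only: const)
        qed
        also have "\<dots> = cnj (\<Sum>h\<in>supp b. b h) * x (0, \<one>)"
          by (simp only: cnj_sum sum_distrib_right)
        also have "\<dots> = 0" using b by (simp add: zero_sum_def)
        finally show ?thesis .
      qed
      ultimately show "(\<lambda>n. cform f (X n) b) \<longlonglongrightarrow> 0"
        by (simp only: cform_eq_cev[OF zsupp[OF b]])
    qed
    then show ?thesis using null_imp_limfun[OF X(1)] X(2) by (simp add: zero_completion)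
  qed
  let ?almost = "\<exists>x\<in>carrier completion. x \<noteq> \<zero>\<^bsub>completion\<^esub> \<and>
      (\<forall>g\<in>Q. hnorm completion (trans_op g x \<ominus>\<^bsub>completion\<^esub> x) < \<epsilon> * hnorm completion x)"
  have no_inv: "\<not> ?almost"
  proof
    assume ?almost
    then have "\<exists>x\<in>carrier completion. x \<noteq> \<zero>\<^bsub>completion\<^esub> \<and> (\<forall>g\<in>carrier G. trans_op g x = x)"
      by (rule kp[unfolded kazhdan_pair_def, rule_format, OF unitary])
    then obtain x where "x \<in> carrier completion" "x \<noteq> \<zero>\<^bsub>completion\<^esub>" "\<forall>g\<in>carrier G. trans_op g x = x"
      by (elim bexE conjE) (rule that)
    then show False using inv_zero by (elim notE)
  qed
  define x where "x = limfun (\<lambda>_. a)"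
  note ca = cauchy_const[OF a]
  have hx: "hnorm completion x = nrm a"
    unfolding x_def by (rule LIMSEQ_unique[OF hnorm_tendsto[OF ca] tendsto_const])
  have xc: "x \<in> carrier completion" using ca by (auto simp: x_def carrier_completion)
  have "x \<noteq> \<zero>\<^bsub>completion\<^esub>"
  proof
    assume "x = \<zero>\<^bsub>completion\<^esub>"
    then have "(\<lambda>_::nat. nrm a) \<longlonglongrightarrow> 0"
      using limfun_imp_null[OF ca] by (simp add: x_def zero_completion)
      then have "nrm a = 0" by (rule LIMSEQ_unique[OF tendsto_const])
    then show False using pos nrm_sq[OF a] by simp
  qed
  then have "\<not> (\<forall>g\<in>Q. hnorm completion (trans_op g x \<ominus>\<^bsub>completion\<^esub> x) < \<epsilon> * hnorm completion x)"
    using no_inv xc by fast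
  then obtain q where q: "q \<in> Q" "\<epsilon> * nrm a \<le> hnorm completion (trans_op q x \<ominus>\<^bsub>completion\<^esub> x)"
    unfolding hx by (auto simp: not_less)
  have qG: "q \<in> carrier G" using q Q by auto
  have "trans_op q x = limfun (\<lambda>_. ltrans q a)" using lim_trans[OF qG ca] by (simp add: x_def)
  moreover have "hnorm completion (limfun (\<lambda>_. ltrans q a) \<ominus>\<^bsub>completion\<^esub> limfun (\<lambda>_. a)) = nrm (ltrans q a - a)"
    by (rule LIMSEQ_unique[OF hnorm_minus_tendsto[OF cauchy_const[OF zero_sum_ltrans[OF qG a]] ca] tendsto_const])
  ultimately have "hnorm completion (trans_op q x \<ominus>\<^bsub>completion\<^esub> x) = nrm (ltrans q a - a)"
    by (simp only: x_def)
  then have le: "\<epsilon> * nrm a \<le> nrm (ltrans q a - a)" using q by simp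
  have "\<epsilon>\<^sup>2 * Re (cform f a a) \<le> Re (cform f (ltrans q a - a) (ltrans q a - a))" if "\<epsilon> > 0"
  proof -
    have "(\<epsilon> * nrm a)\<^sup>2 \<le> (nrm (ltrans q a - a))\<^sup>2"
      using le that nrm_nonneg[OF a] by (intro power_mono) auto
    then show ?thesis
      using nrm_sq[OF a] nrm_sq[OF V_diff[OF zero_sum_ltrans[OF qG a] a]]
      by (simp add: power_mult_distrib)
  qed
  then show ?thesis using q(1) by (meson not_less)
qed

lemma cform_of_real: "cform f (\<lambda>g. complex_of_real (a g)) (\<lambda>g. complex_of_real (b g)) =
    complex_of_real (kform f a b)"
proof -
  have "supp (\<lambda>g. complex_of_real (c g)) = supp c" for c :: "'a \<Rightarrow> real" by (auto simp: supp_def)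
  then show ?thesis by (simp add: cform_def kform_def)
qed

lemma displacement_kform:
  assumes "posdef G f" "a \<in> fsupp (carrier G)" "s \<in> carrier G"
  shows "kform f (ltrans s a - a) (ltrans s a - a) = 2 * (kform f a a - kform f (ltrans s a) a)"
    "kform f a a - kform f (ltrans s a) a \<ge> 0"
proof -
  interpret semi_ip "fsupp (carrier G)" "kform f" by (rule semi_ip_kform[OF assms(1)])
  have l: "ltrans s a \<in> fsupp (carrier G)" by (rule ltrans_fsupp[OF assms(3,2)])
  have "kform f (ltrans s a) (ltrans s a) = kform f a a"
    using assms by (intro kform_ltrans) (auto simp: fsupp_def)
  then show 1: "kform f (ltrans s a - a) (ltrans s a - a) = 2 * (kform f a a - kform f (ltrans s a) a)"
    using B_sym[OF l assms(2)] by (simp add: B_diff B_diff_right V_diff l assms(2))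
  show "kform f a a - kform f (ltrans s a) a \<ge> 0"
    using B_nonneg[OF V_diff[OF l assms(2)]] 1 by simp
qed

text \<open>The return to real functions. A squared displacement is twice the difference of
  pairings, hence the factor 1/2.\<close>

lemma kazhdan_pair_ineq:
  assumes kp: "kazhdan_pair G Q \<epsilon>" and Q: "Q \<subseteq> carrier G" and \<epsilon>: "\<epsilon> > 0" and f: "posdef G f"
    and a: "a \<in> fsupp (carrier G)" "(\<Sum>g\<in>supp a. a g) = 0" and pos: "kform f a a > 0"
  shows "\<exists>q\<in>Q. \<epsilon>\<^sup>2 / 2 * kform f a a \<le> kform f a a - kform f (ltrans q a) a"
proof -
  let ?c = "\<lambda>a g. complex_of_real (a g)"
  have s: "supp (?c a) = supp a" by (auto simp: supp_def)
  have "?c a \<in> zero_sum"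
    using a by (simp add: zero_sum_def fsupp_def s flip: of_real_sum)
  moreover have "Re (cform f (?c a) (?c a)) > 0" using pos by (simp add: cform_of_real)
  ultimately obtain q where q: "q \<in> Q"
    "\<epsilon>\<^sup>2 * Re (cform f (?c a) (?c a)) \<le>
      Re (cform f (ltrans q (?c a) - ?c a) (ltrans q (?c a) - ?c a))"
    using kazhdan_pair_zero_sum[OF kp Q f] \<epsilon> by force
  have "ltrans q (?c a) - ?c a = ?c (ltrans q a - a)"
    by (auto simp: ltrans_def fun_eq_iff)
  then have "\<epsilon>\<^sup>2 * kform f a a \<le> kform f (ltrans q a - a) (ltrans q a - a)"
    using q(2) by (simp only: cform_of_real Re_complex_of_real)
  then have "\<epsilon>\<^sup>2 / 2 * kform f a a \<le> kform f a a - kform f (ltrans q a) a"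
    using displacement_kform(1)[OF f a(1)] q(1) Q by (auto simp: subset_eq)
  then show ?thesis using q(1) by blast
qed

section \<open>Subgroups generated by Kazhdan sets\<close>

definition coset_class :: "'a set \<Rightarrow> 'a \<Rightarrow> 'a set" where
  "coset_class \<Lambda> g = {h \<in> carrier G. inv h \<otimes> g \<in> \<Lambda>}"

lemma coset_class_eq_iff:
  assumes "subgroup \<Lambda> G" "g \<in> carrier G" "h \<in> carrier G"
  shows "coset_class \<Lambda> g = coset_class \<Lambda> h \<longleftrightarrow> inv h \<otimes> g \<in> \<Lambda>"
proof
  assume eq: "coset_class \<Lambda> g = coset_class \<Lambda> h"
  have "h \<in> coset_class \<Lambda> h"
    using assms subgroup.one_closed by (auto simp: coset_class_def)
  then show "inv h \<otimes> g \<in> \<Lambda>" unfolding eq[symmetric] by (simp add: coset_class_def)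
next
  assume l: "inv h \<otimes> g \<in> \<Lambda>"
  have "inv k \<otimes> g \<in> \<Lambda> \<longleftrightarrow> inv k \<otimes> h \<in> \<Lambda>" if k: "k \<in> carrier G" for k
  proof
    assume "inv k \<otimes> h \<in> \<Lambda>"
    then have "(inv k \<otimes> h) \<otimes> (inv h \<otimes> g) \<in> \<Lambda>" using l subgroup.m_closed[OF assms(1)] by blast
    moreover have "(inv k \<otimes> h) \<otimes> (inv h \<otimes> g) = inv k \<otimes> g"
      using assms k by (metis inv_closed inv_solve_left m_assoc m_closed)
    ultimately show "inv k \<otimes> g \<in> \<Lambda>" by simp
  next
    assume "inv k \<otimes> g \<in> \<Lambda>"
    then have "(inv k \<otimes> g) \<otimes> inv (inv h \<otimes> g) \<in> \<Lambda>"
      using l subgroup.m_closed[OF assms(1)] subgroup.m_inv_closed[OF assms(1)] by blast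
    moreover have "(inv k \<otimes> g) \<otimes> inv (inv h \<otimes> g) = inv k \<otimes> h"
      using assms k by (simp add: inv_mult_group) (metis inv_closed inv_solve_right m_assoc m_closed)
    ultimately show "inv k \<otimes> h \<in> \<Lambda>" by simp
  qed
  then show "coset_class \<Lambda> g = coset_class \<Lambda> h" by (auto simp: coset_class_def)
qed

text \<open>The matrix coefficient of the base point in the permutation representation on the left
  cosets of \<open>\<Lambda>\<close>. Grouping by cosets turns the quadratic form into a sum of
  squares of coset sums.\<close>

lemma posdef_indicator:
  assumes "subgroup \<Lambda> G"
  shows "posdef G (\<lambda>g. if g \<in> \<Lambda> then 1 else 0)"
  unfolding posdef_def
proof (intro conjI ballI allI impI)
  fix g assume "g \<in> carrier G"
  then have "inv g \<in> \<Lambda> \<longleftrightarrow> g \<in> \<Lambda>"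
    using subgroup.m_inv_closed[OF assms, of g] subgroup.m_inv_closed[OF assms, of "inv g"] by auto
  then show "(if inv g \<in> \<Lambda> then 1 else 0) = (if g \<in> \<Lambda> then 1 else (0::real))" by simp
next
  fix F and a :: "'a \<Rightarrow> real" assume F: "finite F" "F \<subseteq> carrier G"
  let ?c = "coset_class \<Lambda>"
  have "(\<Sum>g\<in>F. \<Sum>h\<in>F. a g * a h * (if inv h \<otimes> g \<in> \<Lambda> then 1 else 0)) =
      (\<Sum>g\<in>F. a g * (\<Sum>h | h \<in> F \<and> ?c h = ?c g. a h))"
  proof (rule sum.cong[OF refl])
    fix g assume g: "g \<in> F"
    have "?c h = ?c g \<longleftrightarrow> inv h \<otimes> g \<in> \<Lambda>" if "h \<in> F" for h
      using coset_class_eq_iff[OF assms, of g h] that g F by (auto simp: subset_eq)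
    then have "(\<Sum>h\<in>F. a g * a h * (if inv h \<otimes> g \<in> \<Lambda> then 1 else 0)) =
        (\<Sum>h\<in>F. if ?c h = ?c g then a g * a h else 0)"
      by (intro sum.cong) auto
    also have "\<dots> = (\<Sum>h | h \<in> F \<and> ?c h = ?c g. a g * a h)"
      using F by (simp add: sum.inter_filter)
    finally show "(\<Sum>h\<in>F. a g * a h * (if inv h \<otimes> g \<in> \<Lambda> then 1 else 0)) =
        a g * (\<Sum>h | h \<in> F \<and> ?c h = ?c g. a h)" by (simp add: sum_distrib_left)
  qed
  also have "\<dots> = (\<Sum>C\<in>?c ` F. \<Sum>g | g \<in> F \<and> ?c g = C. a g * (\<Sum>h | h \<in> F \<and> ?c h = ?c g. a h))"
    by (rule sum.image_gen[OF F(1)])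
  also have "\<dots> = (\<Sum>C\<in>?c ` F. (\<Sum>g | g \<in> F \<and> ?c g = C. a g)\<^sup>2)"
    by (rule sum.cong[OF refl]) (simp add: sum_distrib_right power2_eq_square)
  also have "\<dots> \<ge> 0" by (intro sum_nonneg) simp
  finally show "0 \<le> (\<Sum>g\<in>F. \<Sum>h\<in>F. a g * a h * (if inv h \<otimes> g \<in> \<Lambda> then 1 else 0))" .
qed

text \<open>Given N cosets besides the subgroup itself, take the unit mass at the base coset minus
  the uniform mass on the others. This has sum zero and norm near 1, while \<open>Q\<close> fixes
  the base coset and so moves it by a defect of at most \<open>1 / real N\<close>. Large N
  contradicts the Kazhdan pair.\<close>

lemma kazhdan_set_finite_index:
  assumes kp: "kazhdan_pair G Q \<epsilon>" and Q: "Q \<subseteq> carrier G" and \<epsilon>: "\<epsilon> > 0"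
  shows "finite (coset_class (generate G Q) ` carrier G)"
proof (rule ccontr)
  define \<Lambda> where "\<Lambda> = generate G Q"
  let ?c = "coset_class \<Lambda>"
  assume "infinite (coset_class (generate G Q) ` carrier G)"
  then have inf: "infinite (?c ` carrier G - {?c \<one>})" by (simp add: \<Lambda>_def)
  have sub: "subgroup \<Lambda> G" unfolding \<Lambda>_def by (rule generate_is_subgroup[OF Q])
  \<comment> \<open>The final comparison reads
    \<open>\<epsilon>\<^sup>2 / 2 * (real N + 1) \<le> 1\<close>, which this choice
    excludes.\<close>
  obtain N :: nat where N: "2 / \<epsilon>\<^sup>2 < real N" using reals_Archimedean2 by blast
  then have N0: "N > 0" using \<epsilon> by (cases N) (auto simp: not_less field_simps)
  obtain B where B: "finite B" "card B = N" "B \<subseteq> ?c ` carrier G - {?c \<one>}"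
    using infinite_arbitrarily_large[OF inf] by blast
  then obtain R where R: "R \<subseteq> carrier G" "inj_on ?c R" "B = ?c ` R"
    using subset_image_inj[of B ?c "carrier G"] by blast
  have Rf: "finite R" "card R = N" using B R by (auto simp: finite_image_iff card_image)
  have R1: "\<one> \<notin> R" and R\<Lambda>: "\<And>h. h \<in> R \<Longrightarrow> h \<notin> \<Lambda>"
  proof -
    show "h \<notin> \<Lambda>" if "h \<in> R" for h
    proof
      assume "h \<in> \<Lambda>"
      then have "?c h = ?c \<one>" using R that by (subst coset_class_eq_iff[OF sub]) auto
      then show False using B R that by auto
    qed
    then show "\<one> \<notin> R" using subgroup.one_closed[OF sub] by blast
  qed
  define f where "f = (\<lambda>g. if g \<in> \<Lambda> then 1 else (0::real))"
  have f: "posdef G f" unfolding f_def by (rule posdef_indicator[OF sub])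
  define a where "a = (\<lambda>g. if g = \<one> then 1 else if g \<in> R then - 1 / real N else 0)"
  have supp_a: "supp a = insert \<one> R" using N0 by (auto simp: supp_def a_def)
  have aR: "a g = - 1 / real N" if "g \<in> R" for g using that R1 by (auto simp: a_def)
  have a1: "a \<one> = 1" by (simp add: a_def)
  have a: "a \<in> fsupp (carrier G)" using R Rf by (simp add: fsupp_def supp_a)
  have sum0: "(\<Sum>g\<in>supp a. a g) = 0"
    using Rf R1 N0 by (simp add: supp_a a1 aR)
  \<comment> \<open>Contributions of the base point with itself, of the two mixed kinds, and of
    \<open>R\<close> with itself. For \<open>q\<close> in \<open>\<Lambda>\<close> the mixed ones
    vanish, because \<open>R\<close> avoids the base coset.\<close>
  have split: "kform f (ltrans q a) a = f q + (\<Sum>h\<in>R. - 1 / real N * f (inv h \<otimes> q))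
      + (\<Sum>g\<in>R. - 1 / real N * f (q \<otimes> g))
      + (\<Sum>g\<in>R. \<Sum>h\<in>R. 1 / (real N)\<^sup>2 * f (inv h \<otimes> (q \<otimes> g)))"
    if q: "q \<in> carrier G" for q
  proof -
    have "kform f (ltrans q a) a = (\<Sum>g\<in>insert \<one> R. \<Sum>h\<in>insert \<one> R. a g * a h * f (inv h \<otimes> (q \<otimes> g)))"
      using R by (subst kform_ltrans_left[OF q]) (auto simp: supp_a)
    then show ?thesis
      using Rf R1 q R by (simp add: a1 aR sum.distrib power2_eq_square subset_eq)
  qed
  have Rin: "h \<in> carrier G" if "h \<in> R" for h using that R by auto
  have z: "(\<Sum>h\<in>R. - 1 / real N * f (inv h \<otimes> q)) = 0" "(\<Sum>g\<in>R. - 1 / real N * f (q \<otimes> g)) = 0"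
    if q: "q \<in> \<Lambda>" for q
  proof -
    have qG: "q \<in> carrier G" using subgroup.subset[OF sub] q by auto
    have "inv h \<otimes> q \<notin> \<Lambda>" if h: "h \<in> R" for h
    proof
      assume "inv h \<otimes> q \<in> \<Lambda>"
      then have "q \<otimes> inv (inv h \<otimes> q) \<in> \<Lambda>"
        using subgroup.m_closed[OF sub q] subgroup.m_inv_closed[OF sub] by blast
      then have "h \<in> \<Lambda>" using Rin[OF h] qG by (simp add: inv_mult_group m_assoc[symmetric])
      then show False using R\<Lambda>[OF h] by simp
    qed
    then show "(\<Sum>h\<in>R. - 1 / real N * f (inv h \<otimes> q)) = 0" by (intro sum.neutral) (auto simp: f_def)
    have "q \<otimes> g \<notin> \<Lambda>" if g: "g \<in> R" for g
    proof
      assume "q \<otimes> g \<in> \<Lambda>"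
      then have "inv q \<otimes> (q \<otimes> g) \<in> \<Lambda>"
        using subgroup.m_closed[OF sub] subgroup.m_inv_closed[OF sub q] by blast
      then have "g \<in> \<Lambda>" using Rin[OF g] qG by (simp add: m_assoc[symmetric])
      then show False using R\<Lambda>[OF g] by simp
    qed
    then show "(\<Sum>g\<in>R. - 1 / real N * f (q \<otimes> g)) = 0" by (intro sum.neutral) (auto simp: f_def)
  qed
  have self: "kform f a a = 1 + 1 / real N"
  proof -
    have "kform f a a = kform f (ltrans \<one> a) a" using R by (simp add: ltrans_one supp_a)
    also have "\<dots> = 1 + (\<Sum>g\<in>R. \<Sum>h\<in>R. 1 / (real N)\<^sup>2 * f (inv h \<otimes> (\<one> \<otimes> g)))"
      using z[OF subgroup.one_closed[OF sub]] subgroup.one_closed[OF sub]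
      by (subst split) (auto simp: f_def)
    also have "(\<Sum>g\<in>R. \<Sum>h\<in>R. 1 / (real N)\<^sup>2 * f (inv h \<otimes> (\<one> \<otimes> g))) =
        (\<Sum>g\<in>R. \<Sum>h\<in>R. if h = g then 1 / (real N)\<^sup>2 else 0)"
    proof (intro sum.cong refl)
      fix g h assume gh: "g \<in> R" "h \<in> R"
      have "inv h \<otimes> g \<in> \<Lambda> \<longleftrightarrow> h = g"
        using coset_class_eq_iff[OF sub Rin[OF gh(1)] Rin[OF gh(2)]] inj_onD[OF R(2)] gh by metis
      then show "1 / (real N)\<^sup>2 * f (inv h \<otimes> (\<one> \<otimes> g)) = (if h = g then 1 / (real N)\<^sup>2 else 0)"
        using Rin[OF gh(1)] by (simp add: f_def)
    qed
    also have "\<dots> = 1 / real N" using Rf N0 by (simp add: power2_eq_square)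
    finally show ?thesis .
  qed
  have ge1: "kform f (ltrans q a) a \<ge> 1" if "q \<in> Q" for q
  proof -
    have q: "q \<in> \<Lambda>" "q \<in> carrier G" using that Q by (auto simp: \<Lambda>_def generate.incl)
    have "(\<Sum>g\<in>R. \<Sum>h\<in>R. 1 / (real N)\<^sup>2 * f (inv h \<otimes> (q \<otimes> g))) \<ge> 0"
      by (intro sum_nonneg) (auto simp: f_def)
    then show ?thesis using split[OF q(2)] z[OF q(1)] q by (simp add: f_def)
  qed
  have apos: "kform f a a > 0" unfolding self using N0 by (intro add_pos_pos) auto
  obtain q where "q \<in> Q" "\<epsilon>\<^sup>2 / 2 * kform f a a \<le> kform f a a - kform f (ltrans q a) a"
    using kazhdan_pair_ineq[OF kp Q \<epsilon> f a sum0] apos by blast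
  then have "\<epsilon>\<^sup>2 / 2 * (1 + 1 / real N) \<le> 1 / real N" using self ge1 by force
  then have "(\<epsilon>\<^sup>2 / 2 * (1 + 1 / real N)) * real N \<le> (1 / real N) * real N"
    by (intro mult_right_mono) auto
  moreover have "(\<epsilon>\<^sup>2 / 2 * (1 + 1 / real N)) * real N = \<epsilon>\<^sup>2 / 2 * (real N + 1)"
    "(1 / real N) * real N = 1"
    using N0 by (auto simp: field_simps)
  ultimately have "\<epsilon>\<^sup>2 / 2 * (real N + 1) \<le> 1" by (simp only:)
  moreover have "\<epsilon>\<^sup>2 / 2 * real N > 1" using N \<epsilon> by (simp add: field_simps)
  moreover have "\<epsilon>\<^sup>2 / 2 * (real N + 1) = \<epsilon>\<^sup>2 / 2 * real N + \<epsilon>\<^sup>2 / 2" by (simp only: distrib_left mult_1_right)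
  moreover have "\<epsilon>\<^sup>2 / 2 \<ge> 0" by simp
  ultimately show False by linarith
qed

text \<open>\<open>Q\<close> generates a subgroup of finite index, and coset representatives
  complete it to a generating set. All terms of the sum over \<open>S\<close> are nonnegative, and
  the one for the element of \<open>Q\<close> supplied by the Kazhdan pair already dominates the
  left side.\<close>

lemma property_T_kazhdan_gap:
  assumes "property_T G"
  shows "\<exists>S \<kappa>. kazhdan_gap G S \<kappa>"
proof -
  obtain Q \<epsilon> where Q: "finite Q" "Q \<subseteq> carrier G" and \<epsilon>: "\<epsilon> > 0" and kp: "kazhdan_pair G Q \<epsilon>"
    using assms by (auto simp: property_T_def)
  let ?c = "coset_class (generate G Q)"
  have sub: "subgroup (generate G Q) G" by (rule generate_is_subgroup[OF Q(2)])
  obtain R where R: "R \<subseteq> carrier G" "finite R" "?c ` R = ?c ` carrier G"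
    using finite_subset_image[OF kazhdan_set_finite_index[OF kp Q(2) \<epsilon>] order_refl] by metis
  define S where "S = insert \<one> (Q \<union> R \<union> m_inv G ` (Q \<union> R))"
  have SG: "S \<subseteq> carrier G" using Q R by (auto simp: S_def)
  have Sf: "finite S" using Q R by (simp add: S_def)
  have "kazhdan_gap G S (\<epsilon>\<^sup>2 / 2)"
  proof
    show "finite S" "S \<subseteq> carrier G" "\<one> \<in> S" using SG Sf by (auto simp: S_def)
    show "inv s \<in> S" if "s \<in> S" for s using that Q R by (auto simp: S_def subset_eq)
    show "0 < \<epsilon>\<^sup>2 / 2" using \<epsilon> by simp
    show "generate G S = carrier G"
    proof (intro equalityI subsetI)
      fix g assume "g \<in> generate G S"
      then show "g \<in> carrier G" using generate_incl[OF SG] by auto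
    next
      fix g assume g: "g \<in> carrier G"
      then obtain r where r: "r \<in> R" "?c g = ?c r" using R(3) by (metis imageE imageI)
      have rG: "r \<in> carrier G" using r R by auto
      have "inv r \<otimes> g \<in> generate G Q"
        using coset_class_eq_iff[OF sub g rG] r by simp
      then have "inv r \<otimes> g \<in> generate G S" using mono_generate[of Q S] by (auto simp: S_def)
      moreover have "r \<in> generate G S" using r by (auto simp: S_def intro: generate.incl)
      ultimately have "r \<otimes> (inv r \<otimes> g) \<in> generate G S" by (rule generate.eng[rotated])
      then show "g \<in> generate G S" using rG g by (simp add: m_assoc[symmetric])
    qed
    fix f F and a :: "'a \<Rightarrow> real"
    assume f: "posdef G f" and F: "finite F" "F \<subseteq> carrier G" and s0: "(\<Sum>g\<in>F. a g) = 0"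
    \<comment> \<open>\<open>kform\<close> sums over the support, so \<open>a\<close> is cut off to
      \<open>F\<close>.\<close>
    define b where "b = (\<lambda>g. if g \<in> F then a g else 0)"
    have supp_b: "supp b \<subseteq> F" by (auto simp: supp_def b_def)
    then have b: "b \<in> fsupp (carrier G)" using F by (auto simp: fsupp_def intro: finite_subset)
    have b0: "(\<Sum>g\<in>supp b. b g) = 0"
    proof -
      have "(\<Sum>g\<in>supp b. b g) = (\<Sum>g\<in>F. b g)"
        by (rule sum.mono_neutral_left) (use F supp_b in \<open>auto simp: supp_def\<close>)
      then show ?thesis using s0 by (simp add: b_def)
    qed
    have bb: "kform f b b = (\<Sum>g\<in>F. \<Sum>h\<in>F. a g * a h * f (inv h \<otimes> g))"
      by (subst kform_superset[OF F(1) F(1) supp_b supp_b]) (simp add: b_def)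
    have bs: "kform f (ltrans s b) b = (\<Sum>g\<in>F. \<Sum>h\<in>F. a g * a h * f (inv h \<otimes> (s \<otimes> g)))"
      if s: "s \<in> S" for s
    proof -
      have sG: "s \<in> carrier G" using s SG by auto
      have "kform f (ltrans s b) b =
          (\<Sum>g\<in>supp b. \<Sum>h\<in>supp b. b g * b h * f (inv h \<otimes> (s \<otimes> g)))"
        using supp_b F by (intro kform_ltrans_left[OF sG]) auto
      also have "\<dots> = (\<Sum>g\<in>F. \<Sum>h\<in>supp b. b g * b h * f (inv h \<otimes> (s \<otimes> g)))"
        by (rule sum.mono_neutral_left) (use F supp_b in \<open>auto simp: supp_def\<close>)
      also have "\<dots> = (\<Sum>g\<in>F. \<Sum>h\<in>F. b g * b h * f (inv h \<otimes> (s \<otimes> g)))"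
        by (intro sum.cong refl sum.mono_neutral_left) (use F supp_b in \<open>auto simp: supp_def\<close>)
      finally show ?thesis by (simp add: b_def)
    qed
    have nn: "kform f b b - kform f (ltrans s b) b \<ge> 0" if "s \<in> S" for s
      using displacement_kform(2)[OF f b] that SG by auto
    have "\<epsilon>\<^sup>2 / 2 * kform f b b \<le> (\<Sum>s\<in>S. kform f b b - kform f (ltrans s b) b)"
    proof (cases "kform f b b > 0")
      case True
      obtain q where q: "q \<in> Q" "\<epsilon>\<^sup>2 / 2 * kform f b b \<le> kform f b b - kform f (ltrans q b) b"
        using kazhdan_pair_ineq[OF kp Q(2) \<epsilon> f b b0 True] by blast
      note q(2)
      also have "kform f b b - kform f (ltrans q b) b \<le> (\<Sum>s\<in>S. kform f b b - kform f (ltrans s b) b)"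
        using nn q(1) Sf by (intro member_le_sum) (auto simp: S_def)
      finally show ?thesis .
    next
      case False
      have "kform f b b \<ge> 0" using f F by (simp add: bb posdef_def)
      then have "kform f b b = 0" using False by simp
      then show ?thesis using nn by (simp add: sum_nonneg)
    qed
    then show "\<epsilon>\<^sup>2 / 2 * (\<Sum>g\<in>F. \<Sum>h\<in>F. a g * a h * f (inv h \<otimes> g)) \<le>
      (\<Sum>s\<in>S. \<Sum>g\<in>F. \<Sum>h\<in>F. a g * a h * (f (inv h \<otimes> g) - f (inv h \<otimes> (s \<otimes> g))))"
      by (simp add: bb bs right_diff_distrib sum_subtractf cong: sum.cong)
  qed
  then show ?thesis by blast
qed

end

section \<open>Unitary matrices and local representations\<close>

lemma mat_adjoint_dim [simp]: "dim_row (mat_adjoint A) = dim_col A" "dim_col (mat_adjoint A) = dim_row A"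
  by (auto simp: mat_adjoint_def)

lemma mat_adjoint_index [simp]:
  "i < dim_col A \<Longrightarrow> j < dim_row A \<Longrightarrow> mat_adjoint A $$ (i, j) = cnj (A $$ (j, i))"
  for A :: "complex mat"
  by (simp add: mat_adjoint_def mat_of_rows_index)

lemma mat_adjoint_carrier [intro, simp]: "A \<in> carrier_mat m n \<Longrightarrow> mat_adjoint A \<in> carrier_mat n m"
  by (rule carrier_matI) simp_all

lemma mult_mat_index:
  assumes "A \<in> carrier_mat m n" "B \<in> carrier_mat n p" "i < m" "j < p"
  shows "(A * B) $$ (i, j) = (\<Sum>k<n. A $$ (i, k) * B $$ (k, j))"
  using assms by (auto simp: scalar_prod_def atLeast0LessThan intro!: sum.cong)

lemma mat_adjoint_adjoint [simp]: "mat_adjoint (mat_adjoint A) = A" for A :: "complex mat"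
  by (rule eq_matI) auto

lemma mat_adjoint_mult:
  fixes A :: "complex mat"
  assumes A: "A \<in> carrier_mat m n" and B: "B \<in> carrier_mat n p"
  shows "mat_adjoint (A * B) = mat_adjoint B * mat_adjoint A"
proof (rule eq_matI)
  show "dim_row (mat_adjoint (A * B)) = dim_row (mat_adjoint B * mat_adjoint A)"
    "dim_col (mat_adjoint (A * B)) = dim_col (mat_adjoint B * mat_adjoint A)" using A B by auto
  fix i j assume "i < dim_row (mat_adjoint B * mat_adjoint A)" "j < dim_col (mat_adjoint B * mat_adjoint A)"
  then have ij: "i < p" "j < m" using A B by auto
  have "mat_adjoint (A * B) $$ (i, j) = cnj ((A * B) $$ (j, i))"
    by (rule mat_adjoint_index) (use A B ij in auto)
  also have "\<dots> = (\<Sum>k<n. cnj (B $$ (k, i)) * cnj (A $$ (j, k)))"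
    unfolding mult_mat_index[OF A B ij(2,1)] by (simp add: mult.commute)
  also have "\<dots> = (\<Sum>k<n. mat_adjoint B $$ (i, k) * mat_adjoint A $$ (k, j))"
    using A B ij by (intro sum.cong refl) auto
  also have "\<dots> = (mat_adjoint B * mat_adjoint A) $$ (i, j)"
    using ij by (intro mult_mat_index[symmetric]) (use A B in auto)
  finally show "mat_adjoint (A * B) $$ (i, j) = (mat_adjoint B * mat_adjoint A) $$ (i, j)" .
qed

lemma mat_adjoint_one [simp]: "mat_adjoint (1\<^sub>m n) = (1\<^sub>m n :: complex mat)"
  by (rule eq_matI) auto

lemma unitary_group_simps:
  "carrier (unitary_group k) = {u \<in> carrier_mat k k. mat_adjoint u * u = 1\<^sub>m k \<and> u * mat_adjoint u = 1\<^sub>m k}"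
  "mult (unitary_group k) = (*)" "one (unitary_group k) = 1\<^sub>m k"
  by (simp_all add: unitary_group_def)

lemma unitaryD:
  assumes "u \<in> carrier (unitary_group k)"
  shows "u \<in> carrier_mat k k" "mat_adjoint u * u = 1\<^sub>m k" "u * mat_adjoint u = 1\<^sub>m k"
    "mat_adjoint u \<in> carrier_mat k k"
  using assms by (auto simp: unitary_group_simps)

lemma unitaryI:
  assumes "u \<in> carrier_mat k k" "mat_adjoint u * u = 1\<^sub>m k"
  shows "u \<in> carrier (unitary_group k)"
  using assms mat_mult_left_right_inverse[of "mat_adjoint u" k u] by (auto simp: unitary_group_simps)

lemma unitary_adjoint: "u \<in> carrier (unitary_group k) \<Longrightarrow> mat_adjoint u \<in> carrier (unitary_group k)"
  by (auto simp: unitary_group_simps)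

lemma unitary_cancel:
  assumes "u \<in> carrier (unitary_group k)"
  shows "X \<in> carrier_mat k p \<Longrightarrow> mat_adjoint u * (u * X) = X"
    "X \<in> carrier_mat k p \<Longrightarrow> u * (mat_adjoint u * X) = X"
    "X \<in> carrier_mat p k \<Longrightarrow> X * u * mat_adjoint u = X"
    "X \<in> carrier_mat p k \<Longrightarrow> X * mat_adjoint u * u = X"
proof -
  note u = unitaryD[OF assms]
  show "mat_adjoint u * (u * X) = X" if "X \<in> carrier_mat k p"
    unfolding assoc_mult_mat[OF u(4) u(1) that, symmetric] u(2) using that by simp
  show "u * (mat_adjoint u * X) = X" if "X \<in> carrier_mat k p"
    unfolding assoc_mult_mat[OF u(1) u(4) that, symmetric] u(3) using that by simp
  show "X * u * mat_adjoint u = X" if "X \<in> carrier_mat p k"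
    unfolding assoc_mult_mat[OF that u(1) u(4)] u(3) using that by simp
  show "X * mat_adjoint u * u = X" if "X \<in> carrier_mat p k"
    unfolding assoc_mult_mat[OF that u(4) u(1)] u(2) using that by simp
qed

lemma unitary_mult:
  assumes "u \<in> carrier (unitary_group k)" "v \<in> carrier (unitary_group k)"
  shows "u * v \<in> carrier (unitary_group k)"
proof (rule unitaryI)
  note u = unitaryD[OF assms(1)] and v = unitaryD[OF assms(2)]
  show "u * v \<in> carrier_mat k k" using u v by auto
  have "mat_adjoint (u * v) * (u * v) = mat_adjoint v * (mat_adjoint u * (u * v))"
    using u v by (simp add: mat_adjoint_mult[OF u(1) v(1)] assoc_mult_mat[of _ k k _ k _ k])
  then show "mat_adjoint (u * v) * (u * v) = 1\<^sub>m k"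
    by (simp add: unitary_cancel[OF assms(1) v(1)] v)
qed

lemma unitary_group_is_group: "group (unitary_group k)"
proof (rule groupI)
  fix x y z
  assume "x \<in> carrier (unitary_group k)" "y \<in> carrier (unitary_group k)" "z \<in> carrier (unitary_group k)"
  note x = unitaryD[OF this(1)] and y = unitaryD[OF this(2)] and z = unitaryD[OF this(3)]
  show "x \<otimes>\<^bsub>unitary_group k\<^esub> y \<otimes>\<^bsub>unitary_group k\<^esub> z = x \<otimes>\<^bsub>unitary_group k\<^esub> (y \<otimes>\<^bsub>unitary_group k\<^esub> z)"
    using assoc_mult_mat[OF x(1) y(1) z(1)] by (simp add: unitary_group_simps)
next
  fix x assume x: "x \<in> carrier (unitary_group k)"
  show "\<exists>y\<in>carrier (unitary_group k). y \<otimes>\<^bsub>unitary_group k\<^esub> x = \<one>\<^bsub>unitary_group k\<^esub>"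
    using unitary_adjoint[OF x] unitaryD[OF x] by (auto simp: unitary_group_simps)
next
  fix x y assume "x \<in> carrier (unitary_group k)" "y \<in> carrier (unitary_group k)"
  then show "x \<otimes>\<^bsub>unitary_group k\<^esub> y \<in> carrier (unitary_group k)"
    using unitary_mult by (simp add: unitary_group_simps(2))
qed (auto simp: unitary_group_simps)

lemma inv_unitary_group:
  assumes "u \<in> carrier (unitary_group k)"
  shows "inv\<^bsub>unitary_group k\<^esub> u = mat_adjoint u"
  using unitary_adjoint[OF assms] unitaryD[OF assms] assms
  by (intro group.inv_equality[OF unitary_group_is_group]) (simp_all add: unitary_group_simps(2,3))

text \<open>Unnormalized, in contrast to \<open>hs_norm\<close>: bounded defects are to be weighed
  against the dimension itself.\<close>

definition hsip :: "complex mat \<Rightarrow> complex mat \<Rightarrow> complex" where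
  "hsip X Y = (\<Sum>i<dim_row X. \<Sum>j<dim_col X. X $$ (i, j) * cnj (Y $$ (i, j)))"

definition hs2 :: "complex mat \<Rightarrow> real" where
  "hs2 X = (\<Sum>i<dim_row X. \<Sum>j<dim_col X. (cmod (X $$ (i, j)))\<^sup>2)"

lemma hsip_self: "hsip X X = complex_of_real (hs2 X)"
  by (simp add: hsip_def hs2_def complex_norm_square del: of_real_power)

lemma hs2_nonneg: "0 \<le> hs2 X"
  by (simp add: hs2_def sum_nonneg)

lemma hs2_eq_0:
  assumes "X \<in> carrier_mat m n" "hs2 X = 0"
  shows "X = 0\<^sub>m m n"
proof (rule eq_matI)
  fix i j assume "i < dim_row (0\<^sub>m m n)" "j < dim_col (0\<^sub>m m n)"
  then have ij: "i < m" "j < n" by auto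
  have "\<forall>i<m. (\<Sum>j<n. (cmod (X $$ (i, j)))\<^sup>2) = 0"
    using assms by (simp add: hs2_def sum_nonneg_eq_0_iff sum_nonneg)
  then have "\<forall>j<n. (cmod (X $$ (i, j)))\<^sup>2 = 0" using ij by (simp add: sum_nonneg_eq_0_iff)
  then show "X $$ (i, j) = 0\<^sub>m m n $$ (i, j)" using ij by simp
qed (use assms in auto)

lemma hsip_mult_left:
  assumes A: "A \<in> carrier_mat m n" and X: "X \<in> carrier_mat n p" and Y: "Y \<in> carrier_mat m p"
  shows "hsip (A * X) Y = hsip X (mat_adjoint A * Y)"
proof -
  have "hsip (A * X) Y = (\<Sum>i<m. \<Sum>j<p. \<Sum>k<n. A $$ (i, k) * X $$ (k, j) * cnj (Y $$ (i, j)))"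
    unfolding hsip_def using A X
    by (auto simp: mult_mat_index[OF A X] sum_distrib_right simp del: index_mult_mat(1) intro!: sum.cong)
  also have "\<dots> = (\<Sum>i<m. \<Sum>k<n. \<Sum>j<p. A $$ (i, k) * X $$ (k, j) * cnj (Y $$ (i, j)))"
    by (intro sum.cong refl sum.swap)
  also have "\<dots> = (\<Sum>k<n. \<Sum>i<m. \<Sum>j<p. A $$ (i, k) * X $$ (k, j) * cnj (Y $$ (i, j)))"
    by (rule sum.swap)
  also have "\<dots> = (\<Sum>k<n. \<Sum>j<p. \<Sum>i<m. A $$ (i, k) * X $$ (k, j) * cnj (Y $$ (i, j)))"
    by (intro sum.cong refl sum.swap)
  also have "\<dots> = hsip X (mat_adjoint A * Y)"
    unfolding hsip_def using A X
    by (auto simp: mult_mat_index[OF mat_adjoint_carrier[OF A] Y] sum_distrib_left cnj_sum mult_ac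
        simp del: index_mult_mat(1) intro!: sum.cong)
  finally show ?thesis .
qed

lemma hsip_mult_right:
  assumes X: "X \<in> carrier_mat m n" and A: "A \<in> carrier_mat n p" and Y: "Y \<in> carrier_mat m p"
  shows "hsip (X * A) Y = hsip X (Y * mat_adjoint A)"
proof -
  have "hsip (X * A) Y = (\<Sum>i<m. \<Sum>j<p. \<Sum>k<n. X $$ (i, k) * A $$ (k, j) * cnj (Y $$ (i, j)))"
    unfolding hsip_def using A X
    by (auto simp: mult_mat_index[OF X A] sum_distrib_right simp del: index_mult_mat(1) intro!: sum.cong)
  also have "\<dots> = (\<Sum>i<m. \<Sum>k<n. \<Sum>j<p. X $$ (i, k) * A $$ (k, j) * cnj (Y $$ (i, j)))"
    by (intro sum.cong refl sum.swap)
  also have "\<dots> = hsip X (Y * mat_adjoint A)"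
    unfolding hsip_def using A X
    by (auto simp: mult_mat_index[OF Y mat_adjoint_carrier[OF A]] sum_distrib_left cnj_sum mult_ac
        simp del: index_mult_mat(1) intro!: sum.cong)
  finally show ?thesis .
qed

lemma hs2_unitary_left:
  assumes "u \<in> carrier (unitary_group m)" "X \<in> carrier_mat m n"
  shows "hs2 (u * X) = hs2 X"
proof -
  note u = unitaryD[OF assms(1)]
  have "hsip (u * X) (u * X) = hsip X X"
    using u assms(2) unitary_cancel(1)[OF assms] by (simp add: hsip_mult_left[of u m m X n])
  then show ?thesis by (simp add: hsip_self)
qed

lemma hs2_unitary_right:
  assumes "u \<in> carrier (unitary_group n)" "X \<in> carrier_mat m n"
  shows "hs2 (X * u) = hs2 X"
proof -
  note u = unitaryD[OF assms(1)]
  have "hsip (X * u) (X * u) = hsip X X"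
    using u assms(2) unitary_cancel(3)[OF assms] by (simp add: hsip_mult_right[of X m n u n])
  then show ?thesis by (simp add: hsip_self)
qed

text \<open>Matrices of a given size are handled as functions on index pairs, of which only the
  entries below \<open>m\<close> and \<open>n\<close> count. Functions vanishing there are null
  vectors, which a semidefinite form tolerates.\<close>

definition fip :: "nat \<Rightarrow> nat \<Rightarrow> (nat \<times> nat \<Rightarrow> complex) \<Rightarrow> (nat \<times> nat \<Rightarrow> complex) \<Rightarrow> real" where
  "fip m n x y = Re (\<Sum>i<m. \<Sum>j<n. x (i, j) * cnj (y (i, j)))"

lemma semi_ip_fip: "semi_ip UNIV (fip m n)"
proof
  show "fip m n x y = fip m n y x" for x y
    by (simp add: fip_def algebra_simps)
  show "0 \<le> fip m n x x" for x
    by (auto simp: fip_def intro!: sum_nonneg add_nonneg_nonneg)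
qed (auto simp: fip_def sum.distrib algebra_simps sum_distrib_left scaleR_conv_of_real)

lemma fip_mat: "X \<in> carrier_mat m n \<Longrightarrow> fip m n (\<lambda>p. X $$ p) (\<lambda>p. Y $$ p) = Re (hsip X Y)"
  by (simp add: fip_def hsip_def)

definition hsn :: "complex mat \<Rightarrow> real" where "hsn X = sqrt (hs2 X)"

lemma hsn_nonneg: "0 \<le> hsn X"
  by (simp add: hsn_def hs2_nonneg)

lemma hsn_sq: "(hsn X)\<^sup>2 = hs2 X"
  by (simp add: hsn_def hs2_nonneg)

lemma hsn_fip: "X \<in> carrier_mat m n \<Longrightarrow> hsn X = sqrt (fip m n (\<lambda>p. X $$ p) (\<lambda>p. X $$ p))"
  by (simp add: fip_mat hsip_self hsn_def)

lemma fip_cong: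
  assumes "\<And>i j. i < m \<Longrightarrow> j < n \<Longrightarrow> x (i, j) = x' (i, j)" "\<And>i j. i < m \<Longrightarrow> j < n \<Longrightarrow> y (i, j) = y' (i, j)"
  shows "fip m n x y = fip m n x' y'"
  unfolding fip_def by (intro arg_cong[of _ _ Re] sum.cong refl) (simp add: assms)

lemma hsn_triangle:
  assumes "X \<in> carrier_mat m n" "Y \<in> carrier_mat m n" "Z \<in> carrier_mat m n"
  shows "hsn (X - Z) \<le> hsn (X - Y) + hsn (Y - Z)"
proof -
  interpret semi_ip UNIV "fip m n" by (rule semi_ip_fip)
  have eq: "hsn (A - B) = nrm ((\<lambda>p. A $$ p) - (\<lambda>p. B $$ p))"
    if "A \<in> carrier_mat m n" "B \<in> carrier_mat m n" for A B
    using that by (subst hsn_fip[of _ m n]) (auto simp: nrm_def intro!: fip_cong)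
  show ?thesis using assms by (simp only: eq nrm_triangle_diff[OF UNIV_I UNIV_I UNIV_I])
qed

lemma hs2_minus_commute: "X \<in> carrier_mat m n \<Longrightarrow> Y \<in> carrier_mat m n \<Longrightarrow> hs2 (X - Y) = hs2 (Y - X)"
  by (auto simp: hs2_def norm_minus_commute intro!: sum.cong)

lemma hsn_minus_commute: "X \<in> carrier_mat m n \<Longrightarrow> Y \<in> carrier_mat m n \<Longrightarrow> hsn (X - Y) = hsn (Y - X)"
  by (simp add: hsn_def hs2_minus_commute)

lemma hsn_mult_unitary_diff:
  assumes "u \<in> carrier (unitary_group m)" "X \<in> carrier_mat m n" "Y \<in> carrier_mat m n"
  shows "hsn (u * X - u * Y) = hsn (X - Y)"
proof -
  have "u * X - u * Y = u * (X - Y)"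
    using mult_minus_distrib_mat[of u m m X n Y] unitaryD[OF assms(1)] assms by simp
  then show ?thesis
    using hs2_unitary_left[OF assms(1) minus_carrier_mat[OF assms(3)], of X] by (simp add: hsn_def)
qed

lemma hsn_mult_unitary_diff_right:
  assumes "u \<in> carrier (unitary_group n)" "X \<in> carrier_mat m n" "Y \<in> carrier_mat m n"
  shows "hsn (X * u - Y * u) = hsn (X - Y)"
proof -
  have "X * u - Y * u = (X - Y) * u"
    using minus_mult_distrib_mat[of X m n Y u n] unitaryD[OF assms(1)] assms by simp
  then show ?thesis
    using hs2_unitary_right[OF assms(1) minus_carrier_mat[OF assms(3)], of X] by (simp add: hsn_def)
qed

lemma mat_trace_eq: "A \<in> carrier_mat n n \<Longrightarrow> mat_trace A = (\<Sum>i<n. A $$ (i, i))"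
  by (auto simp: mat_trace_def diag_mat_def interv_sum_list_conv_sum_set_nat atLeast0LessThan)

lemma mat_trace_mult:
  assumes "A \<in> carrier_mat m n" "B \<in> carrier_mat n m"
  shows "mat_trace (A * B) = (\<Sum>i<m. \<Sum>k<n. A $$ (i, k) * B $$ (k, i))"
  using assms
  by (subst mat_trace_eq[of _ m]) (auto simp: mult_mat_index[OF assms] simp del: index_mult_mat(1))

lemma mat_trace_commute:
  assumes "A \<in> carrier_mat m n" "B \<in> carrier_mat n m"
  shows "mat_trace (A * B) = mat_trace (B * A)"
  unfolding mat_trace_mult[OF assms] mat_trace_mult[OF assms(2,1)]
  by (subst sum.swap) (simp add: mult.commute)

lemma hsip_trace:
  assumes "X \<in> carrier_mat m n" "Y \<in> carrier_mat m n"
  shows "hsip X Y = mat_trace (mat_adjoint Y * X)"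
proof -
  have "mat_trace (mat_adjoint Y * X) = (\<Sum>i<n. \<Sum>k<m. mat_adjoint Y $$ (i, k) * X $$ (k, i))"
    by (rule mat_trace_mult) (use assms in auto)
  also have "\<dots> = (\<Sum>k<m. \<Sum>i<n. X $$ (k, i) * cnj (Y $$ (k, i)))"
    using assms by (subst sum.swap) (auto simp: mult.commute intro!: sum.cong)
  finally show ?thesis using assms by (simp add: hsip_def)
qed

lemma hs_norm_eq: "x \<in> carrier_mat k k \<Longrightarrow> hs_norm k x = hsn x / sqrt (real k)"
  by (simp add: hs_norm_def hsip_trace[symmetric] hsip_self hsn_def real_sqrt_divide)

lemma hs_dist_eq: "u \<in> carrier_mat k k \<Longrightarrow> v \<in> carrier_mat k k \<Longrightarrow> hs_dist k u v = hsn (u - v) / sqrt (real k)"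
  using hs_norm_eq[OF minus_carrier_mat[of v k k u]] by (simp add: hs_dist_def)

section \<open>Words in the generators and local representations\<close>

definition wd :: "('b, 'm) monoid_scheme \<Rightarrow> ('s \<Rightarrow> 'b) \<Rightarrow> 's list \<Rightarrow> 'b" where
  "wd M \<tau> w = foldr (\<lambda>s x. \<tau> s \<otimes>\<^bsub>M\<^esub> x) w \<one>\<^bsub>M\<^esub>"

lemma wd_Nil [simp]: "wd M \<tau> [] = \<one>\<^bsub>M\<^esub>"
  and wd_Cons [simp]: "wd M \<tau> (s # w) = \<tau> s \<otimes>\<^bsub>M\<^esub> wd M \<tau> w"
  by (simp_all add: wd_def)

lemma (in monoid) wd_closed: "(\<And>s. s \<in> set w \<Longrightarrow> \<tau> s \<in> carrier G) \<Longrightarrow> wd G \<tau> w \<in> carrier G"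
  by (induction w) auto

lemma (in monoid) wd_append:
  "(\<And>s. s \<in> set u \<union> set v \<Longrightarrow> \<tau> s \<in> carrier G) \<Longrightarrow> wd G \<tau> (u @ v) = wd G \<tau> u \<otimes> wd G \<tau> v"
  by (induction u) (auto simp: wd_closed m_assoc)

context kazhdan_gap
begin

abbreviation val :: "'a list \<Rightarrow> 'a" where "val w \<equiv> wd G (\<lambda>s. s) w"

definition winv :: "'a list \<Rightarrow> 'a list" where "winv w = rev (map (m_inv G) w)"

text \<open>A partial homomorphism provides exactly this kind of information at a single late index;
  it does not imply a homomorphism defined on the whole group.\<close>

definition local_rep :: "nat \<Rightarrow> ('c, 'm) monoid_scheme \<Rightarrow> ('a \<Rightarrow> 'c) \<Rightarrow> bool" where
  "local_rep R M \<tau> \<longleftrightarrow> (\<forall>s\<in>S. \<tau> s \<in> carrier M) \<and>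
     (\<forall>w. set w \<subseteq> S \<and> length w \<le> R \<and> val w = \<one> \<longrightarrow> wd M \<tau> w = \<one>\<^bsub>M\<^esub>)"

definition wordof :: "'a \<Rightarrow> 'a list" where
  "wordof g = (SOME w. set w \<subseteq> S \<and> val w = g)"

text \<open>Extension to all group elements through one fixed word for each. It is multiplicative on
  a given pair once \<open>R\<close> is large against the words involved. That threshold depends on
  the pair, but neither on the target group nor on \<open>\<tau>\<close>, which makes limits over
  varying dimensions possible.\<close>

definition ext :: "('c, 'm) monoid_scheme \<Rightarrow> ('a \<Rightarrow> 'c) \<Rightarrow> 'a \<Rightarrow> 'c" where
  "ext M \<tau> g = wd M \<tau> (wordof g)"

lemma val_closed: "set w \<subseteq> S \<Longrightarrow> val w \<in> carrier G"
  using S_carrier by (intro wd_closed) auto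

lemma val_append: "set u \<subseteq> S \<Longrightarrow> set v \<subseteq> S \<Longrightarrow> val (u @ v) = val u \<otimes> val v"
  using S_carrier by (intro wd_append) auto

lemma winv_props:
  "set w \<subseteq> S \<Longrightarrow> set (winv w) \<subseteq> S \<and> length (winv w) = length w \<and> val (winv w) = inv (val w)"
proof (induction w)
  case (Cons s w)
  then have s: "s \<in> S" "s \<in> carrier G" "set w \<subseteq> S" using S_carrier by auto
  have eq: "winv (s # w) = winv w @ [inv s]" by (simp add: winv_def)
  have "val (winv (s # w)) = inv (val w) \<otimes> inv s"
    unfolding eq using Cons.IH[OF s(3)] S_inv[OF s(1)] s(2) by (subst val_append) auto
  also have "\<dots> = inv (val (s # w))" using val_closed[OF s(3)] s(2) by (simp add: inv_mult_group)
  finally show ?case using Cons.IH[OF s(3)] S_inv[OF s(1)] by (simp add: eq)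
qed (simp add: winv_def)

lemma exists_word: "g \<in> carrier G \<Longrightarrow> \<exists>w. set w \<subseteq> S \<and> val w = g"
proof -
  assume "g \<in> carrier G"
  then have "g \<in> generate G S" using S_generate by simp
  then show ?thesis
  proof (induction rule: generate.induct)
    case one
    show ?case by (rule exI[of _ "[]"]) simp
  next
    case (incl s)
    then show ?case using S_carrier by (intro exI[of _ "[s]"]) auto
  next
    case (inv s)
    then show ?case using S_carrier S_inv[OF inv] by (intro exI[of _ "[inv s]"]) auto
  next
    case (eng g h)
    then obtain u v where "set u \<subseteq> S" "val u = g" "set v \<subseteq> S" "val v = h" by auto
    then show ?case by (intro exI[of _ "u @ v"]) (simp add: val_append)
  qed
qed

lemma wordof: "g \<in> carrier G \<Longrightarrow> set (wordof g) \<subseteq> S" "g \<in> carrier G \<Longrightarrow> val (wordof g) = g"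
  using someI_ex[OF exists_word, of g] by (auto simp: wordof_def)

lemma local_rep_mono: "local_rep R M \<tau> \<Longrightarrow> R' \<le> R \<Longrightarrow> local_rep R' M \<tau>"
  by (auto simp: local_rep_def)

lemma local_rep_closed: "local_rep R M \<tau> \<Longrightarrow> s \<in> S \<Longrightarrow> \<tau> s \<in> carrier M"
  by (simp add: local_rep_def)

lemma local_wd_closed:
  assumes "group M" "local_rep R M \<tau>" "set w \<subseteq> S" shows "wd M \<tau> w \<in> carrier M"
  using assms by (intro monoid.wd_closed) (auto simp: local_rep_def group_def)

lemma local_wd_append:
  assumes "group M" "local_rep R M \<tau>" "set u \<subseteq> S" "set v \<subseteq> S"
  shows "wd M \<tau> (u @ v) = wd M \<tau> u \<otimes>\<^bsub>M\<^esub> wd M \<tau> v"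
  using assms by (intro monoid.wd_append) (auto simp: local_rep_def group_def)

lemma local_inv:
  assumes "group M" "local_rep R M \<tau>" "R \<ge> 2" "s \<in> S"
  shows "\<tau> (inv s) = inv\<^bsub>M\<^esub> (\<tau> s)"
proof -
  interpret M: group M by fact
  have c: "\<tau> s \<in> carrier M" "\<tau> (inv s) \<in> carrier M"
    using assms S_inv by (auto simp: local_rep_def)
  have "s \<in> carrier G" using assms S_carrier by auto
  then have "wd M \<tau> [inv s, s] = \<one>\<^bsub>M\<^esub>"
    using assms S_inv by (auto simp: local_rep_def simp del: wd_Cons intro!: assms(2)[unfolded local_rep_def, THEN conjunct2, rule_format]) simp
  then have "\<tau> (inv s) \<otimes>\<^bsub>M\<^esub> \<tau> s = \<one>\<^bsub>M\<^esub>" using c by simp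
  then show ?thesis using c by (metis M.inv_equality)
qed

lemma local_wd_winv:
  assumes "group M" "local_rep R M \<tau>" "R \<ge> 2" "set w \<subseteq> S"
  shows "wd M \<tau> (winv w) = inv\<^bsub>M\<^esub> (wd M \<tau> w)"
  using assms(4)
proof (induction w)
  case Nil
  interpret M: group M by fact
  show ?case by (simp add: winv_def)
next
  case (Cons s w)
  interpret M: group M by fact
  have s: "s \<in> S" "set w \<subseteq> S" using Cons by auto
  have c: "\<tau> s \<in> carrier M" "wd M \<tau> w \<in> carrier M"
    using local_rep_closed[OF assms(2) s(1)] local_wd_closed[OF assms(1,2) s(2)] by auto
  have "wd M \<tau> (winv (s # w)) = wd M \<tau> (winv w @ [inv s])" by (simp add: winv_def)
  also have "\<dots> = wd M \<tau> (winv w) \<otimes>\<^bsub>M\<^esub> wd M \<tau> [inv s]"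
    using winv_props[OF s(2)] S_inv[OF s(1)] by (intro local_wd_append[OF assms(1,2)]) auto
  also have "\<dots> = inv\<^bsub>M\<^esub> (wd M \<tau> (s # w))"
    using Cons.IH[OF s(2)] c by (simp add: local_inv[OF assms(1-3) s(1)] M.inv_mult_group)
  finally show ?case .
qed

text \<open>The relator condition is applied to \<open>u\<close> followed by the formal inverse of
  \<open>v\<close>. The bound 2 on \<open>R\<close> makes \<open>\<tau>\<close> respect inverses of
  generators.\<close>

lemma local_wd_eq:
  assumes "group M" "local_rep R M \<tau>" "R \<ge> 2" "set u \<subseteq> S" "set v \<subseteq> S" "val u = val v"
    "length u + length v \<le> R"
  shows "wd M \<tau> u = wd M \<tau> v"
proof -
  interpret M: group M by fact
  have c: "wd M \<tau> u \<in> carrier M" "wd M \<tau> v \<in> carrier M"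
    using assms by (auto intro: local_wd_closed)
  have "wd M \<tau> (u @ winv v) = \<one>\<^bsub>M\<^esub>"
    using assms(2) winv_props[OF assms(5)] assms val_closed[OF assms(5)]
    by (auto simp: local_rep_def val_append)
  then have "wd M \<tau> u \<otimes>\<^bsub>M\<^esub> inv\<^bsub>M\<^esub> (wd M \<tau> v) = \<one>\<^bsub>M\<^esub>"
    using winv_props[OF assms(5)] assms
    by (simp add: local_wd_append[OF assms(1,2)] local_wd_winv[OF assms(1-3)])
  then show ?thesis using c by (metis M.inv_closed M.inv_equality M.inv_inv)
qed

lemma ext_closed: "group M \<Longrightarrow> local_rep R M \<tau> \<Longrightarrow> g \<in> carrier G \<Longrightarrow> ext M \<tau> g \<in> carrier M"
  unfolding ext_def using wordof by (intro local_wd_closed) auto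

lemma ext_mult:
  assumes "g \<in> carrier G" "h \<in> carrier G"
  obtains R0 where "\<And>R (M :: ('c, 'm) monoid_scheme) \<tau>. R \<ge> R0 \<Longrightarrow> group M \<Longrightarrow> local_rep R M \<tau> \<Longrightarrow>
      ext M \<tau> (g \<otimes> h) = ext M \<tau> g \<otimes>\<^bsub>M\<^esub> ext M \<tau> h"
proof
  fix R and M :: "('c, 'm) monoid_scheme" and \<tau>
  assume R: "R \<ge> 2 + length (wordof (g \<otimes> h)) + length (wordof g) + length (wordof h)"
    and M: "group M" and l: "local_rep R M \<tau>"
  have "wd M \<tau> (wordof (g \<otimes> h)) = wd M \<tau> (wordof g @ wordof h)"
    using assms R by (intro local_wd_eq[OF M l]) (auto simp: wordof val_append subsetD[OF wordof(1)])
  then show "ext M \<tau> (g \<otimes> h) = ext M \<tau> g \<otimes>\<^bsub>M\<^esub> ext M \<tau> h"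
    using assms by (simp add: ext_def local_wd_append[OF M l] wordof)
qed

lemma ext_inv:
  assumes "g \<in> carrier G"
  obtains R0 where "\<And>R (M :: ('c, 'm) monoid_scheme) \<tau>. R \<ge> R0 \<Longrightarrow> group M \<Longrightarrow> local_rep R M \<tau> \<Longrightarrow>
      ext M \<tau> (inv g) = inv\<^bsub>M\<^esub> (ext M \<tau> g)"
proof
  fix R and M :: "('c, 'm) monoid_scheme" and \<tau>
  assume R: "R \<ge> 2 + length (wordof (inv g)) + length (wordof g)"
    and M: "group M" and l: "local_rep R M \<tau>"
  have "wd M \<tau> (wordof (inv g)) = wd M \<tau> (winv (wordof g))"
    using assms R winv_props[OF wordof(1)[OF assms]]
    by (intro local_wd_eq[OF M l]) (auto simp: wordof subsetD[OF wordof(1)])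
  then show "ext M \<tau> (inv g) = inv\<^bsub>M\<^esub> (ext M \<tau> g)"
    using assms R by (simp add: ext_def local_wd_winv[OF M l] wordof)
qed

lemma ext_generator:
  obtains R0 where "\<And>R (M :: ('c, 'm) monoid_scheme) \<tau> s. R \<ge> R0 \<Longrightarrow> group M \<Longrightarrow> local_rep R M \<tau> \<Longrightarrow>
      s \<in> S \<Longrightarrow> ext M \<tau> s = \<tau> s"
proof
  fix R s and M :: "('c, 'm) monoid_scheme" and \<tau>
  assume R: "R \<ge> 3 + (\<Sum>s\<in>S. length (wordof s))"
    and M: "group M" and l: "local_rep R M \<tau>" and s: "s \<in> S"
  interpret M: group M by fact
  have sG: "s \<in> carrier G" using s S_carrier by auto
  have "length (wordof s) \<le> (\<Sum>s\<in>S. length (wordof s))"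
    using s S_finite by (intro member_le_sum) auto
  then have "wd M \<tau> (wordof s) = wd M \<tau> [s]"
    using R s sG by (intro local_wd_eq[OF M l]) (auto simp: wordof subsetD[OF wordof(1)])
  then show "ext M \<tau> s = \<tau> s" using local_rep_closed[OF l s] by (simp add: ext_def)
qed

end

section \<open>Almost intertwiners are near intertwiners\<close>

lemma conj_carrier [simp]:
  assumes "u \<in> carrier (unitary_group m)" "v \<in> carrier (unitary_group n)" "X \<in> carrier_mat m n"
  shows "u * X * mat_adjoint v \<in> carrier_mat m n"
  using unitaryD(1)[OF assms(1)] unitaryD(4)[OF assms(2)] assms(3) by (metis mult_carrier_mat)

lemma hsip_conj_adjoint:
  assumes u: "u \<in> carrier (unitary_group m)" and v: "v \<in> carrier (unitary_group n)"
    and X: "X \<in> carrier_mat m n" and Y: "Y \<in> carrier_mat m n"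
  shows "hsip (u * X * mat_adjoint v) Y = hsip X (mat_adjoint u * Y * v)"
proof -
  note u' = unitaryD[OF u] and v' = unitaryD[OF v]
  have uX: "u * X \<in> carrier_mat m n" and Yv: "Y * v \<in> carrier_mat m n"
    using u'(1) v'(1) X Y by (metis mult_carrier_mat)+
  have "hsip (u * X * mat_adjoint v) Y = hsip (u * X) (Y * mat_adjoint (mat_adjoint v))"
    by (rule hsip_mult_right[OF uX v'(4) Y])
  also have "\<dots> = hsip (u * X) (Y * v)" by (simp only: mat_adjoint_adjoint)
  also have "\<dots> = hsip X (mat_adjoint u * (Y * v))" by (rule hsip_mult_left[OF u'(1) X Yv])
  also have "mat_adjoint u * (Y * v) = mat_adjoint u * Y * v"
    by (rule assoc_mult_mat[OF u'(4) Y v'(1), symmetric])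
  finally show ?thesis .
qed

lemma hsip_conj:
  assumes u: "u \<in> carrier (unitary_group m)" and v: "v \<in> carrier (unitary_group n)"
    and X: "X \<in> carrier_mat m n" and Y: "Y \<in> carrier_mat m n"
  shows "hsip (u * X * mat_adjoint v) (u * Y * mat_adjoint v) = hsip X Y"
proof -
  note u' = unitaryD[OF u] and v' = unitaryD[OF v]
  have uY: "u * Y \<in> carrier_mat m n" and Yv: "Y * mat_adjoint v \<in> carrier_mat m n"
    using u'(1) v'(4) Y by (metis mult_carrier_mat)+
  have "mat_adjoint u * (u * Y * mat_adjoint v) = mat_adjoint u * (u * (Y * mat_adjoint v))"
    by (simp only: assoc_mult_mat[OF u'(1) Y v'(4)])
  also have "\<dots> = Y * mat_adjoint v" by (rule unitary_cancel(1)[OF u Yv])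
  finally have "mat_adjoint u * (u * Y * mat_adjoint v) * v = Y"
    using unitary_cancel(4)[OF v Y] by simp
  then show ?thesis
    by (simp only: hsip_conj_adjoint[OF u v X conj_carrier[OF u v Y]])
qed

context isometry_family
begin

lemma lap_selfadjoint:
  assumes i: "bij_betw i S S"
    and sym: "\<And>s x y. \<lbrakk>s \<in> S; x \<in> V; y \<in> V\<rbrakk> \<Longrightarrow> B (L s x) y = B x (L (i s) y)"
    and x: "x \<in> V" and y: "y \<in> V"
  shows "B (lap x) y = B x (lap y)"
proof -
  have iS: "i s \<in> S" if "s \<in> S" for s using i that by (auto simp: bij_betw_def)
  have "B (\<Sum>s\<in>S. x - L s x) y = (\<Sum>s\<in>S. B x (y - L (i s) y))"
    using x y iS by (subst B_sum) (auto simp: V_diff L_in B_diff B_diff_right sym intro!: sum.cong)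
  also have "\<dots> = (\<Sum>s\<in>S. B x (y - L s y))"
    by (rule sum.reindex_bij_betw[OF i])
  also have "\<dots> = B x (\<Sum>s\<in>S. y - L s y)"
    using x y by (subst B_sum_right) (auto simp: V_diff L_in)
  finally show ?thesis
    using x y by (simp add: lap_def B_scale B_scale_right V_sum V_diff L_in)
qed

text \<open>By the spectral theorem, \<open>lap \<le> K * lap^2\<close> would bound
  \<open>lap\<close> from below on its own range. Cauchy-Schwarz for the form
  \<open>B (lap x) y\<close> replaces that theorem: it bounds the square of the left side by the
  product of both sides, and one factor \<open>B (lap u) (lap u)\<close> cancels.\<close>

lemma lap_gap_on_range:
  assumes i: "bij_betw i S S"
    and sym: "\<And>s x y. \<lbrakk>s \<in> S; x \<in> V; y \<in> V\<rbrakk> \<Longrightarrow> B (L s x) y = B x (L (i s) y)"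
    and K: "\<And>x. x \<in> V \<Longrightarrow> B (lap x) x \<le> K * B (lap x) (lap x)" and K0: "K \<ge> 0"
    and u: "u \<in> V"
  shows "B (lap u) (lap u) \<le> K * B (lap (lap u)) (lap u)"
proof -
  have nn: "0 \<le> B (lap x) x" if "x \<in> V" for x
    using lap_sq_le[OF that] B_nonneg[OF lap_in[OF that]] by linarith
  interpret Q: semi_ip V "\<lambda>x y. B (lap x) y"
  proof
    fix x y z assume xyz: "x \<in> V" "y \<in> V" "z \<in> V"
    show "B (lap (x + y)) z = B (lap x) z + B (lap y) z"
      using xyz by (simp add: lap_selfadjoint[OF i sym] V_add lap_in B_add)
  next
    fix x y r assume xy: "x \<in> V" "y \<in> V"
    show "B (lap (r *\<^sub>R x)) y = r * B (lap x) y"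
      using xy by (simp add: lap_selfadjoint[OF i sym] V_scale lap_in B_scale)
    show "B (lap x) y = B (lap y) x"
      using lap_selfadjoint[OF i sym xy] B_sym[OF xy(1) lap_in[OF xy(2)]] by simp
  qed (auto simp: V_zero V_add V_scale nn)
  let ?w = "lap u"
  have w: "?w \<in> V" by (rule lap_in[OF u])
  have cs: "(B ?w ?w)\<^sup>2 \<le> B (lap u) u * B (lap ?w) ?w" by (rule Q.Cauchy_Schwarz[OF u w])
  also have "\<dots> \<le> (K * B ?w ?w) * B (lap ?w) ?w"
    by (intro mult_right_mono K nn u w)
  finally have le: "B ?w ?w * B ?w ?w \<le> B ?w ?w * (K * B (lap ?w) ?w)"
    by (simp only: power2_eq_square mult_ac)
  show ?thesis
  proof (cases "B ?w ?w = 0")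
    case True
    then show ?thesis using K0 nn[OF w] by simp
  next
    case False
    then have "B ?w ?w > 0" using B_nonneg[OF w] by simp
    then show ?thesis using le by (simp only: mult_le_cancel_left_pos)
  qed
qed

end

section \<open>Rectangular matrices as a space acted on by two local representations\<close>

context kazhdan_gap
begin

text \<open>The intertwiners are the fixed points of this action, so a gap for its coefficients
  \<open>mcoef\<close> controls how far an almost intertwiner is from a true one.\<close>

definition orb :: "nat \<Rightarrow> nat \<Rightarrow> ('a \<Rightarrow> complex mat) \<Rightarrow> ('a \<Rightarrow> complex mat) \<Rightarrow> complex mat \<Rightarrow> 'a \<Rightarrow> complex mat" where
  "orb d d' \<sigma> \<rho> X g =
     ext (unitary_group d) \<sigma> g * X * mat_adjoint (ext (unitary_group d') \<rho> g)"

definition mcoef :: "nat \<Rightarrow> nat \<Rightarrow> ('a \<Rightarrow> complex mat) \<Rightarrow> ('a \<Rightarrow> complex mat) \<Rightarrow> complex mat \<Rightarrow> 'a \<Rightarrow> real" where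
  "mcoef d d' \<sigma> \<rho> X g = Re (hsip (orb d d' \<sigma> \<rho> X g) X)"

definition rep_pair :: "nat \<Rightarrow> nat \<Rightarrow> nat \<Rightarrow> ('a \<Rightarrow> complex mat) \<Rightarrow> ('a \<Rightarrow> complex mat) \<Rightarrow> complex mat \<Rightarrow> bool" where
  "rep_pair R d d' \<sigma> \<rho> X \<longleftrightarrow> local_rep R (unitary_group d) \<sigma> \<and> local_rep R (unitary_group d') \<rho> \<and>
     X \<in> carrier_mat d d'"

text \<open>An identity for homomorphisms. A local representation satisfies it once \<open>R\<close>
  passes a threshold depending on \<open>g\<close> and \<open>h\<close> only, whatever the
  dimensions are.\<close>

lemma mcoef_quotient:
  assumes g: "g \<in> carrier G" and h: "h \<in> carrier G"
  shows "\<exists>R0. \<forall>R d d' \<sigma> \<rho> X. R \<ge> R0 \<longrightarrow> rep_pair R d d' \<sigma> \<rho> X \<longrightarrow>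
    mcoef d d' \<sigma> \<rho> X (inv h \<otimes> g) = Re (hsip (orb d d' \<sigma> \<rho> X g) (orb d d' \<sigma> \<rho> X h))"
proof -
  obtain R1 where R1: "\<And>R (M :: complex mat monoid) \<tau>. R \<ge> R1 \<Longrightarrow> group M \<Longrightarrow> local_rep R M \<tau> \<Longrightarrow>
      ext M \<tau> (inv h \<otimes> g) = ext M \<tau> (inv h) \<otimes>\<^bsub>M\<^esub> ext M \<tau> g"
    using ext_mult[OF inv_closed[OF h] g] by blast
  obtain R2 where R2: "\<And>R (M :: complex mat monoid) \<tau>. R \<ge> R2 \<Longrightarrow> group M \<Longrightarrow> local_rep R M \<tau> \<Longrightarrow>
      ext M \<tau> (inv h) = inv\<^bsub>M\<^esub> (ext M \<tau> h)"
    using ext_inv[OF h] by blast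
  show ?thesis
  proof (intro exI allI impI)
    fix R d d' \<sigma> \<rho> X
    assume R: "max R1 R2 \<le> R" and rp: "rep_pair R d d' \<sigma> \<rho> X"
    let ?a = "ext (unitary_group d) \<sigma> g" and ?b = "ext (unitary_group d) \<sigma> h"
    let ?a' = "ext (unitary_group d') \<rho> g" and ?b' = "ext (unitary_group d') \<rho> h"
    have l: "local_rep R (unitary_group d) \<sigma>" "local_rep R (unitary_group d') \<rho>" and X: "X \<in> carrier_mat d d'"
      using rp by (auto simp: rep_pair_def)
    have ab: "?a \<in> carrier (unitary_group d)" "?b \<in> carrier (unitary_group d)"
      "?a' \<in> carrier (unitary_group d')" "?b' \<in> carrier (unitary_group d')"
      using g h l by (auto intro!: ext_closed[OF unitary_group_is_group])
    note a = unitaryD[OF ab(1)] and b = unitaryD[OF ab(2)] and a' = unitaryD[OF ab(3)] and b' = unitaryD[OF ab(4)]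
    have e: "ext (unitary_group d) \<sigma> (inv h \<otimes> g) = mat_adjoint ?b * ?a"
      "ext (unitary_group d') \<rho> (inv h \<otimes> g) = mat_adjoint ?b' * ?a'"
      using R l R1[OF _ unitary_group_is_group] R2[OF _ unitary_group_is_group] ab
      by (auto simp: inv_unitary_group unitary_group_simps(2))
    let ?Z = "?a * X * mat_adjoint ?a'"
    have Z: "?Z \<in> carrier_mat d d'" by (rule conj_carrier[OF ab(1,3) X])
    have aX: "?a * X \<in> carrier_mat d d'" using a(1) X by (metis mult_carrier_mat)
    have baX: "mat_adjoint ?b * (?a * X) \<in> carrier_mat d d'" using b(4) aX by (metis mult_carrier_mat)
    have "orb d d' \<sigma> \<rho> X (inv h \<otimes> g) = mat_adjoint ?b * ?a * X * (mat_adjoint ?a' * ?b')"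
      unfolding orb_def e by (simp only: mat_adjoint_mult[OF b'(4) a'(1)] mat_adjoint_adjoint)
    also have "\<dots> = mat_adjoint ?b * (?a * X) * (mat_adjoint ?a' * ?b')"
      by (simp only: assoc_mult_mat[OF b(4) a(1) X])
    also have "\<dots> = mat_adjoint ?b * (?a * X) * mat_adjoint ?a' * ?b'"
      by (rule assoc_mult_mat[OF baX a'(4) b'(1), symmetric])
    also have "\<dots> = mat_adjoint ?b * ?Z * mat_adjoint (mat_adjoint ?b')"
      by (simp only: assoc_mult_mat[OF b(4) aX a'(4)] mat_adjoint_adjoint)
    finally have "hsip (orb d d' \<sigma> \<rho> X (inv h \<otimes> g)) X =
        hsip ?Z (mat_adjoint (mat_adjoint ?b) * X * mat_adjoint ?b')"
      by (simp only: hsip_conj_adjoint[OF unitary_adjoint[OF ab(2)] unitary_adjoint[OF ab(4)] Z X])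
    then show "mcoef d d' \<sigma> \<rho> X (inv h \<otimes> g) = Re (hsip (orb d d' \<sigma> \<rho> X g) (orb d d' \<sigma> \<rho> X h))"
      by (simp only: mcoef_def orb_def mat_adjoint_adjoint)
  qed
qed

lemma mcoef_quotient_uniform:
  assumes F: "finite F" "F \<subseteq> carrier G"
  shows "\<exists>R0. \<forall>R d d' \<sigma> \<rho> X. R \<ge> R0 \<longrightarrow> rep_pair R d d' \<sigma> \<rho> X \<longrightarrow> (\<forall>g\<in>F. \<forall>h\<in>F.
    mcoef d d' \<sigma> \<rho> X (inv h \<otimes> g) = Re (hsip (orb d d' \<sigma> \<rho> X g) (orb d d' \<sigma> \<rho> X h)))"
proof -
  obtain r where r: "\<And>g h R d d' \<sigma> \<rho> X. \<lbrakk>g \<in> carrier G; h \<in> carrier G; R \<ge> r g h; rep_pair R d d' \<sigma> \<rho> X\<rbrakk> \<Longrightarrow>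
    mcoef d d' \<sigma> \<rho> X (inv h \<otimes> g) = Re (hsip (orb d d' \<sigma> \<rho> X g) (orb d d' \<sigma> \<rho> X h))"
    using mcoef_quotient by metis
  show ?thesis
  proof (intro exI allI impI ballI)
    fix R d d' \<sigma> \<rho> X g h
    assume R: "(\<Sum>g\<in>F. \<Sum>h\<in>F. r g h) \<le> R" and rp: "rep_pair R d d' \<sigma> \<rho> X" and gh: "g \<in> F" "h \<in> F"
    have "r g h \<le> (\<Sum>h\<in>F. r g h)" using gh F by (intro member_le_sum) auto
    also have "\<dots> \<le> (\<Sum>g\<in>F. \<Sum>h\<in>F. r g h)" using gh F by (intro member_le_sum[of g F "\<lambda>g. \<Sum>h\<in>F. r g h"]) auto
    finally show "mcoef d d' \<sigma> \<rho> X (inv h \<otimes> g) = Re (hsip (orb d d' \<sigma> \<rho> X g) (orb d d' \<sigma> \<rho> X h))"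
      using R rp gh F by (intro r[of g h R]) auto
  qed
qed

lemma orb_carrier:
  assumes "rep_pair R d d' \<sigma> \<rho> X" "g \<in> carrier G"
  shows "orb d d' \<sigma> \<rho> X g \<in> carrier_mat d d'"
  using assms unfolding orb_def rep_pair_def
  by (intro conj_carrier ext_closed[OF unitary_group_is_group]) auto

lemma mcoef_gram:
  assumes F: "finite F" "F \<subseteq> carrier G"
  shows "\<exists>R0. \<forall>R d d' \<sigma> \<rho> X. R \<ge> R0 \<longrightarrow> rep_pair R d d' \<sigma> \<rho> X \<longrightarrow> gram G F (mcoef d d' \<sigma> \<rho> X)"
proof -
  obtain R0 where R0: "\<And>R d d' \<sigma> \<rho> X g h. \<lbrakk>R \<ge> R0; rep_pair R d d' \<sigma> \<rho> X; g \<in> F; h \<in> F\<rbrakk> \<Longrightarrow>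
    mcoef d d' \<sigma> \<rho> X (inv h \<otimes> g) = Re (hsip (orb d d' \<sigma> \<rho> X g) (orb d d' \<sigma> \<rho> X h))"
    using mcoef_quotient_uniform[OF F] by blast
  show ?thesis
  proof (intro exI allI impI)
    fix R d d' \<sigma> \<rho> X
    assume R: "R0 \<le> R" and rp: "rep_pair R d d' \<sigma> \<rho> X"
    \<comment> \<open>The real coordinates are the real and imaginary parts of the entries, told
      apart by the boolean.\<close>
    define x where "x g = (\<lambda>(p, b). if b then Re (orb d d' \<sigma> \<rho> X g $$ p) else Im (orb d d' \<sigma> \<rho> X g $$ p))" for g
    show "gram G F (mcoef d d' \<sigma> \<rho> X)"
    proof (rule gramI[of "({..<d} \<times> {..<d'}) \<times> (UNIV :: bool set)" _ _ _ x])
      fix g h assume gh: "g \<in> F" "h \<in> F"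
      have c: "orb d d' \<sigma> \<rho> X g \<in> carrier_mat d d'" using orb_carrier[OF rp] gh F by auto
      have "mcoef d d' \<sigma> \<rho> X (inv h \<otimes> g) = (\<Sum>i<d. \<Sum>j<d'.
          Re (orb d d' \<sigma> \<rho> X g $$ (i, j)) * Re (orb d d' \<sigma> \<rho> X h $$ (i, j)) +
          Im (orb d d' \<sigma> \<rho> X g $$ (i, j)) * Im (orb d d' \<sigma> \<rho> X h $$ (i, j)))"
        using c by (simp add: R0[OF R rp gh] hsip_def)
      also have "\<dots> = (\<Sum>p\<in>{..<d} \<times> {..<d'}. \<Sum>b\<in>UNIV. x g (p, b) * x h (p, b))"
        by (simp add: sum.cartesian_product x_def UNIV_bool split_def add.commute)
      also have "\<dots> = (\<Sum>i\<in>({..<d} \<times> {..<d'}) \<times> UNIV. x g i * x h i)"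
        by (simp add: sum.cartesian_product split_def)
      finally show "mcoef d d' \<sigma> \<rho> X (inv h \<otimes> g) = (\<Sum>i\<in>({..<d} \<times> {..<d'}) \<times> UNIV. x g i * x h i)" .
    qed simp
  qed
qed

text \<open>The same number serves as relator length and as constant, so the n-th counterexample is
  a pair of local representations of length n that violates the gap by the factor n. Along this
  sequence the coefficients become Gram on every finite window, and \<open>gram_seq_gap\<close>
  applies.\<close>

lemma mcoef_energy_gap:
  assumes cnt: "countable (carrier G)"
  shows "\<exists>R. \<forall>d d' \<sigma> \<rho> X. rep_pair R d d' \<sigma> \<rho> X \<longrightarrow>
    energy1 (mcoef d d' \<sigma> \<rho> X) \<le> real R * energy2 (mcoef d d' \<sigma> \<rho> X)"
proof (rule ccontr)
  assume "\<not> ?thesis"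
  then have "\<forall>R. \<exists>d d' \<sigma> \<rho> X. rep_pair R d d' \<sigma> \<rho> X \<and>
    energy1 (mcoef d d' \<sigma> \<rho> X) > real R * energy2 (mcoef d d' \<sigma> \<rho> X)"
    by (auto simp: not_le)
  then obtain d d' \<sigma> \<rho> X where bad: "\<And>n. rep_pair n (d n) (d' n) (\<sigma> n) (\<rho> n) (X n)"
    "\<And>n. energy1 (mcoef (d n) (d' n) (\<sigma> n) (\<rho> n) (X n)) >
      real n * energy2 (mcoef (d n) (d' n) (\<sigma> n) (\<rho> n) (X n))"
    by metis
  show False
  proof (rule gram_seq_gap[OF cnt _ bad(2)])
    fix F assume F: "finite F" "F \<subseteq> carrier G"
    obtain R0 where "\<And>R d d' \<sigma> \<rho> X. R \<ge> R0 \<Longrightarrow> rep_pair R d d' \<sigma> \<rho> X \<Longrightarrow> gram G F (mcoef d d' \<sigma> \<rho> X)"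
      using mcoef_gram[OF F] by blast
    then have "gram G F (mcoef (d n) (d' n) (\<sigma> n) (\<rho> n) (X n))" if "n \<ge> R0" for n
      using bad(1)[of n] that by blast
    then show "\<forall>\<^sub>F n in sequentially. gram G F (mcoef (d n) (d' n) (\<sigma> n) (\<rho> n) (X n))"
      by (rule eventually_sequentiallyI)
  qed
qed

definition conj_op :: "nat \<Rightarrow> nat \<Rightarrow> ('a \<Rightarrow> complex mat) \<Rightarrow> ('a \<Rightarrow> complex mat) \<Rightarrow> 'a \<Rightarrow>
    (nat \<times> nat \<Rightarrow> complex) \<Rightarrow> nat \<times> nat \<Rightarrow> complex" where
  "conj_op d d' \<sigma> \<rho> s x = (\<lambda>(i, j). if i < d \<and> j < d'
     then (\<sigma> s * mat d d' x * mat_adjoint (\<rho> s)) $$ (i, j) else 0)"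

lemma conj_op_isometry_family:
  assumes "local_rep R (unitary_group d) \<sigma>" "local_rep R (unitary_group d') \<rho>"
  shows "isometry_family UNIV (fip d d') S (conj_op d d' \<sigma> \<rho>)"
    and "s \<in> S \<Longrightarrow> mat d d' (conj_op d d' \<sigma> \<rho> s x) = \<sigma> s * mat d d' x * mat_adjoint (\<rho> s)"
    and "fip d d' x y = Re (hsip (mat d d' x) (mat d d' y))"
proof -
  let ?L = "conj_op d d' \<sigma> \<rho>"
  have u: "\<sigma> s \<in> carrier (unitary_group d)" "\<rho> s \<in> carrier (unitary_group d')" if "s \<in> S" for s
    using assms that by (auto simp: local_rep_def)
  have M: "mat d d' (?L s x) = \<sigma> s * mat d d' x * mat_adjoint (\<rho> s)" if s: "s \<in> S" for s x
  proof -
    have c: "\<sigma> s * mat d d' x * mat_adjoint (\<rho> s) \<in> carrier_mat d d'"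
      by (rule conj_carrier[OF u[OF s]]) simp
    show ?thesis
    proof (rule eq_matI)
      fix i j assume a: "i < dim_row (\<sigma> s * mat d d' x * mat_adjoint (\<rho> s))"
        "j < dim_col (\<sigma> s * mat d d' x * mat_adjoint (\<rho> s))"
      have ij: "i < d" "j < d'" using a unfolding carrier_matD[OF c] by auto
      show "mat d d' (?L s x) $$ (i, j) = (\<sigma> s * mat d d' x * mat_adjoint (\<rho> s)) $$ (i, j)"
        by (simp add: conj_op_def ij del: index_mult_mat(1))
    qed (simp_all only: carrier_matD[OF c] dim_row_mat dim_col_mat)
  qed
  show "s \<in> S \<Longrightarrow> mat d d' (?L s x) = \<sigma> s * mat d d' x * mat_adjoint (\<rho> s)" by (rule M)
  have f: "fip d d' x y = Re (hsip (mat d d' x) (mat d d' y))" for x y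
    by (simp add: fip_def hsip_def)
  show "fip d d' x y = Re (hsip (mat d d' x) (mat d d' y))" by (rule f)
  interpret semi_ip UNIV "fip d d'" by (rule semi_ip_fip)
  show "isometry_family UNIV (fip d d') S ?L"
  proof
    show "finite S" "S \<noteq> {}" using S_finite S_one by auto
    fix s and x y :: "nat \<times> nat \<Rightarrow> complex" and r :: real
    assume s: "s \<in> S"
    note us = unitaryD[OF u(1)[OF s]] and ur = unitaryD[OF u(2)[OF s]]
    have c: "mat d d' z \<in> carrier_mat d d'" for z :: "nat \<times> nat \<Rightarrow> complex" by simp
    have uc: "\<sigma> s * mat d d' z \<in> carrier_mat d d'" for z using us(1) c by (metis mult_carrier_mat)
    have cc: "\<sigma> s * mat d d' z * mat_adjoint (\<rho> s) \<in> carrier_mat d d'" for z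
      by (rule conj_carrier[OF u[OF s] c])
    have "mat d d' (x + y) = mat d d' x + mat d d' y" by (rule eq_matI) auto
    then have "\<sigma> s * mat d d' (x + y) * mat_adjoint (\<rho> s) =
        \<sigma> s * mat d d' x * mat_adjoint (\<rho> s) + \<sigma> s * mat d d' y * mat_adjoint (\<rho> s)"
      by (simp only: mult_add_distrib_mat[OF us(1) c c] add_mult_distrib_mat[OF uc uc ur(4)])
    then show "?L s (x + y) = ?L s x + ?L s y"
      using carrier_matD(1)[OF us(1)] carrier_matD(1)[OF ur(1)]
      by (auto simp: conj_op_def fun_eq_iff simp del: index_mult_mat(1))
    have "mat d d' (r *\<^sub>R x) = complex_of_real r \<cdot>\<^sub>m mat d d' x"
      by (rule eq_matI) (auto simp: scaleR_conv_of_real)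
    then have "\<sigma> s * mat d d' (r *\<^sub>R x) * mat_adjoint (\<rho> s) =
        complex_of_real r \<cdot>\<^sub>m (\<sigma> s * mat d d' x * mat_adjoint (\<rho> s))"
      by (simp only: mult_smult_distrib[OF us(1) c] mult_smult_assoc_mat[OF uc ur(4)])
    then show "?L s (r *\<^sub>R x) = r *\<^sub>R ?L s x"
      using carrier_matD(1)[OF us(1)] carrier_matD(1)[OF ur(1)]
      by (auto simp: conj_op_def fun_eq_iff scaleR_conv_of_real simp del: index_mult_mat(1))
    show "fip d d' (?L s x) (?L s y) = fip d d' x y"
      by (simp only: f M[OF s] hsip_conj[OF u[OF s] c c])
  qed auto
qed

lemma entry_le_nrm:
  assumes "i < d" "j < d'"
  shows "cmod (x (i, j)) \<le> sqrt (fip d d' x x)"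
proof -
  have "fip d d' x x = (\<Sum>i<d. \<Sum>j<d'. (cmod (x (i, j)))\<^sup>2)"
    unfolding fip_def by (simp only: complex_norm_square[symmetric] Re_sum Re_complex_of_real)
  moreover have "(cmod (x (i, j)))\<^sup>2 \<le> (\<Sum>j<d'. (cmod (x (i, j)))\<^sup>2)"
    using assms by (intro member_le_sum) auto
  moreover have "(\<Sum>j<d'. (cmod (x (i, j)))\<^sup>2) \<le> (\<Sum>i<d. \<Sum>j<d'. (cmod (x (i, j)))\<^sup>2)"
    using assms by (intro member_le_sum[of i "{..<d}" "\<lambda>i. \<Sum>j<d'. (cmod (x (i, j)))\<^sup>2"]) (auto intro: sum_nonneg)
  ultimately have "(cmod (x (i, j)))\<^sup>2 \<le> fip d d' x x" by linarith
  then show ?thesis by (rule real_le_rsqrt)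
qed

text \<open>The iterated lazy average of the conjugates of \<open>X\<close> converges geometrically
  to a fixed point \<open>T\<close>, and the geometric series bounds the distance by the norm of the
  Laplacian of \<open>X\<close>. The rate stems from \<open>mcoef_energy_gap\<close>, so it does not
  depend on the dimensions.\<close>

theorem intertwiner_near:
  assumes cnt: "countable (carrier G)"
  obtains R C where "C \<ge> 0" "\<And>d d' \<sigma> \<rho> X. \<lbrakk>local_rep R (unitary_group d) \<sigma>;
      local_rep R (unitary_group d') \<rho>; X \<in> carrier_mat d d'\<rbrakk> \<Longrightarrow>
    \<exists>T\<in>carrier_mat d d'. (\<forall>s\<in>S. \<sigma> s * T = T * \<rho> s) \<and>
      hs2 (X - T) \<le> C * (\<Sum>s\<in>S. hs2 (\<sigma> s * X - X * \<rho> s))"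
proof -
  obtain R1 where R1: "\<And>d d' \<sigma> \<rho> X. rep_pair R1 d d' \<sigma> \<rho> X \<Longrightarrow>
      energy1 (mcoef d d' \<sigma> \<rho> X) \<le> real R1 * energy2 (mcoef d d' \<sigma> \<rho> X)"
    using mcoef_energy_gap[OF cnt] by blast
  obtain R2 where R2: "\<And>R d d' \<sigma> \<rho> X g h. \<lbrakk>R \<ge> R2; rep_pair R d d' \<sigma> \<rho> X; g \<in> S; h \<in> S\<rbrakk> \<Longrightarrow>
    mcoef d d' \<sigma> \<rho> X (inv h \<otimes> g) = Re (hsip (orb d d' \<sigma> \<rho> X g) (orb d d' \<sigma> \<rho> X h))"
    using mcoef_quotient_uniform[OF S_finite S_carrier] by blast
  obtain R3 where R3: "\<And>R (M :: complex mat monoid) \<tau> s. R \<ge> R3 \<Longrightarrow> group M \<Longrightarrow> local_rep R M \<tau> \<Longrightarrow>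
      s \<in> S \<Longrightarrow> ext M \<tau> s = \<tau> s"
    using ext_generator by blast
  \<comment> \<open>The sum passes all three thresholds, and the summand 2 secures
    \<open>local_inv\<close>.\<close>
  define R where "R = R1 + R2 + R3 + 2"
  \<comment> \<open>The sum of displacements is \<open>2 * real (card S)\<close> times the
    Laplacian, which converts the constant \<open>R1\<close> of the energies.\<close>
  define K where "K = 2 * real (card S) * real R1"
  define K' where "K' = max 1 K"
  define q where "q = sqrt (1 - 1 / K')"
  have q: "0 \<le> q" "q < 1" by (auto simp: q_def K'_def field_simps)
  show ?thesis
  \<comment> \<open>The square of the geometric series bound, with \<open>lap_energy\<close>
    supplying the division by \<open>4 * real (card S)\<close>.\<close>
  proof (rule that[of "(1 / (1 - q))\<^sup>2 / (4 * real (card S))" R])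
    show "0 \<le> (1 / (1 - q))\<^sup>2 / (4 * real (card S))" by simp
    fix d d' \<sigma> \<rho> and X :: "complex mat"
    assume l: "local_rep R (unitary_group d) \<sigma>" "local_rep R (unitary_group d') \<rho>"
      and X: "X \<in> carrier_mat d d'"
    let ?L = "conj_op d d' \<sigma> \<rho>"
    note fam = conj_op_isometry_family[OF l]
    interpret isometry_family UNIV "fip d d'" S ?L by (rule fam(1))
    have u: "\<sigma> s \<in> carrier (unitary_group d)" "\<rho> s \<in> carrier (unitary_group d')" if "s \<in> S" for s
      using l that by (auto simp: local_rep_def)
    have cM: "mat d d' x \<in> carrier_mat d d'" for x :: "nat \<times> nat \<Rightarrow> complex" by simp
    have orbS: "orb d d' \<sigma> \<rho> (mat d d' x) s = mat d d' (?L s x)" if s: "s \<in> S" for s x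
      using R3[OF _ unitary_group_is_group l(1) s] R3[OF _ unitary_group_is_group l(2) s] fam(2)[OF s]
      by (simp add: orb_def R_def)
    have coef: "mcoef d d' \<sigma> \<rho> (mat d d' x) (inv t \<otimes> s) = fip d d' (?L s x) (?L t x)"
      if "s \<in> S" "t \<in> S" for s t x
    proof -
      have "rep_pair R d d' \<sigma> \<rho> (mat d d' x)" using l by (simp add: rep_pair_def)
      then have "mcoef d d' \<sigma> \<rho> (mat d d' x) (inv t \<otimes> s) =
          Re (hsip (orb d d' \<sigma> \<rho> (mat d d' x) s) (orb d d' \<sigma> \<rho> (mat d d' x) t))"
        using that by (intro R2[of R]) (auto simp: R_def)
      then show ?thesis using that by (simp only: orbS fam(3))
    qed
    have coef1: "mcoef d d' \<sigma> \<rho> (mat d d' x) \<one> = fip d d' x x" for x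
      using coef[OF S_one S_one, of x] L_iso[OF S_one UNIV_I UNIV_I] by simp
    have coefS: "mcoef d d' \<sigma> \<rho> (mat d d' x) s = fip d d' (?L s x) x" if "s \<in> S" for s x
      using orbS[OF that] by (simp only: mcoef_def fam(3))
    have gapK: "fip d d' (lap x) x \<le> K * fip d d' (lap x) (lap x)" for x
    proof -
      have rp: "rep_pair R1 d d' \<sigma> \<rho> (mat d d' x)"
        using l by (auto simp: rep_pair_def R_def intro: local_rep_mono)
      let ?D = "\<Sum>s\<in>S. x - ?L s x"
      have e1: "energy1 (mcoef d d' \<sigma> \<rho> (mat d d' x)) = fip d d' ?D x"
        unfolding energy1_def
        by (subst B_sum) (auto simp: B_diff coef1 coefS intro!: sum.cong)
      have "fip d d' ?D ?D = (\<Sum>s\<in>S. \<Sum>t\<in>S. fip d d' (x - ?L s x) (x - ?L t x))"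
        by (subst B_sum, simp, simp, intro sum.cong refl, subst B_sum_right) auto
      also have "\<dots> = energy2 (mcoef d d' \<sigma> \<rho> (mat d d' x))"
        unfolding energy2_def
      proof (intro sum.cong refl)
        fix s t assume st: "s \<in> S" "t \<in> S"
        have "fip d d' x (?L t x) = fip d d' (?L t x) x" by (rule B_sym) auto
        then show "fip d d' (x - ?L s x) (x - ?L t x) =
          mcoef d d' \<sigma> \<rho> (mat d d' x) \<one> - mcoef d d' \<sigma> \<rho> (mat d d' x) s
            - mcoef d d' \<sigma> \<rho> (mat d d' x) t + mcoef d d' \<sigma> \<rho> (mat d d' x) (inv t \<otimes> s)"
          using st B_diff[of x "?L s x" "x - ?L t x"] B_diff_right[of x "?L t x" x]
            B_diff_right[of x "?L t x" "?L s x"]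
          by (simp only: coef1 coefS coef UNIV_I)
      qed
      finally have e2: "fip d d' ?D ?D = energy2 (mcoef d d' \<sigma> \<rho> (mat d d' x))" .
      have le: "fip d d' ?D x \<le> real R1 * fip d d' ?D ?D" using R1[OF rp] by (simp only: e1 e2)
      let ?c = "1 / (2 * real (card S))"
      have "fip d d' (lap x) x = ?c * fip d d' ?D x" by (simp only: lap_def B_scale[OF UNIV_I UNIV_I])
      also have "\<dots> \<le> ?c * (real R1 * fip d d' ?D ?D)" using le by (intro mult_left_mono) auto
      also have "\<dots> = K * (?c * (?c * fip d d' ?D ?D))" using card_pos by (simp add: K_def)
      also have "?c * (?c * fip d d' ?D ?D) = fip d d' (lap x) (lap x)"
        by (simp only: lap_def B_scale[OF UNIV_I UNIV_I] B_scale_right[OF UNIV_I UNIV_I])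
      finally show ?thesis .
    qed
    have invbij: "bij_betw (m_inv G) S S"
      by (rule bij_betwI[of _ _ _ "m_inv G"]) (use S_inv S_carrier in auto)
    have sym: "fip d d' (?L s x) y = fip d d' x (?L (inv s) y)" if s: "s \<in> S" for s x y
    proof -
      have "\<sigma> (inv s) = mat_adjoint (\<sigma> s)" "\<rho> (inv s) = mat_adjoint (\<rho> s)"
        using local_inv[OF unitary_group_is_group l(1) _ s] local_inv[OF unitary_group_is_group l(2) _ s]
        by (auto simp: inv_unitary_group u[OF s] R_def)
      then show ?thesis
        by (simp only: fam(3) fam(2)[OF s] fam(2)[OF S_inv[OF s]] hsip_conj_adjoint[OF u[OF s] cM cM] mat_adjoint_adjoint)
    qed
    have rangegap: "fip d d' (lap x) (lap x) \<le> K * fip d d' (lap (lap x)) (lap x)" for x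
      by (rule lap_gap_on_range[OF invbij sym gapK]) (auto simp: K_def)
    interpret gapped_family UNIV "fip d d'" S ?L "range lap" K'
    proof
      show "avg x \<in> range lap" if "x \<in> range lap" for x
        using that by (auto simp: lap_avg[symmetric])
      show "1 \<le> K'" by (simp add: K'_def)
      fix w assume "w \<in> range lap"
      then obtain x where w: "w = lap x" by blast
      have "fip d d' w w \<le> K * fip d d' (lap w) w" unfolding w by (rule rangegap)
      also have "\<dots> \<le> K' * fip d d' (lap w) w"
        using order_trans[OF B_nonneg lap_sq_le, of w] by (intro mult_right_mono) (auto simp: K'_def)
      finally show "fip d d' w w \<le> K' * fip d d' (lap w) w" .
    qed auto
    have rate: "rate = q" by (simp add: rate_def q_def)
    define x0 where "x0 = (\<lambda>p. X $$ p)"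
    define x where "x k = (avg ^^ k) x0" for k
    define c where "c = nrm (lap x0)"
    have c0: "c \<ge> 0" by (simp add: c_def nrm_nonneg)
    have Mx0: "mat d d' x0 = X" using X by (auto simp: x0_def)
    have dist: "nrm (x m - x (m + k)) \<le> q ^ m / (1 - q) * c" for m k
      using funpow_avg_dist[OF UNIV_I, of m x0 k] by (simp only: x_def c_def rate)
    have conv: "convergent (\<lambda>k. x k (i, j))" if ij: "i < d" "j < d'" for i j
    proof -
      have lim0: "(\<lambda>m. q ^ m / (1 - q) * c) \<longlonglongrightarrow> 0"
        using tendsto_mult_left_zero[OF LIMSEQ_realpow_zero[OF q], of "c / (1 - q)"]
        by (simp only: times_divide_eq_left times_divide_eq_right)
      have "Cauchy (\<lambda>k. x k (i, j))"
      proof (rule CauchyI', unfold dist_norm)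
        fix e :: real assume "e > 0"
        then obtain N where N: "\<And>m. m \<ge> N \<Longrightarrow> norm (q ^ m / (1 - q) * c - 0) < e"
          using LIMSEQ_D[OF lim0] by blast
        show "\<exists>M. \<forall>m\<ge>M. \<forall>n>m. norm (x m (i, j) - x n (i, j)) < e"
        proof (intro exI allI impI)
          fix m n assume mn: "N \<le> m" "m < n"
          have "norm (x m (i, j) - x n (i, j)) = cmod ((x m - x n) (i, j))" by simp
          also have "\<dots> \<le> nrm (x m - x n)" unfolding nrm_def by (rule entry_le_nrm[OF ij])
          also have "\<dots> \<le> q ^ m / (1 - q) * c" using dist[of m "n - m"] mn by simp
          also have "\<dots> < e"
            using N[OF mn(1)] unfolding real_norm_def diff_0_right
            by (rule order_le_less_trans[OF abs_ge_self])
          finally show "norm (x m (i, j) - x n (i, j)) < e" .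
        qed
      qed
      then show ?thesis by (simp add: Cauchy_convergent_iff)
    qed
    define y where "y = (\<lambda>p. lim (\<lambda>k. x k p))"
    have xy: "(\<lambda>k. x k (i, j)) \<longlonglongrightarrow> y (i, j)" if "i < d" "j < d'" for i j
      using conv[OF that] by (simp add: y_def convergent_LIMSEQ_iff)
    have fip_lim: "(\<lambda>k. fip d d' (x k - y) (x k - y)) \<longlonglongrightarrow> 0"
    proof -
      have z: "(\<lambda>k. (x k - y) (i, j) * cnj ((x k - y) (i, j))) \<longlonglongrightarrow> 0 * cnj 0"
        if "i \<in> {..<d}" "j \<in> {..<d'}" for i j
      proof (intro tendsto_mult tendsto_cnj)
        show "(\<lambda>k. (x k - y) (i, j)) \<longlonglongrightarrow> 0"
          using LIM_zero[OF xy[of i j]] that by simp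
        then show "(\<lambda>k. (x k - y) (i, j)) \<longlonglongrightarrow> 0" .
      qed
      have "(\<lambda>k. \<Sum>i<d. \<Sum>j<d'. (x k - y) (i, j) * cnj ((x k - y) (i, j))) \<longlonglongrightarrow> (\<Sum>i<d. \<Sum>j<d'. 0 * cnj 0)"
        by (rule tendsto_sum, rule tendsto_sum, rule z)
      from tendsto_Re[OF this] show ?thesis by (simp only: fip_def mult_zero_left sum.neutral_const zero_complex.sel)
    qed
    have nrm_lim: "(\<lambda>k. nrm (x k - y)) \<longlonglongrightarrow> 0"
      using tendsto_real_sqrt[OF fip_lim] by (simp add: nrm_def)
    have nrm_y: "nrm (x0 - y) \<le> 1 / (1 - q) * c"
    proof (rule LIMSEQ_le_const)
      show "(\<lambda>k. 1 / (1 - q) * c + nrm (x k - y)) \<longlonglongrightarrow> 1 / (1 - q) * c"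
        using tendsto_add[OF tendsto_const nrm_lim] by simp
      have "nrm (x0 - y) \<le> 1 / (1 - q) * c + nrm (x k - y)" for k
        using nrm_triangle_diff[of x0 "x k" y] dist[of 0 k] by (simp add: x_def)
      then show "\<exists>N. \<forall>k\<ge>N. nrm (x0 - y) \<le> 1 / (1 - q) * c + nrm (x k - y)" by blast
    qed
    have fixed: "nrm (y - ?L s y) = 0" if s: "s \<in> S" for s
    proof -
      have bound: "(nrm (x k - ?L s (x k)))\<^sup>2 \<le> q ^ k * (4 * real (card S) * c * nrm x0)" for k
      proof -
        have "(nrm (x k - ?L s (x k)))\<^sup>2 \<le> 4 * real (card S) * nrm (lap (x k)) * nrm (x k)"
          by (rule displacement_le[OF s UNIV_I])
        also have "\<dots> \<le> 4 * real (card S) * (q ^ k * c) * nrm x0"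
          unfolding x_def c_def
          by (intro mult_mono mult_left_mono nrm_lap_funpow_avg[OF UNIV_I, unfolded rate] nrm_funpow_avg_le)
            (auto simp: nrm_nonneg q)
        finally show ?thesis by (simp only: mult_ac)
      qed
      have "(\<lambda>k. q ^ k * (4 * real (card S) * c * nrm x0)) \<longlonglongrightarrow> 0"
        using LIMSEQ_realpow_zero[OF q] by (rule tendsto_mult_left_zero)
      then have "(\<lambda>k. (nrm (x k - ?L s (x k)))\<^sup>2) \<longlonglongrightarrow> 0"
        by (rule tendsto_sandwich[rotated 2, OF tendsto_const]) (auto simp: bound)
      then have d0: "(\<lambda>k. nrm (x k - ?L s (x k))) \<longlonglongrightarrow> 0" by (simp add: tendsto_null_power)
      have le: "nrm (y - ?L s y) \<le> nrm (x k - y) + (nrm (x k - ?L s (x k)) + nrm (x k - y))" for k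
      proof -
        have "nrm (y - ?L s y) \<le> nrm (y - x k) + nrm (x k - ?L s y)" by (rule nrm_triangle_diff) auto
        moreover have "nrm (x k - ?L s y) \<le> nrm (x k - ?L s (x k)) + nrm (?L s (x k) - ?L s y)"
          by (rule nrm_triangle_diff) auto
        moreover have "nrm (?L s (x k) - ?L s y) = nrm (x k - y)"
          using L_diff[OF s UNIV_I UNIV_I, of "x k" y] nrm_L[OF s UNIV_I, of "x k - y"] by (simp only:)
        moreover have "nrm (y - x k) = nrm (x k - y)" by (rule nrm_minus_commute) auto
        ultimately show ?thesis by linarith
      qed
      have "nrm (y - ?L s y) \<le> 0 + (0 + 0)"
        by (rule LIMSEQ_le_const[OF tendsto_add[OF nrm_lim tendsto_add[OF d0 nrm_lim]]]) (use le in blast)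
      then show ?thesis using nrm_nonneg[of "y - ?L s y"] by simp
    qed
    define T where "T = mat d d' y"
    have T: "T \<in> carrier_mat d d'" by (simp add: T_def)
    have "\<sigma> s * T = T * \<rho> s" if s: "s \<in> S" for s
    proof -
      have cc: "\<sigma> s * T * mat_adjoint (\<rho> s) \<in> carrier_mat d d'" by (rule conj_carrier[OF u[OF s] T])
      have "T = \<sigma> s * T * mat_adjoint (\<rho> s)"
      proof (rule eq_matI)
        fix i j assume "i < dim_row (\<sigma> s * T * mat_adjoint (\<rho> s))" "j < dim_col (\<sigma> s * T * mat_adjoint (\<rho> s))"
        then have ij: "i < d" "j < d'" unfolding carrier_matD[OF cc] by auto
        have "cmod ((y - ?L s y) (i, j)) \<le> nrm (y - ?L s y)"
          unfolding nrm_def by (rule entry_le_nrm[OF ij])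
        then have "y (i, j) = ?L s y (i, j)" using fixed[OF s] by simp
        then show "T $$ (i, j) = (\<sigma> s * T * mat_adjoint (\<rho> s)) $$ (i, j)"
          using ij by (simp add: T_def conj_op_def del: index_mult_mat(1))
      next
        show "dim_row T = dim_row (\<sigma> s * T * mat_adjoint (\<rho> s))"
          "dim_col T = dim_col (\<sigma> s * T * mat_adjoint (\<rho> s))"
          by (simp_all only: carrier_matD[OF cc] carrier_matD[OF T])
      qed
      then have "T * \<rho> s = \<sigma> s * T * mat_adjoint (\<rho> s) * \<rho> s"
        by (rule arg_cong[where f = "\<lambda>A. A * \<rho> s"])
      also have "\<dots> = \<sigma> s * T"
        by (rule unitary_cancel(4)[OF u(2)[OF s] mult_carrier_mat[OF unitaryD(1)[OF u(1)[OF s]] T]])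
      finally show ?thesis by simp
    qed
    moreover have "hs2 (X - T) \<le> (1 / (1 - q))\<^sup>2 / (4 * real (card S)) * (\<Sum>s\<in>S. hs2 (\<sigma> s * X - X * \<rho> s))"
    proof -
      have fd: "fip d d' z z = hs2 (mat d d' z)" for z using fam(3) by (simp add: hsip_self)
      have "mat d d' (x0 - y) = X - T"
        by (rule eq_matI) (use X in \<open>auto simp: x0_def T_def\<close>)
      then have "hs2 (X - T) = (nrm (x0 - y))\<^sup>2" by (simp only: nrm_sq[OF UNIV_I] fd)
      also have "\<dots> \<le> (1 / (1 - q) * c)\<^sup>2" using nrm_y by (intro power_mono) (auto simp: nrm_nonneg)
      also have "\<dots> = (1 / (1 - q))\<^sup>2 * fip d d' (lap x0) (lap x0)"
        by (simp only: power_mult_distrib c_def nrm_sq[OF UNIV_I])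
      also have "\<dots> \<le> (1 / (1 - q))\<^sup>2 * fip d d' (lap x0) x0"
        by (intro mult_left_mono lap_sq_le) auto
      also have "\<dots> = (1 / (1 - q))\<^sup>2 / (4 * real (card S)) *
          (\<Sum>s\<in>S. fip d d' (x0 - ?L s x0) (x0 - ?L s x0))"
        using card_pos by (subst lap_energy) auto
      also have "(\<Sum>s\<in>S. fip d d' (x0 - ?L s x0) (x0 - ?L s x0)) = (\<Sum>s\<in>S. hs2 (\<sigma> s * X - X * \<rho> s))"
      proof (rule sum.cong[OF refl])
        fix s assume s: "s \<in> S"
        note us = u[OF s]
        have sX: "\<sigma> s * X \<in> carrier_mat d d'" using unitaryD(1)[OF us(1)] X by (metis mult_carrier_mat)
        have Xr: "X * \<rho> s \<in> carrier_mat d d'" using unitaryD(1)[OF us(2)] X by (metis mult_carrier_mat)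
        have cc: "\<sigma> s * X * mat_adjoint (\<rho> s) \<in> carrier_mat d d'" by (rule conj_carrier[OF us X])
        have "mat d d' (x0 - ?L s x0) = X - \<sigma> s * X * mat_adjoint (\<rho> s)"
        proof (rule eq_matI)
          let ?Z = "\<sigma> s * X * mat_adjoint (\<rho> s)"
          fix i j assume "i < dim_row (X - ?Z)" "j < dim_col (X - ?Z)"
          then have ij: "i < d" "j < d'" unfolding index_minus_mat(2,3) carrier_matD[OF cc] by auto
          have L: "?L s x0 (i, j) = ?Z $$ (i, j)"
            using ij by (simp add: conj_op_def Mx0 del: index_mult_mat(1))
          have m: "(X - ?Z) $$ (i, j) = X $$ (i, j) - ?Z $$ (i, j)"
            by (rule index_minus_mat(1)) (simp_all only: carrier_matD[OF cc] ij)
          have "mat d d' (x0 - ?L s x0) $$ (i, j) = x0 (i, j) - ?L s x0 (i, j)" using ij by simp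
          then show "mat d d' (x0 - ?L s x0) $$ (i, j) = (X - ?Z) $$ (i, j)"
            unfolding m L by (simp only: x0_def)
        qed (simp_all only: dim_row_mat dim_col_mat index_minus_mat(2,3) carrier_matD[OF cc])
        then have "fip d d' (x0 - ?L s x0) (x0 - ?L s x0) = hs2 (X - \<sigma> s * X * mat_adjoint (\<rho> s))"
          by (simp only: fd)
        \<comment> \<open>Right multiplication by the unitary \<open>\<rho> s\<close> turns the
          distance from the conjugate into the intertwining defect.\<close>
        also have "\<dots> = hs2 ((X - \<sigma> s * X * mat_adjoint (\<rho> s)) * \<rho> s)"
          by (rule hs2_unitary_right[OF us(2) minus_carrier_mat[OF cc], symmetric])
        also have "(X - \<sigma> s * X * mat_adjoint (\<rho> s)) * \<rho> s = X * \<rho> s - \<sigma> s * X"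
          by (simp only: minus_mult_distrib_mat[OF X cc unitaryD(1)[OF us(2)]] unitary_cancel(4)[OF us(2) sX])
        also have "hs2 (X * \<rho> s - \<sigma> s * X) = hs2 (\<sigma> s * X - X * \<rho> s)"
          by (rule hs2_minus_commute[OF Xr sX])
        finally show "fip d d' (x0 - ?L s x0) (x0 - ?L s x0) = hs2 (\<sigma> s * X - X * \<rho> s)" .
      qed
      finally show ?thesis .
    qed
    ultimately show "\<exists>T\<in>carrier_mat d d'. (\<forall>s\<in>S. \<sigma> s * T = T * \<rho> s) \<and>
      hs2 (X - T) \<le> (1 / (1 - q))\<^sup>2 / (4 * real (card S)) * (\<Sum>s\<in>S. hs2 (\<sigma> s * X - X * \<rho> s))"
      using T by blast
  qed
qed

end

section \<open>Deleting a point of a transitive action\<close>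

context kazhdan_gap
begin

lemma partial_hom_wd:
  assumes grp: "\<And>k. k > 0 \<Longrightarrow> group (\<G> k)" and ph: "partial_hom G \<G> k \<psi>" and w: "set w \<subseteq> S"
  shows "\<forall>\<^sub>F n in sequentially. wd (\<G> (k n)) (\<psi> n) w = \<psi> n (val w)"
  using w
proof (induction w)
  case Nil
  have "\<forall>\<^sub>F n in sequentially. \<psi> n (\<one> \<otimes> \<one>) = \<psi> n \<one> \<otimes>\<^bsub>\<G> (k n)\<^esub> \<psi> n \<one>"
    using ph unfolding partial_hom_def eventually_sequentially by blast
  then show ?case
  proof eventually_elim
    case (elim n)
    interpret M: group "\<G> (k n)" using grp ph by (auto simp: partial_hom_def map_seq_def)
    have c: "\<psi> n \<one> \<in> carrier (\<G> (k n))" using ph by (auto simp: partial_hom_def map_seq_def)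
    \<comment> \<open>An idempotent of a group is its identity.\<close>
    have "\<psi> n \<one> \<otimes>\<^bsub>\<G> (k n)\<^esub> \<psi> n \<one> = \<psi> n \<one>" using elim by simp
    then have "\<psi> n \<one> = \<one>\<^bsub>\<G> (k n)\<^esub>" using c by simp
    then show ?case by simp
  qed
next
  case (Cons s w)
  then have s: "s \<in> carrier G" "set w \<subseteq> S" using S_carrier by auto
  have "\<forall>\<^sub>F n in sequentially. \<psi> n (s \<otimes> val w) = \<psi> n s \<otimes>\<^bsub>\<G> (k n)\<^esub> \<psi> n (val w)"
    using ph s(1) val_closed[OF s(2)] unfolding partial_hom_def eventually_sequentially by blast
  with Cons.IH[OF s(2)] show ?case by eventually_elim simp
qed

lemma partial_hom_local_rep:
  assumes grp: "\<And>k. k > 0 \<Longrightarrow> group (\<G> k)" and ph: "partial_hom G \<G> k \<psi>"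
  shows "\<forall>\<^sub>F n in sequentially. local_rep R (\<G> (k n)) (\<psi> n)"
    "g \<in> carrier G \<Longrightarrow> \<forall>\<^sub>F n in sequentially. \<psi> n g = ext (\<G> (k n)) (\<psi> n) g"
proof -
  let ?W = "{w. set w \<subseteq> S \<and> length w \<le> R}"
  have "finite ?W" by (rule finite_lists_length_le[OF S_finite])
  then have "\<forall>\<^sub>F n in sequentially. \<forall>w\<in>?W. wd (\<G> (k n)) (\<psi> n) w = \<psi> n (val w)"
    by (intro eventually_ball_finite ballI partial_hom_wd[OF grp ph]) auto
  moreover have "\<forall>\<^sub>F n in sequentially. \<one>\<^bsub>\<G> (k n)\<^esub> = \<psi> n \<one>"
    using partial_hom_wd[OF grp ph, of "[]"] by simp
  ultimately show "\<forall>\<^sub>F n in sequentially. local_rep R (\<G> (k n)) (\<psi> n)"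
  proof eventually_elim
    case (elim n)
    have "\<psi> n s \<in> carrier (\<G> (k n))" if "s \<in> S" for s
      using ph that S_carrier by (auto simp: partial_hom_def map_seq_def)
    then show ?case using elim by (auto simp: local_rep_def)
  qed
  show "\<forall>\<^sub>F n in sequentially. \<psi> n g = ext (\<G> (k n)) (\<psi> n) g" if "g \<in> carrier G"
  proof -
    have "\<forall>\<^sub>F n in sequentially. wd (\<G> (k n)) (\<psi> n) (wordof g) = \<psi> n (val (wordof g))"
      by (rule partial_hom_wd[OF grp ph wordof(1)[OF that]])
    then show ?thesis by eventually_elim (simp add: ext_def wordof(2)[OF that])
  qed
qed

text \<open>Once \<open>\<phi> n g\<close> is further than c from the identity and closer than c to
  \<open>\<psi> n g\<close>, the latter two differ. Only this nontriviality of
  \<open>\<psi> n g\<close> is carried over, with no lower bound on its distance from the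
  identity.\<close>

lemma separating_partial_hom:
  assumes sep: "admits_separating_approx_hom G \<G> d" and st: "locally_stable G \<G> d"
  shows "\<exists>k \<psi>. partial_hom G \<G> k \<psi> \<and>
    (\<forall>g\<in>carrier G. g \<noteq> \<one> \<longrightarrow> (\<forall>\<^sub>F n in sequentially. \<psi> n g \<noteq> \<one>\<^bsub>\<G> (k n)\<^esub>))"
proof -
  obtain k \<phi> where a: "approx_hom G \<G> d k \<phi>" and s: "separating G \<G> d k \<phi>"
    using sep by (auto simp: admits_separating_approx_hom_def)
  obtain \<psi> where p: "partial_hom G \<G> k \<psi>"
    and l: "\<And>g. g \<in> carrier G \<Longrightarrow> (\<lambda>n. d (k n) (\<phi> n g) (\<psi> n g)) \<longlonglongrightarrow> 0"
    using st a unfolding locally_stable_def by blast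
  show ?thesis
  proof (intro exI conjI ballI impI)
    show "partial_hom G \<G> k \<psi>" by (rule p)
    fix g assume g: "g \<in> carrier G" "g \<noteq> \<one>"
    then have "liminf (\<lambda>n. ereal (d (k n) (\<phi> n g) \<one>\<^bsub>\<G> (k n)\<^esub>)) > 0"
      using s by (auto simp: separating_def)
    then obtain c where c: "0 < ereal c" "ereal c < liminf (\<lambda>n. ereal (d (k n) (\<phi> n g) \<one>\<^bsub>\<G> (k n)\<^esub>))"
      using ereal_dense2 by blast
    have "\<forall>\<^sub>F n in sequentially. ereal c < ereal (d (k n) (\<phi> n g) \<one>\<^bsub>\<G> (k n)\<^esub>)"
      by (rule less_LiminfD[OF c(2)])
    moreover have "\<forall>\<^sub>F n in sequentially. d (k n) (\<phi> n g) (\<psi> n g) < c"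
      using c(1) by (intro order_tendstoD(2)[OF l[OF g(1)]]) simp
    ultimately show "\<forall>\<^sub>F n in sequentially. \<psi> n g \<noteq> \<one>\<^bsub>\<G> (k n)\<^esub>"
      by eventually_elim auto
  qed
qed

text \<open>Deleting one point (or one dimension) from large indecomposable partial homomorphisms
  gives an approximate homomorphism, which stability corrects.\<close>

lemma stable_deletion:
  fixes \<G> :: "nat \<Rightarrow> 'c monoid"
  assumes grp: "\<And>k. k > 0 \<Longrightarrow> group (\<G> k)"
    and red: "\<And>m x. \<lbrakk>m \<ge> 2; x \<in> carrier (\<G> m)\<rbrakk> \<Longrightarrow> red m x \<in> carrier (\<G> (m - 1))"
    and red_mult: "\<And>m x y. \<lbrakk>m \<ge> 2; x \<in> carrier (\<G> m); y \<in> carrier (\<G> m)\<rbrakk> \<Longrightarrow>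
        \<bar>d (m - 1) (red m (x \<otimes>\<^bsub>\<G> m\<^esub> y)) (red m x \<otimes>\<^bsub>\<G> (m - 1)\<^esub> red m y)\<bar> \<le> \<beta> m"
    and \<beta>: "\<beta> \<longlonglongrightarrow> 0"
    and large: "\<And>R M. \<exists>m>M. \<exists>\<sigma>. local_rep R (\<G> m) \<sigma> \<and> Irr m \<sigma>"
    and st: "locally_stable G \<G> d" and e: "e > 0"
  shows "\<exists>m \<sigma> \<rho>. m > M \<and> m \<ge> 2 \<and> local_rep R (\<G> m) \<sigma> \<and> Irr m \<sigma> \<and>
    local_rep R (\<G> (m - 1)) \<rho> \<and> (\<forall>s\<in>S. d (m - 1) (red m (\<sigma> s)) (\<rho> s) < e)"
proof -
  \<comment> \<open>Relator length and degree grow together: the former makes \<open>ext\<close>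
    eventually multiplicative on every pair, the latter drives \<open>\<beta>\<close> to 0.\<close>
  have "\<exists>m \<sigma>. m > j + 2 \<and> local_rep j (\<G> m) \<sigma> \<and> Irr m \<sigma>" for j using large[of "j + 2" j] by blast
  then obtain m \<sigma> where m: "\<And>j. m j > j + 2" and l: "\<And>j. local_rep j (\<G> (m j)) (\<sigma> j)"
    and irr: "\<And>j. Irr (m j) (\<sigma> j)" by metis
  have m2: "m j \<ge> 2" "m j > 0" "m j - 1 > 0" for j using m[of j] by auto
  define \<phi> where "\<phi> j g = red (m j) (ext (\<G> (m j)) (\<sigma> j) g)" for j g
  have extc: "ext (\<G> (m j)) (\<sigma> j) g \<in> carrier (\<G> (m j))" if "g \<in> carrier G" for j g
    by (rule ext_closed[OF grp[OF m2(2)] l that])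
  have "filterlim m at_top sequentially"
  proof (rule filterlim_at_top_mono[OF filterlim_ident], intro always_eventually allI)
    show "j \<le> m j" for j using m[of j] by simp
  qed
  then have \<beta>m: "(\<lambda>j. \<beta> (m j)) \<longlonglongrightarrow> 0" by (rule filterlim_compose[OF \<beta>])
  have "approx_hom G \<G> d (\<lambda>j. m j - 1) \<phi>"
    unfolding approx_hom_def map_seq_def
  proof (intro conjI allI ballI)
    show "m j - 1 > 0" for j by (rule m2)
    show "\<phi> j \<in> carrier G \<rightarrow> carrier (\<G> (m j - 1))" for j
      using extc red[OF m2(1)] by (auto simp: \<phi>_def)
    fix g h assume gh: "g \<in> carrier G" "h \<in> carrier G"
    obtain R0 where R0: "\<And>R (M :: 'c monoid) \<tau>. R \<ge> R0 \<Longrightarrow> group M \<Longrightarrow> local_rep R M \<tau> \<Longrightarrow>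
      ext M \<tau> (g \<otimes> h) = ext M \<tau> g \<otimes>\<^bsub>M\<^esub> ext M \<tau> h" using ext_mult[OF gh] by blast
    show "(\<lambda>j. d (m j - 1) (\<phi> j (g \<otimes> h)) (\<phi> j g \<otimes>\<^bsub>\<G> (m j - 1)\<^esub> \<phi> j h)) \<longlonglongrightarrow> 0"
    proof (rule tendsto_rabs_zero_cancel, rule tendsto_sandwich[OF _ _ tendsto_const \<beta>m])
      show "\<forall>\<^sub>F j in sequentially. \<bar>d (m j - 1) (\<phi> j (g \<otimes> h)) (\<phi> j g \<otimes>\<^bsub>\<G> (m j - 1)\<^esub> \<phi> j h)\<bar> \<le> \<beta> (m j)"
      proof (rule eventually_sequentiallyI[of R0])
        fix j assume "R0 \<le> j"
        from R0[OF this grp[OF m2(2)] l]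
        show "\<bar>d (m j - 1) (\<phi> j (g \<otimes> h)) (\<phi> j g \<otimes>\<^bsub>\<G> (m j - 1)\<^esub> \<phi> j h)\<bar> \<le> \<beta> (m j)"
          using red_mult[OF m2(1) extc[OF gh(1)] extc[OF gh(2)]] by (simp only: \<phi>_def)
      qed
    qed simp
  qed
  then obtain \<psi> where ph: "partial_hom G \<G> (\<lambda>j. m j - 1) \<psi>"
    and close: "\<And>g. g \<in> carrier G \<Longrightarrow> (\<lambda>j. d (m j - 1) (\<phi> j g) (\<psi> j g)) \<longlonglongrightarrow> 0"
    using st unfolding locally_stable_def by blast
  obtain R1 where R1: "\<And>R (M :: 'c monoid) \<tau> s. R \<ge> R1 \<Longrightarrow> group M \<Longrightarrow> local_rep R M \<tau> \<Longrightarrow>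
      s \<in> S \<Longrightarrow> ext M \<tau> s = \<tau> s" using ext_generator by blast
  have "\<forall>\<^sub>F j in sequentially. local_rep R (\<G> (m j - 1)) (\<psi> j)"
    by (rule partial_hom_local_rep(1)[OF grp ph])
  moreover have "\<forall>\<^sub>F j in sequentially. \<forall>s\<in>S. d (m j - 1) (\<phi> j s) (\<psi> j s) < e"
    using S_carrier by (intro eventually_ball_finite S_finite ballI order_tendstoD(2)[OF close _] e) auto
  moreover have "\<forall>\<^sub>F j in sequentially. j \<ge> R + M + R1" by (rule eventually_ge_at_top)
  ultimately have "\<forall>\<^sub>F j in sequentially. local_rep R (\<G> (m j - 1)) (\<psi> j) \<and>
      (\<forall>s\<in>S. d (m j - 1) (\<phi> j s) (\<psi> j s) < e) \<and> j \<ge> R + M + R1"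
    by eventually_elim blast
  then obtain j where j: "local_rep R (\<G> (m j - 1)) (\<psi> j)" "\<And>s. s \<in> S \<Longrightarrow> d (m j - 1) (\<phi> j s) (\<psi> j s) < e"
      "j \<ge> R + M + R1"
    unfolding eventually_sequentially by blast
  show ?thesis
  proof (intro exI conjI ballI)
    show "m j \<ge> 2" "Irr (m j) (\<sigma> j)" "local_rep R (\<G> (m j - 1)) (\<psi> j)" by (rule m2 irr j)+
    show "m j > M" using m[of j] j(3) by simp
    show "local_rep R (\<G> (m j)) (\<sigma> j)" using l j(3) by (rule local_rep_mono[OF _ order_trans[rotated]]) simp
    fix s assume s: "s \<in> S"
    have "ext (\<G> (m j)) (\<sigma> j) s = \<sigma> j s" by (rule R1[OF _ grp[OF m2(2)] l s]) (use j(3) in simp)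
    then show "d (m j - 1) (red (m j) (\<sigma> j s)) (\<psi> j s) < e" using j(2)[OF s] by (simp only: \<phi>_def)
  qed
qed

end

text \<open>The first-return permutation: the preimage of \<open>m\<close> is sent to
  \<open>p m\<close>, and \<open>m\<close> becomes a fixed point, cut out of its cycle.\<close>

definition perm_red :: "nat \<Rightarrow> (nat \<Rightarrow> nat) \<Rightarrow> nat \<Rightarrow> nat" where
  "perm_red m p = Transposition.transpose m (p m) \<circ> p"

lemma perm_red_permutes:
  assumes "m \<ge> 2" "p permutes {1..m}"
  shows "perm_red m p permutes {1..m - 1}"
proof -
  have "p m \<in> {1..m}" unfolding permutes_in_image[OF assms(2)] using assms(1) by simp
  then have "perm_red m p permutes {1..m}"
    unfolding perm_red_def using assms by (intro permutes_compose permutes_swap_id) auto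
  moreover have "perm_red m p m = m" by (simp add: perm_red_def)
  moreover have "x = m" if "x \<in> {1..m}" "x \<notin> {1..m - 1}" for x using that by auto
  ultimately show ?thesis unfolding permutes_def by metis
qed

lemma perm_red_eq:
  assumes "p permutes {1..m}" "i \<noteq> m" "p i \<noteq> m"
  shows "perm_red m p i = p i"
proof -
  have "p i \<noteq> p m" using permutes_inj[OF assms(1)] assms(2) by (auto dest: injD)
  then show ?thesis using assms by (simp add: perm_red_def)
qed

lemma card_perm_preimage:
  assumes "p permutes A" shows "finite {i. p i = (m :: nat)}" "card {i. p i = m} \<le> 1"
proof -
  have "{i. p i = m} = {inv' p m}"
    using permutes_inverses[OF assms] by auto
  then show "finite {i. p i = m}" "card {i. p i = m} \<le> 1" by auto
qed

text \<open>Both sides agree unless the path of \<open>i\<close> under \<open>q\<close> and then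
  \<open>p\<close> meets \<open>m\<close>, which happens for at most two points.\<close>

lemma perm_red_mult:
  assumes "m \<ge> 2" "p permutes {1..m}" "q permutes {1..m}"
  shows "\<bar>hamming_dist (m - 1) (perm_red m (p \<circ> q)) (perm_red m p \<circ> perm_red m q)\<bar> \<le> 2 / real (m - 1)"
proof -
  let ?D = "{i \<in> {1..m - 1}. perm_red m (p \<circ> q) i \<noteq> (perm_red m p \<circ> perm_red m q) i}"
  have pq: "(p \<circ> q) permutes {1..m}" using assms by (intro permutes_compose)
  have "?D \<subseteq> {i. q i = m} \<union> {i. (p \<circ> q) i = m}"
  proof
    fix i assume i: "i \<in> ?D"
    show "i \<in> {i. q i = m} \<union> {i. (p \<circ> q) i = m}"
    proof (rule ccontr)
      assume n: "i \<notin> {i. q i = m} \<union> {i. (p \<circ> q) i = m}"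
      have "i \<noteq> m" using i assms(1) by auto
      have "perm_red m (p \<circ> q) i = (p \<circ> q) i"
        by (rule perm_red_eq[OF pq \<open>i \<noteq> m\<close>]) (use n in simp)
      moreover have "perm_red m q i = q i"
        by (rule perm_red_eq[OF assms(3) \<open>i \<noteq> m\<close>]) (use n in simp)
      moreover have "perm_red m p (q i) = p (q i)" using n by (intro perm_red_eq assms) auto
      ultimately show False using i by simp
    qed
  qed
  then have "card ?D \<le> card ({i. q i = m} \<union> {i. (p \<circ> q) i = m})"
    by (intro card_mono finite_UnI card_perm_preimage[OF assms(3)] card_perm_preimage[OF pq])
  also have "\<dots> \<le> card {i. q i = m} + card {i. (p \<circ> q) i = m}" by (rule card_Un_le)
  also have "\<dots> \<le> 1 + 1" by (intro add_mono card_perm_preimage[OF assms(3)] card_perm_preimage[OF pq])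
  finally have "real (card ?D) \<le> 2" by simp
  then show ?thesis by (simp add: hamming_dist_def divide_right_mono)
qed

text \<open>Permutations act on \<open>{1..m}\<close> while matrix indices start at 0, hence the
  shifts by \<open>Suc\<close>.\<close>

definition perm_mat :: "nat \<Rightarrow> (nat \<Rightarrow> nat) \<Rightarrow> complex mat" where
  "perm_mat m p = mat m m (\<lambda>(i, j). if Suc i = p (Suc j) then 1 else 0)"

lemma perm_mat_carrier [simp]: "perm_mat m p \<in> carrier_mat m m"
  by (simp add: perm_mat_def)

lemma perm_mat_mult_left:
  assumes p: "p permutes {1..m}" and X: "X \<in> carrier_mat m n" and ij: "i < m" "j < n"
  shows "(perm_mat m p * X) $$ (p (Suc i) - 1, j) = X $$ (i, j)"
proof -
  have pi: "p (Suc i) \<in> {1..m}" unfolding permutes_in_image[OF p] using ij by simp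
  have "(perm_mat m p * X) $$ (p (Suc i) - 1, j) =
      (\<Sum>k<m. perm_mat m p $$ (p (Suc i) - 1, k) * X $$ (k, j))"
    by (rule mult_mat_index[OF perm_mat_carrier X]) (use pi ij in auto)
  also have "\<dots> = (\<Sum>k<m. if k = i then X $$ (k, j) else 0)"
  proof (rule sum.cong[OF refl])
    fix k assume "k \<in> {..<m}"
    moreover have "p (Suc i) = p (Suc k) \<longleftrightarrow> k = i" using permutes_inj[OF p] by (auto dest: injD)
    moreover have "p (Suc i) - 1 < m" "Suc (p (Suc i) - 1) = p (Suc i)" using pi by auto
    ultimately show "perm_mat m p $$ (p (Suc i) - 1, k) * X $$ (k, j) = (if k = i then X $$ (k, j) else 0)"
      by (simp add: perm_mat_def del: One_nat_def)
  qed
  finally show ?thesis using ij by simp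
qed

lemma perm_mat_mult_right:
  assumes p: "p permutes {1..n}" and X: "X \<in> carrier_mat m n" and ij: "i < m" "j < n"
  shows "(X * perm_mat n p) $$ (i, j) = X $$ (i, p (Suc j) - 1)"
proof -
  have pj: "p (Suc j) \<in> {1..n}" unfolding permutes_in_image[OF p] using ij by simp
  have "(X * perm_mat n p) $$ (i, j) = (\<Sum>k<n. X $$ (i, k) * perm_mat n p $$ (k, j))"
    by (rule mult_mat_index[OF X perm_mat_carrier ij])
  also have "\<dots> = (\<Sum>k<n. if k = p (Suc j) - 1 then X $$ (i, k) else 0)"
    by (rule sum.cong[OF refl]) (use pj ij in \<open>auto simp: perm_mat_def\<close>)
  finally show ?thesis using pj by (simp add: less_diff_conv2)
qed

lemma perm_mat_compose:
  assumes p: "p permutes {1..m}" and q: "q permutes {1..m}"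
  shows "perm_mat m (p \<circ> q) = perm_mat m p * perm_mat m q"
proof (rule eq_matI)
  fix i j assume "i < dim_row (perm_mat m p * perm_mat m q)" "j < dim_col (perm_mat m p * perm_mat m q)"
  then have ij: "i < m" "j < m" by (auto simp: perm_mat_def)
  have qj: "q (Suc j) \<in> {1..m}" unfolding permutes_in_image[OF q] using ij by simp
  have "(perm_mat m p * perm_mat m q) $$ (i, j) = perm_mat m p $$ (i, q (Suc j) - 1)"
    by (rule perm_mat_mult_right[OF q perm_mat_carrier ij])
  also have "\<dots> = perm_mat m (p \<circ> q) $$ (i, j)" using ij qj by (auto simp: perm_mat_def)
  finally show "perm_mat m (p \<circ> q) $$ (i, j) = (perm_mat m p * perm_mat m q) $$ (i, j)" by simp
qed (auto simp: perm_mat_def)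

lemma perm_mat_id: "perm_mat m id = 1\<^sub>m m"
  by (rule eq_matI) (auto simp: perm_mat_def)

lemma perm_mat_unitary:
  assumes p: "p permutes {1..m}"
  shows "perm_mat m p \<in> carrier (unitary_group m)"
proof (rule unitaryI)
  have "mat_adjoint (perm_mat m p) = perm_mat m (inv' p)"
  proof (rule eq_matI)
    fix i j assume "i < dim_row (perm_mat m (inv' p))" "j < dim_col (perm_mat m (inv' p))"
    then have ij: "i < m" "j < m" by (auto simp: perm_mat_def)
    have "Suc j = p (Suc i) \<longleftrightarrow> Suc i = inv' p (Suc j)" using permutes_inverses[OF p] by metis
    then show "mat_adjoint (perm_mat m p) $$ (i, j) = perm_mat m (inv' p) $$ (i, j)"
      using ij by (auto simp: perm_mat_def)
  qed (auto simp: perm_mat_def)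
  then show "mat_adjoint (perm_mat m p) * perm_mat m p = 1\<^sub>m m"
    by (simp add: perm_mat_compose[OF permutes_inv[OF p] p, symmetric] permutes_inv_o(2)[OF p] perm_mat_id perm_mat_id[unfolded id_def])
qed simp

context kazhdan_gap
begin

lemma local_rep_perm_mat:
  assumes "local_rep R (sym_group m) \<sigma>"
  shows "local_rep R (unitary_group m) (\<lambda>s. perm_mat m (\<sigma> s))"
proof -
  have perm: "\<sigma> s permutes {1..m}" if "s \<in> S" for s
    using local_rep_closed[OF assms that] by (simp add: sym_group_carrier)
  have wd_eq: "wd (unitary_group m) (\<lambda>s. perm_mat m (\<sigma> s)) w = perm_mat m (wd (sym_group m) \<sigma> w)"
    if "set w \<subseteq> S" for w
    using that
  proof (induction w)
    case Nil
    show ?case by (simp add: perm_mat_id perm_mat_id[unfolded id_def] sym_group_one unitary_group_simps(3))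
  next
    case (Cons s w)
    then have "wd (sym_group m) \<sigma> w permutes {1..m}"
      using local_wd_closed[OF sym_group_is_group assms, of w] by (simp add: sym_group_carrier)
    then have "perm_mat m (\<sigma> s \<circ> wd (sym_group m) \<sigma> w) = perm_mat m (\<sigma> s) * perm_mat m (wd (sym_group m) \<sigma> w)"
      using perm[of s] Cons.prems by (intro perm_mat_compose) auto
    moreover have "wd (unitary_group m) (\<lambda>s. perm_mat m (\<sigma> s)) w = perm_mat m (wd (sym_group m) \<sigma> w)"
      using Cons by simp
    ultimately show ?case by (simp only: wd_Cons sym_group_mult unitary_group_simps(2))
  qed
  show ?thesis
    unfolding local_rep_def
  proof (intro conjI ballI allI impI)
    show "perm_mat m (\<sigma> s) \<in> carrier (unitary_group m)" if "s \<in> S" for s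
      by (rule perm_mat_unitary[OF perm[OF that]])
    fix w assume w: "set w \<subseteq> S \<and> length w \<le> R \<and> val w = \<one>"
    then have "wd (sym_group m) \<sigma> w = \<one>\<^bsub>sym_group m\<^esub>" using assms unfolding local_rep_def by blast
    then show "wd (unitary_group m) (\<lambda>s. perm_mat m (\<sigma> s)) w = \<one>\<^bsub>unitary_group m\<^esub>"
      using w by (simp add: wd_eq perm_mat_id perm_mat_id[unfolded id_def] sym_group_one unitary_group_simps(3))
  qed
qed

definition transitive_rep :: "nat \<Rightarrow> ('a \<Rightarrow> nat \<Rightarrow> nat) \<Rightarrow> bool" where
  "transitive_rep m \<sigma> \<longleftrightarrow> (\<forall>A\<subseteq>{1..m}. (\<forall>s\<in>S. \<sigma> s ` A \<subseteq> A) \<longrightarrow> A = {} \<or> A = {1..m})"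

end

definition incl_mat :: "nat \<Rightarrow> complex mat" where
  "incl_mat m = mat m (m - 1) (\<lambda>(i, j). if i = j then 1 else 0)"

lemma incl_mat_carrier [simp]: "incl_mat m \<in> carrier_mat m (m - 1)"
  by (simp add: incl_mat_def)

text \<open>Column by column: where \<open>p\<close> and \<open>q\<close> disagree the column is a
  difference of two distinct basis vectors, of squared norm 2; elsewhere it vanishes.\<close>

lemma hs2_perm_incl:
  assumes "m \<ge> 2" and p: "p permutes {1..m}" and q: "q permutes {1..m - 1}"
  shows "hs2 (perm_mat m p * incl_mat m - incl_mat m * perm_mat (m - 1) q) \<le>
    2 * real (card {i \<in> {1..m - 1}. p i \<noteq> q i})"
proof -
  let ?Z = "perm_mat m p * incl_mat m - incl_mat m * perm_mat (m - 1) q"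
  have c: "perm_mat m p * incl_mat m \<in> carrier_mat m (m - 1)"
    "incl_mat m * perm_mat (m - 1) q \<in> carrier_mat m (m - 1)"
    by (rule mult_carrier_mat[OF perm_mat_carrier incl_mat_carrier], rule mult_carrier_mat[OF incl_mat_carrier perm_mat_carrier])
  have e1: "(perm_mat m p * incl_mat m) $$ (i, j) = (if Suc i = p (Suc j) then 1 else 0)"
    if "i < m" "j < m - 1" for i j
  proof -
    have "(perm_mat m p * incl_mat m) $$ (i, j) = (\<Sum>k<m. perm_mat m p $$ (i, k) * incl_mat m $$ (k, j))"
      by (rule mult_mat_index[OF perm_mat_carrier incl_mat_carrier that])
    also have "\<dots> = (\<Sum>k<m. if k = j then perm_mat m p $$ (i, k) else 0)"
      by (rule sum.cong[OF refl]) (use that in \<open>auto simp: incl_mat_def\<close>)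
    also have "\<dots> = perm_mat m p $$ (i, j)" using that by (subst sum.delta) auto
    also have "\<dots> = (if Suc i = p (Suc j) then 1 else 0)" using that by (simp add: perm_mat_def)
    finally show ?thesis .
  qed
  have e2: "(incl_mat m * perm_mat (m - 1) q) $$ (i, j) = (if Suc i = q (Suc j) then 1 else 0)"
    if "i < m" "j < m - 1" for i j
  proof -
    have "q (Suc j) \<in> {1..m - 1}" unfolding permutes_in_image[OF q] using that by simp
    then show ?thesis
      using perm_mat_mult_right[OF q incl_mat_carrier that] that by (auto simp: incl_mat_def)
  qed
  have col: "(\<Sum>i<m. (cmod (?Z $$ (i, j)))\<^sup>2) \<le> (if p (Suc j) \<noteq> q (Suc j) then 2 else 0)" if j: "j < m - 1" for j
  proof -
    define z where "z i = ?Z $$ (i, j)" for i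
    have Z: "z i = (if Suc i = p (Suc j) then 1 else 0) - (if Suc i = q (Suc j) then 1 else 0)"
      if i: "i < m" for i
    proof -
      have "z i = (perm_mat m p * incl_mat m) $$ (i, j) - (incl_mat m * perm_mat (m - 1) q) $$ (i, j)"
        unfolding z_def by (rule index_minus_mat(1)) (simp_all only: carrier_matD[OF c(2)] i j)
      then show ?thesis by (simp only: e1[OF i j] e2[OF i j])
    qed
    have "(\<Sum>i<m. (cmod (z i))\<^sup>2) \<le> (if p (Suc j) \<noteq> q (Suc j) then 2 else 0)"
    proof (cases "p (Suc j) = q (Suc j)")
      case True
      have "z i = 0" if "i < m" for i unfolding Z[OF that] True by simp
      then show ?thesis using True by simp
    next
      case False
      have "(\<Sum>i<m. (cmod (z i))\<^sup>2) \<le>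
          (\<Sum>i<m. (if i = p (Suc j) - 1 then 1 else 0) + (if i = q (Suc j) - 1 then 1 else 0))"
      proof (rule sum_mono)
        fix i assume "i \<in> {..<m}"
        then have "i < m" by simp
        show "(cmod (z i))\<^sup>2 \<le>
          (if i = p (Suc j) - 1 then 1 else 0) + (if i = q (Suc j) - 1 then 1 else 0)"
          unfolding Z[OF \<open>i < m\<close>] using False by auto
      qed
      also have "\<dots> \<le> 1 + 1" unfolding sum.distrib by (intro add_mono) (simp_all add: sum.delta)
      finally show ?thesis using False by simp
    qed
    then show ?thesis by (simp only: z_def)
  qed
  have "hs2 ?Z = (\<Sum>i<m. \<Sum>j<m - 1. (cmod (?Z $$ (i, j)))\<^sup>2)"
    unfolding hs2_def carrier_matD[OF minus_carrier_mat[OF c(2)]] by (rule refl)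
  also have "\<dots> = (\<Sum>j<m - 1. \<Sum>i<m. (cmod (?Z $$ (i, j)))\<^sup>2)" by (rule sum.swap)
  also have "\<dots> \<le> (\<Sum>j<m - 1. if p (Suc j) \<noteq> q (Suc j) then 2 else 0)" by (intro sum_mono col) simp
  also have "\<dots> = (\<Sum>j\<in>{1..m - 1}. if p j \<noteq> q j then 2 else 0)"
    by (rule sum.reindex_bij_witness[of _ "\<lambda>j. j - 1" Suc]) auto
  also have "\<dots> = 2 * real (card {i \<in> {1..m - 1}. p i \<noteq> q i})"
    by (subst sum.inter_filter[symmetric]) auto
  finally show ?thesis .
qed

text \<open>The summand 1 accounts for the point that \<open>p\<close> sends to \<open>m\<close>; at
  all other points below \<open>m\<close> the permutation and its reduction agree.\<close>

lemma card_hamming_le: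
  assumes "m \<ge> 2" and p: "p permutes {1..m}" and h: "hamming_dist (m - 1) (perm_red m p) q < e"
  shows "real (card {i \<in> {1..m - 1}. p i \<noteq> q i}) \<le> 1 + e * real (m - 1)"
proof -
  let ?E = "{i \<in> {1..m - 1}. perm_red m p i \<noteq> q i}"
  have "{i \<in> {1..m - 1}. p i \<noteq> q i} \<subseteq> {i. p i = m} \<union> ?E"
  proof
    fix i assume i: "i \<in> {i \<in> {1..m - 1}. p i \<noteq> q i}"
    show "i \<in> {i. p i = m} \<union> ?E"
    proof (cases "p i = m")
      case False
      have "i \<noteq> m" using i assms(1) by auto
      then have "perm_red m p i = p i" using False by (intro perm_red_eq[OF p])
      then show ?thesis using i by auto
    qed simp
  qed
  then have "card {i \<in> {1..m - 1}. p i \<noteq> q i} \<le> card ({i. p i = m} \<union> ?E)"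
    by (intro card_mono finite_UnI card_perm_preimage[OF p]) auto
  also have "\<dots> \<le> card {i. p i = m} + card ?E" by (rule card_Un_le)
  also have "\<dots> \<le> 1 + card ?E" using card_perm_preimage(2)[OF p, of m] by simp
  finally have "real (card {i \<in> {1..m - 1}. p i \<noteq> q i}) \<le> 1 + real (card ?E)" by simp
  moreover have "real (card ?E) < e * real (m - 1)"
    using h assms(1) by (simp add: hamming_dist_def divide_less_eq)
  ultimately show ?thesis by linarith
qed

text \<open>If \<open>T\<close> is close to the inclusion, then the pairs at which its entry is close to 1 form an
  invariant relation that is mostly the diagonal. The points it matches one to one form an
  invariant set, hence everything, which embeds \<open>m\<close> points into \<open>m - 1\<close> points.\<close>

lemma (in kazhdan_gap) transitive_intertwiner_far:
  assumes m: "m \<ge> 2" and \<sigma>: "\<And>s. s \<in> S \<Longrightarrow> \<sigma> s permutes {1..m}" and \<rho>: "\<And>s. s \<in> S \<Longrightarrow> \<rho> s permutes {1..m - 1}"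
    and tr: "transitive_rep m \<sigma>" and T: "T \<in> carrier_mat m (m - 1)"
    and intw: "\<And>s. s \<in> S \<Longrightarrow> perm_mat m (\<sigma> s) * T = T * perm_mat (m - 1) (\<rho> s)"
  shows "real (m - 1) \<le> 8 * hs2 (incl_mat m - T)"
proof (rule ccontr)
  assume small: "\<not> ?thesis"
  \<comment> \<open>An entry closer than 1/2 to 1 is at least 1/2 away from 0, so every pair on
    which \<open>A\<close> differs from the diagonal costs at least 1/4 in
    \<open>hs2\<close>.\<close>
  define A where "A = {(y, x). cmod (T $$ (y - 1, x - 1) - 1) < 1 / 2}"
  let ?Y = "{1..m}" and ?X = "{1..m - 1}"
  \<comment> \<open>An intertwiner of permutation matrices is constant on orbits of pairs.\<close>
  have Ainv: "(\<sigma> s y, \<rho> s x) \<in> A \<longleftrightarrow> (y, x) \<in> A" if s: "s \<in> S" and yx: "y \<in> ?Y" "x \<in> ?X" for s y x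
  proof -
    have y': "\<sigma> s y \<in> ?Y" unfolding permutes_in_image[OF \<sigma>[OF s]] using yx by simp
    have ij: "y - 1 < m" "x - 1 < m - 1" "Suc (y - 1) = y" "Suc (x - 1) = x" "\<sigma> s y - 1 < m" using yx y' by auto
    have "T $$ (y - 1, x - 1) = (perm_mat m (\<sigma> s) * T) $$ (\<sigma> s y - 1, x - 1)"
      using perm_mat_mult_left[OF \<sigma>[OF s] T ij(1,2)] ij(3) by simp
    also have "\<dots> = (T * perm_mat (m - 1) (\<rho> s)) $$ (\<sigma> s y - 1, x - 1)" by (simp only: intw[OF s])
    also have "\<dots> = T $$ (\<sigma> s y - 1, \<rho> s x - 1)"
      using perm_mat_mult_right[OF \<rho>[OF s] T ij(5,2)] ij(4) by simp
    finally show ?thesis by (simp add: A_def)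
  qed
  define Bad where "Bad = {(y, x) \<in> ?Y \<times> ?X. (y, x) \<in> A \<longleftrightarrow> y \<noteq> x}"
  have Badf: "finite Bad" unfolding Bad_def by (rule finite_subset[of _ "?Y \<times> ?X"]) auto
  have "real (card Bad) * (1 / 4) \<le> hs2 (incl_mat m - T)"
  proof -
    have "real (card Bad) * (1 / 4) = (\<Sum>(y, x)\<in>Bad. 1 / 4)" by simp
    also have "\<dots> \<le> (\<Sum>(y, x)\<in>Bad. (cmod ((incl_mat m - T) $$ (y - 1, x - 1)))\<^sup>2)"
    proof (rule sum_mono, clarify)
      fix y x assume b: "(y, x) \<in> Bad"
      then have ij: "y - 1 < m" "x - 1 < m - 1" and eq: "y - 1 = x - 1 \<longleftrightarrow> y = x" by (auto simp: Bad_def)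
      have e: "(incl_mat m - T) $$ (y - 1, x - 1) = (if y = x then 1 else 0) - T $$ (y - 1, x - 1)"
        using ij eq carrier_matD[OF T] by (simp add: incl_mat_def)
      have "1 / 2 \<le> cmod ((incl_mat m - T) $$ (y - 1, x - 1))"
      proof (cases "y = x")
        case True
        then show ?thesis using b e by (auto simp: Bad_def A_def not_less norm_minus_commute)
      next
        case False
        then have "cmod (T $$ (y - 1, x - 1) - 1) < 1 / 2" using b by (auto simp: Bad_def A_def)
        then have "1 / 2 \<le> cmod (T $$ (y - 1, x - 1))"
          using norm_triangle_ineq2[of 1 "1 - T $$ (y - 1, x - 1)"] by (simp add: norm_minus_commute)
        then show ?thesis using e False by simp
      qed
      then have "(1 / 2)\<^sup>2 \<le> (cmod ((incl_mat m - T) $$ (y - 1, x - 1)))\<^sup>2" by (intro power_mono) auto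
      then show "1 / 4 \<le> (cmod ((incl_mat m - T) $$ (y - 1, x - 1)))\<^sup>2" by (simp add: power2_eq_square)
    qed
    also have "\<dots> \<le> (\<Sum>(y, x)\<in>?Y \<times> ?X. (cmod ((incl_mat m - T) $$ (y - 1, x - 1)))\<^sup>2)"
      by (rule sum_mono2) (auto simp: Bad_def)
    also have "\<dots> = (\<Sum>y\<in>?Y. \<Sum>x\<in>?X. (cmod ((incl_mat m - T) $$ (y - 1, x - 1)))\<^sup>2)"
      by (rule sum.cartesian_product[symmetric])
    also have "\<dots> = (\<Sum>i<m. \<Sum>j<m - 1. (cmod ((incl_mat m - T) $$ (i, j)))\<^sup>2)"
      by (rule sum.reindex_bij_witness[of _ Suc "\<lambda>j. j - 1"])
        (auto intro!: sum.reindex_bij_witness[of _ "\<lambda>j. j - 1" Suc])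
    also have "\<dots> = hs2 (incl_mat m - T)"
      unfolding hs2_def carrier_matD[OF minus_carrier_mat[OF T]] by (rule refl)
    finally show ?thesis .
  qed
  \<comment> \<open>The constant 8 is the inverse cost 4 of a bad pair times 2, because one bad pair
    can spoil one row index and one column index.\<close>
  then have cB: "2 * card Bad < m - 1" using small m by linarith
  define Z where "Z = {y \<in> ?Y. \<exists>x\<in>?X. (\<forall>x'\<in>?X. (y, x') \<in> A \<longleftrightarrow> x' = x) \<and> (\<forall>y'\<in>?Y. (y', x) \<in> A \<longleftrightarrow> y' = y)}"
  have "Z \<noteq> {}"
  proof
    assume "Z = {}"
    have "?X \<subseteq> fst ` Bad \<union> snd ` Bad"
    proof
      fix j assume j: "j \<in> ?X"
      show "j \<in> fst ` Bad \<union> snd ` Bad"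
      proof (rule ccontr)
        assume n: "j \<notin> fst ` Bad \<union> snd ` Bad"
        have jY: "j \<in> ?Y" using j by auto
        have "(j, x') \<in> A \<longleftrightarrow> x' = j" if "x' \<in> ?X" for x'
        proof -
          have "(j, x') \<notin> Bad" using n by force
          then show ?thesis using that jY by (auto simp: Bad_def)
        qed
        moreover have "(y', j) \<in> A \<longleftrightarrow> y' = j" if "y' \<in> ?Y" for y'
        proof -
          have "(y', j) \<notin> Bad" using n by force
          then show ?thesis using that j by (auto simp: Bad_def)
        qed
        ultimately have "j \<in> Z" using j jY unfolding Z_def by blast
        then show False using \<open>Z = {}\<close> by simp
      qed
    qed
    then have "card ?X \<le> card (fst ` Bad \<union> snd ` Bad)" using Badf by (intro card_mono) auto
    also have "\<dots> \<le> card (fst ` Bad) + card (snd ` Bad)" by (rule card_Un_le)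
    also have "\<dots> \<le> card Bad + card Bad" by (intro add_mono card_image_le Badf)
    finally show False using cB by simp
  qed
  moreover have "\<sigma> s ` Z \<subseteq> Z" if s: "s \<in> S" for s
  proof
    fix y1 assume "y1 \<in> \<sigma> s ` Z"
    then obtain y where y: "y \<in> Z" "y1 = \<sigma> s y" by blast
    then obtain x where x: "y \<in> ?Y" "x \<in> ?X" "\<And>x'. x' \<in> ?X \<Longrightarrow> (y, x') \<in> A \<longleftrightarrow> x' = x"
      "\<And>y'. y' \<in> ?Y \<Longrightarrow> (y', x) \<in> A \<longleftrightarrow> y' = y" unfolding Z_def by blast
    have y1: "y1 \<in> ?Y" unfolding y(2) permutes_in_image[OF \<sigma>[OF s]] by (rule x(1))
    have x1: "\<rho> s x \<in> ?X" unfolding permutes_in_image[OF \<rho>[OF s]] by (rule x(2))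
    have 1: "(y1, x') \<in> A \<longleftrightarrow> x' = \<rho> s x" if x': "x' \<in> ?X" for x'
    proof -
      obtain x2 where x2: "x2 \<in> ?X" "x' = \<rho> s x2" using permutes_image[OF \<rho>[OF s]] x' by blast
      have "(y1, x') \<in> A \<longleftrightarrow> x2 = x" using Ainv[OF s x(1) x2(1)] x(3)[OF x2(1)] by (simp only: y(2) x2(2))
      also have "\<dots> \<longleftrightarrow> x' = \<rho> s x" using permutes_inj[OF \<rho>[OF s]] x2(2) by (auto dest: injD)
      finally show ?thesis .
    qed
    have 2: "(y', \<rho> s x) \<in> A \<longleftrightarrow> y' = y1" if y': "y' \<in> ?Y" for y'
    proof -
      obtain y2 where y2: "y2 \<in> ?Y" "y' = \<sigma> s y2" using permutes_image[OF \<sigma>[OF s]] y' by blast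
      have "(y', \<rho> s x) \<in> A \<longleftrightarrow> y2 = y" using Ainv[OF s y2(1) x(2)] x(4)[OF y2(1)] by (simp only: y2(2))
      also have "\<dots> \<longleftrightarrow> y' = y1" using permutes_inj[OF \<sigma>[OF s]] y2(2) y(2) by (auto dest: injD)
      finally show ?thesis .
    qed
    show "y1 \<in> Z" unfolding Z_def using y1 x1 1 2 by blast
  qed
  moreover have "Z \<subseteq> ?Y" by (auto simp: Z_def)
  ultimately have Z: "Z = ?Y" using tr unfolding transitive_rep_def by blast
  have "\<forall>y\<in>?Y. \<exists>x\<in>?X. (y, x) \<in> A \<and> (\<forall>y'\<in>?Y. (y', x) \<in> A \<longleftrightarrow> y' = y)"
    unfolding Z[symmetric] by (auto simp: Z_def)
  then obtain f where f: "\<And>y. y \<in> ?Y \<Longrightarrow> f y \<in> ?X" "\<And>y y'. y \<in> ?Y \<Longrightarrow> y' \<in> ?Y \<Longrightarrow> (y', f y) \<in> A \<longleftrightarrow> y' = y"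
    by metis
  have "inj_on f ?Y" by (rule inj_onI) (metis f(2))
  then have "card ?Y \<le> card ?X" by (rule card_inj_on_le) (use f(1) in auto)
  then show False using m by simp
qed

context kazhdan_gap
begin

lemma wd_sym_group: "wd (sym_group m) \<tau> w = wd (sym_group m') \<tau> w"
  by (simp add: wd_def sym_group_mult sym_group_one)

lemma wd_cong: "(\<And>s. s \<in> set w \<Longrightarrow> \<tau> s = \<tau>' s) \<Longrightarrow> wd M \<tau> w = wd M \<tau>' w"
  by (induction w) auto

text \<open>On orbits of at most \<open>M\<close> points there are only finitely many possible actions, so two
  fixed elements of the infinite group act alike on all of them.\<close>

lemma large_transitive:
  assumes inf: "infinite (carrier G)" and ph: "partial_hom G sym_group k \<psi>"
    and sep: "\<And>g. \<lbrakk>g \<in> carrier G; g \<noteq> \<one>\<rbrakk> \<Longrightarrow> \<forall>\<^sub>F n in sequentially. \<psi> n g \<noteq> \<one>\<^bsub>sym_group (k n)\<^esub>"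
  shows "\<exists>m>M. \<exists>\<sigma>. local_rep R (sym_group m) \<sigma> \<and> transitive_rep m \<sigma>"
proof -
  let ?P = "{p. p permutes {1..M}}"
  \<comment> \<open>All ways in which the generators can act on \<open>M\<close> points.
    \<open>F g\<close> tabulates the action of the chosen word for \<open>g\<close> under each of
    them, so \<open>F\<close> has finite range and cannot be injective on an infinite group.\<close>
  define Ty where "Ty = S \<rightarrow>\<^sub>E ?P"
  have Pf: "finite ?P" by (rule finite_permutations) simp
  have Tyf: "finite Ty" unfolding Ty_def by (intro finite_PiE S_finite Pf)
  define F where "F g = restrict (\<lambda>\<tau>. wd (sym_group M) \<tau> (wordof g)) Ty" for g
  have Fin: "F g \<in> Ty \<rightarrow>\<^sub>E ?P" if g: "g \<in> carrier G" for g
  proof (rule PiE_I)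
    fix \<tau> assume "\<tau> \<in> Ty"
    then have "wd (sym_group M) \<tau> (wordof g) \<in> carrier (sym_group M)"
      using wordof(1)[OF g] by (intro monoid.wd_closed group.axioms(1) sym_group_is_group)
        (auto simp: Ty_def sym_group_carrier)
    then show "F g \<tau> \<in> ?P" using \<open>\<tau> \<in> Ty\<close> by (simp add: F_def sym_group_carrier)
  qed (simp add: F_def)
  have "finite (F ` carrier G)"
    by (rule finite_subset[of _ "Ty \<rightarrow>\<^sub>E ?P"]) (use Fin Tyf Pf in \<open>auto intro!: finite_PiE\<close>)
  then have "\<not> inj_on F (carrier G)" using inf finite_imageD by blast
  then obtain g h where gh: "g \<in> carrier G" "h \<in> carrier G" "F g = F h" "g \<noteq> h" by (auto simp: inj_on_def)
  have ne: "inv h \<otimes> g \<in> carrier G" "inv h \<otimes> g \<noteq> \<one>"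
  proof -
    show "inv h \<otimes> g \<in> carrier G" using gh by simp
    have "g = h \<otimes> (inv h \<otimes> g)" using gh by (simp add: m_assoc[symmetric])
    then show "inv h \<otimes> g \<noteq> \<one>" using gh by auto
  qed
  obtain R1 where R1: "\<And>R (M :: (nat \<Rightarrow> nat) monoid) \<tau>. R \<ge> R1 \<Longrightarrow> group M \<Longrightarrow> local_rep R M \<tau> \<Longrightarrow>
      ext M \<tau> (inv h \<otimes> g) = ext M \<tau> (inv h) \<otimes>\<^bsub>M\<^esub> ext M \<tau> g"
    using ext_mult[OF inv_closed[OF gh(2)] gh(1)] by blast
  obtain R2 where R2: "\<And>R (M :: (nat \<Rightarrow> nat) monoid) \<tau>. R \<ge> R2 \<Longrightarrow> group M \<Longrightarrow> local_rep R M \<tau> \<Longrightarrow>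
      ext M \<tau> (inv h) = inv\<^bsub>M\<^esub> (ext M \<tau> h)"
    using ext_inv[OF gh(2)] by blast
  define R' where "R' = R + R1 + R2 + 2"
  have grp: "group (sym_group j)" for j by (rule sym_group_is_group)
  have "\<forall>\<^sub>F n in sequentially. local_rep R' (sym_group (k n)) (\<psi> n)"
    by (rule partial_hom_local_rep(1)[OF grp ph])
  moreover have "\<forall>\<^sub>F n in sequentially. \<psi> n (inv h \<otimes> g) = ext (sym_group (k n)) (\<psi> n) (inv h \<otimes> g)"
    by (rule partial_hom_local_rep(2)[OF grp ph ne(1)])
  ultimately have "\<forall>\<^sub>F n in sequentially. local_rep R' (sym_group (k n)) (\<psi> n) \<and>
      ext (sym_group (k n)) (\<psi> n) (inv h \<otimes> g) \<noteq> \<one>\<^bsub>sym_group (k n)\<^esub>"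
    using sep[OF ne] by eventually_elim simp
  then obtain n where n: "local_rep R' (sym_group (k n)) (\<psi> n)"
      "ext (sym_group (k n)) (\<psi> n) (inv h \<otimes> g) \<noteq> \<one>\<^bsub>sym_group (k n)\<^esub>"
    unfolding eventually_sequentially by blast
  define K where "K = k n"
  define \<tau> where "\<tau> = \<psi> n"
  let ?w = "wd (sym_group K) \<tau>"
  have l: "local_rep R' (sym_group K) \<tau>" using n(1) by (simp add: K_def \<tau>_def)
  have wperm: "?w w permutes {1..K}" if "set w \<subseteq> S" for w
    using local_wd_closed[OF grp l that] by (simp add: sym_group_carrier)
  have wapp: "?w (u @ v) x = ?w u (?w v x)" if "set u \<subseteq> S" "set v \<subseteq> S" for u v x
    using local_wd_append[OF grp l that] by (simp add: sym_group_mult)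
  have tperm: "\<tau> s permutes {1..K}" if "s \<in> S" for s
    using local_rep_closed[OF l that] by (simp add: sym_group_carrier)
  have "?w (wordof g) \<noteq> ?w (wordof h)"
  proof
    assume "?w (wordof g) = ?w (wordof h)"
    then have "ext (sym_group K) \<tau> g = ext (sym_group K) \<tau> h" by (simp add: ext_def)
    moreover have "ext (sym_group K) \<tau> h \<in> carrier (sym_group K)" by (rule ext_closed[OF grp l gh(2)])
    ultimately have "ext (sym_group K) \<tau> (inv h \<otimes> g) = \<one>\<^bsub>sym_group K\<^esub>"
      using R1[OF _ grp l] R2[OF _ grp l] group.l_inv[OF grp] by (simp add: R'_def)
    then show False using n(2) by (simp add: K_def \<tau>_def)
  qed
  \<comment> \<open>The action on the orbit of a point at which the two words differ cannot be among
    the tabulated small ones, so this orbit is large.\<close>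
  then obtain i where i: "?w (wordof g) i \<noteq> ?w (wordof h) i" by blast
  have iK: "i \<in> {1..K}"
  proof (rule ccontr)
    assume "i \<notin> {1..K}"
    then show False
      using i permutes_not_in[OF wperm[OF wordof(1)[OF gh(1)]]] permutes_not_in[OF wperm[OF wordof(1)[OF gh(2)]]] by simp
  qed
  define Orb where "Orb = {?w w i |w. set w \<subseteq> S}"
  have Osub: "Orb \<subseteq> {1..K}"
  proof
    fix x assume "x \<in> Orb"
    then obtain w where w: "x = ?w w i" "set w \<subseteq> S" by (auto simp: Orb_def)
    show "x \<in> {1..K}" unfolding w(1) permutes_in_image[OF wperm[OF w(2)]] by (rule iK)
  qed
  then have Of: "finite Orb" by (rule finite_subset) simp
  have iO: "i \<in> Orb" unfolding Orb_def by (intro CollectI exI[of _ "[]"]) (simp add: sym_group_one)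
  have Oinv: "\<tau> s x \<in> Orb" if s: "s \<in> S" and x: "x \<in> Orb" for s x
  proof -
    obtain w where "x = ?w w i" "set w \<subseteq> S" using x by (auto simp: Orb_def)
    then show ?thesis unfolding Orb_def using s by (intro CollectI exI[of _ "s # w"]) (simp add: sym_group_mult)
  qed
  define m where "m = card Orb"
  obtain e where e: "bij_betw e {1..m} Orb"
    using ex_bij_betw_nat_finite_1[OF Of] by (auto simp: m_def)
  let ?e' = "inv_into {1..m} e"
  have ee': "e (?e' x) = x" "?e' x \<in> {1..m}" if "x \<in> Orb" for x
    using that e bij_betw_inv_into_right[OF e that] bij_betwE[OF bij_betw_inv_into[OF e]] by auto
  have e'e: "?e' (e x) = x" "e x \<in> Orb" if "x \<in> {1..m}" for x
    using bij_betw_inv_into_left[OF e that] bij_betwE[OF e] that by auto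
  define \<sigma> where "\<sigma> s = (\<lambda>x. if x \<in> {1..m} then ?e' (\<tau> s (e x)) else x)" for s
  have \<sigma>in: "\<sigma> s x \<in> {1..m} \<and> e (\<sigma> s x) = \<tau> s (e x)" if "s \<in> S" "x \<in> {1..m}" for s x
    using ee'[OF Oinv[OF that(1) e'e(2)[OF that(2)]]] that by (simp add: \<sigma>_def)
  have \<sigma>perm: "\<sigma> s permutes {1..m}" if s: "s \<in> S" for s
  proof (rule bij_imp_permutes)
    have "inj_on (\<sigma> s) {1..m}"
    proof (rule inj_onI)
      fix x y assume xy: "x \<in> {1..m}" "y \<in> {1..m}" "\<sigma> s x = \<sigma> s y"
      then have "\<tau> s (e x) = \<tau> s (e y)" using \<sigma>in[OF s] by metis
      then have "e x = e y" using permutes_inj[OF tperm[OF s]] by (auto dest: injD)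
      then show "x = y" using e'e xy by metis
    qed
    moreover have "\<sigma> s ` {1..m} \<subseteq> {1..m}" using \<sigma>in[OF s] by blast
    ultimately show "bij_betw (\<sigma> s) {1..m} {1..m}"
      by (simp add: bij_betw_def endo_inj_surj)
  next
    fix x assume "x \<notin> {1..m}"
    then show "\<sigma> s x = x" unfolding \<sigma>_def by (simp only: if_False)
  qed
  have \<sigma>w: "wd (sym_group m) \<sigma> w x \<in> {1..m} \<and> e (wd (sym_group m) \<sigma> w x) = ?w w (e x)"
    if "set w \<subseteq> S" "x \<in> {1..m}" for w x
    using that(1)
  proof (induction w)
    case (Cons s w)
    then show ?case using \<sigma>in[of s "wd (sym_group m) \<sigma> w x"] by (simp add: sym_group_mult)
  qed (use that(2) in \<open>simp add: sym_group_one\<close>)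
  have \<sigma>wperm: "wd (sym_group m) \<sigma> w permutes {1..m}" if "set w \<subseteq> S" for w
  proof -
    have "wd (sym_group m) \<sigma> w \<in> carrier (sym_group m)"
      using that \<sigma>perm by (intro monoid.wd_closed group.axioms(1) grp) (auto simp: sym_group_carrier)
    then show ?thesis by (simp add: sym_group_carrier)
  qed
  have mM: "m > M"
  proof (rule ccontr)
    assume "\<not> m > M"
    then have mM: "m \<le> M" by simp
    \<comment> \<open>An action on at most \<open>M\<close> points is extended to
      \<open>{1..M}\<close> by fixed points. Words keep their values, since composition does not
      depend on the degree.\<close>
    have "\<sigma> s permutes {1..M}" if "s \<in> S" for s
      by (rule permutes_subset[OF \<sigma>perm[OF that]]) (use mM in auto)
    then have Ty: "restrict \<sigma> S \<in> Ty" by (auto simp: Ty_def)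
    have eq: "wd (sym_group M) (restrict \<sigma> S) w = wd (sym_group m) \<sigma> w" if "set w \<subseteq> S" for w
    proof -
      have "wd (sym_group M) (restrict \<sigma> S) w = wd (sym_group M) \<sigma> w"
        using that by (intro wd_cong) auto
      also have "\<dots> = wd (sym_group m) \<sigma> w" by (rule wd_sym_group)
      finally show ?thesis .
    qed
    have "wd (sym_group M) (restrict \<sigma> S) (wordof g) = wd (sym_group M) (restrict \<sigma> S) (wordof h)"
      using fun_cong[OF gh(3), of "restrict \<sigma> S"] Ty by (simp add: F_def)
    then have "wd (sym_group m) \<sigma> (wordof g) = wd (sym_group m) \<sigma> (wordof h)"
      using eq wordof(1) gh by simp
    then have "?w (wordof g) (e (?e' i)) = ?w (wordof h) (e (?e' i))"
      using \<sigma>w[OF wordof(1)[OF gh(1)] ee'(2)[OF iO]] \<sigma>w[OF wordof(1)[OF gh(2)] ee'(2)[OF iO]] by metis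
    then show False using i ee'(1)[OF iO] by simp
  qed
  have "local_rep R (sym_group m) \<sigma>"
    unfolding local_rep_def
  proof (intro conjI ballI allI impI)
    show "\<sigma> s \<in> carrier (sym_group m)" if "s \<in> S" for s using \<sigma>perm[OF that] by (simp add: sym_group_carrier)
    fix w assume w: "set w \<subseteq> S \<and> length w \<le> R \<and> val w = \<one>"
    then have "?w w = id" using l unfolding local_rep_def R'_def by (simp add: sym_group_one)
    have "wd (sym_group m) \<sigma> w x = x" for x
    proof (cases "x \<in> {1..m}")
      case True
      then have "e (wd (sym_group m) \<sigma> w x) = e x" "wd (sym_group m) \<sigma> w x \<in> {1..m}"
        using \<sigma>w[of w x] w \<open>?w w = id\<close> by auto
      then show ?thesis using e'e True by metis
    next
      case False
      then show ?thesis using permutes_not_in[OF \<sigma>wperm] w by blast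
    qed
    then show "wd (sym_group m) \<sigma> w = \<one>\<^bsub>sym_group m\<^esub>" by (simp add: sym_group_one fun_eq_iff)
  qed
  moreover have "transitive_rep m \<sigma>"
    unfolding transitive_rep_def
  proof (intro allI impI)
    fix A assume A: "A \<subseteq> {1..m}" "\<forall>s\<in>S. \<sigma> s ` A \<subseteq> A"
    have wA: "wd (sym_group m) \<sigma> w a \<in> A" if "set w \<subseteq> S" "a \<in> A" for w a
      using that(1) by (induction w) (use A that in \<open>auto simp: sym_group_mult sym_group_one\<close>)
    show "A = {} \<or> A = {1..m}"
    proof (rule disjCI)
      assume "A \<noteq> {1..m}"
      show "A = {}"
      proof (rule ccontr)
        assume "A \<noteq> {}"
        then obtain a where a: "a \<in> A" by blast
        have am: "a \<in> {1..m}" using a A by auto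
        obtain w0 where w0: "e a = ?w w0 i" "set w0 \<subseteq> S" using e'e(2)[OF am] by (auto simp: Orb_def)
        \<comment> \<open>Words lead from the position of \<open>a\<close> back to the base point
          \<open>i\<close>, and from there to any other point of the orbit.\<close>
        have return_i: "?w (winv w0) (e a) = i"
        proof -
          have "?w (winv w0) = inv' (?w w0)"
            using local_wd_winv[OF grp l _ w0(2)] local_wd_closed[OF grp l w0(2)] by (simp add: R'_def)
          then show ?thesis using permutes_inverses(2)[OF wperm[OF w0(2)]] by (simp add: w0(1))
        qed
        have "{1..m} \<subseteq> A"
        proof
          fix x assume x: "x \<in> {1..m}"
          obtain w1 where w1: "e x = ?w w1 i" "set w1 \<subseteq> S" using e'e(2)[OF x] by (auto simp: Orb_def)
          have ws: "set (w1 @ winv w0) \<subseteq> S" "set (winv w0) \<subseteq> S" using w1 winv_props[OF w0(2)] by auto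
          have "e (wd (sym_group m) \<sigma> (w1 @ winv w0) a) = ?w (w1 @ winv w0) (e a)"
            using \<sigma>w[OF ws(1) am] by simp
          also have "\<dots> = e x" by (simp only: wapp[OF w1(2) ws(2)] return_i w1(1))
          finally have "wd (sym_group m) \<sigma> (w1 @ winv w0) a = x"
            using \<sigma>w[OF ws(1) am] e'e x by metis
          then show "x \<in> A" using wA[OF ws(1) a] by simp
        qed
        then show False using \<open>A \<noteq> {1..m}\<close> A by blast
      qed
    qed
  qed
  ultimately show ?thesis using mM by blast
qed

theorem sofic_not_locally_P_stable:
  assumes inf: "infinite (carrier G)" and cnt: "countable (carrier G)" and "sofic G"
  shows "\<not> locally_P_stable G"
proof
  assume "locally_P_stable G"
  then have st: "locally_stable G sym_group hamming_dist" by (simp add: locally_P_stable_def)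
  obtain k \<psi> where ph: "partial_hom G sym_group k \<psi>"
    and sep: "\<And>g. \<lbrakk>g \<in> carrier G; g \<noteq> \<one>\<rbrakk> \<Longrightarrow> \<forall>\<^sub>F n in sequentially. \<psi> n g \<noteq> \<one>\<^bsub>sym_group (k n)\<^esub>"
    using separating_partial_hom[OF assms(3)[unfolded sofic_def] st] by metis
  obtain R C where C: "C \<ge> 0" and near: "\<And>d d' \<sigma> \<rho> X. \<lbrakk>local_rep R (unitary_group d) \<sigma>;
      local_rep R (unitary_group d') \<rho>; X \<in> carrier_mat d d'\<rbrakk> \<Longrightarrow>
    \<exists>T\<in>carrier_mat d d'. (\<forall>s\<in>S. \<sigma> s * T = T * \<rho> s) \<and>
      hs2 (X - T) \<le> C * (\<Sum>s\<in>S. hs2 (\<sigma> s * X - X * \<rho> s))"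
  proof (rule intertwiner_near[OF cnt], goal_cases)
    case (1 R C)
    show ?case by (rule 1(1)[OF 1(2)]) (rule 1(3))
  qed
  \<comment> \<open>The 1 in \<open>C + 1\<close> keeps \<open>D\<close> positive when
    \<open>C\<close> is zero.\<close>
  define D where "D = (C + 1) * real (card S)"
  have D: "D > 0" using C card_S by (auto simp: D_def)
  \<comment> \<open>With this tolerance and the next choice of \<open>M\<close>, the intertwiner
    estimate is \<open>2 * D + real (m - 1) / 32\<close>, which is less than
    \<open>real (m - 1) / 16\<close>. That undercuts the value \<open>real (m - 1) / 8\<close>
    demanded by \<open>transitive_intertwiner_far\<close>.\<close>
  define e where "e = 1 / (64 * D)"
  have e: "e > 0" using D by (simp add: e_def)
  define M where "M = nat \<lceil>64 * D\<rceil> + 1"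
  have \<beta>: "(\<lambda>m. 2 / real (m - 1)) \<longlonglongrightarrow> 0"
  proof -
    have "(\<lambda>n. 2 * (1 / real n)) \<longlonglongrightarrow> 2 * 0" by (intro tendsto_mult tendsto_const lim_1_over_n)
    then have "(\<lambda>n. 2 / real (Suc n - 1)) \<longlonglongrightarrow> 0" by simp
    then show ?thesis by (subst (asm) filterlim_sequentially_Suc)
  qed
  have "\<exists>m \<sigma> \<rho>. m > M \<and> m \<ge> 2 \<and> local_rep R (sym_group m) \<sigma> \<and> transitive_rep m \<sigma> \<and>
    local_rep R (sym_group (m - 1)) \<rho> \<and> (\<forall>s\<in>S. hamming_dist (m - 1) (perm_red m (\<sigma> s)) (\<rho> s) < e)"
  proof (rule stable_deletion[where \<G> = sym_group and red = perm_red and d = hamming_dist and e = e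
        and M = M and R = R and Irr = transitive_rep, OF _ _ _ \<beta> _ st e])
    show "group (sym_group j)" for j by (rule sym_group_is_group)
    show "perm_red j x \<in> carrier (sym_group (j - 1))" if "j \<ge> 2" "x \<in> carrier (sym_group j)" for j x
      using perm_red_permutes that by (simp add: sym_group_carrier)
    show "\<bar>hamming_dist (j - 1) (perm_red j (x \<otimes>\<^bsub>sym_group j\<^esub> y))
        (perm_red j x \<otimes>\<^bsub>sym_group (j - 1)\<^esub> perm_red j y)\<bar> \<le> 2 / real (j - 1)"
      if "j \<ge> 2" "x \<in> carrier (sym_group j)" "y \<in> carrier (sym_group j)" for j x y
      using perm_red_mult[of j x y] that by (simp add: sym_group_carrier sym_group_mult)
    show "\<exists>m>M. \<exists>\<sigma>. local_rep R (sym_group m) \<sigma> \<and> transitive_rep m \<sigma>" for R M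
      by (rule large_transitive[OF inf ph sep])
  qed
  then obtain m \<sigma> \<rho> where m: "m > M" "m \<ge> 2" and \<sigma>: "local_rep R (sym_group m) \<sigma>" and tr: "transitive_rep m \<sigma>"
    and \<rho>: "local_rep R (sym_group (m - 1)) \<rho>"
    and close: "\<And>s. s \<in> S \<Longrightarrow> hamming_dist (m - 1) (perm_red m (\<sigma> s)) (\<rho> s) < e"
    by blast
  have perm: "\<sigma> s permutes {1..m}" "\<rho> s permutes {1..m - 1}" if "s \<in> S" for s
    using local_rep_closed[OF \<sigma> that] local_rep_closed[OF \<rho> that] by (auto simp: sym_group_carrier)
  obtain T where T: "T \<in> carrier_mat m (m - 1)"
    "\<And>s. s \<in> S \<Longrightarrow> perm_mat m (\<sigma> s) * T = T * perm_mat (m - 1) (\<rho> s)"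
    "hs2 (incl_mat m - T) \<le>
      C * (\<Sum>s\<in>S. hs2 (perm_mat m (\<sigma> s) * incl_mat m - incl_mat m * perm_mat (m - 1) (\<rho> s)))"
    using near[OF local_rep_perm_mat[OF \<sigma>] local_rep_perm_mat[OF \<rho>] incl_mat_carrier]
    by (elim bexE conjE) (rule that, assumption, erule (1) bspec, assumption)
  have each: "hs2 (perm_mat m (\<sigma> s) * incl_mat m - incl_mat m * perm_mat (m - 1) (\<rho> s)) \<le> 2 * (1 + e * real (m - 1))"
    if s: "s \<in> S" for s
    by (rule order_trans[OF hs2_perm_incl[OF m(2) perm[OF s]]], rule mult_left_mono,
        rule card_hamming_le[OF m(2) perm(1)[OF s] close[OF s]]) simp
  have "hs2 (incl_mat m - T) \<le> C * (\<Sum>s\<in>S. 2 * (1 + e * real (m - 1)))"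
    by (rule order_trans[OF T(3)]) (intro mult_left_mono sum_mono each C)
  also have "\<dots> = C * real (card S) * (2 * (1 + e * real (m - 1)))" by simp
  also have "\<dots> \<le> D * (2 * (1 + e * real (m - 1)))"
    using e card_S by (intro mult_right_mono) (auto simp: D_def distrib_right)
  also have "\<dots> = 2 * D + real (m - 1) / 32" using D by (simp add: e_def field_simps)
  finally have le: "hs2 (incl_mat m - T) \<le> 2 * D + real (m - 1) / 32" .
  have "64 * D < real (m - 1)" using m(1) D unfolding M_def by linarith
  moreover have "real (m - 1) \<le> 8 * hs2 (incl_mat m - T)"
    by (rule transitive_intertwiner_far[OF m(2) perm tr T(1,2)])
  ultimately show False using le D by linarith
qed

end

section \<open>Deleting a dimension of a unitary matrix\<close>

lemma mat_eqI:
  assumes "A \<in> carrier_mat m n" "B \<in> carrier_mat m n"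
    "\<And>i j. i < m \<Longrightarrow> j < n \<Longrightarrow> A $$ (i, j) = B $$ (i, j)"
  shows "A = B"
  by (rule eq_matI) (use assms carrier_matD in auto)

lemma unitary_entry_sum:
  assumes u: "u \<in> carrier (unitary_group d)" and ij: "i < d" "j < d"
  shows "(\<Sum>k<d. cnj (u $$ (k, i)) * u $$ (k, j)) = (if i = j then 1 else 0)"
    "(\<Sum>k<d. u $$ (i, k) * cnj (u $$ (j, k))) = (if i = j then 1 else 0)"
proof -
  note u' = unitaryD[OF u]
  have "(mat_adjoint u * u) $$ (i, j) = (\<Sum>k<d. mat_adjoint u $$ (i, k) * u $$ (k, j))"
    by (rule mult_mat_index[OF u'(4) u'(1) ij])
  also have "\<dots> = (\<Sum>k<d. cnj (u $$ (k, i)) * u $$ (k, j))"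
    by (rule sum.cong[OF refl]) (use u'(1) ij in simp)
  finally show "(\<Sum>k<d. cnj (u $$ (k, i)) * u $$ (k, j)) = (if i = j then 1 else 0)"
    unfolding u'(2) using ij by simp
  have "(u * mat_adjoint u) $$ (i, j) = (\<Sum>k<d. u $$ (i, k) * mat_adjoint u $$ (k, j))"
    by (rule mult_mat_index[OF u'(1) u'(4) ij])
  also have "\<dots> = (\<Sum>k<d. u $$ (i, k) * cnj (u $$ (j, k)))"
    by (rule sum.cong[OF refl]) (use u'(1) ij in simp)
  finally show "(\<Sum>k<d. u $$ (i, k) * cnj (u $$ (j, k))) = (if i = j then 1 else 0)"
    unfolding u'(3) using ij by simp
qed

lemma unitaryI_entries:
  assumes u: "u \<in> carrier_mat d d"
    and e: "\<And>i j. i < d \<Longrightarrow> j < d \<Longrightarrow> (\<Sum>k<d. cnj (u $$ (k, i)) * u $$ (k, j)) = (if i = j then 1 else 0)"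
  shows "u \<in> carrier (unitary_group d)"
proof (rule unitaryI[OF u])
  have a: "mat_adjoint u \<in> carrier_mat d d" by (rule mat_adjoint_carrier[OF u])
  show "mat_adjoint u * u = 1\<^sub>m d"
  proof (rule mat_eqI[OF mult_carrier_mat[OF a u] one_carrier_mat])
    fix i j assume ij: "i < d" "j < d"
    have "(mat_adjoint u * u) $$ (i, j) = (\<Sum>k<d. mat_adjoint u $$ (i, k) * u $$ (k, j))"
      by (rule mult_mat_index[OF a u ij])
    also have "\<dots> = (\<Sum>k<d. cnj (u $$ (k, i)) * u $$ (k, j))"
      by (rule sum.cong[OF refl]) (use u ij in simp)
    also have "\<dots> = 1\<^sub>m d $$ (i, j)" using e[OF ij] ij by simp
    finally show "(mat_adjoint u * u) $$ (i, j) = 1\<^sub>m d $$ (i, j)" .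
  qed
qed

text \<open>The upper left block of \<open>r u\<close>, where \<open>r\<close> is the unitary rank one perturbation of the
  identity that maps the last column of \<open>u\<close> to the last basis vector.\<close>

definition ured :: "nat \<Rightarrow> complex mat \<Rightarrow> complex mat" where
  "ured d u = mat (d - 1) (d - 1)
     (\<lambda>(i, j). u $$ (i, j) + u $$ (i, d - 1) * u $$ (d - 1, j) * (1 / (1 - u $$ (d - 1, d - 1))))"

lemma ured_carrier [simp]: "ured d u \<in> carrier_mat (d - 1) (d - 1)"
  by (simp add: ured_def)

lemma unitary_last_sums:
  assumes d: "d \<ge> 2" and u: "u \<in> carrier (unitary_group d)"
  defines "l \<equiv> d - 1"
  shows "\<And>i j. i < d \<Longrightarrow> j < d \<Longrightarrow> (\<Sum>k<l. cnj (u $$ (k, i)) * u $$ (k, j)) =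
      (if i = j then 1 else 0) - cnj (u $$ (l, i)) * u $$ (l, j)"
    "(\<Sum>k<l. (cmod (u $$ (k, l)))\<^sup>2) = 1 - (cmod (u $$ (l, l)))\<^sup>2"
    "(\<Sum>k<l. (cmod (u $$ (l, k)))\<^sup>2) = 1 - (cmod (u $$ (l, l)))\<^sup>2"
proof -
  have dl: "d = Suc l" "l < d" using d by (auto simp: l_def)
  show 1: "(\<Sum>k<l. cnj (u $$ (k, i)) * u $$ (k, j)) =
      (if i = j then 1 else 0) - cnj (u $$ (l, i)) * u $$ (l, j)" if "i < d" "j < d" for i j
    using unitary_entry_sum(1)[OF u that] unfolding dl(1) sum.lessThan_Suc by (simp add: eq_diff_eq)
  have "complex_of_real (\<Sum>k<l. (cmod (u $$ (k, l)))\<^sup>2) = (\<Sum>k<l. cnj (u $$ (k, l)) * u $$ (k, l))"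
    by (simp only: of_real_sum complex_norm_square mult.commute[of "cnj _"])
  also have "\<dots> = complex_of_real (1 - (cmod (u $$ (l, l)))\<^sup>2)"
    unfolding 1[OF dl(2) dl(2)] by (simp only: of_real_diff of_real_1 complex_norm_square mult.commute[of "cnj _"] if_True simp_thms)
  finally show "(\<Sum>k<l. (cmod (u $$ (k, l)))\<^sup>2) = 1 - (cmod (u $$ (l, l)))\<^sup>2" by (simp only: of_real_eq_iff)
  have 2: "(\<Sum>k<l. u $$ (l, k) * cnj (u $$ (l, k))) = 1 - u $$ (l, l) * cnj (u $$ (l, l))"
    using unitary_entry_sum(2)[OF u dl(2) dl(2)] unfolding dl(1) sum.lessThan_Suc by (simp add: eq_diff_eq)
  have "complex_of_real (\<Sum>k<l. (cmod (u $$ (l, k)))\<^sup>2) = (\<Sum>k<l. u $$ (l, k) * cnj (u $$ (l, k)))"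
    by (simp only: of_real_sum complex_norm_square)
  also have "\<dots> = complex_of_real (1 - (cmod (u $$ (l, l)))\<^sup>2)"
    unfolding 2 by (simp only: of_real_diff of_real_1 complex_norm_square)
  finally show "(\<Sum>k<l. (cmod (u $$ (l, k)))\<^sup>2) = 1 - (cmod (u $$ (l, l)))\<^sup>2" by (simp only: of_real_eq_iff)
qed

text \<open>The reduced matrix is what remains when the last output coordinate of \<open>u\<close>
  is fed back as its last input, the analogue of the first-return permutation. With corner entry
  \<open>\<delta>\<close>, solving for the fed-back coordinate gives the factor
  \<open>1 / (1 - \<delta>)\<close>, and norms are preserved because that coordinate enters and
  leaves with the same weight.\<close>

lemma ured_unitary:
  assumes d: "d \<ge> 2" and u: "u \<in> carrier (unitary_group d)"
  shows "ured d u \<in> carrier (unitary_group (d - 1))"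
proof (rule unitaryI_entries[OF ured_carrier])
  define l where "l = d - 1"
  have l: "l < d" using d by (simp add: l_def)
  note sums = unitary_last_sums[OF d u, folded l_def]
  fix i j assume "i < d - 1" "j < d - 1"
  then have ij: "i < l" "j < l" "i < d" "j < d" by (auto simp: l_def)
  define t where "t = 1 / (1 - u $$ (l, l))"
  define ci where "ci = u $$ (l, i)"
  define cj where "cj = u $$ (l, j)"
  define \<delta> where "\<delta> = u $$ (l, l)"
  have r: "ured d u $$ (k, m) = u $$ (k, m) + u $$ (k, l) * (u $$ (l, m) * t)" if "k < l" "m < l" for k m
    using that by (simp add: ured_def l_def t_def)
  have "(\<Sum>k<l. cnj (ured d u $$ (k, i)) * ured d u $$ (k, j)) =
      (\<Sum>k<l. cnj (u $$ (k, i)) * u $$ (k, j) + cj * t * (cnj (u $$ (k, i)) * u $$ (k, l))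
        + cnj (ci * t) * (cnj (u $$ (k, l)) * u $$ (k, j))
        + cnj (ci * t) * (cj * t) * (cnj (u $$ (k, l)) * u $$ (k, l)))"
  proof (rule sum.cong[OF refl])
    fix k assume "k \<in> {..<l}"
    then show "cnj (ured d u $$ (k, i)) * ured d u $$ (k, j) =
      cnj (u $$ (k, i)) * u $$ (k, j) + cj * t * (cnj (u $$ (k, i)) * u $$ (k, l))
        + cnj (ci * t) * (cnj (u $$ (k, l)) * u $$ (k, j))
        + cnj (ci * t) * (cj * t) * (cnj (u $$ (k, l)) * u $$ (k, l))"
      by (simp add: r ij ci_def cj_def algebra_simps)
  qed
  also have "\<dots> = ((if i = j then 1 else 0) - cnj ci * cj) + cj * t * (0 - cnj ci * \<delta>)
        + cnj (ci * t) * (0 - cnj \<delta> * cj) + cnj (ci * t) * (cj * t) * (1 - cnj \<delta> * \<delta>)"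
    unfolding sum.distrib sum_distrib_left[symmetric] sums(1)[OF ij(3,4)] sums(1)[OF ij(3) l]
      sums(1)[OF l ij(4)] sums(1)[OF l l]
    using ij by (simp add: ci_def cj_def \<delta>_def)
  also have "\<dots> = (if i = j then 1 else 0)"
  \<comment> \<open>If the corner entry is 1, unitarity makes the rest of the last row vanish, so
    the value 0 of the division by zero does no harm: the correction term is zero anyway.\<close>
  proof (cases "\<delta> = 1")
    case True
    have "(\<Sum>k<l. (cmod (u $$ (l, k)))\<^sup>2) = 0" using sums(3) True by (simp add: \<delta>_def)
    then have "\<forall>k<l. u $$ (l, k) = 0" by (simp add: sum_nonneg_eq_0_iff)
    then have "ci = 0" "cj = 0" using ij by (auto simp: ci_def cj_def)
    then show ?thesis by simp
  next
    case False
    have t1: "t * \<delta> = t - 1" using False by (simp add: t_def \<delta>_def[symmetric] field_simps)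
    have t2: "cnj t * cnj \<delta> = cnj t - 1" using arg_cong[OF t1, of cnj] by simp
    have t3: "cnj t * t * (cnj \<delta> * \<delta>) = (cnj t - 1) * (t - 1)"
      using t1 t2 by (metis mult.assoc mult.commute)
    have "((if i = j then 1 else 0) - cnj ci * cj) + cj * t * (0 - cnj ci * \<delta>)
        + cnj (ci * t) * (0 - cnj \<delta> * cj) + cnj (ci * t) * (cj * t) * (1 - cnj \<delta> * \<delta>) =
      (if i = j then 1 else 0) + cnj ci * cj * (- 1 - t * \<delta> - cnj t * cnj \<delta> + cnj t * t - cnj t * t * (cnj \<delta> * \<delta>))"
      by (simp add: algebra_simps)
    also have "- 1 - t * \<delta> - cnj t * cnj \<delta> + cnj t * t - cnj t * t * (cnj \<delta> * \<delta>) = 0"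
      unfolding t1 t2 t3 by (simp add: algebra_simps)
    finally show ?thesis by simp
  qed
  finally show "(\<Sum>k<d - 1. cnj (ured d u $$ (k, i)) * ured d u $$ (k, j)) = (if i = j then 1 else 0)"
    by (simp only: l_def)
qed

lemma mult_incl_index:
  assumes "u \<in> carrier_mat k d" "i < k" "j < d - 1"
  shows "(u * incl_mat d) $$ (i, j) = u $$ (i, j)"
proof -
  have "(u * incl_mat d) $$ (i, j) = (\<Sum>m<d. u $$ (i, m) * incl_mat d $$ (m, j))"
    by (rule mult_mat_index[OF assms(1) incl_mat_carrier assms(2,3)])
  also have "\<dots> = (\<Sum>m<d. if m = j then u $$ (i, m) else 0)"
    by (rule sum.cong[OF refl]) (use assms in \<open>auto simp: incl_mat_def\<close>)
  also have "\<dots> = u $$ (i, j)" using assms by (subst sum.delta) auto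
  finally show ?thesis .
qed

lemma incl_mult_index:
  assumes "v \<in> carrier_mat (d - 1) k" "i < d" "j < k"
  shows "(incl_mat d * v) $$ (i, j) = (if i < d - 1 then v $$ (i, j) else 0)"
proof -
  have "(incl_mat d * v) $$ (i, j) = (\<Sum>m<d - 1. incl_mat d $$ (i, m) * v $$ (m, j))"
    by (rule mult_mat_index[OF incl_mat_carrier assms])
  also have "\<dots> = (\<Sum>m<d - 1. if m = i then v $$ (m, j) else 0)"
    by (rule sum.cong[OF refl]) (use assms in \<open>auto simp: incl_mat_def\<close>)
  also have "\<dots> = (if i < d - 1 then v $$ (i, j) else 0)" by (simp add: sum.delta)
  finally show ?thesis .
qed

lemma hs2_carrier: "X \<in> carrier_mat m n \<Longrightarrow> hs2 X = (\<Sum>i<m. \<Sum>j<n. (cmod (X $$ (i, j)))\<^sup>2)"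
  by (simp add: hs2_def)

text \<open>The defect consists of the last row of \<open>u\<close> and a rank one block, and its
  squared norm \<open>(b * cmod t)\<^sup>2 + b\<close> involves only the corner entry. As
  \<open>b\<close> is at most 1 and at most twice the distance of the corner entry from 1, this is
  at most 5, whatever \<open>d\<close> is.\<close>

lemma ured_close:
  assumes d: "d \<ge> 2" and u: "u \<in> carrier (unitary_group d)"
  shows "hsn (u * incl_mat d - incl_mat d * ured d u) \<le> 3"
proof -
  define l where "l = d - 1"
  have dl: "d = Suc l" using d by (simp add: l_def)
  note u' = unitaryD[OF u]
  note sums = unitary_last_sums[OF d u, folded l_def]
  define t where "t = 1 / (1 - u $$ (l, l))"
  define b where "b = 1 - (cmod (u $$ (l, l)))\<^sup>2"
  have c: "u * incl_mat d \<in> carrier_mat d l" "incl_mat d * ured d u \<in> carrier_mat d l"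
    unfolding l_def by (rule mult_carrier_mat[OF u'(1) incl_mat_carrier] mult_carrier_mat[OF incl_mat_carrier ured_carrier])+
  define Z where "Z = u * incl_mat d - incl_mat d * ured d u"
  have Zc: "Z \<in> carrier_mat d l" unfolding Z_def by (rule minus_carrier_mat[OF c(2)])
  have Z: "Z $$ (i, j) = u $$ (i, j) - (if i < l then ured d u $$ (i, j) else 0)" if ij: "i < d" "j < l" for i j
  proof -
    have "Z $$ (i, j) = (u * incl_mat d) $$ (i, j) - (incl_mat d * ured d u) $$ (i, j)"
      unfolding Z_def by (rule index_minus_mat(1)) (simp_all only: carrier_matD[OF c(2)] ij)
    then show ?thesis
      using mult_incl_index[OF u'(1), of i j] incl_mult_index[OF ured_carrier, of i d j u] ij by (simp only: l_def)
  qed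
  have "hs2 Z = (\<Sum>i<l. \<Sum>j<l. (cmod (Z $$ (i, j)))\<^sup>2) + (\<Sum>j<l. (cmod (Z $$ (l, j)))\<^sup>2)"
    unfolding hs2_carrier[OF Zc] dl sum.lessThan_Suc by (rule refl)
  also have "(\<Sum>j<l. (cmod (Z $$ (l, j)))\<^sup>2) = b"
  proof -
    have "(\<Sum>j<l. (cmod (Z $$ (l, j)))\<^sup>2) = (\<Sum>j<l. (cmod (u $$ (l, j)))\<^sup>2)"
      by (rule sum.cong[OF refl]) (simp add: Z dl)
    then show ?thesis by (simp only: sums(3) b_def)
  qed
  also have "(\<Sum>i<l. \<Sum>j<l. (cmod (Z $$ (i, j)))\<^sup>2) = (\<Sum>i<l. \<Sum>j<l. (cmod (u $$ (i, l)))\<^sup>2 * ((cmod (u $$ (l, j)))\<^sup>2 * (cmod t)\<^sup>2))"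
  proof (intro sum.cong refl)
    fix i j assume "i \<in> {..<l}" "j \<in> {..<l}"
    then have ij: "i < l" "j < l" "i < d" by (auto simp: dl)
    have "Z $$ (i, j) = - (u $$ (i, l) * (u $$ (l, j) * t))"
      unfolding Z[OF ij(3,2)] using ij by (simp add: ured_def t_def l_def)
    then show "(cmod (Z $$ (i, j)))\<^sup>2 = (cmod (u $$ (i, l)))\<^sup>2 * ((cmod (u $$ (l, j)))\<^sup>2 * (cmod t)\<^sup>2)"
      by (simp only: norm_minus_cancel norm_mult power_mult_distrib)
  qed
  also have "\<dots> = b * (b * (cmod t)\<^sup>2)"
    by (simp only: sum_distrib_left[symmetric] sum_distrib_right[symmetric] sums(2,3) b_def)
  finally have eq: "hs2 Z = (b * cmod t)\<^sup>2 + b" by (simp add: power2_eq_square mult_ac)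
  have b0: "b \<ge> 0" using sums(3) by (simp only: b_def[symmetric]) (metis sum_nonneg zero_le_power2)
  have b1: "b \<le> 1" by (simp add: b_def)
  define x where "x = cmod (u $$ (l, l))"
  have x0: "x \<ge> 0" by (simp add: x_def)
  have "x\<^sup>2 \<le> 1\<^sup>2" using b0 unfolding b_def x_def[symmetric] by simp
  then have x1: "x \<le> 1" by (rule power2_le_imp_le) simp
  have "b \<le> 2 * (1 - x)"
  proof -
    have "b = (1 - x) * (1 + x)" by (simp add: b_def x_def[symmetric] power2_eq_square algebra_simps)
    also have "\<dots> \<le> (1 - x) * 2" using x0 x1 by (intro mult_left_mono) auto
    finally show ?thesis by simp
  qed
  also have "1 - x \<le> cmod (1 - u $$ (l, l))"
    using norm_triangle_ineq2[of 1 "u $$ (l, l)"] by (simp add: x_def)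
  finally have bt: "b \<le> 2 * cmod (1 - u $$ (l, l))" by simp
  have "b * cmod t \<le> 2"
  proof (cases "u $$ (l, l) = 1")
    case True
    then show ?thesis by (simp add: t_def)
  next
    case False
    then have "cmod (1 - u $$ (l, l)) > 0" by simp
    then show ?thesis using bt by (simp add: t_def norm_divide divide_le_eq)
  qed
  then have "(b * cmod t)\<^sup>2 \<le> 2\<^sup>2" using b0 by (intro power_mono) auto
  then have "hs2 Z \<le> 3\<^sup>2" using eq b1 by simp
  then have "hsn Z \<le> 3" unfolding hsn_def by (intro real_le_lsqrt) (auto simp: hs2_nonneg)
  then show ?thesis by (simp only: Z_def)
qed

lemma hs2_incl_mult:
  assumes "v \<in> carrier_mat (d - 1) k" "d \<ge> 2"
  shows "hs2 (incl_mat d * v) = hs2 v"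
proof -
  have c: "incl_mat d * v \<in> carrier_mat d k" by (rule mult_carrier_mat[OF incl_mat_carrier assms(1)])
  have dl: "d = Suc (d - 1)" using assms(2) by simp
  have "hs2 (incl_mat d * v) = (\<Sum>i<Suc (d - 1). \<Sum>j<k. (cmod ((incl_mat d * v) $$ (i, j)))\<^sup>2)"
    unfolding hs2_carrier[OF c] dl[symmetric] by (rule refl)
  also have "\<dots> = (\<Sum>i<d - 1. \<Sum>j<k. (cmod ((incl_mat d * v) $$ (i, j)))\<^sup>2)
      + (\<Sum>j<k. (cmod ((incl_mat d * v) $$ (d - 1, j)))\<^sup>2)" by (rule sum.lessThan_Suc)
  also have "(\<Sum>j<k. (cmod ((incl_mat d * v) $$ (d - 1, j)))\<^sup>2) = (\<Sum>j<k. 0)"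
  proof (rule sum.cong[OF refl])
    fix j assume "j \<in> {..<k}"
    then have "(incl_mat d * v) $$ (d - 1, j) = (if d - 1 < d - 1 then v $$ (d - 1, j) else 0)"
      using assms(2) by (intro incl_mult_index[OF assms(1)]) auto
    then show "(cmod ((incl_mat d * v) $$ (d - 1, j)))\<^sup>2 = 0" by (simp only: less_irrefl if_False norm_zero) simp
  qed
  also have "(\<Sum>i<d - 1. \<Sum>j<k. (cmod ((incl_mat d * v) $$ (i, j)))\<^sup>2) = (\<Sum>i<d - 1. \<Sum>j<k. (cmod (v $$ (i, j)))\<^sup>2)"
  proof (intro sum.cong refl)
    fix i j assume "i \<in> {..<d - 1}" "j \<in> {..<k}"
    then have ij: "i < d - 1" "j < k" "i < d" by auto
    have "(incl_mat d * v) $$ (i, j) = (if i < d - 1 then v $$ (i, j) else 0)"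
      by (rule incl_mult_index[OF assms(1) ij(3,2)])
    with ij(1) show "(cmod ((incl_mat d * v) $$ (i, j)))\<^sup>2 = (cmod (v $$ (i, j)))\<^sup>2" by (simp only: if_True)
  qed
  finally show ?thesis by (simp only: hs2_carrier[OF assms(1)] sum.neutral_const add_0_right)
qed

lemma hsn_incl_diff:
  assumes "v \<in> carrier_mat (d - 1) k" "w \<in> carrier_mat (d - 1) k" "d \<ge> 2"
  shows "hsn (incl_mat d * v - incl_mat d * w) = hsn (v - w)"
  unfolding hsn_def mult_minus_distrib_mat[OF incl_mat_carrier assms(1,2), symmetric]
  by (simp only: hs2_incl_mult[OF minus_carrier_mat[OF assms(2)] assms(3)])

text \<open>The defect is split into three comparisons of a matrix with its reduction along the
  inclusion, each at most 3 in the unnormalized norm. Division by the square root of the dimension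
  therefore sends it to 0.\<close>

lemma ured_mult:
  assumes d: "d \<ge> 2" and u: "u \<in> carrier (unitary_group d)" and v: "v \<in> carrier (unitary_group d)"
  shows "\<bar>hs_dist (d - 1) (ured d (u * v)) (ured d u * ured d v)\<bar> \<le> 9 / sqrt (real (d - 1))"
proof -
  let ?I = "incl_mat d" and ?u = "ured d u" and ?v = "ured d v" and ?w = "ured d (u * v)"
  note u' = unitaryD[OF u] and v' = unitaryD[OF v]
  note uv = unitary_mult[OF u v] and ru = ured_unitary[OF d u] and rv = ured_unitary[OF d v]
  have cI: "?I \<in> carrier_mat d (d - 1)" by (rule incl_mat_carrier)
  have c: "?u * ?v \<in> carrier_mat (d - 1) (d - 1)" by (rule mult_carrier_mat[OF ured_carrier ured_carrier])
  have Iw: "?I * ?w \<in> carrier_mat d (d - 1)" and Iu: "?I * ?u \<in> carrier_mat d (d - 1)"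
    and Iv: "?I * ?v \<in> carrier_mat d (d - 1)" and uI: "u * ?I \<in> carrier_mat d (d - 1)"
    and vI: "v * ?I \<in> carrier_mat d (d - 1)" and uvI: "u * v * ?I \<in> carrier_mat d (d - 1)"
    by (rule mult_carrier_mat[OF cI ured_carrier] mult_carrier_mat[OF u'(1) cI]
        mult_carrier_mat[OF v'(1) cI] mult_carrier_mat[OF unitaryD(1)[OF uv] cI])+
  have Iuv: "?I * (?u * ?v) \<in> carrier_mat d (d - 1)" by (rule mult_carrier_mat[OF cI c])
  have uIv: "u * (?I * ?v) \<in> carrier_mat d (d - 1)" by (rule mult_carrier_mat[OF u'(1) Iv])
  have "hsn (?w - ?u * ?v) = hsn (?I * ?w - ?I * (?u * ?v))"
    by (rule hsn_incl_diff[OF ured_carrier c d, symmetric])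
  also have "\<dots> \<le> hsn (?I * ?w - u * v * ?I) + hsn (u * v * ?I - ?I * (?u * ?v))"
    by (rule hsn_triangle[OF Iw uvI Iuv])
  also have "hsn (?I * ?w - u * v * ?I) \<le> 3"
    unfolding hsn_minus_commute[OF Iw uvI] by (rule ured_close[OF d uv])
  also have "hsn (u * v * ?I - ?I * (?u * ?v)) \<le> hsn (u * v * ?I - u * (?I * ?v)) + hsn (u * (?I * ?v) - ?I * (?u * ?v))"
    by (rule hsn_triangle[OF uvI uIv Iuv])
  also have "hsn (u * v * ?I - u * (?I * ?v)) \<le> 3"
    unfolding assoc_mult_mat[OF u'(1) v'(1) cI] hsn_mult_unitary_diff[OF u vI Iv] by (rule ured_close[OF d v])
  also have "hsn (u * (?I * ?v) - ?I * (?u * ?v)) \<le> 3"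
    unfolding assoc_mult_mat[OF u'(1) cI ured_carrier, symmetric] assoc_mult_mat[OF cI ured_carrier ured_carrier, symmetric]
      hsn_mult_unitary_diff_right[OF rv uI Iu] by (rule ured_close[OF d u])
  finally have le: "hsn (?w - ?u * ?v) \<le> 9" by simp
  have "hs_dist (d - 1) ?w (?u * ?v) = hsn (?w - ?u * ?v) / sqrt (real (d - 1))"
    by (rule hs_dist_eq[OF ured_carrier c])
  then show ?thesis using le hsn_nonneg[of "?w - ?u * ?v"] by (simp add: abs_of_nonneg divide_right_mono)
qed

text \<open>Vectors are treated as matrices with one column.\<close>

lemma singular_kernel:
  fixes P :: "complex mat"
  assumes P: "P \<in> carrier_mat d d" and "det P = 0"
  obtains V where "V \<in> carrier_mat d 1" "V \<noteq> 0\<^sub>m d 1" "P * V = 0\<^sub>m d 1"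
proof -
  obtain v where v: "v \<in> carrier_vec d" "v \<noteq> 0\<^sub>v d" "P *\<^sub>v v = 0\<^sub>v d"
    using det_0_iff_vec_prod_zero_field[OF P] assms(2) by blast
  define V where "V = mat d 1 (\<lambda>(i, j). v $ i)"
  have V: "V \<in> carrier_mat d 1" by (simp add: V_def)
  show ?thesis
  proof (rule that[OF V])
    show "V \<noteq> 0\<^sub>m d 1"
    proof
      assume "V = 0\<^sub>m d 1"
      have "v $ i = 0" if "i < d" for i
      proof -
        have "V $$ (i, 0) = 0\<^sub>m d 1 $$ (i, 0)" using \<open>V = 0\<^sub>m d 1\<close> by simp
        then show ?thesis using that by (simp add: V_def)
      qed
      then have "v = 0\<^sub>v d" using v(1) by (intro eq_vecI) auto
      then show False using v(2) by simp
    qed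
    show "P * V = 0\<^sub>m d 1"
    proof (rule mat_eqI[OF mult_carrier_mat[OF P V] zero_carrier_mat])
      fix i j :: nat assume ij: "i < d" "j < 1"
      have "(P * V) $$ (i, j) = (\<Sum>m<d. P $$ (i, m) * V $$ (m, j))" by (rule mult_mat_index[OF P V ij])
      also have "\<dots> = (\<Sum>m<d. P $$ (i, m) * v $ m)"
        by (rule sum.cong[OF refl]) (use ij in \<open>simp add: V_def\<close>)
      also have "\<dots> = (P *\<^sub>v v) $ i"
        using ij P v(1) by (simp add: scalar_prod_def atLeast0LessThan)
      also have "\<dots> = 0" using v(3) ij by simp
      finally show "(P * V) $$ (i, j) = 0\<^sub>m d 1 $$ (i, j)" using ij by simp
    qed
  qed
qed

text \<open>Padding by zero rows gives a square matrix. Its transpose kills the unit vector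
  belonging to the first padded row, so the determinant is 0.\<close>

lemma wide_kernel:
  fixes A :: "complex mat"
  assumes A: "A \<in> carrier_mat k d" and "k < d"
  obtains v where "v \<in> carrier_mat d 1" "v \<noteq> 0\<^sub>m d 1" "A * v = 0\<^sub>m k 1"
proof -
  define P where "P = mat d d (\<lambda>(i, j). if i < k then A $$ (i, j) else 0)"
  have P: "P \<in> carrier_mat d d" by (simp add: P_def)
  have "\<exists>v. v \<in> carrier_vec d \<and> v \<noteq> 0\<^sub>v d \<and> transpose_mat P *\<^sub>v v = 0\<^sub>v d"
  proof (intro exI[of _ "unit_vec d k :: complex vec"] conjI)
    show "(unit_vec d k :: complex vec) \<in> carrier_vec d" by simp
    show "(unit_vec d k :: complex vec) \<noteq> 0\<^sub>v d"
    proof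
      assume "unit_vec d k = (0\<^sub>v d :: complex vec)"
      then have "(unit_vec d k :: complex vec) $ k = 0\<^sub>v d $ k" by simp
      then show False using assms(2) by simp
    qed
    show "transpose_mat P *\<^sub>v unit_vec d k = 0\<^sub>v d"
      by (rule eq_vecI) (use assms(2) in \<open>auto simp: P_def\<close>)
  qed
  then have "det (transpose_mat P) = 0"
    using det_0_iff_vec_prod_zero_field[of "transpose_mat P" d] P by auto
  then have "det P = 0" using det_transpose[OF P] by simp
  then obtain V where V: "V \<in> carrier_mat d 1" "V \<noteq> 0\<^sub>m d 1" "P * V = 0\<^sub>m d 1"
    by (rule singular_kernel[OF P])
  show ?thesis
  proof (rule that[OF V(1,2)], rule mat_eqI[OF mult_carrier_mat[OF A V(1)] zero_carrier_mat])
    fix i j :: nat assume ij: "i < k" "j < 1"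
    then have id: "i < d" using assms(2) by simp
    have "(A * V) $$ (i, j) = (\<Sum>m<d. A $$ (i, m) * V $$ (m, j))" by (rule mult_mat_index[OF A V(1) ij])
    also have "\<dots> = (\<Sum>m<d. P $$ (i, m) * V $$ (m, j))"
      by (rule sum.cong[OF refl]) (use ij id in \<open>simp add: P_def\<close>)
    also have "\<dots> = (P * V) $$ (i, j)" by (rule mult_mat_index[OF P V(1) id ij(2), symmetric])
    finally show "(A * V) $$ (i, j) = 0\<^sub>m k 1 $$ (i, j)" unfolding V(3) using ij id by simp
  qed
qed

section \<open>Isometric matrices and orthonormal bases of kernels\<close>

definition isometric :: "nat \<Rightarrow> nat \<Rightarrow> complex mat \<Rightarrow> bool" where
  "isometric d e W \<longleftrightarrow> W \<in> carrier_mat d e \<and> mat_adjoint W * W = 1\<^sub>m e"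

lemma isometric_le:
  assumes "isometric d e W" shows "e \<le> d"
proof (rule ccontr)
  assume "\<not> e \<le> d"
  then have "d < e" by simp
  have W: "W \<in> carrier_mat d e" "mat_adjoint W * W = 1\<^sub>m e" using assms by (auto simp: isometric_def)
  obtain v where v: "v \<in> carrier_mat e 1" "v \<noteq> 0\<^sub>m e 1" "W * v = 0\<^sub>m d 1"
    using wide_kernel[OF W(1) \<open>d < e\<close>] by metis
  have "v = mat_adjoint W * W * v" unfolding W(2) using v(1) by simp
  also have "\<dots> = mat_adjoint W * (W * v)" by (rule assoc_mult_mat[OF mat_adjoint_carrier[OF W(1)] W(1) v(1)])
  also have "\<dots> = 0\<^sub>m e 1" unfolding v(3) by (rule right_mult_zero_mat[OF mat_adjoint_carrier[OF W(1)]])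
  finally show False using v(2) by simp
qed

lemma isometric_iff_entries:
  assumes "W \<in> carrier_mat d e"
  shows "isometric d e W \<longleftrightarrow> (\<forall>i<e. \<forall>j<e. (\<Sum>k<d. cnj (W $$ (k, i)) * W $$ (k, j)) = (if i = j then 1 else 0))"
proof -
  have a: "mat_adjoint W \<in> carrier_mat e d" by (rule mat_adjoint_carrier[OF assms])
  have ent: "(mat_adjoint W * W) $$ (i, j) = (\<Sum>k<d. cnj (W $$ (k, i)) * W $$ (k, j))" if "i < e" "j < e" for i j
  proof -
    have "(mat_adjoint W * W) $$ (i, j) = (\<Sum>k<d. mat_adjoint W $$ (i, k) * W $$ (k, j))"
      by (rule mult_mat_index[OF a assms that])
    also have "\<dots> = (\<Sum>k<d. cnj (W $$ (k, i)) * W $$ (k, j))"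
      by (rule sum.cong[OF refl]) (use assms that in simp)
    finally show ?thesis .
  qed
  show ?thesis
  proof
    assume "isometric d e W"
    then have "mat_adjoint W * W = 1\<^sub>m e" by (simp add: isometric_def)
    then show "\<forall>i<e. \<forall>j<e. (\<Sum>k<d. cnj (W $$ (k, i)) * W $$ (k, j)) = (if i = j then 1 else 0)"
      using ent by (metis index_one_mat(1))
  next
    assume r: "\<forall>i<e. \<forall>j<e. (\<Sum>k<d. cnj (W $$ (k, i)) * W $$ (k, j)) = (if i = j then 1 else 0)"
    have "mat_adjoint W * W = 1\<^sub>m e"
      by (rule mat_eqI[OF mult_carrier_mat[OF a assms] one_carrier_mat]) (simp only: ent r index_one_mat(1))
    then show "isometric d e W" using assms by (simp add: isometric_def)
  qed
qed

text \<open>The columns of \<open>W\<close> form an orthonormal basis of the kernel, found as an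
  isometric matrix into the kernel with the most columns. If some \<open>Y\<close> were not
  reproduced, its residual would have a nonzero column in the kernel and orthogonal to
  \<open>W\<close>; normalized, it would be one more column.\<close>

lemma kernel_basis:
  fixes A :: "complex mat"
  assumes A: "A \<in> carrier_mat k d"
  obtains e W where "isometric d e W" "A * W = 0\<^sub>m k e"
    "\<And>Y p. Y \<in> carrier_mat d p \<Longrightarrow> A * Y = 0\<^sub>m k p \<Longrightarrow> W * (mat_adjoint W * Y) = Y"
proof -
  define Q where "Q e \<longleftrightarrow> (\<exists>W. isometric d e W \<and> A * W = 0\<^sub>m k e)" for e
  have "Q 0"
  proof -
    have W: "0\<^sub>m d 0 \<in> carrier_mat d 0" by simp
    have "isometric d 0 (0\<^sub>m d 0)" unfolding isometric_iff_entries[OF W] by simp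
    moreover have "A * 0\<^sub>m d 0 = 0\<^sub>m k 0" by (rule right_mult_zero_mat[OF A])
    ultimately show ?thesis unfolding Q_def by blast
  qed
  have bound: "\<forall>e. Q e \<longrightarrow> e \<le> d" using isometric_le by (auto simp: Q_def)
  define e where "e = Greatest Q"
  have Qe: "Q e" unfolding e_def by (rule GreatestI_nat[of Q 0 d, OF \<open>Q 0\<close>]) (use bound in blast)
  have nQ: "\<not> Q (Suc e)"
  proof
    assume "Q (Suc e)"
    then have "Suc e \<le> e" unfolding e_def by (rule Greatest_le_nat[of Q _ d]) (use bound in blast)
    then show False by simp
  qed
  obtain W where iso: "isometric d e W" and AW: "A * W = 0\<^sub>m k e" using Qe by (auto simp: Q_def)
  have W: "W \<in> carrier_mat d e" "mat_adjoint W * W = 1\<^sub>m e" using iso by (auto simp: isometric_def)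
  have aW: "mat_adjoint W \<in> carrier_mat e d" by (rule mat_adjoint_carrier[OF W(1)])
  show ?thesis
  proof (rule that[OF iso AW])
    fix Y p assume Y: "Y \<in> carrier_mat d p" and AY: "A * Y = 0\<^sub>m k p"
    have aY: "mat_adjoint W * Y \<in> carrier_mat e p" by (rule mult_carrier_mat[OF aW Y])
    have WY: "W * (mat_adjoint W * Y) \<in> carrier_mat d p" by (rule mult_carrier_mat[OF W(1) aY])
    define Z where "Z = Y - W * (mat_adjoint W * Y)"
    have Z: "Z \<in> carrier_mat d p" unfolding Z_def by (rule minus_carrier_mat[OF WY])
    have "mat_adjoint W * (W * (mat_adjoint W * Y)) = mat_adjoint W * Y"
      unfolding assoc_mult_mat[OF aW W(1) aY, symmetric] W(2) by (rule left_mult_one_mat[OF aY])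
    then have aZ: "mat_adjoint W * Z = 0\<^sub>m e p"
      unfolding Z_def mult_minus_distrib_mat[OF aW Y WY] using aY by simp
    have AZ: "A * Z = 0\<^sub>m k p"
      unfolding Z_def mult_minus_distrib_mat[OF A Y WY] assoc_mult_mat[OF A W(1) aY, symmetric] AW AY
      using left_mult_zero_mat[OF aY, of k] by simp
    have "Z = 0\<^sub>m d p"
    proof (rule ccontr)
      assume "Z \<noteq> 0\<^sub>m d p"
      then obtain i0 q where q: "i0 < d" "q < p" "Z $$ (i0, q) \<noteq> 0"
        using mat_eqI[OF Z zero_carrier_mat] by (metis index_zero_mat(1))
      define r where "r = sqrt (\<Sum>i<d. (cmod (Z $$ (i, q)))\<^sup>2)"
      have "(\<Sum>i<d. (cmod (Z $$ (i, q)))\<^sup>2) > 0"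
        using q by (intro sum_pos2[of _ i0]) auto
      then have r: "r > 0" "r\<^sup>2 = (\<Sum>i<d. (cmod (Z $$ (i, q)))\<^sup>2)" by (auto simp: r_def)
      define W' where "W' = mat d (Suc e) (\<lambda>(i, j). if j < e then W $$ (i, j) else Z $$ (i, q) / complex_of_real r)"
      have W': "W' \<in> carrier_mat d (Suc e)" by (simp add: W'_def)
      have orth: "(\<Sum>i<d. cnj (W $$ (i, j)) * Z $$ (i, q)) = 0" if "j < e" for j
      proof -
        have "(mat_adjoint W * Z) $$ (j, q) = (\<Sum>i<d. mat_adjoint W $$ (j, i) * Z $$ (i, q))"
          by (rule mult_mat_index[OF aW Z that q(2)])
        also have "\<dots> = (\<Sum>i<d. cnj (W $$ (i, j)) * Z $$ (i, q))"
          by (rule sum.cong[OF refl]) (use W(1) that in simp)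
        finally show ?thesis unfolding aZ using that q by simp
      qed
      have zz: "(\<Sum>i<d. cnj (Z $$ (i, q)) * Z $$ (i, q)) = complex_of_real (r\<^sup>2)"
        unfolding r(2) by (simp only: of_real_sum complex_norm_square mult.commute[of "cnj _"])
      have "isometric d (Suc e) W'"
        unfolding isometric_iff_entries[OF W']
      proof (intro allI impI)
        fix i j assume ij: "i < Suc e" "j < Suc e"
        consider "i < e" "j < e" | "i < e" "j = e" | "i = e" "j < e" | "i = e" "j = e" using ij by linarith
        then show "(\<Sum>k<d. cnj (W' $$ (k, i)) * W' $$ (k, j)) = (if i = j then 1 else 0)"
        proof cases
          case 1
          have "(\<Sum>k<d. cnj (W' $$ (k, i)) * W' $$ (k, j)) = (\<Sum>k<d. cnj (W $$ (k, i)) * W $$ (k, j))"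
            by (rule sum.cong[OF refl]) (use 1 in \<open>simp add: W'_def\<close>)
          then show ?thesis using iso[unfolded isometric_iff_entries[OF W(1)]] 1 by simp
        next
          case 2
          have "(\<Sum>k<d. cnj (W' $$ (k, i)) * W' $$ (k, j)) = (\<Sum>k<d. cnj (W $$ (k, i)) * Z $$ (k, q)) / complex_of_real r"
            unfolding sum_divide_distrib by (rule sum.cong[OF refl]) (use 2 in \<open>simp add: W'_def\<close>)
          then show ?thesis using 2 by (simp add: orth)
        next
          case 3
          have "(\<Sum>k<d. cnj (W' $$ (k, i)) * W' $$ (k, j)) = cnj (\<Sum>k<d. cnj (W $$ (k, j)) * Z $$ (k, q)) / complex_of_real r"
            unfolding sum_divide_distrib cnj_sum by (rule sum.cong[OF refl]) (use 3 in \<open>simp add: W'_def\<close>)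
          then show ?thesis using 3 by (simp only: orth) simp
        next
          case 4
          have "(\<Sum>k<d. cnj (W' $$ (k, i)) * W' $$ (k, j)) =
              (\<Sum>k<d. cnj (Z $$ (k, q)) * Z $$ (k, q)) / (complex_of_real r * complex_of_real r)"
            unfolding sum_divide_distrib by (rule sum.cong[OF refl]) (use 4 in \<open>simp add: W'_def\<close>)
          then show ?thesis unfolding zz using 4 r(1) by (simp add: power2_eq_square)
        qed
      qed
      moreover have "A * W' = 0\<^sub>m k (Suc e)"
      proof (rule mat_eqI[OF mult_carrier_mat[OF A W'] zero_carrier_mat])
        fix i j assume ij: "i < k" "j < Suc e"
        have "(A * W') $$ (i, j) = (\<Sum>m<d. A $$ (i, m) * W' $$ (m, j))" by (rule mult_mat_index[OF A W' ij])
        also have "\<dots> = 0"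
        proof (cases "j < e")
          case True
          have "(\<Sum>m<d. A $$ (i, m) * W' $$ (m, j)) = (\<Sum>m<d. A $$ (i, m) * W $$ (m, j))"
            by (rule sum.cong[OF refl]) (use True in \<open>simp add: W'_def\<close>)
          also have "\<dots> = (A * W) $$ (i, j)" by (rule mult_mat_index[OF A W(1) ij(1) True, symmetric])
          finally show ?thesis unfolding AW using ij True by simp
        next
          case False
          have "(\<Sum>m<d. A $$ (i, m) * W' $$ (m, j)) = (\<Sum>m<d. A $$ (i, m) * Z $$ (m, q)) / complex_of_real r"
            unfolding sum_divide_distrib by (rule sum.cong[OF refl]) (use False ij in \<open>simp add: W'_def\<close>)
          also have "(\<Sum>m<d. A $$ (i, m) * Z $$ (m, q)) = (A * Z) $$ (i, q)"
            by (rule mult_mat_index[OF A Z ij(1) q(2), symmetric])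
          finally show ?thesis unfolding AZ using ij q by simp
        qed
        finally show "(A * W') $$ (i, j) = 0\<^sub>m k (Suc e) $$ (i, j)" using ij by simp
      qed
      ultimately show False using nQ by (auto simp: Q_def)
    qed
    then have z: "Z $$ (i, j) = 0" if "i < d" "j < p" for i j using that by simp
    show "W * (mat_adjoint W * Y) = Y"
    proof (rule mat_eqI[OF WY Y])
      fix i j assume ij: "i < d" "j < p"
      have "Z $$ (i, j) = Y $$ (i, j) - (W * (mat_adjoint W * Y)) $$ (i, j)"
        unfolding Z_def by (rule index_minus_mat(1)) (simp_all only: carrier_matD[OF WY] ij)
      then show "(W * (mat_adjoint W * Y)) $$ (i, j) = Y $$ (i, j)" using z[OF ij] by (metis right_minus_eq)
    qed
  qed
qed

section \<open>Irreducible local representations\<close>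

lemma mat_adjoint_zero [simp]: "mat_adjoint (0\<^sub>m m n) = (0\<^sub>m n m :: complex mat)"
  by (rule eq_matI) auto

lemma mat_trace_one [simp]: "mat_trace (1\<^sub>m d) = of_nat d"
  by (simp add: mat_trace_eq[OF one_carrier_mat])

lemma hs2_unitary: "u \<in> carrier (unitary_group d) \<Longrightarrow> hs2 u = real d"
proof -
  assume u: "u \<in> carrier (unitary_group d)"
  have "complex_of_real (hs2 u) = mat_trace (mat_adjoint u * u)"
    unfolding hsip_self[symmetric] by (rule hsip_trace[OF unitaryD(1)[OF u] unitaryD(1)[OF u]])
  then have "complex_of_real (hs2 u) = complex_of_real (real d)" unfolding unitaryD(2)[OF u] by simp
  then show ?thesis by (simp only: of_real_eq_iff)
qed

lemma hs2_diff:
  assumes "X \<in> carrier_mat m n" "Y \<in> carrier_mat m n"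
  shows "hs2 (X - Y) = hs2 X + hs2 Y - 2 * Re (hsip Y X)"
proof -
  have e: "(cmod (x - y))\<^sup>2 = (cmod x)\<^sup>2 + (cmod y)\<^sup>2 - 2 * Re (y * cnj x)" for x y
    unfolding cmod_power2 by (simp add: power2_eq_square algebra_simps)
  have "hs2 (X - Y) = (\<Sum>i<m. \<Sum>j<n. (cmod (X $$ (i, j)))\<^sup>2 + (cmod (Y $$ (i, j)))\<^sup>2 - 2 * Re (Y $$ (i, j) * cnj (X $$ (i, j))))"
    unfolding hs2_carrier[OF minus_carrier_mat[OF assms(2)]]
    by (intro sum.cong refl) (use assms in \<open>simp only: e[symmetric] index_minus_mat(1) carrier_matD lessThan_iff\<close>)
  also have "\<dots> = hs2 X + hs2 Y - 2 * (\<Sum>i<m. \<Sum>j<n. Re (Y $$ (i, j) * cnj (X $$ (i, j))))"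
    unfolding hs2_carrier[OF assms(1)] hs2_carrier[OF assms(2)]
    by (simp only: sum_subtractf sum.distrib sum_distrib_left)
  also have "(\<Sum>i<m. \<Sum>j<n. Re (Y $$ (i, j) * cnj (X $$ (i, j)))) = Re (hsip Y X)"
    unfolding hsip_def Re_sum carrier_matD[OF assms(2)] by (rule refl)
  finally show ?thesis .
qed

lemma hs2_unitary_diff:
  assumes "a \<in> carrier (unitary_group d)" "b \<in> carrier (unitary_group d)"
  shows "hs2 (a - b) = 2 * real d - 2 * Re (mat_trace (mat_adjoint a * b))"
  unfolding hs2_diff[OF unitaryD(1)[OF assms(1)] unitaryD(1)[OF assms(2)]]
    hs2_unitary[OF assms(1)] hs2_unitary[OF assms(2)]
    hsip_trace[OF unitaryD(1)[OF assms(2)] unitaryD(1)[OF assms(1)]] by simp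

lemma unitary_entry_le:
  assumes u: "u \<in> carrier (unitary_group d)" and "i < d" "j < d"
  shows "cmod (u $$ (i, j)) \<le> 1"
proof -
  have "complex_of_real (\<Sum>k<d. (cmod (u $$ (i, k)))\<^sup>2) = (\<Sum>k<d. u $$ (i, k) * cnj (u $$ (i, k)))"
    by (simp only: of_real_sum complex_norm_square)
  also have "\<dots> = complex_of_real 1" unfolding unitary_entry_sum(2)[OF u assms(2,2)] by simp
  finally have "(\<Sum>k<d. (cmod (u $$ (i, k)))\<^sup>2) = 1" by (simp only: of_real_eq_iff)
  moreover have "(cmod (u $$ (i, j)))\<^sup>2 \<le> (\<Sum>k<d. (cmod (u $$ (i, k)))\<^sup>2)"
    by (rule member_le_sum) (use assms in auto)
  ultimately have "(cmod (u $$ (i, j)))\<^sup>2 \<le> 1\<^sup>2" by simp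
  then show ?thesis by (rule power2_le_imp_le) simp
qed

lemma adjoint_intertwines:
  assumes u: "u \<in> carrier (unitary_group d)" and v: "v \<in> carrier (unitary_group d')"
    and T: "T \<in> carrier_mat d d'" and eq: "u * T = T * v"
  shows "v * mat_adjoint T = mat_adjoint T * u"
proof -
  note u' = unitaryD[OF u] and v' = unitaryD[OF v]
  have aT: "mat_adjoint T \<in> carrier_mat d' d" by (rule mat_adjoint_carrier[OF T])
  have e: "mat_adjoint T * mat_adjoint u = mat_adjoint v * mat_adjoint T"
    using arg_cong[OF eq, of mat_adjoint] unfolding mat_adjoint_mult[OF u'(1) T] mat_adjoint_mult[OF T v'(1)] .
  have "mat_adjoint T = mat_adjoint T * mat_adjoint u * u" by (rule unitary_cancel(4)[OF u aT, symmetric])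
  also have "\<dots> = mat_adjoint v * (mat_adjoint T * u)"
    unfolding e by (rule assoc_mult_mat[OF v'(4) aT u'(1)])
  finally have "v * mat_adjoint T = v * (mat_adjoint v * (mat_adjoint T * u))" by (rule arg_cong)
  also have "\<dots> = mat_adjoint T * u" by (rule unitary_cancel(2)[OF v mult_carrier_mat[OF aT u'(1)]])
  finally show ?thesis .
qed

lemma wd_unitary:
  assumes "\<And>s. s \<in> set w \<Longrightarrow> \<tau> s \<in> carrier (unitary_group d)"
  shows "wd (unitary_group d) \<tau> w \<in> carrier (unitary_group d)"
  by (rule monoid.wd_closed[OF group.is_monoid[OF unitary_group_is_group] assms])

lemma wd_intertwines:
  assumes A: "A \<in> carrier_mat d' d"
    and "\<And>s. s \<in> set w \<Longrightarrow> \<rho> s \<in> carrier (unitary_group d')"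
    and "\<And>s. s \<in> set w \<Longrightarrow> \<sigma> s \<in> carrier (unitary_group d)"
    and "\<And>s. s \<in> set w \<Longrightarrow> \<rho> s * A = A * \<sigma> s"
  shows "wd (unitary_group d') \<rho> w * A = A * wd (unitary_group d) \<sigma> w"
  using assms(2-)
proof (induction w)
  case Nil
  then show ?case using A by (simp add: unitary_group_simps)
next
  case (Cons s w)
  let ?r = "wd (unitary_group d') \<rho> w" and ?q = "wd (unitary_group d) \<sigma> w"
  have r: "?r \<in> carrier_mat d' d'" and q: "?q \<in> carrier_mat d d"
    using unitaryD(1)[OF wd_unitary, of w \<rho> d'] unitaryD(1)[OF wd_unitary, of w \<sigma> d] Cons.prems by auto
  have rs: "\<rho> s \<in> carrier_mat d' d'" and qs: "\<sigma> s \<in> carrier_mat d d"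
    using Cons.prems unitaryD(1) by auto
  have IH: "?r * A = A * ?q" using Cons by auto
  have "\<rho> s * ?r * A = \<rho> s * (A * ?q)" unfolding assoc_mult_mat[OF rs r A] IH by (rule refl)
  also have "\<dots> = \<rho> s * A * ?q" by (rule assoc_mult_mat[OF rs A q, symmetric])
  also have "\<dots> = A * (\<sigma> s * ?q)" using Cons.prems(3)[of s] assoc_mult_mat[OF A qs q] by simp
  finally show ?case by (simp add: unitary_group_simps)
qed

text \<open>By \<open>inv\<close> the range of \<open>W\<close> is invariant under \<open>u\<close>,
  so the compression is a restriction and loses no norm.\<close>

lemma isometric_compression:
  assumes W: "isometric d e W" and u: "u \<in> carrier (unitary_group d)"
    and inv: "u * W = W * (mat_adjoint W * (u * W))"
  shows "mat_adjoint W * (u * W) \<in> carrier (unitary_group e)"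
proof (rule unitaryI)
  let ?v = "mat_adjoint W * (u * W)"
  have Wc: "W \<in> carrier_mat d e" and aW: "mat_adjoint W \<in> carrier_mat e d"
    using W by (auto simp: isometric_def)
  note u' = unitaryD[OF u]
  have uW: "u * W \<in> carrier_mat d e" by (rule mult_carrier_mat[OF u'(1) Wc])
  show v: "?v \<in> carrier_mat e e" by (rule mult_carrier_mat[OF aW uW])
  have "mat_adjoint ?v * ?v = mat_adjoint (u * W) * W * ?v"
    unfolding mat_adjoint_mult[OF aW uW] mat_adjoint_adjoint by (rule refl)
  also have "\<dots> = mat_adjoint (u * W) * (u * W)"
    unfolding assoc_mult_mat[OF mat_adjoint_carrier[OF uW] Wc v] inv[symmetric] by (rule refl)
  also have "\<dots> = mat_adjoint W * (mat_adjoint u * (u * W))"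
    unfolding mat_adjoint_mult[OF u'(1) Wc] by (rule assoc_mult_mat[OF aW u'(4) uW])
  also have "\<dots> = 1\<^sub>m e" unfolding unitary_cancel(1)[OF u Wc] using W by (simp add: isometric_def)
  finally show "mat_adjoint ?v * ?v = 1\<^sub>m e" .
qed

text \<open>Compactness of a finite product of unitary groups, used as a pigeonhole principle:
  entries are bounded by 1, and consecutive terms of a convergent subsequence come arbitrarily
  close.\<close>

lemma close_unitary_pair:
  fixes U :: "nat \<Rightarrow> 'b \<Rightarrow> complex mat" and d :: "'b \<Rightarrow> nat"
  assumes J: "finite J" and U: "\<And>n s. s \<in> J \<Longrightarrow> U n s \<in> carrier (unitary_group (d s))" and e: "\<epsilon> > 0"
  shows "\<exists>m n. m < n \<and> (\<forall>s\<in>J. hs2 (U m s - U n s) \<le> \<epsilon>)"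
proof -
  define A where "A = (SIGMA s:J. {..<d s} \<times> {..<d s} \<times> (UNIV :: bool set))"
  define f where "f n x = (case x of (s, i, j, b) \<Rightarrow> if b then Re (U n s $$ (i, j)) else Im (U n s $$ (i, j)))"
    for n and x :: "'b \<times> nat \<times> nat \<times> bool"
  have "finite A" unfolding A_def using J by (intro finite_SigmaI finite_cartesian_product) auto
  then have cA: "countable A" by (rule countable_finite)
  have bd: "\<bar>f n x\<bar> \<le> 1" if xA: "x \<in> A" for x n
  proof -
    obtain s i j b where x: "x = (s, i, j, b)" "s \<in> J" "i < d s" "j < d s" using xA unfolding A_def by (cases x) auto
    have "cmod (U n s $$ (i, j)) \<le> 1" by (rule unitary_entry_le[OF U[OF x(2)] x(3,4)])
    then show ?thesis using abs_Re_le_cmod[of "U n s $$ (i, j)"] abs_Im_le_cmod[of "U n s $$ (i, j)"]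
      by (simp add: f_def x(1))
  qed
  obtain r where r: "strict_mono r" "\<And>x. x \<in> A \<Longrightarrow> convergent (\<lambda>n. f (r n) x)"
    by (rule pointwise_convergent_subseq[where f = f and M = 1, OF cA bd]) (assumption | blast)+
  define L where "L x = lim (\<lambda>n. f (r n) x)" for x
  have L: "(\<lambda>n. f (r n) x) \<longlonglongrightarrow> L x" if "x \<in> A" for x
    using r(2)[OF that] by (simp add: L_def convergent_LIMSEQ_iff)
  have df: "(\<lambda>n. (f (r n) x - f (r (Suc n)) x)\<^sup>2) \<longlonglongrightarrow> 0" if "x \<in> A" for x
  proof -
    have "(\<lambda>n. (f (r n) x - f (r (Suc n)) x)\<^sup>2) \<longlonglongrightarrow> (L x - L x)\<^sup>2"
      by (intro tendsto_intros L that LIMSEQ_Suc[OF L[OF that]])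
    then show ?thesis by simp
  qed
  have ev: "\<forall>\<^sub>F n in sequentially. hs2 (U (r n) s - U (r (Suc n)) s) < \<epsilon>" if s: "s \<in> J" for s
  proof -
    have eq: "hs2 (U m s - U n s) = (\<Sum>i<d s. \<Sum>j<d s. (f m (s, i, j, True) - f n (s, i, j, True))\<^sup>2
        + (f m (s, i, j, False) - f n (s, i, j, False))\<^sup>2)" for m n
      unfolding hs2_carrier[OF minus_carrier_mat[OF unitaryD(1)[OF U[OF s, of n]]]]
    proof (intro sum.cong refl)
      fix i j assume "i \<in> {..<d s}" "j \<in> {..<d s}"
      then have ij: "i < dim_row (U n s)" "j < dim_col (U n s)" using unitaryD(1)[OF U[OF s, of n]] by auto
      show "(cmod ((U m s - U n s) $$ (i, j)))\<^sup>2 = (f m (s, i, j, True) - f n (s, i, j, True))\<^sup>2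
        + (f m (s, i, j, False) - f n (s, i, j, False))\<^sup>2"
        unfolding index_minus_mat(1)[OF ij] cmod_power2 by (simp add: f_def)
    qed
    have "(\<lambda>n. hs2 (U (r n) s - U (r (Suc n)) s)) \<longlonglongrightarrow> (\<Sum>i<d s. \<Sum>j<d s. 0 + 0)"
      unfolding eq by (intro tendsto_sum tendsto_add df) (auto simp: A_def s)
    then have "(\<lambda>n. hs2 (U (r n) s - U (r (Suc n)) s)) \<longlonglongrightarrow> 0" by simp
    then show ?thesis using e by (rule order_tendstoD)
  qed
  have "\<forall>\<^sub>F n in sequentially. \<forall>s\<in>J. hs2 (U (r n) s - U (r (Suc n)) s) < \<epsilon>"
    by (intro eventually_ball_finite[OF J] ballI ev)
  then obtain n where n: "\<And>s. s \<in> J \<Longrightarrow> hs2 (U (r n) s - U (r (Suc n)) s) < \<epsilon>"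
    unfolding eventually_sequentially by blast
  show ?thesis
    by (rule exI[of _ "r n"], rule exI[of _ "r (Suc n)"])
      (use r(1) n in \<open>auto simp: strict_mono_Suc_iff intro: less_imp_le\<close>)
qed

context kazhdan_gap
begin

definition irr :: "nat \<Rightarrow> ('a \<Rightarrow> complex mat) \<Rightarrow> bool" where
  "irr d \<sigma> \<longleftrightarrow> \<not> (\<exists>e W. 0 < e \<and> e < d \<and> isometric d e W \<and>
     (\<forall>s\<in>S. \<sigma> s * W = W * (mat_adjoint W * (\<sigma> s * W))))"

text \<open>The kernel of the adjoint of an intertwiner into an irreducible is invariant.\<close>

lemma irr_adjoint_inj:
  assumes irr: "irr d \<sigma>"
    and \<sigma>: "\<And>s. s \<in> S \<Longrightarrow> \<sigma> s \<in> carrier (unitary_group d)"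
    and \<rho>: "\<And>s. s \<in> S \<Longrightarrow> \<rho> s \<in> carrier (unitary_group d')"
    and T: "T \<in> carrier_mat d d'" "T \<noteq> 0\<^sub>m d d'" and int: "\<And>s. s \<in> S \<Longrightarrow> \<sigma> s * T = T * \<rho> s"
    and v: "v \<in> carrier_mat d 1" "mat_adjoint T * v = 0\<^sub>m d' 1"
  shows "v = 0\<^sub>m d 1"
proof -
  have aT: "mat_adjoint T \<in> carrier_mat d' d" by (rule mat_adjoint_carrier[OF T(1)])
  obtain e W where iso: "isometric d e W" and TW: "mat_adjoint T * W = 0\<^sub>m d' e"
    and compl: "\<And>Y p. Y \<in> carrier_mat d p \<Longrightarrow> mat_adjoint T * Y = 0\<^sub>m d' p \<Longrightarrow> W * (mat_adjoint W * Y) = Y"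
    by (rule kernel_basis[OF aT], rule that) (assumption | blast)+
  have W: "W \<in> carrier_mat d e" "mat_adjoint W * W = 1\<^sub>m e" using iso by (auto simp: isometric_def)
  have aW: "mat_adjoint W \<in> carrier_mat e d" by (rule mat_adjoint_carrier[OF W(1)])
  have "\<sigma> s * W = W * (mat_adjoint W * (\<sigma> s * W))" if s: "s \<in> S" for s
  proof -
    note u = unitaryD(1)[OF \<sigma>[OF s]] and r = unitaryD(1)[OF \<rho>[OF s]]
    have "mat_adjoint T * (\<sigma> s * W) = mat_adjoint T * \<sigma> s * W" by (rule assoc_mult_mat[OF aT u W(1), symmetric])
    also have "\<dots> = \<rho> s * mat_adjoint T * W"
      unfolding adjoint_intertwines[OF \<sigma>[OF s] \<rho>[OF s] T(1) int[OF s]] by (rule refl)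
    also have "\<dots> = 0\<^sub>m d' e" unfolding assoc_mult_mat[OF r aT W(1)] TW by (rule right_mult_zero_mat[OF r])
    finally show ?thesis by (rule compl[OF mult_carrier_mat[OF u W(1)], symmetric])
  qed
  then have "\<not> (0 < e \<and> e < d)" using irr iso unfolding irr_def by blast
  moreover have "e \<le> d" by (rule isometric_le[OF iso])
  ultimately consider "e = 0" | "e = d" by linarith
  then show ?thesis
  proof cases
    case 1
    have c: "mat_adjoint W * v \<in> carrier_mat e 1" by (rule mult_carrier_mat[OF aW v(1)])
    show ?thesis
    proof (rule mat_eqI[OF v(1) zero_carrier_mat])
      fix i j :: nat assume ij: "i < d" "j < 1"
      have "v $$ (i, j) = (W * (mat_adjoint W * v)) $$ (i, j)" unfolding compl[OF v] by (rule refl)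
      also have "\<dots> = (\<Sum>k<e. W $$ (i, k) * (mat_adjoint W * v) $$ (k, j))" by (rule mult_mat_index[OF W(1) c ij])
      finally show "v $$ (i, j) = 0\<^sub>m d 1 $$ (i, j)" using 1 ij by simp
    qed
  next
    case 2
    have Wu: "W \<in> carrier (unitary_group d)" using W 2 by (intro unitaryI) auto
    have "mat_adjoint T = mat_adjoint T * W * mat_adjoint W" by (rule unitary_cancel(3)[OF Wu aT, symmetric])
    also have "\<dots> = 0\<^sub>m d' d" unfolding TW by (rule left_mult_zero_mat[OF aW])
    finally have "mat_adjoint (mat_adjoint T) = 0\<^sub>m d d'" by (simp only: mat_adjoint_zero)
    then show ?thesis using T(2) by simp
  qed
qed

text \<open>Schur's lemma: \<open>irr_adjoint_inj\<close> makes the adjoint of \<open>T\<close>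
  injective, hence invertible, and conjugation by it carries one representation to the
  other.\<close>

lemma irr_character_eq:
  assumes irr: "irr d \<sigma>"
    and \<sigma>: "\<And>s. s \<in> S \<Longrightarrow> \<sigma> s \<in> carrier (unitary_group d)"
    and \<rho>: "\<And>s. s \<in> S \<Longrightarrow> \<rho> s \<in> carrier (unitary_group d)"
    and T: "T \<in> carrier_mat d d" "T \<noteq> 0\<^sub>m d d" and int: "\<And>s. s \<in> S \<Longrightarrow> \<sigma> s * T = T * \<rho> s"
    and w: "set w \<subseteq> S"
  shows "mat_trace (wd (unitary_group d) \<rho> w) = mat_trace (wd (unitary_group d) \<sigma> w)"
proof -
  let ?A = "mat_adjoint T" and ?r = "wd (unitary_group d) \<rho> w" and ?q = "wd (unitary_group d) \<sigma> w"
  have A: "?A \<in> carrier_mat d d" by (rule mat_adjoint_carrier[OF T(1)])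
  have "det ?A \<noteq> 0"
  proof
    assume "det ?A = 0"
    then obtain V where V: "V \<in> carrier_mat d 1" "V \<noteq> 0\<^sub>m d 1" "?A * V = 0\<^sub>m d 1"
      by (rule singular_kernel[OF A])
    have "V = 0\<^sub>m d 1" by (rule irr_adjoint_inj[OF irr \<sigma> \<rho> T int V(1,3)])
    with V(2) show False by simp
  qed
  then have "?A \<in> Units (ring_mat TYPE(complex) d ())" by (rule det_non_zero_imp_unit[OF A])
  then obtain B where B: "B \<in> carrier_mat d d" "?A * B = 1\<^sub>m d" "B * ?A = 1\<^sub>m d"
    unfolding Units_def ring_mat_simps by blast
  have r: "?r \<in> carrier_mat d d" and q: "?q \<in> carrier_mat d d"
    using w \<sigma> \<rho> by (auto intro!: unitaryD(1)[OF wd_unitary])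
  have eq: "?r * ?A = ?A * ?q"
  proof (rule wd_intertwines[OF A])
    fix s assume "s \<in> set w"
    then have s: "s \<in> S" using w by auto
    show "\<rho> s \<in> carrier (unitary_group d)" "\<sigma> s \<in> carrier (unitary_group d)" by (rule \<rho>[OF s], rule \<sigma>[OF s])
    show "\<rho> s * ?A = ?A * \<sigma> s" by (rule adjoint_intertwines[OF \<sigma>[OF s] \<rho>[OF s] T(1) int[OF s]])
  qed
  have "?r = ?r * (?A * B)" unfolding B(2) by (rule right_mult_one_mat[OF r, symmetric])
  also have "\<dots> = ?A * ?q * B" unfolding eq[symmetric] by (rule assoc_mult_mat[OF r A B(1), symmetric])
  finally have "mat_trace ?r = mat_trace (B * (?A * ?q))"
    using mat_trace_commute[OF mult_carrier_mat[OF A q] B(1)] by simp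
  also have "B * (?A * ?q) = ?q"
    unfolding assoc_mult_mat[OF B(1) A q, symmetric] B(3) by (rule left_mult_one_mat[OF q])
  finally show ?thesis .
qed

lemma subrep:
  assumes l: "local_rep R (unitary_group d) \<sigma>" and W: "isometric d e W"
    and inv: "\<And>s. s \<in> S \<Longrightarrow> \<sigma> s * W = W * (mat_adjoint W * (\<sigma> s * W))"
  shows "local_rep R (unitary_group e) (\<lambda>s. mat_adjoint W * (\<sigma> s * W))"
    "set w \<subseteq> S \<Longrightarrow> mat_adjoint W * (wd (unitary_group d) \<sigma> w * W) =
      wd (unitary_group e) (\<lambda>s. mat_adjoint W * (\<sigma> s * W)) w"
proof -
  let ?\<tau> = "\<lambda>s. mat_adjoint W * (\<sigma> s * W)"
  have Wc: "W \<in> carrier_mat d e" "mat_adjoint W * W = 1\<^sub>m e" and aW: "mat_adjoint W \<in> carrier_mat e d"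
    using W by (auto simp: isometric_def)
  have \<tau>: "?\<tau> s \<in> carrier (unitary_group e)" if "s \<in> S" for s
    by (rule isometric_compression[OF W local_rep_closed[OF l that] inv[OF that]])
  show *: "mat_adjoint W * (wd (unitary_group d) \<sigma> w * W) = wd (unitary_group e) ?\<tau> w" if w: "set w \<subseteq> S" for w
  proof -
    have q: "wd (unitary_group e) ?\<tau> w \<in> carrier_mat e e"
      using w \<tau> by (auto intro!: unitaryD(1)[OF wd_unitary])
    have "wd (unitary_group d) \<sigma> w * W = W * wd (unitary_group e) ?\<tau> w"
    proof (rule wd_intertwines[OF Wc(1)])
      fix s assume "s \<in> set w"
      then have s: "s \<in> S" using w by auto
      show "\<sigma> s \<in> carrier (unitary_group d)" by (rule local_rep_closed[OF l s])
      show "?\<tau> s \<in> carrier (unitary_group e)" by (rule \<tau>[OF s])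
      show "\<sigma> s * W = W * ?\<tau> s" by (rule inv[OF s])
    qed
    then have "mat_adjoint W * (wd (unitary_group d) \<sigma> w * W) = mat_adjoint W * W * wd (unitary_group e) ?\<tau> w"
      by (simp only: assoc_mult_mat[OF aW Wc(1) q])
    then show ?thesis unfolding Wc(2) left_mult_one_mat[OF q] .
  qed
  show "local_rep R (unitary_group e) ?\<tau>"
    unfolding local_rep_def
  proof (intro conjI ballI allI impI)
    fix w assume w: "set w \<subseteq> S \<and> length w \<le> R \<and> val w = \<one>"
    then have "wd (unitary_group d) \<sigma> w = 1\<^sub>m d" using l by (simp add: local_rep_def unitary_group_simps)
    then show "wd (unitary_group e) ?\<tau> w = \<one>\<^bsub>unitary_group e\<^esub>"
      using *[of w] w by (simp add: unitary_group_simps Wc left_mult_one_mat[OF Wc(1)])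
  qed (rule \<tau>)
qed

text \<open>Trace and dimension are both additive over direct sums. A reducible local representation
  splits into an invariant subspace and its orthogonal complement, both again local representations
  of the same relator length, so the bound passes from the irreducibles to all by induction on the
  dimension.\<close>

lemma character_large:
  assumes w: "set w \<subseteq> S"
    and irrs: "\<And>d \<sigma>. \<lbrakk>d > 0; local_rep R (unitary_group d) \<sigma>; irr d \<sigma>\<rbrakk> \<Longrightarrow>
      Re (mat_trace (wd (unitary_group d) \<sigma> w)) \<ge> real d / 2"
    and "local_rep R (unitary_group d) \<sigma>"
  shows "Re (mat_trace (wd (unitary_group d) \<sigma> w)) \<ge> real d / 2"
  using assms(3)
proof (induction d arbitrary: \<sigma> rule: less_induct)
  case (less d)
  note l = less.prems
  let ?U = "\<lambda>d. unitary_group d"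
  have q: "wd (?U d) \<sigma> w \<in> carrier_mat d d"
    using w local_rep_closed[OF l] by (auto intro!: unitaryD(1)[OF wd_unitary])
  consider "d = 0" | "d > 0" "irr d \<sigma>" | "\<not> irr d \<sigma>" by blast
  then show ?case
  proof cases
    case 1
    then show ?thesis using q by (simp add: mat_trace_eq)
  next
    case 2
    then show ?thesis using irrs l by blast
  next
    case 3
    then obtain e W where e: "0 < e" "e < d" and W: "isometric d e W"
      and inv: "\<And>s. s \<in> S \<Longrightarrow> \<sigma> s * W = W * (mat_adjoint W * (\<sigma> s * W))"
      unfolding irr_def by blast
    have Wc: "W \<in> carrier_mat d e" "mat_adjoint W * W = 1\<^sub>m e" using W by (auto simp: isometric_def)
    have aW: "mat_adjoint W \<in> carrier_mat e d" by (rule mat_adjoint_carrier[OF Wc(1)])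
    \<comment> \<open>\<open>V\<close> is an orthonormal basis of the complement of the range of
      \<open>W\<close>, obtained as the kernel of the adjoint.\<close>
    obtain e2 V where V: "isometric d e2 V" and WV: "mat_adjoint W * V = 0\<^sub>m e e2"
      and compl: "\<And>Y p. Y \<in> carrier_mat d p \<Longrightarrow> mat_adjoint W * Y = 0\<^sub>m e p \<Longrightarrow> V * (mat_adjoint V * Y) = Y"
      by (rule kernel_basis[OF aW], rule that) (assumption | blast)+
    have Vc: "V \<in> carrier_mat d e2" "mat_adjoint V * V = 1\<^sub>m e2" using V by (auto simp: isometric_def)
    have aV: "mat_adjoint V \<in> carrier_mat e2 d" by (rule mat_adjoint_carrier[OF Vc(1)])
    have inv2: "\<sigma> s * V = V * (mat_adjoint V * (\<sigma> s * V))" if s: "s \<in> S" for s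
    proof -
      note u = local_rep_closed[OF l s]
      note v = isometric_compression[OF W u inv[OF s]]
      have "mat_adjoint W * (\<sigma> s * V) = mat_adjoint W * \<sigma> s * V"
        by (rule assoc_mult_mat[OF aW unitaryD(1)[OF u] Vc(1), symmetric])
      also have "\<dots> = mat_adjoint W * (\<sigma> s * W) * mat_adjoint W * V"
        by (simp only: adjoint_intertwines[OF u v Wc(1) inv[OF s]])
      also have "\<dots> = 0\<^sub>m e e2"
        unfolding assoc_mult_mat[OF unitaryD(1)[OF v] aW Vc(1)] WV by (rule right_mult_zero_mat[OF unitaryD(1)[OF v]])
      finally show ?thesis by (rule compl[OF mult_carrier_mat[OF unitaryD(1)[OF u] Vc(1)], symmetric])
    qed
    have WW: "W * mat_adjoint W \<in> carrier_mat d d" and VV: "V * mat_adjoint V \<in> carrier_mat d d"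
      by (rule mult_carrier_mat[OF Wc(1) aW], rule mult_carrier_mat[OF Vc(1) aV])
    \<comment> \<open>The projection onto that complement. Identifying it with the projection given
      by \<open>V\<close> yields the resolution of the identity that splits traces.\<close>
    define Y where "Y = 1\<^sub>m d - W * mat_adjoint W"
    have Y: "Y \<in> carrier_mat d d" unfolding Y_def by (rule minus_carrier_mat[OF WW])
    have "mat_adjoint W * (W * mat_adjoint W) = mat_adjoint W"
      unfolding assoc_mult_mat[OF aW Wc(1) aW, symmetric] Wc(2) by (rule left_mult_one_mat[OF aW])
    then have "mat_adjoint W * Y = 0\<^sub>m e d"
      unfolding Y_def mult_minus_distrib_mat[OF aW one_carrier_mat WW] right_mult_one_mat[OF aW]
      using aW by simp
    then have VY: "V * (mat_adjoint V * Y) = Y" by (rule compl[OF Y])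
    have VW: "mat_adjoint V * W = 0\<^sub>m e2 e"
      using arg_cong[OF WV, of mat_adjoint] unfolding mat_adjoint_mult[OF aW Vc(1)] mat_adjoint_adjoint mat_adjoint_zero .
    have "mat_adjoint V * (W * mat_adjoint W) = 0\<^sub>m e2 d"
      unfolding assoc_mult_mat[OF aV Wc(1) aW, symmetric] VW by (rule left_mult_zero_mat[OF aW])
    then have "mat_adjoint V * Y = mat_adjoint V"
      unfolding Y_def mult_minus_distrib_mat[OF aV one_carrier_mat WW] right_mult_one_mat[OF aV]
      using carrier_matD[OF Vc(1)] by (intro eq_matI) auto
    then have VY': "V * mat_adjoint V = Y" using VY by simp
    have sum1: "W * mat_adjoint W + V * mat_adjoint V = 1\<^sub>m d"
      unfolding VY' Y_def by (rule eq_matI) (use WW in \<open>auto simp del: index_mult_mat(1)\<close>)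
    have split: "mat_trace A = mat_trace (mat_adjoint W * (A * W)) + mat_trace (mat_adjoint V * (A * V))"
      if A: "A \<in> carrier_mat d d" for A
    proof -
      have AW: "A * W \<in> carrier_mat d e" and AV: "A * V \<in> carrier_mat d e2"
        by (rule mult_carrier_mat[OF A Wc(1)], rule mult_carrier_mat[OF A Vc(1)])
      have "A = A * (W * mat_adjoint W) + A * (V * mat_adjoint V)"
        unfolding mult_add_distrib_mat[OF A WW VV, symmetric] sum1 by (rule right_mult_one_mat[OF A, symmetric])
      also have "\<dots> = A * W * mat_adjoint W + A * V * mat_adjoint V"
        by (simp only: assoc_mult_mat[OF A Wc(1) aW] assoc_mult_mat[OF A Vc(1) aV])
      finally have eq: "A = A * W * mat_adjoint W + A * V * mat_adjoint V" .
      have c: "A * W * mat_adjoint W \<in> carrier_mat d d" "A * V * mat_adjoint V \<in> carrier_mat d d"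
        by (rule mult_carrier_mat[OF AW aW], rule mult_carrier_mat[OF AV aV])
      have "mat_trace (A * W * mat_adjoint W + A * V * mat_adjoint V) =
          mat_trace (A * W * mat_adjoint W) + mat_trace (A * V * mat_adjoint V)"
        unfolding mat_trace_eq[OF c(1)] mat_trace_eq[OF c(2)] mat_trace_eq[OF add_carrier_mat[OF c(2)]] sum.distrib[symmetric]
        by (rule sum.cong[OF refl], rule index_add_mat(1)) (use carrier_matD[OF c(2)] in simp_all)
      then have "mat_trace A = mat_trace (A * W * mat_adjoint W) + mat_trace (A * V * mat_adjoint V)"
        by (simp only: eq[symmetric])
      then show ?thesis unfolding mat_trace_commute[OF AW aW] mat_trace_commute[OF AV aV] .
    qed
    have "(of_nat d :: complex) = of_nat (e + e2)"
      using split[OF one_carrier_mat] unfolding left_mult_one_mat[OF Wc(1)] left_mult_one_mat[OF Vc(1)] Wc(2) Vc(2) by simp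
    then have de: "d = e + e2" by (simp only: of_nat_eq_iff)
    have "mat_trace (wd (?U d) \<sigma> w) = mat_trace (wd (?U e) (\<lambda>s. mat_adjoint W * (\<sigma> s * W)) w)
        + mat_trace (wd (?U e2) (\<lambda>s. mat_adjoint V * (\<sigma> s * V)) w)"
      using split[OF q] subrep(2)[OF l W inv w] subrep(2)[OF l V inv2 w] by simp
    moreover have "Re (mat_trace (wd (?U e) (\<lambda>s. mat_adjoint W * (\<sigma> s * W)) w)) \<ge> real e / 2"
      by (rule less.IH[OF e(2) subrep(1)[OF l W inv]])
    moreover have "Re (mat_trace (wd (?U e2) (\<lambda>s. mat_adjoint V * (\<sigma> s * V)) w)) \<ge> real e2 / 2"
      by (rule less.IH[OF _ subrep(1)[OF l V inv2]]) (use de e in simp)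
    ultimately show ?thesis by (simp add: de)
  qed
qed

end

section \<open>Tensor powers and large irreducibles\<close>

text \<open>Index pairs of a tensor product are coded as \<open>a * p + b\<close>.\<close>

lemma sum_div_mod:
  fixes f :: "nat \<Rightarrow> nat \<Rightarrow> 'b::comm_monoid_add"
  shows "(\<Sum>k<n * p. f (k div p) (k mod p)) = (\<Sum>a<n. \<Sum>b<p. f a b)"
proof -
  have lt: "a * p + b < n * p" if "a < n" "b < p" for a b
  proof -
    have "a * p + b < Suc a * p" using that by simp
    also have "\<dots> \<le> n * p" using that by (intro mult_le_mono1) simp
    finally show ?thesis .
  qed
  have "(\<Sum>k<n * p. f (k div p) (k mod p)) = (\<Sum>(a, b)\<in>{..<n} \<times> {..<p}. f a b)"
    by (rule sum.reindex_bij_witness[of _ "\<lambda>(a, b). a * p + b" "\<lambda>k. (k div p, k mod p)"])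
      (auto simp: lt less_mult_imp_div_less intro!: mod_less_divisor gr0I)
  then show ?thesis by (simp only: sum.cartesian_product)
qed

definition kron :: "nat \<Rightarrow> nat \<Rightarrow> complex mat \<Rightarrow> complex mat \<Rightarrow> complex mat" where
  "kron n p A B = mat (n * p) (n * p) (\<lambda>(i, j). A $$ (i div p, j div p) * B $$ (i mod p, j mod p))"

lemma kron_carrier [simp]: "kron n p A B \<in> carrier_mat (n * p) (n * p)"
  by (simp add: kron_def)

lemma div_mod_less: "i < n * p \<Longrightarrow> i div p < n \<and> i mod p < (p::nat)"
  by (auto simp: less_mult_imp_div_less intro!: mod_less_divisor gr0I)

lemma kron_mult:
  assumes A: "A \<in> carrier_mat n n" "A' \<in> carrier_mat n n" and B: "B \<in> carrier_mat p p" "B' \<in> carrier_mat p p"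
  shows "kron n p (A * A') (B * B') = kron n p A B * kron n p A' B'"
proof (rule mat_eqI[OF kron_carrier mult_carrier_mat[OF kron_carrier kron_carrier]])
  fix i j assume ij: "i < n * p" "j < n * p"
  note i = div_mod_less[OF ij(1)] and j = div_mod_less[OF ij(2)]
  have "(kron n p A B * kron n p A' B') $$ (i, j) = (\<Sum>k<n * p. kron n p A B $$ (i, k) * kron n p A' B' $$ (k, j))"
    by (rule mult_mat_index[OF kron_carrier kron_carrier ij])
  also have "\<dots> = (\<Sum>k<n * p. (A $$ (i div p, k div p) * A' $$ (k div p, j div p)) *
      (B $$ (i mod p, k mod p) * B' $$ (k mod p, j mod p)))"
    by (rule sum.cong[OF refl]) (use ij in \<open>simp add: kron_def\<close>)
  also have "\<dots> = (\<Sum>a<n. \<Sum>b<p. (A $$ (i div p, a) * A' $$ (a, j div p)) * (B $$ (i mod p, b) * B' $$ (b, j mod p)))"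
    by (rule sum_div_mod)
  also have "\<dots> = (\<Sum>a<n. A $$ (i div p, a) * A' $$ (a, j div p)) * (\<Sum>b<p. B $$ (i mod p, b) * B' $$ (b, j mod p))"
    by (rule sum_product[symmetric])
  also have "\<dots> = (A * A') $$ (i div p, j div p) * (B * B') $$ (i mod p, j mod p)"
    using mult_mat_index[OF A conjunct1[OF i] conjunct1[OF j]] mult_mat_index[OF B conjunct2[OF i] conjunct2[OF j]] by simp
  also have "\<dots> = kron n p (A * A') (B * B') $$ (i, j)"
    using ij unfolding kron_def by (simp only: index_mat(1) split_conv)
  finally show "kron n p (A * A') (B * B') $$ (i, j) = (kron n p A B * kron n p A' B') $$ (i, j)" by (rule sym)
qed

lemma kron_unitary:
  assumes u: "u \<in> carrier (unitary_group n)" and v: "v \<in> carrier (unitary_group p)"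
  shows "kron n p u v \<in> carrier (unitary_group (n * p))"
proof (rule unitaryI_entries[OF kron_carrier])
  fix i j assume ij: "i < n * p" "j < n * p"
  note i = div_mod_less[OF ij(1)] and j = div_mod_less[OF ij(2)]
  have "(\<Sum>k<n * p. cnj (kron n p u v $$ (k, i)) * kron n p u v $$ (k, j)) =
      (\<Sum>k<n * p. (cnj (u $$ (k div p, i div p)) * u $$ (k div p, j div p)) *
        (cnj (v $$ (k mod p, i mod p)) * v $$ (k mod p, j mod p)))"
    by (rule sum.cong[OF refl]) (use ij in \<open>simp add: kron_def\<close>)
  also have "\<dots> = (\<Sum>a<n. \<Sum>b<p. (cnj (u $$ (a, i div p)) * u $$ (a, j div p)) * (cnj (v $$ (b, i mod p)) * v $$ (b, j mod p)))"
    by (rule sum_div_mod)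
  also have "\<dots> = (\<Sum>a<n. cnj (u $$ (a, i div p)) * u $$ (a, j div p)) * (\<Sum>b<p. cnj (v $$ (b, i mod p)) * v $$ (b, j mod p))"
    by (rule sum_product[symmetric])
  also have "\<dots> = (if i div p = j div p then 1 else 0) * (if i mod p = j mod p then 1 else 0)"
    using unitary_entry_sum(1)[OF u conjunct1[OF i] conjunct1[OF j]]
      unitary_entry_sum(1)[OF v conjunct2[OF i] conjunct2[OF j]] by simp
  also have "\<dots> = (if i = j then 1 else 0)"
  proof -
    have "i = j \<longleftrightarrow> i div p = j div p \<and> i mod p = j mod p" by (metis div_mult_mod_eq)
    then show ?thesis by auto
  qed
  finally show "(\<Sum>k<n * p. cnj (kron n p u v $$ (k, i)) * kron n p u v $$ (k, j)) = (if i = j then 1 else 0)" .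
qed

lemma kron_trace:
  assumes A: "A \<in> carrier_mat n n" and B: "B \<in> carrier_mat p p"
  shows "mat_trace (kron n p A B) = mat_trace A * mat_trace B"
proof -
  have "mat_trace (kron n p A B) = (\<Sum>k<n * p. A $$ (k div p, k div p) * B $$ (k mod p, k mod p))"
    unfolding mat_trace_eq[OF kron_carrier] by (rule sum.cong[OF refl]) (simp add: kron_def)
  also have "\<dots> = (\<Sum>a<n. \<Sum>b<p. A $$ (a, a) * B $$ (b, b))" by (rule sum_div_mod)
  also have "\<dots> = mat_trace A * mat_trace B"
    unfolding mat_trace_eq[OF A] mat_trace_eq[OF B] by (rule sum_product[symmetric])
  finally show ?thesis .
qed

section \<open>Adding a trivial summand and taking tensor powers\<close>

definition one_dsum :: "nat \<Rightarrow> complex mat \<Rightarrow> complex mat" where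
  "one_dsum k A = mat (Suc k) (Suc k) (\<lambda>(i, j). if i < k \<and> j < k then A $$ (i, j) else if i = j then 1 else 0)"

lemma one_dsum_carrier [simp]: "one_dsum k A \<in> carrier_mat (Suc k) (Suc k)"
  by (simp add: one_dsum_def)

lemma one_dsum_index:
  "i < k \<Longrightarrow> j < k \<Longrightarrow> one_dsum k A $$ (i, j) = A $$ (i, j)"
  "i < k \<Longrightarrow> one_dsum k A $$ (i, k) = 0" "i < k \<Longrightarrow> one_dsum k A $$ (k, i) = 0" "one_dsum k A $$ (k, k) = 1"
  by (simp_all add: one_dsum_def)

lemma one_dsum_mult:
  assumes A: "A \<in> carrier_mat k k" "B \<in> carrier_mat k k"
  shows "one_dsum k (A * B) = one_dsum k A * one_dsum k B"
proof (rule mat_eqI[OF one_dsum_carrier mult_carrier_mat[OF one_dsum_carrier one_dsum_carrier]])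
  fix i j assume ij: "i < Suc k" "j < Suc k"
  have eq: "(one_dsum k A * one_dsum k B) $$ (i, j) =
      (\<Sum>m<k. one_dsum k A $$ (i, m) * one_dsum k B $$ (m, j)) + one_dsum k A $$ (i, k) * one_dsum k B $$ (k, j)"
    unfolding mult_mat_index[OF one_dsum_carrier one_dsum_carrier ij] by (rule sum.lessThan_Suc)
  consider "i < k" "j < k" | "i < k" "j = k" | "i = k" "j < k" | "i = k" "j = k" using ij by linarith
  then show "one_dsum k (A * B) $$ (i, j) = (one_dsum k A * one_dsum k B) $$ (i, j)"
  proof cases
    case 1
    have "(\<Sum>m<k. one_dsum k A $$ (i, m) * one_dsum k B $$ (m, j)) = (A * B) $$ (i, j)"
      unfolding mult_mat_index[OF A 1] by (rule sum.cong[OF refl]) (simp add: one_dsum_index 1)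
    then show ?thesis unfolding eq using 1 by (simp only: one_dsum_index) simp
  next
    case 2
    have "(\<Sum>m<k. one_dsum k A $$ (i, m) * one_dsum k B $$ (m, j)) = 0"
      by (rule sum.neutral) (simp add: one_dsum_index 2)
    then show ?thesis unfolding eq using 2 by (simp add: one_dsum_index)
  next
    case 3
    have "(\<Sum>m<k. one_dsum k A $$ (i, m) * one_dsum k B $$ (m, j)) = 0"
      by (rule sum.neutral) (simp add: one_dsum_index 3)
    then show ?thesis unfolding eq using 3 by (simp add: one_dsum_index)
  next
    case 4
    have "(\<Sum>m<k. one_dsum k A $$ (i, m) * one_dsum k B $$ (m, j)) = 0"
      by (rule sum.neutral) (simp add: one_dsum_index 4)
    then show ?thesis unfolding eq using 4 by (simp add: one_dsum_index)
  qed
qed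

lemma one_dsum_unitary:
  assumes u: "u \<in> carrier (unitary_group k)"
  shows "one_dsum k u \<in> carrier (unitary_group (Suc k))"
proof (rule unitaryI_entries[OF one_dsum_carrier])
  fix i j assume ij: "i < Suc k" "j < Suc k"
  let ?D = "one_dsum k u"
  consider "i < k" "j < k" | "i < k" "j = k" | "i = k" "j < k" | "i = k" "j = k" using ij by linarith
  then show "(\<Sum>m<Suc k. cnj (?D $$ (m, i)) * ?D $$ (m, j)) = (if i = j then 1 else 0)"
  proof cases
    case 1
    have "(\<Sum>m<k. cnj (?D $$ (m, i)) * ?D $$ (m, j)) = (if i = j then 1 else 0)"
      unfolding unitary_entry_sum(1)[OF u 1, symmetric] by (rule sum.cong[OF refl]) (simp add: one_dsum_index 1)
    then show ?thesis using 1 by (simp add: one_dsum_index)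
  next
    case 2
    have "(\<Sum>m<k. cnj (?D $$ (m, i)) * ?D $$ (m, j)) = 0" by (rule sum.neutral) (simp add: one_dsum_index 2)
    then show ?thesis using 2 by (simp add: one_dsum_index)
  next
    case 3
    have "(\<Sum>m<k. cnj (?D $$ (m, i)) * ?D $$ (m, j)) = 0" by (rule sum.neutral) (simp add: one_dsum_index 3)
    then show ?thesis using 3 by (simp add: one_dsum_index)
  next
    case 4
    have "(\<Sum>m<k. cnj (?D $$ (m, i)) * ?D $$ (m, j)) = 0" by (rule sum.neutral) (simp add: one_dsum_index 4)
    then show ?thesis using 4 by (simp add: one_dsum_index)
  qed
qed

lemma one_dsum_trace:
  assumes A: "A \<in> carrier_mat k k" shows "mat_trace (one_dsum k A) = 1 + mat_trace A"
proof -
  have "(\<Sum>i<k. one_dsum k A $$ (i, i)) = mat_trace A"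
    unfolding mat_trace_eq[OF A] by (rule sum.cong[OF refl]) (simp add: one_dsum_index)
  then show ?thesis unfolding mat_trace_eq[OF one_dsum_carrier] by (simp add: one_dsum_index)
qed

primrec tensor_power :: "nat \<Rightarrow> nat \<Rightarrow> complex mat \<Rightarrow> complex mat" where
  "tensor_power k 0 A = 1\<^sub>m 1"
| "tensor_power k (Suc r) A = kron (Suc k) (Suc k ^ r) (one_dsum k A) (tensor_power k r A)"

lemma tensor_power_unitary:
  "u \<in> carrier (unitary_group k) \<Longrightarrow> tensor_power k r u \<in> carrier (unitary_group (Suc k ^ r))"
proof (induction r)
  case 0
  then show ?case by (simp add: unitary_group_simps)
next
  case (Suc r)
  then show ?case unfolding tensor_power.simps power_Suc by (intro kron_unitary one_dsum_unitary) auto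
qed

lemma tensor_power_hom: "tensor_power k r \<in> hom (unitary_group k) (unitary_group (Suc k ^ r))"
proof (rule homI)
  fix u v assume u: "u \<in> carrier (unitary_group k)" and v: "v \<in> carrier (unitary_group k)"
  show "tensor_power k r u \<in> carrier (unitary_group (Suc k ^ r))" by (rule tensor_power_unitary[OF u])
  have "tensor_power k r (u * v) = tensor_power k r u * tensor_power k r v"
  proof (induction r)
    case (Suc r)
    show ?case unfolding tensor_power.simps Suc one_dsum_mult[OF unitaryD(1)[OF u] unitaryD(1)[OF v]]
      by (intro kron_mult one_dsum_carrier unitaryD(1) tensor_power_unitary u v)
  qed simp
  then show "tensor_power k r (u \<otimes>\<^bsub>unitary_group k\<^esub> v) =
      tensor_power k r u \<otimes>\<^bsub>unitary_group (Suc k ^ r)\<^esub> tensor_power k r v"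
    by (simp only: unitary_group_simps)
qed

lemma tensor_power_trace:
  "u \<in> carrier (unitary_group k) \<Longrightarrow> mat_trace (tensor_power k r u) = (1 + mat_trace u) ^ r"
proof (induction r)
  case (Suc r)
  show ?case
    unfolding tensor_power.simps kron_trace[OF one_dsum_carrier unitaryD(1)[OF tensor_power_unitary[OF Suc.prems]]]
      one_dsum_trace[OF unitaryD(1)[OF Suc.prems]] Suc.IH[OF Suc.prems] by simp
qed simp

text \<open>Adding the trivial summand rules out the scalar matrices, for which the trace has
  maximal modulus.\<close>

lemma norm_one_plus_trace_less:
  assumes u: "u \<in> carrier (unitary_group k)" "u \<noteq> 1\<^sub>m k"
  shows "cmod (1 + mat_trace u) < real (Suc k)"
proof -
  let ?t = "mat_trace u"
  have uc: "u \<in> carrier_mat k k" by (rule unitaryD(1)[OF u(1)])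
  have "cmod ?t \<le> (\<Sum>i<k. 1)"
    unfolding mat_trace_eq[OF uc] by (rule sum_norm_le) (simp add: unitary_entry_le[OF u(1)])
  then have t: "(cmod ?t)\<^sup>2 \<le> (real k)\<^sup>2" by (intro power_mono) auto
  have one: "1\<^sub>m k \<in> carrier (unitary_group k)"
    using monoid.one_closed[OF group.is_monoid[OF unitary_group_is_group, of k]] by (simp add: unitary_group_simps)
  have "hs2 (1\<^sub>m k - u) \<noteq> 0"
  proof
    assume "hs2 (1\<^sub>m k - u) = 0"
    then have z: "1\<^sub>m k - u = 0\<^sub>m k k" by (rule hs2_eq_0[OF minus_carrier_mat[OF uc]])
    have "u = 1\<^sub>m k"
    proof (rule mat_eqI[OF uc one_carrier_mat])
      fix i j assume ij: "i < k" "j < k"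
      have "(1\<^sub>m k - u) $$ (i, j) = 1\<^sub>m k $$ (i, j) - u $$ (i, j)"
        by (rule index_minus_mat(1)) (use uc ij in auto)
      then show "u $$ (i, j) = 1\<^sub>m k $$ (i, j)" unfolding z using ij by (simp only: index_zero_mat(1)) (metis right_minus_eq)
    qed
    then show False using u(2) by simp
  qed
  then have "hs2 (1\<^sub>m k - u) > 0" using hs2_nonneg[of "1\<^sub>m k - u"] by linarith
  \<comment> \<open>The squared distance of a unitary from the identity is twice the dimension minus
    twice the real trace, so only the identity has real trace equal to the dimension.\<close>
  then have re: "Re ?t < real k"
    unfolding hs2_unitary_diff[OF one u(1)] mat_adjoint_one left_mult_one_mat[OF uc] by simp
  have "(cmod (1 + ?t))\<^sup>2 = 1 + 2 * Re ?t + (cmod ?t)\<^sup>2"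
    unfolding cmod_power2 by (simp add: power2_eq_square algebra_simps)
  also have "\<dots> < 1 + 2 * real k + (real k)\<^sup>2" using re t by linarith
  also have "\<dots> = (real (Suc k))\<^sup>2" by (simp add: power2_eq_square algebra_simps)
  finally show ?thesis by (rule power_less_imp_less_base) simp
qed

lemma wd_hom:
  assumes F: "F \<in> hom M N" and M: "group M" and N: "group N" and "\<And>s. s \<in> set w \<Longrightarrow> \<tau> s \<in> carrier M"
  shows "wd N (\<lambda>s. F (\<tau> s)) w = F (wd M \<tau> w)"
  using assms(4)
proof (induction w)
  case Nil
  show ?case using hom_one[OF F M N] by simp
next
  case (Cons s w)
  then have "wd M \<tau> w \<in> carrier M" by (intro monoid.wd_closed[OF group.is_monoid[OF M]]) auto
  then show ?case using Cons hom_mult[OF F] by simp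
qed

section \<open>Irreducible local representations of bounded dimension\<close>

context kazhdan_gap
begin

text \<open>Tensor powers are genuine homomorphisms between unitary groups, so they preserve every
  relator that a local representation satisfies.\<close>

lemma local_rep_hom:
  assumes F: "F \<in> hom M N" and M: "group M" and N: "group N" and l: "local_rep R M \<tau>"
  shows "local_rep R N (\<lambda>s. F (\<tau> s))"
  unfolding local_rep_def
proof (intro conjI ballI allI impI)
  show "F (\<tau> s) \<in> carrier N" if "s \<in> S" for s using F local_rep_closed[OF l that] by (auto simp: hom_def)
  fix w assume w: "set w \<subseteq> S \<and> length w \<le> R \<and> val w = \<one>"
  then have "wd N (\<lambda>s. F (\<tau> s)) w = F (wd M \<tau> w)"
    using local_rep_closed[OF l] by (intro wd_hom[OF F M N]) auto
  also have "\<dots> = \<one>\<^bsub>N\<^esub>" using l w hom_one[OF F M N] by (simp add: local_rep_def)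
  finally show "wd N (\<lambda>s. F (\<tau> s)) w = \<one>\<^bsub>N\<^esub>" .
qed

text \<open>Local representations are evaluated on words rather than on group elements. The value 0
  on all other words makes equality of characters mean equality of traces on every word over
  \<open>S\<close>.\<close>

definition character :: "nat \<Rightarrow> ('a \<Rightarrow> complex mat) \<Rightarrow> 'a list \<Rightarrow> complex" where
  "character d \<sigma> w = (if set w \<subseteq> S then mat_trace (wd (unitary_group d) \<sigma> w) else 0)"

text \<open>Rigidity in a fixed dimension: among infinitely many characters, compactness produces
  two whose representations are close on \<open>S\<close>. The identity matrix then almost
  intertwines them, a nearby intertwiner is nonzero, and the two characters coincide after
  all.\<close>

lemma finite_irr_characters:
  assumes cnt: "countable (carrier G)"
  shows "\<exists>R. \<forall>d>0. finite {character d \<sigma> |\<sigma>. local_rep R (unitary_group d) \<sigma> \<and> irr d \<sigma>}"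
proof (rule intertwiner_near[OF cnt], goal_cases)
  case (1 R C)
  note near = 1(2)
  show ?case
  proof (intro exI[of _ R] allI impI, rule ccontr)
    fix d :: nat assume d: "d > 0"
    let ?U = "unitary_group d"
    assume "infinite {character d \<sigma> |\<sigma>. local_rep R ?U \<sigma> \<and> irr d \<sigma>}"
    then obtain f :: "nat \<Rightarrow> 'a list \<Rightarrow> complex" where f: "inj f"
      "range f \<subseteq> {character d \<sigma> |\<sigma>. local_rep R ?U \<sigma> \<and> irr d \<sigma>}"
      using infinite_countable_subset by blast
    then have "\<forall>n. \<exists>\<sigma>. f n = character d \<sigma> \<and> local_rep R ?U \<sigma> \<and> irr d \<sigma>" by blast
    then obtain \<sigma> where \<sigma>: "\<And>n. f n = character d (\<sigma> n)" "\<And>n. local_rep R ?U (\<sigma> n)" "\<And>n. irr d (\<sigma> n)" by metis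
    \<comment> \<open>With tolerance \<open>1 / (2 * D)\<close> per generator, the intertwiner lies
      at squared distance less than 1 from the identity matrix, whose own squared norm is
      \<open>d\<close> and hence at least 1.\<close>
    define D where "D = (C + 1) * real (card S)"
    have D: "D > 0" unfolding D_def using 1(1) card_S by (intro mult_pos_pos) auto
    have "\<exists>m n. m < n \<and> (\<forall>s\<in>S. hs2 (\<sigma> m s - \<sigma> n s) \<le> 1 / (2 * D))"
      by (rule close_unitary_pair[of S \<sigma> "\<lambda>s. d" "1 / (2 * D)"])
        (use S_finite local_rep_closed[OF \<sigma>(2)] D in auto)
    then obtain m n where mn: "m < n" "\<And>s. s \<in> S \<Longrightarrow> hs2 (\<sigma> m s - \<sigma> n s) \<le> 1 / (2 * D)" by blast
    obtain T where T: "T \<in> carrier_mat d d" "\<And>s. s \<in> S \<Longrightarrow> \<sigma> m s * T = T * \<sigma> n s"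
      "hs2 (1\<^sub>m d - T) \<le> C * (\<Sum>s\<in>S. hs2 (\<sigma> m s * 1\<^sub>m d - 1\<^sub>m d * \<sigma> n s))"
      using near[OF \<sigma>(2) \<sigma>(2) one_carrier_mat, of m n] by blast
    note T(3)
    also have "(\<Sum>s\<in>S. hs2 (\<sigma> m s * 1\<^sub>m d - 1\<^sub>m d * \<sigma> n s)) \<le> (\<Sum>s\<in>S. 1 / (2 * D))"
    proof (rule sum_mono)
      fix s assume s: "s \<in> S"
      have c: "\<sigma> k s \<in> carrier_mat d d" for k by (rule unitaryD(1)[OF local_rep_closed[OF \<sigma>(2) s]])
      have "\<sigma> m s * 1\<^sub>m d = \<sigma> m s" "1\<^sub>m d * \<sigma> n s = \<sigma> n s"
        by (rule right_mult_one_mat[OF c], rule left_mult_one_mat[OF c])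
      then show "hs2 (\<sigma> m s * 1\<^sub>m d - 1\<^sub>m d * \<sigma> n s) \<le> 1 / (2 * D)" using mn(2)[OF s] by simp
    qed
    also have "C * (\<Sum>s\<in>S. 1 / (2 * D)) \<le> D * (1 / (2 * D))"
    proof -
      have "C * (\<Sum>s\<in>S. 1 / (2 * D)) = C * real (card S) * (1 / (2 * D))" by simp
      also have "\<dots> \<le> D * (1 / (2 * D))"
        using D card_S unfolding D_def by (intro mult_right_mono) auto
      finally show ?thesis .
    qed
    also have "D * (1 / (2 * D)) < 1" using D by simp
    finally have lt: "hs2 (1\<^sub>m d - T) < 1" using 1(1) by (simp add: mult_left_mono)
    have "T \<noteq> 0\<^sub>m d d"
    proof
      assume "T = 0\<^sub>m d d"
      then have "1\<^sub>m d - T = 1\<^sub>m d" by (intro eq_matI) auto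
      moreover have "1\<^sub>m d \<in> carrier ?U"
        using monoid.one_closed[OF group.is_monoid[OF unitary_group_is_group, of d]] by (simp add: unitary_group_simps)
      ultimately have "hs2 (1\<^sub>m d - T) = real d" by (simp add: hs2_unitary)
      with lt d show False by simp
    qed
    then have "character d (\<sigma> n) w = character d (\<sigma> m) w" for w
      using irr_character_eq[OF \<sigma>(3)[of m] local_rep_closed[OF \<sigma>(2)] local_rep_closed[OF \<sigma>(2)] T(1) _ T(2), of w]
      by (simp add: character_def)
    then have "f m = f n" unfolding \<sigma>(1) by (intro ext) simp
    then show False using f(1) mn(1) by (auto dest: injD)
  qed
qed

text \<open>Bounded dimension leaves finitely many characters. Evaluating infinitely many group
  elements in one representation per character gives a sequence in a compact group, so two of them
  nearly agree everywhere, and the word for the inverse of one times the other acts close to the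
  identity.\<close>

lemma exists_word_near_one:
  assumes inf: "infinite (carrier G)" and cnt: "countable (carrier G)"
  shows "\<exists>R0. \<forall>R\<ge>R0. \<forall>M. \<exists>w. set w \<subseteq> S \<and> val w \<noteq> \<one> \<and>
    (\<forall>d \<sigma>. 0 < d \<longrightarrow> d \<le> M \<longrightarrow> local_rep R (unitary_group d) \<sigma> \<longrightarrow> irr d \<sigma> \<longrightarrow>
      Re (mat_trace (wd (unitary_group d) \<sigma> w)) \<ge> real d / 2)"
proof -
  let ?U = "unitary_group"
  obtain R1 where R1: "\<And>d. d > 0 \<Longrightarrow> finite {character d \<sigma> |\<sigma>. local_rep R1 (?U d) \<sigma> \<and> irr d \<sigma>}"
    using finite_irr_characters[OF cnt] by blast
  show ?thesis
  proof (intro exI[of _ "max R1 2"] allI impI)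
    fix R M assume R: "R \<ge> max R1 2"
    define X where "X = (\<Union>d\<in>{1..M}. {character d \<sigma> |\<sigma>. local_rep R (?U d) \<sigma> \<and> irr d \<sigma>})"
    have X: "finite X"
      unfolding X_def
    proof (intro finite_UN_I)
      fix d assume "d \<in> {1..M}"
      then have "finite {character d \<sigma> |\<sigma>. local_rep R1 (?U d) \<sigma> \<and> irr d \<sigma>}" by (intro R1) simp
      then show "finite {character d \<sigma> |\<sigma>. local_rep R (?U d) \<sigma> \<and> irr d \<sigma>}"
        by (rule rev_finite_subset) (use R in \<open>auto intro: local_rep_mono\<close>)
    qed simp
    have "\<forall>\<chi>\<in>X. \<exists>p. local_rep R (?U (fst p)) (snd p) \<and> \<chi> = character (fst p) (snd p)"
      unfolding X_def by fastforce
    \<comment> \<open>One representation is selected for each character. Any irreducible with the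
      same character has the same traces on words, and its degree is the value at the empty
      word.\<close>
    then obtain p where p: "\<And>\<chi>. \<chi> \<in> X \<Longrightarrow> local_rep R (?U (fst (p \<chi>))) (snd (p \<chi>))"
      "\<And>\<chi>. \<chi> \<in> X \<Longrightarrow> \<chi> = character (fst (p \<chi>)) (snd (p \<chi>))" by metis
    obtain g :: "nat \<Rightarrow> 'a" where g: "inj g" "range g \<subseteq> carrier G" using infinite_countable_subset[OF inf] by blast
    have gn: "g n \<in> carrier G" for n using g(2) by blast
    let ?W = "\<lambda>n \<chi>. wd (?U (fst (p \<chi>))) (snd (p \<chi>)) (wordof (g n))"
    have Wu: "?W n \<chi> \<in> carrier (?U (fst (p \<chi>)))" if "\<chi> \<in> X" for n \<chi>
      by (rule local_wd_closed[OF unitary_group_is_group p(1)[OF that] wordof(1)[OF gn]])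
    have "\<exists>m n. m < n \<and> (\<forall>\<chi>\<in>X. hs2 (?W m \<chi> - ?W n \<chi>) \<le> 1)"
    proof (rule close_unitary_pair[of X ?W "\<lambda>\<chi>. fst (p \<chi>)" 1])
      show "finite X" by (rule X)
      show "?W n \<chi> \<in> carrier (?U (fst (p \<chi>)))" if "\<chi> \<in> X" for n \<chi> by (rule Wu[OF that])
    qed simp
    then obtain m n where mn: "m < n" "\<And>\<chi>. \<chi> \<in> X \<Longrightarrow> hs2 (?W m \<chi> - ?W n \<chi>) \<le> 1" by blast
    define u where "u = wordof (g m)"
    define v where "v = wordof (g n)"
    have uv: "set u \<subseteq> S" "set v \<subseteq> S" "val u = g m" "val v = g n" using wordof[OF gn] by (auto simp: u_def v_def)
    note wu = winv_props[OF uv(1)]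
    show "\<exists>w. set w \<subseteq> S \<and> val w \<noteq> \<one> \<and>
      (\<forall>d \<sigma>. 0 < d \<longrightarrow> d \<le> M \<longrightarrow> local_rep R (?U d) \<sigma> \<longrightarrow> irr d \<sigma> \<longrightarrow>
        Re (mat_trace (wd (?U d) \<sigma> w)) \<ge> real d / 2)"
    proof (intro exI[of _ "winv u @ v"] conjI allI impI)
      show w: "set (winv u @ v) \<subseteq> S" using wu uv by simp
      show "val (winv u @ v) \<noteq> \<one>"
      proof
        assume "val (winv u @ v) = \<one>"
        then have "inv (g m) \<otimes> g n = \<one>" using val_append[of "winv u" v] wu uv by simp
        then have "g n = g m" using gn inv_equality[of "inv (g m)" "g n"] inv_inv[OF gn, of m] by (metis inv_closed inv_comm inv_equality)
        then show False using g(1) mn(1) by (auto dest: injD)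
      qed
      fix d \<sigma> assume d: "0 < d" "d \<le> M" and l: "local_rep R (?U d) \<sigma>" and i: "irr d \<sigma>"
      let ?\<chi> = "character d \<sigma>"
      have \<chi>: "?\<chi> \<in> X" unfolding X_def using d l i by (intro UN_I[of d]) auto
      let ?e = "fst (p ?\<chi>)" and ?\<tau> = "snd (p ?\<chi>)"
      note eq = p(2)[OF \<chi>]
      have "?\<chi> [] = character ?e ?\<tau> []" using eq by metis
      then have "(of_nat d :: complex) = of_nat ?e" by (simp add: character_def unitary_group_simps)
      then have de: "?e = d" by (simp only: of_nat_eq_iff)
      have "mat_trace (wd (?U d) \<sigma> (winv u @ v)) = ?\<chi> (winv u @ v)" using w by (simp add: character_def)
      also have "\<dots> = character ?e ?\<tau> (winv u @ v)" using eq by metis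
      also have "\<dots> = mat_trace (wd (?U ?e) ?\<tau> (winv u @ v))" using w by (simp add: character_def)
      also have "wd (?U ?e) ?\<tau> (winv u @ v) = wd (?U ?e) ?\<tau> (winv u) \<otimes>\<^bsub>?U ?e\<^esub> wd (?U ?e) ?\<tau> v"
        by (rule local_wd_append[OF unitary_group_is_group p(1)[OF \<chi>]]) (use wu uv in auto)
      also have "wd (?U ?e) ?\<tau> (winv u) = inv\<^bsub>?U ?e\<^esub> (wd (?U ?e) ?\<tau> u)"
        by (rule local_wd_winv[OF unitary_group_is_group p(1)[OF \<chi>] _ uv(1)]) (use R in simp)
      also have "\<dots> = mat_adjoint (?W m ?\<chi>)" unfolding u_def by (rule inv_unitary_group[OF Wu[OF \<chi>]])
      also have "mat_adjoint (?W m ?\<chi>) \<otimes>\<^bsub>?U ?e\<^esub> wd (?U ?e) ?\<tau> v = mat_adjoint (?W m ?\<chi>) * ?W n ?\<chi>"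
        by (simp only: v_def unitary_group_simps(2))
      finally have tr: "mat_trace (wd (?U d) \<sigma> (winv u @ v)) = mat_trace (mat_adjoint (?W m ?\<chi>) * ?W n ?\<chi>)" .
      \<comment> \<open>Squared distance at most 1 leaves a real trace of at least
        \<open>real d - 1 / 2\<close>, which is at least \<open>real d / 2\<close> because
        \<open>d\<close> is positive.\<close>
      have "2 * real d - 2 * Re (mat_trace (mat_adjoint (?W m ?\<chi>) * ?W n ?\<chi>)) \<le> 1"
        using mn(2)[OF \<chi>] hs2_unitary_diff[OF Wu[OF \<chi>] Wu[OF \<chi>], of m n] de by simp
      then show "Re (mat_trace (wd (?U d) \<sigma> (winv u @ v))) \<ge> real d / 2" unfolding tr using d by simp
    qed
  qed
qed

text \<open>If the irreducibles were of bounded dimension, some element other than the identity would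
  have large normalized trace in every representation, contradicting the decay of the traces of
  tensor powers.\<close>

lemma large_irr:
  assumes inf: "infinite (carrier G)" and cnt: "countable (carrier G)"
    and ph: "partial_hom G unitary_group k \<psi>"
    and sep: "\<And>g. \<lbrakk>g \<in> carrier G; g \<noteq> \<one>\<rbrakk> \<Longrightarrow> \<forall>\<^sub>F n in sequentially. \<psi> n g \<noteq> \<one>\<^bsub>unitary_group (k n)\<^esub>"
  shows "\<exists>m>M. \<exists>\<sigma>. local_rep R (unitary_group m) \<sigma> \<and> irr m \<sigma>"
proof (rule ccontr)
  let ?U = "unitary_group"
  assume neg: "\<not> ?thesis"
  obtain R0 where R0: "\<forall>R\<ge>R0. \<forall>M. \<exists>w. set w \<subseteq> S \<and> val w \<noteq> \<one> \<and>
    (\<forall>d \<sigma>. 0 < d \<longrightarrow> d \<le> M \<longrightarrow> local_rep R (?U d) \<sigma> \<longrightarrow> irr d \<sigma> \<longrightarrow>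
      Re (mat_trace (wd (?U d) \<sigma> w)) \<ge> real d / 2)"
    using exists_word_near_one[OF inf cnt] by (rule exE)
  define Q where "Q = max R R0"
  have Q: "Q \<ge> R0" "Q \<ge> R" by (auto simp: Q_def)
  obtain w where w: "set w \<subseteq> S" "val w \<noteq> \<one>"
    and near: "\<And>d \<sigma>. \<lbrakk>0 < d; d \<le> M; local_rep Q (?U d) \<sigma>; irr d \<sigma>\<rbrakk> \<Longrightarrow>
      Re (mat_trace (wd (?U d) \<sigma> w)) \<ge> real d / 2"
    using R0[rule_format, OF Q(1), of M] by blast
  \<comment> \<open>The assumed absence of irreducibles beyond dimension \<open>M\<close> extends
    the estimate to every local representation of relator length \<open>Q\<close>.\<close>
  have large: "Re (mat_trace (wd (?U d) \<sigma> w)) \<ge> real d / 2" if "local_rep Q (?U d) \<sigma>" for d \<sigma>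
  proof (rule character_large[OF w(1) _ that])
    fix d \<sigma> assume a: "d > 0" "local_rep Q (?U d) \<sigma>" "irr d \<sigma>"
    then have "d \<le> M" using neg local_rep_mono[OF a(2) Q(2)] by (meson not_le)
    then show "Re (mat_trace (wd (?U d) \<sigma> w)) \<ge> real d / 2" using near a by blast
  qed
  have "\<forall>\<^sub>F n in sequentially. local_rep Q (?U (k n)) (\<psi> n)"
    by (rule partial_hom_local_rep(1)[OF unitary_group_is_group ph])
  moreover have "\<forall>\<^sub>F n in sequentially. wd (?U (k n)) (\<psi> n) w = \<psi> n (val w)"
    by (rule partial_hom_wd[OF unitary_group_is_group ph w(1)])
  moreover have "\<forall>\<^sub>F n in sequentially. \<psi> n (val w) \<noteq> \<one>\<^bsub>?U (k n)\<^esub>"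
    by (rule sep[OF val_closed[OF w(1)] w(2)])
  ultimately have "\<forall>\<^sub>F n in sequentially. local_rep Q (?U (k n)) (\<psi> n) \<and> wd (?U (k n)) (\<psi> n) w \<noteq> \<one>\<^bsub>?U (k n)\<^esub>"
    by eventually_elim simp
  then obtain n where l: "local_rep Q (?U (k n)) (\<psi> n)" and n1: "wd (?U (k n)) (\<psi> n) w \<noteq> \<one>\<^bsub>?U (k n)\<^esub>"
    unfolding eventually_sequentially by blast
  define d where "d = k n"
  define u where "u = wd (?U d) (\<psi> n) w"
  have u: "u \<in> carrier (?U d)" unfolding u_def d_def by (rule local_wd_closed[OF unitary_group_is_group l w(1)])
  have u1: "u \<noteq> 1\<^sub>m d" using n1 by (simp add: u_def d_def unitary_group_simps)
  define q where "q = cmod (1 + mat_trace u) / real (Suc d)"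
  have q: "0 \<le> q" "q < 1" using norm_one_plus_trace_less[OF u u1] by (auto simp: q_def)
  \<comment> \<open>The normalized trace of the r-th tensor power has modulus \<open>q ^ r\<close>,
    which this choice pushes below the lower bound 1/2.\<close>
  obtain r where r: "q ^ r < 1 / 2" using real_arch_pow_inv[of "1/2" q] q by auto
  let ?F = "tensor_power d r"
  have lF: "local_rep Q (?U (Suc d ^ r)) (\<lambda>s. ?F (\<psi> n s))"
    by (rule local_rep_hom[OF tensor_power_hom unitary_group_is_group unitary_group_is_group]) (use l in \<open>simp only: d_def\<close>)
  have "wd (?U (Suc d ^ r)) (\<lambda>s. ?F (\<psi> n s)) w = ?F u"
    unfolding u_def
    by (rule wd_hom[OF tensor_power_hom unitary_group_is_group unitary_group_is_group])
      (use w(1) local_rep_closed[OF l] in \<open>auto simp: d_def\<close>)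
  then have "real (Suc d ^ r) / 2 \<le> Re ((1 + mat_trace u) ^ r)"
    using large[OF lF] tensor_power_trace[OF u, of r] by simp
  also have "\<dots> \<le> cmod (1 + mat_trace u) ^ r" using complex_Re_le_cmod[of "(1 + mat_trace u) ^ r"] by (simp only: norm_power)
  also have "\<dots> = q ^ r * real (Suc d ^ r)" by (simp add: q_def power_divide del: of_nat_Suc)
  also have "\<dots> < 1 / 2 * real (Suc d ^ r)" by (rule mult_strict_right_mono[OF r]) (simp del: of_nat_Suc)
  finally show False by simp
qed

theorem hyperlinear_not_locally_HS_stable:
  assumes inf: "infinite (carrier G)" and cnt: "countable (carrier G)" and "hyperlinear G"
  shows "\<not> locally_HS_stable G"
proof
  assume "locally_HS_stable G"
  then have st: "locally_stable G unitary_group hs_dist" by (simp add: locally_HS_stable_def)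
  obtain k \<psi> where ph: "partial_hom G unitary_group k \<psi>"
    and sep: "\<And>g. \<lbrakk>g \<in> carrier G; g \<noteq> \<one>\<rbrakk> \<Longrightarrow> \<forall>\<^sub>F n in sequentially. \<psi> n g \<noteq> \<one>\<^bsub>unitary_group (k n)\<^esub>"
    using separating_partial_hom[OF assms(3)[unfolded hyperlinear_def] st] by metis
  obtain R C where C: "C \<ge> 0" and near: "\<And>d d' \<sigma> \<rho> X. \<lbrakk>local_rep R (unitary_group d) \<sigma>;
      local_rep R (unitary_group d') \<rho>; X \<in> carrier_mat d d'\<rbrakk> \<Longrightarrow>
    \<exists>T\<in>carrier_mat d d'. (\<forall>s\<in>S. \<sigma> s * T = T * \<rho> s) \<and>
      hs2 (X - T) \<le> C * (\<Sum>s\<in>S. hs2 (\<sigma> s * X - X * \<rho> s))"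
  proof (rule intertwiner_near[OF cnt], goal_cases)
    case (1 R C)
    show ?case by (rule 1(1)[OF 1(2)]) (rule 1(3))
  qed
  define D where "D = (C + 1) * real (card S)"
  have D: "D > 0" using C card_S by (auto simp: D_def)
  \<comment> \<open>Since \<open>e\<^sup>2 = 1 / (8 * D)\<close>, the intertwiner estimate becomes
    \<open>18 * D + real (m - 1) / 4\<close>. With \<open>40 * D < real (m - 1)\<close> this is
    below the squared norm \<open>real (m - 1)\<close> of the inclusion, so the intertwiner cannot
    be zero.\<close>
  define e where "e = sqrt (1 / (8 * D))"
  have e: "e > 0" "e\<^sup>2 = 1 / (8 * D)" using D by (auto simp: e_def)
  define M where "M = nat \<lceil>40 * D\<rceil> + 1"
  have \<beta>: "(\<lambda>m. 9 / sqrt (real (m - 1))) \<longlonglongrightarrow> 0"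
  proof -
    have "(\<lambda>n. 9 / sqrt (real n)) \<longlonglongrightarrow> 0"
      by (intro tendsto_divide_0[OF tendsto_const] filterlim_at_top_imp_at_infinity
          filterlim_compose[OF sqrt_at_top] filterlim_real_sequentially)
    then have "(\<lambda>n. 9 / sqrt (real (Suc n - 1))) \<longlonglongrightarrow> 0" by simp
    then show ?thesis by (subst (asm) filterlim_sequentially_Suc)
  qed
  have "\<exists>m \<sigma> \<rho>. m > M \<and> m \<ge> 2 \<and> local_rep R (unitary_group m) \<sigma> \<and> irr m \<sigma> \<and>
    local_rep R (unitary_group (m - 1)) \<rho> \<and> (\<forall>s\<in>S. hs_dist (m - 1) (ured m (\<sigma> s)) (\<rho> s) < e)"
  proof (rule stable_deletion[where \<G> = unitary_group and red = ured and d = hs_dist and e = e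
        and M = M and R = R and Irr = irr, OF _ _ _ \<beta> _ st e(1)])
    show "group (unitary_group j)" for j by (rule unitary_group_is_group)
    show "ured j x \<in> carrier (unitary_group (j - 1))" if "j \<ge> 2" "x \<in> carrier (unitary_group j)" for j x
      by (rule ured_unitary[OF that])
    show "\<bar>hs_dist (j - 1) (ured j (x \<otimes>\<^bsub>unitary_group j\<^esub> y))
        (ured j x \<otimes>\<^bsub>unitary_group (j - 1)\<^esub> ured j y)\<bar> \<le> 9 / sqrt (real (j - 1))"
      if "j \<ge> 2" "x \<in> carrier (unitary_group j)" "y \<in> carrier (unitary_group j)" for j x y
      unfolding unitary_group_simps(2) by (rule ured_mult[OF that])
    show "\<exists>m>M. \<exists>\<sigma>. local_rep R (unitary_group m) \<sigma> \<and> irr m \<sigma>" for R M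
      by (rule large_irr[OF inf cnt ph sep])
  qed
  then obtain m \<sigma> \<rho> where m: "m > M" "m \<ge> 2" and \<sigma>: "local_rep R (unitary_group m) \<sigma>" and irr: "irr m \<sigma>"
    and \<rho>: "local_rep R (unitary_group (m - 1)) \<rho>"
    and close: "\<And>s. s \<in> S \<Longrightarrow> hs_dist (m - 1) (ured m (\<sigma> s)) (\<rho> s) < e"
    by blast
  let ?I = "incl_mat m"
  note cI = incl_mat_carrier[of m]
  have big: "40 * D < real (m - 1)" using m(1) D unfolding M_def by linarith
  \<comment> \<open>By \<open>(a + b)\<^sup>2 \<le> 2 * a\<^sup>2 + 2 * b\<^sup>2\<close>; the 18 is
    twice the square of the bound 3 from \<open>ured_close\<close>.\<close>
  have each: "hs2 (\<sigma> s * ?I - ?I * \<rho> s) \<le> 18 + 2 * (e\<^sup>2 * real (m - 1))" if s: "s \<in> S" for s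
  proof -
    note u = local_rep_closed[OF \<sigma> s] and v = local_rep_closed[OF \<rho> s]
    note vc = unitaryD(1)[OF v]
    let ?n = "sqrt (real (m - 1))"
    have "hsn (ured m (\<sigma> s) - \<rho> s) / ?n < e"
      using close[OF s] unfolding hs_dist_eq[OF ured_carrier vc] .
    then have lt: "hsn (ured m (\<sigma> s) - \<rho> s) < e * ?n" using m(2) by (simp add: divide_less_eq)
    have "hsn (\<sigma> s * ?I - ?I * \<rho> s) \<le> hsn (\<sigma> s * ?I - ?I * ured m (\<sigma> s)) + hsn (?I * ured m (\<sigma> s) - ?I * \<rho> s)"
      by (rule hsn_triangle[OF mult_carrier_mat[OF unitaryD(1)[OF u] cI] mult_carrier_mat[OF cI ured_carrier]
          mult_carrier_mat[OF cI vc]])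
    also have "\<dots> \<le> 3 + e * ?n"
      unfolding hsn_incl_diff[OF ured_carrier vc m(2)] using ured_close[OF m(2) u] lt by linarith
    finally have "(hsn (\<sigma> s * ?I - ?I * \<rho> s))\<^sup>2 \<le> (3 + e * ?n)\<^sup>2" by (rule power_mono[OF _ hsn_nonneg])
    also have "\<dots> \<le> 2 * 3\<^sup>2 + 2 * (e * ?n)\<^sup>2"
      using zero_le_power2[of "3 - e * ?n"] unfolding power2_sum power2_diff by linarith
    also have "(e * ?n)\<^sup>2 = e\<^sup>2 * real (m - 1)" by (simp add: power_mult_distrib)
    finally show ?thesis unfolding hsn_sq by simp
  qed
  obtain T where T: "T \<in> carrier_mat m (m - 1)" "\<And>s. s \<in> S \<Longrightarrow> \<sigma> s * T = T * \<rho> s"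
    "hs2 (?I - T) \<le> C * (\<Sum>s\<in>S. hs2 (\<sigma> s * ?I - ?I * \<rho> s))"
    using near[OF \<sigma> \<rho> cI] by (elim bexE conjE) (rule that, assumption, erule (1) bspec, assumption)
  have "hs2 (?I - T) \<le> C * (\<Sum>s\<in>S. 18 + 2 * (e\<^sup>2 * real (m - 1)))"
    by (rule order_trans[OF T(3)]) (intro mult_left_mono sum_mono each C)
  also have "\<dots> = C * real (card S) * (18 + 2 * (e\<^sup>2 * real (m - 1)))" by simp
  also have "\<dots> \<le> D * (18 + 2 * (e\<^sup>2 * real (m - 1)))"
    using card_S by (intro mult_right_mono) (auto simp: D_def distrib_right)
  also have "\<dots> = 18 * D + real (m - 1) / 4" using D unfolding e(2) by (simp add: field_simps)
  also have "\<dots> < real (m - 1)" using big D by linarith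
  finally have lt: "hs2 (?I - T) < real (m - 1)" .
  have T0: "T \<noteq> 0\<^sub>m m (m - 1)"
  proof
    assume "T = 0\<^sub>m m (m - 1)"
    then have "?I - T = ?I" using carrier_matD[OF cI] by (intro eq_matI) auto
    also have "?I = ?I * 1\<^sub>m (m - 1)" by (rule right_mult_one_mat[OF cI, symmetric])
    finally have "hs2 (?I - T) = hs2 (1\<^sub>m (m - 1))"
      by (simp only: hs2_incl_mult[OF one_carrier_mat m(2)])
    moreover have "1\<^sub>m (m - 1) \<in> carrier (unitary_group (m - 1))"
      using monoid.one_closed[OF group.is_monoid[OF unitary_group_is_group, of "m - 1"]] by (simp add: unitary_group_simps)
    ultimately show False using lt by (simp only: hs2_unitary)
  qed
  have lt: "m - 1 < m" using m(2) by simp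
  obtain v where v: "v \<in> carrier_mat m 1" "v \<noteq> 0\<^sub>m m 1" "mat_adjoint T * v = 0\<^sub>m (m - 1) 1"
    by (rule wide_kernel[OF mat_adjoint_carrier[OF T(1)] lt])
  have "v = 0\<^sub>m m 1"
    by (rule irr_adjoint_inj[OF irr local_rep_closed[OF \<sigma>] local_rep_closed[OF \<rho>] T(1) T0 T(2) v(1,3)])
  with v(2) show False by simp
qed

end

theorem theorem7:
  fixes G :: "('g, 'n) monoid_scheme"
  assumes "group G"
    and "infinite (carrier G)"
    and "countable (carrier G)"
    and "property_T G"
  shows "(sofic G \<longrightarrow> \<not> locally_P_stable G) \<and>
         (hyperlinear G \<longrightarrow> \<not> locally_HS_stable G)"
proof -
  obtain S \<kappa> where "kazhdan_gap G S \<kappa>"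
    using group.property_T_kazhdan_gap[OF assms(1,4)] by blast
  then interpret kazhdan_gap G S \<kappa> .
  show ?thesis
    using sofic_not_locally_P_stable[OF assms(2,3)] hyperlinear_not_locally_HS_stable[OF assms(2,3)] by blast
qed

end
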